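(* There is $\varepsilon_7^*>0$ such that for fixed $\varepsilon<\min\{\varepsilon_2^*,\varepsilon_7^*\}$, large enough $N$, and $K>\frac{C_{LY}}{1-\lambda^2}$, the following holds. Let $$\Lambda_{K,N}>\sup_{f\in B_K\cap F_N}\left\|(I-D_f\tilde{\mathcal L}_{\varepsilon,N})^{-1}|_{F_N}\right\|_{V^{1,1}},$$ $$\delta_{K,N}:=\sup\Big\{\delta:\ \forall f,g\in F_N\cap\mathcal D_1\cap B_K,\ \|f-g\|_{W^{1,1}}\le\delta\Rightarrow\|D_f\tilde{\mathcal L}_{\varepsilon,N}-D_g\tilde{\mathcal L}_{\varepsilon,N}\|_{W^{1,1}}\le\tfrac{1}{4\Lambda_{K,N}}\Big\},$$ and $0<\beta_{K,N}\le\min\{1,\delta_{K,N}\}$ (with $\Lambda_{\tilde K,N},\delta_{\tilde K,N},\beta_{\tilde K,N}$ defined in the same way with $\tilde K$ in place of $K$). Let $h^*_{\varepsilon,N}\in B_K$ be a fixed point of $\tilde{\mathcal L}_{\varepsilon,N}$. Then there is $\tilde K>0$ such that the set $$B'_{\tilde K,N}:=\Big\{h\in\mathcal D_1\cap F_N:\ \mathcal D_1\cap F_N\cap B_{\|\cdot\|_{W^{1,1}}}(h,\beta_{\tilde K,N})\subset B_{\tilde K},\ \|h-\tilde{\mathcal L}_{\varepsilon,N}(h)\|_{W^{1,1}}<\frac{\beta_{\tilde K,N}}{2\Lambda_{\tilde K,N}}\Big\}$$ contains $h^*_{\varepsilon,N}$, and the Newton scheme $$h^{n+1}_{\varepsilon,N}:=h^n_{\varepsilon,N}-\left(I-D_{h^n_{\varepsilon,N}}\tilde{\mathcal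 L}_{\varepsilon,N}\right)^{-1}\left(h^n_{\varepsilon,N}-\tilde{\mathcal L}_{\varepsilon,N}(h^n_{\varepsilon,N})\right)$$ initialised with any $h^0_{\varepsilon,N}\in B'_{\tilde K,N}\cap B_{\|\cdot\|_{W^{1,1}}}(h^*_{\varepsilon,N},\beta_{\tilde K,N})$ converges to the fixed point $h^*_{\varepsilon,N}$ with order-2 convergence in $\|\cdot\|_{W^{1,1}}$: there are $C>0$ and $0<\tilde\gamma<1$ such that for all $n\ge0$, $$\|h^n_{\varepsilon,N}-h^*_{\varepsilon,N}\|_{W^{1,1}}\le C\tilde\gamma^{2^n}.$$
   Context: Function spaces. $\mathbb S^1$ is the circle. $W^{i,1}=W^{i,1}(\mathbb S^1)$ is the Sobolev space (of real functions) with norm $\|f\|_{W^{i,1}}=\|f\|_{L^1}+\sum_{j=1}^i\|f^{(j)}\|_{L^1}$, and $W^{0,1}:=L^1$. $V^{1,1}=\{h\in W^{1,1}:\int h=0\}$ with the $W^{1,1}$ norm. $\mathcal D_1=\{f\in L^1: f\ge0,\ \int_{\mathbb S^1}f=1\}$. $B_{\|\cdot\|_{W^{1,1}}}(h,r)$ is the ball of centre $h$ and radius $r$ in the $W^{1,1}$ norm. Dynamics. $T:\mathbb S^1\to\mathbb S^1$ is a $C^5$ uniformly expanding map and $g:\mathbb S^1\times\mathbb S^1\to\mathbb R$ is a $C^5$ coupling function (not to be confused with the function $g\in F_N$ in the definition of $\delta_{K,N}$). For $\varepsilon\ge 0$ and $f\in\mathcal D_1$ put $I_{\varepsilon,f}(x)=x+\varepsilon\int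 g(x,y)f(y)\,dy$ (mod 1) and $T_{\varepsilon,f}=I_{\varepsilon,f}\circ T$. For a map $S$, $\mathcal L_S:L^1\to L^1$ is its transfer operator: $\int\varphi\circ S\cdot\psi\,dx=\int\varphi\cdot\mathcal L_S\psi\,dx$ for $\psi\in L^1$, $\varphi\in L^\infty$. The (nonlinear) self-consistent transfer operator is $\tilde{\mathcal L}_\varepsilon(h)=\mathcal L_{T_{\varepsilon,h}}h$ (defined on probability densities, and by the same formula near them). Standing constants. Fix a small $\varepsilon_0^*>0$, $\lambda\in(0,1)$ and $C_0>0$ such that all the maps $T_{\varepsilon,f}$ with $\varepsilon\in[0,\varepsilon_0^*]$, $f\in\mathcal D_1$ satisfy $\sup_x 1/|T_{\varepsilon,f}'(x)|\le\lambda$ and $\|T_{\varepsilon,f}\|_{C^5}<C_0$ (all values of $\varepsilon$ considered lie in $[0,\varepsilon_0^*]$). There is then a constant $C_{LY}>0$, fixed throughout, with $\|\mathcal L_{T_{\varepsilon,f_n}\circ\cdots\circ T_{\varepsilon,f_1}}h\|_{W^{i,1}}\le\lambda^{in}\|h\|_{W^{i,1}}+C_{LY}\|h\|_{W^{i-1,1}}$ for all such maps, $h\in W^{i,1}$, $i=1,2,3,4$, $n\in\mathbb N$. For $K>0$ let $B_K=\{h\in\mathcal D_1\cap W^{2,1}:\|h\|_{W^{2,1}}\le K\}$. The constant $\varepsilon_2^*$. By known results there is $\varepsilon_1^*\in(0,\varepsilon_0^*]$, $C>0$, $\theta\in(0,1)$ with $\|\mathcal L_{T_{\varepsilon,f_n}}\cdots\mathcal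 L_{T_{\varepsilon,f_1}}h\|_{W^{i,1}}\le C\theta^n\|h\|_{W^{i,1}}$ for all $\varepsilon\in[0,\varepsilon_1^*]$, $i=1,2$, $h\in W^{i,1}$ with $\int h=0$, and all sequences $(f_j)$ in $B_K$ (for the fixed $K\ge C_{LY}/(1-\lambda^2)$); and there is $\varepsilon_2^*\in(0,\varepsilon_1^*]$ such that for all $\varepsilon\in[0,\varepsilon_2^*]$, $\tilde{\mathcal L}_\varepsilon$ has a unique fixed point $h_\varepsilon^*\in B_K$, and there are $C_K>0$, $\gamma\in(0,1)$ with $\|\tilde{\mathcal L}_\varepsilon^n(h^0)-h_\varepsilon^*\|_{W^{1,1}}\le C_K\gamma^n$ for all $\varepsilon\in[0,\varepsilon_2^*]$, $h^0\in B_K$. Discretisation. With $e_k(x)=e^{2\pi ikx}$, the Fejér kernel is $K_N=\sum_{|k|\le N-1}(1-|k|/N)e_k$, $\Pi_Nf(x)=\int_{\mathbb S^1}K_N(x-y)f(y)\,dy$, $F_N=\mathrm{span}\{e_k:k=-N+1,\ldots,N\}$ (real-valued elements being meant when they are arguments of the nonlinear operator), and $\tilde{\mathcal L}_{\varepsilon,N}:=\Pi_N\tilde{\mathcal L}_\varepsilon$. For every $\varepsilon\in[0,\varepsilon_0^*]$ and $N$, $\tilde{\mathcal L}_{\varepsilon,N}$ has a fixed point $h^*_{\varepsilon,N}\in B_K$. $D_f\tilde{\mathcal L}_{\varepsilon,N}$ denotes the Fréchet derivative at $f$ of $\tilde{\mathcal L}_{\varepsilon,N}$ as a map of $F_N$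 with the $W^{1,1}$ norm; $\|D_f\tilde{\mathcal L}_{\varepsilon,N}-D_g\tilde{\mathcal L}_{\varepsilon,N}\|_{W^{1,1}}$ is the operator norm on $F_N$ with the $W^{1,1}$ norm; the inverse $(I-D_f\tilde{\mathcal L}_{\varepsilon,N})^{-1}$ is taken on $F_N\cap V^{1,1}$ and $\|\cdot\|_{V^{1,1}}$ is its operator norm there. *)

theory Defs
  imports "HOL-Analysis.Analysis"
begin

section \<open>Functions on the circle\<close>

text \<open>The circle is \<open>\<real>/\<int>\<close>. Real functions on it are \<open>1\<close>-periodic functions on \<open>\<real>\<close>, and maps of the
  circle into itself are given by their lifts. Elements of \<open>L\<^sup>1\<close> are represented by functions, so
  identities between elements of \<open>L\<^sup>1\<close> are identities almost everywhere.\<close>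

definition periodic1 :: "(real \<Rightarrow> real) \<Rightarrow> bool" where
  "periodic1 f \<longleftrightarrow> (\<forall>x. f (x + 1) = f x)"

definition cint :: "(real \<Rightarrow> real) \<Rightarrow> real" where
  "cint f = (LINT x:{0..1}|lborel. f x)"

definition L1 :: "(real \<Rightarrow> real) set" where
  "L1 = {f. periodic1 f \<and> set_integrable lborel {0..1} f}"

definition Linf :: "(real \<Rightarrow> real) set" where
  "Linf = {f. periodic1 f \<and> f \<in> borel_measurable borel \<and> (\<exists>B. AE x in lborel. \<bar>f x\<bar> \<le> B)}"

definition densities :: "(real \<Rightarrow> real) set" where
  "densities = {f \<in> L1. (AE x in lborel. 0 \<le> f x) \<and> cint f = 1}"

definition C_k :: "nat \<Rightarrow> (real \<Rightarrow> real) \<Rightarrow> bool" where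
  "C_k k f \<longleftrightarrow> (\<forall>j<k. \<forall>x. (deriv ^^ j) f field_differentiable (at x)) \<and>
               continuous_on UNIV ((deriv ^^ k) f)"

primrec C_k2 :: "nat \<Rightarrow> (real \<times> real \<Rightarrow> real) \<Rightarrow> bool" where
  "C_k2 0 f \<longleftrightarrow> continuous_on UNIV f"
| "C_k2 (Suc k) f \<longleftrightarrow> (\<exists>f1 f2.
     (\<forall>p. (f has_derivative (\<lambda>h. f1 p * fst h + f2 p * snd h)) (at p)) \<and> C_k2 k f1 \<and> C_k2 k f2)"


section \<open>Sobolev spaces \<open>W\<^sup>i\<^sup>,\<^sup>1\<close>\<close>

definition test_function :: "(real \<Rightarrow> real) \<Rightarrow> bool" where
  "test_function \<phi> \<longleftrightarrow> periodic1 \<phi> \<and> (\<forall>k. C_k k \<phi>)"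

definition is_weak_deriv :: "nat \<Rightarrow> (real \<Rightarrow> real) \<Rightarrow> (real \<Rightarrow> real) \<Rightarrow> bool" where
  "is_weak_deriv j f u \<longleftrightarrow> u \<in> L1 \<and>
     (\<forall>\<phi>. test_function \<phi> \<longrightarrow>
        cint (\<lambda>x. f x * (deriv ^^ j) \<phi> x) = (-1) ^ j * cint (\<lambda>x. u x * \<phi> x))"

definition weak_deriv :: "nat \<Rightarrow> (real \<Rightarrow> real) \<Rightarrow> real \<Rightarrow> real" where
  "weak_deriv j f = (SOME u. is_weak_deriv j f u)"

definition W :: "nat \<Rightarrow> (real \<Rightarrow> real) set" where
  "W i = {f \<in> L1. \<forall>j\<le>i. \<exists>u. is_weak_deriv j f u}"

text \<open>Meaningful for \<open>f \<in> W i\<close> only. The term \<open>j = 0\<close> is the \<open>L\<^sup>1\<close> norm of \<open>f\<close>, because the weak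
  derivative of order \<open>0\<close> is \<open>f\<close> almost everywhere.\<close>

definition Wnorm :: "nat \<Rightarrow> (real \<Rightarrow> real) \<Rightarrow> real" where
  "Wnorm i f = (\<Sum>j\<le>i. cint (\<lambda>x. \<bar>weak_deriv j f x\<bar>))"

definition V11 :: "(real \<Rightarrow> real) set" where
  "V11 = {h \<in> W 1. cint h = 0}"

definition W11_ball :: "(real \<Rightarrow> real) \<Rightarrow> real \<Rightarrow> (real \<Rightarrow> real) set" where
  "W11_ball h r = {u \<in> W 1. Wnorm 1 (\<lambda>x. u x - h x) < r}"

definition BK :: "real \<Rightarrow> (real \<Rightarrow> real) set" where
  "BK K = {h \<in> densities \<inter> W 2. Wnorm 2 h \<le> K}"


section \<open>Dynamics\<close>

definition circle_map_lift :: "(real \<Rightarrow> real) \<Rightarrow> bool" where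
  "circle_map_lift S \<longleftrightarrow> (\<exists>d::int. \<forall>x. S (x + 1) = S x + of_int d)"

definition uniformly_expanding :: "(real \<Rightarrow> real) \<Rightarrow> bool" where
  "uniformly_expanding S \<longleftrightarrow> (\<exists>c>1. \<forall>x. c \<le> \<bar>deriv S x\<bar>)"

definition coupling :: "(real \<Rightarrow> real \<Rightarrow> real) \<Rightarrow> bool" where
  "coupling g \<longleftrightarrow> (\<forall>x y. g (x + 1) y = g x y \<and> g x (y + 1) = g x y) \<and> C_k2 5 (\<lambda>(x, y). g x y)"

text \<open>The \<open>C\<^sup>5\<close> norm of a circle map: its values lie on the circle, so only the derivatives of
  order \<open>1, \<dots>, 5\<close> of a lift enter.\<close>

definition C5_norm :: "(real \<Rightarrow> real) \<Rightarrow> real" where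
  "C5_norm S = (\<Sum>j=1..5. (SUP x. \<bar>(deriv ^^ j) S x\<bar>))"

definition I_map :: "(real \<Rightarrow> real \<Rightarrow> real) \<Rightarrow> real \<Rightarrow> (real \<Rightarrow> real) \<Rightarrow> real \<Rightarrow> real" where
  "I_map g \<epsilon> f x = x + \<epsilon> * cint (\<lambda>y. g x y * f y)"

definition T_map ::
  "(real \<Rightarrow> real) \<Rightarrow> (real \<Rightarrow> real \<Rightarrow> real) \<Rightarrow> real \<Rightarrow> (real \<Rightarrow> real) \<Rightarrow> real \<Rightarrow> real" where
  "T_map T g \<epsilon> f = I_map g \<epsilon> f \<circ> T"

definition is_transfer :: "(real \<Rightarrow> real) \<Rightarrow> (real \<Rightarrow> real) \<Rightarrow> (real \<Rightarrow> real) \<Rightarrow> bool" where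
  "is_transfer S \<psi> u \<longleftrightarrow> u \<in> L1 \<and>
     (\<forall>\<phi>\<in>Linf. cint (\<lambda>x. \<phi> (S x) * \<psi> x) = cint (\<lambda>x. \<phi> x * u x))"

text \<open>A representative of \<open>\<L>\<^sub>S \<psi>\<close>, which is determined almost everywhere.\<close>

definition transfer :: "(real \<Rightarrow> real) \<Rightarrow> (real \<Rightarrow> real) \<Rightarrow> real \<Rightarrow> real" where
  "transfer S \<psi> = (SOME u. is_transfer S \<psi> u)"

definition sc_transfer ::
  "(real \<Rightarrow> real) \<Rightarrow> (real \<Rightarrow> real \<Rightarrow> real) \<Rightarrow> real \<Rightarrow> (real \<Rightarrow> real) \<Rightarrow> real \<Rightarrow> real" where
  "sc_transfer T g \<epsilon> h = transfer (T_map T g \<epsilon> h) h"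


section \<open>Standing constants\<close>

definition uniform_constants ::
  "(real \<Rightarrow> real) \<Rightarrow> (real \<Rightarrow> real \<Rightarrow> real) \<Rightarrow> real \<Rightarrow> real \<Rightarrow> real \<Rightarrow> bool" where
  "uniform_constants T g \<epsilon>0 lam C0 \<longleftrightarrow>
     (\<forall>\<epsilon>\<in>{0..\<epsilon>0}. \<forall>f\<in>densities.
        (\<forall>x. deriv (T_map T g \<epsilon> f) x \<noteq> 0 \<and> 1 / \<bar>deriv (T_map T g \<epsilon> f) x\<bar> \<le> lam) \<and>
        C5_norm (T_map T g \<epsilon> f) < C0)"

text \<open>For \<open>fs = [f\<^sub>1, \<dots>, f\<^sub>n]\<close> the fold is \<open>T\<^sub>\<epsilon>\<^sub>,\<^sub>f\<^sub>n \<circ> \<dots> \<circ> T\<^sub>\<epsilon>\<^sub>,\<^sub>f\<^sub>1\<close>.\<close>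

definition lasota_yorke ::
  "(real \<Rightarrow> real) \<Rightarrow> (real \<Rightarrow> real \<Rightarrow> real) \<Rightarrow> real \<Rightarrow> real \<Rightarrow> real \<Rightarrow> bool" where
  "lasota_yorke T g \<epsilon>0 lam CLY \<longleftrightarrow>
     (\<forall>\<epsilon>\<in>{0..\<epsilon>0}. \<forall>fs. set fs \<subseteq> densities \<longrightarrow>
        (\<forall>i\<in>{1..4}. \<forall>h\<in>W i.
           transfer (fold (\<lambda>f S. T_map T g \<epsilon> f \<circ> S) fs id) h \<in> W i \<and>
           Wnorm i (transfer (fold (\<lambda>f S. T_map T g \<epsilon> f \<circ> S) fs id) h)
             \<le> lam ^ (i * length fs) * Wnorm i h + CLY * Wnorm (i - 1) h))"

definition sequential_contraction ::
  "(real \<Rightarrow> real) \<Rightarrow> (real \<Rightarrow> real \<Rightarrow> real) \<Rightarrow> real \<Rightarrow> real \<Rightarrow> bool" where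
  "sequential_contraction T g K \<epsilon>1 \<longleftrightarrow>
     (\<exists>C \<theta>. 0 < C \<and> 0 < \<theta> \<and> \<theta> < 1 \<and>
       (\<forall>\<epsilon>\<in>{0..\<epsilon>1}. \<forall>fs. set fs \<subseteq> BK K \<longrightarrow>
          (\<forall>i\<in>{1..2}. \<forall>h\<in>W i. cint h = 0 \<longrightarrow>
             fold (\<lambda>f. transfer (T_map T g \<epsilon> f)) fs h \<in> W i \<and>
             Wnorm i (fold (\<lambda>f. transfer (T_map T g \<epsilon> f)) fs h)
               \<le> C * \<theta> ^ length fs * Wnorm i h)))"

definition exponential_convergence ::
  "(real \<Rightarrow> real) \<Rightarrow> (real \<Rightarrow> real \<Rightarrow> real) \<Rightarrow> real \<Rightarrow> real \<Rightarrow> bool" where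
  "exponential_convergence T g K \<epsilon>2 \<longleftrightarrow>
     (\<exists>CK \<gamma>. 0 < CK \<and> 0 < \<gamma> \<and> \<gamma> < 1 \<and>
       (\<forall>\<epsilon>\<in>{0..\<epsilon>2}. \<exists>hs\<in>BK K.
          (AE x in lborel. sc_transfer T g \<epsilon> hs x = hs x) \<and>
          (\<forall>h\<in>BK K. (AE x in lborel. sc_transfer T g \<epsilon> h x = h x) \<longrightarrow>
                      (AE x in lborel. h x = hs x)) \<and>
          (\<forall>h0\<in>BK K. \<forall>n.
             (sc_transfer T g \<epsilon> ^^ n) h0 \<in> W 1 \<and>
             Wnorm 1 (\<lambda>x. (sc_transfer T g \<epsilon> ^^ n) h0 x - hs x) \<le> CK * \<gamma> ^ n)))"


section \<open>Fejer discretisation\<close>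

definition e_fun :: "int \<Rightarrow> real \<Rightarrow> complex" where
  "e_fun k x = exp (2 * of_real pi * \<i> * of_int k * of_real x)"

text \<open>The sum is real, since the terms of index \<open>k\<close> and \<open>-k\<close> are conjugate.\<close>

definition fejer :: "nat \<Rightarrow> real \<Rightarrow> real" where
  "fejer N x = Re (\<Sum>k\<in>{k::int. \<bar>k\<bar> \<le> int N - 1}. of_real (1 - \<bar>of_int k\<bar> / of_nat N) * e_fun k x)"

definition Pi_N :: "nat \<Rightarrow> (real \<Rightarrow> real) \<Rightarrow> real \<Rightarrow> real" where
  "Pi_N N f x = cint (\<lambda>y. fejer N (x - y) * f y)"

text \<open>The real-valued elements of the complex span.\<close>

definition F_N :: "nat \<Rightarrow> (real \<Rightarrow> real) set" where
  "F_N N = {f. \<exists>c::int \<Rightarrow> complex. \<forall>x.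
              complex_of_real (f x) = (\<Sum>k\<in>{- int N + 1..int N}. c k * e_fun k x)}"

definition V_N :: "nat \<Rightarrow> (real \<Rightarrow> real) set" where
  "V_N N = F_N N \<inter> V11"

definition sc_transfer_N ::
  "(real \<Rightarrow> real) \<Rightarrow> (real \<Rightarrow> real \<Rightarrow> real) \<Rightarrow> real \<Rightarrow> nat \<Rightarrow> (real \<Rightarrow> real) \<Rightarrow> real \<Rightarrow> real" where
  "sc_transfer_N T g \<epsilon> N h = Pi_N N (sc_transfer T g \<epsilon> h)"

definition has_frechet_on_F ::
  "nat \<Rightarrow> ((real \<Rightarrow> real) \<Rightarrow> real \<Rightarrow> real) \<Rightarrow> (real \<Rightarrow> real) \<Rightarrow>
   ((real \<Rightarrow> real) \<Rightarrow> real \<Rightarrow> real) \<Rightarrow> bool" where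
  "has_frechet_on_F N \<Phi> f D \<longleftrightarrow>
     (\<forall>h\<in>F_N N. D h \<in> F_N N) \<and>
     (\<forall>h\<in>F_N N. \<forall>k\<in>F_N N. \<forall>a b::real. D (\<lambda>x. a * h x + b * k x) = (\<lambda>x. a * D h x + b * D k x)) \<and>
     (\<exists>B. \<forall>h\<in>F_N N. Wnorm 1 (D h) \<le> B * Wnorm 1 h) \<and>
     (\<forall>e>0. \<exists>d>0. \<forall>h\<in>F_N N. Wnorm 1 h < d \<longrightarrow>
        Wnorm 1 (\<lambda>x. \<Phi> (\<lambda>y. f y + h y) x - \<Phi> f x - D h x) \<le> e * Wnorm 1 h)"

text \<open>Determined on \<open>F_N N\<close>, arbitrary outside.\<close>

definition D_sc ::
  "(real \<Rightarrow> real) \<Rightarrow> (real \<Rightarrow> real \<Rightarrow> real) \<Rightarrow> real \<Rightarrow> nat \<Rightarrow> (real \<Rightarrow> real) \<Rightarrow>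
   (real \<Rightarrow> real) \<Rightarrow> real \<Rightarrow> real" where
  "D_sc T g \<epsilon> N f = (SOME D. has_frechet_on_F N (sc_transfer_N T g \<epsilon> N) f D)"

text \<open>The operator norm on a subspace \<open>X\<close> with the \<open>W\<^sup>1\<^sup>,\<^sup>1\<close> norm, possibly infinite.\<close>

definition opnorm_on ::
  "(real \<Rightarrow> real) set \<Rightarrow> ((real \<Rightarrow> real) \<Rightarrow> real \<Rightarrow> real) \<Rightarrow> ereal" where
  "opnorm_on X A = (SUP h\<in>{h \<in> X. Wnorm 1 h \<le> 1}. ereal (Wnorm 1 (A h)))"

definition I_minus_D ::
  "(real \<Rightarrow> real) \<Rightarrow> (real \<Rightarrow> real \<Rightarrow> real) \<Rightarrow> real \<Rightarrow> nat \<Rightarrow> (real \<Rightarrow> real) \<Rightarrow>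
   (real \<Rightarrow> real) \<Rightarrow> real \<Rightarrow> real" where
  "I_minus_D T g \<epsilon> N f h = (\<lambda>x. h x - D_sc T g \<epsilon> N f h x)"

definition inv_I_minus_D ::
  "(real \<Rightarrow> real) \<Rightarrow> (real \<Rightarrow> real \<Rightarrow> real) \<Rightarrow> real \<Rightarrow> nat \<Rightarrow> (real \<Rightarrow> real) \<Rightarrow>
   (real \<Rightarrow> real) \<Rightarrow> real \<Rightarrow> real" where
  "inv_I_minus_D T g \<epsilon> N f = inv_into (V_N N) (I_minus_D T g \<epsilon> N f)"

definition newton_defined_at ::
  "(real \<Rightarrow> real) \<Rightarrow> (real \<Rightarrow> real \<Rightarrow> real) \<Rightarrow> real \<Rightarrow> nat \<Rightarrow> (real \<Rightarrow> real) \<Rightarrow> bool" where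
  "newton_defined_at T g \<epsilon> N f \<longleftrightarrow>
     (\<exists>D. has_frechet_on_F N (sc_transfer_N T g \<epsilon> N) f D) \<and>
     bij_betw (I_minus_D T g \<epsilon> N f) (V_N N) (V_N N)"

definition inverse_bound ::
  "(real \<Rightarrow> real) \<Rightarrow> (real \<Rightarrow> real \<Rightarrow> real) \<Rightarrow> real \<Rightarrow> nat \<Rightarrow> real \<Rightarrow> ereal" where
  "inverse_bound T g \<epsilon> N K =
     (SUP f\<in>BK K \<inter> F_N N. opnorm_on (V_N N) (inv_I_minus_D T g \<epsilon> N f))"

text \<open>Extended real: the supremum is infinite when the derivative varies little, for instance when \<open>\<epsilon> = 0\<close>.\<close>

definition delta_KN ::
  "(real \<Rightarrow> real) \<Rightarrow> (real \<Rightarrow> real \<Rightarrow> real) \<Rightarrow> real \<Rightarrow> nat \<Rightarrow> real \<Rightarrow> real \<Rightarrow> ereal" where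
  "delta_KN T g \<epsilon> N K \<Lambda> = Sup (ereal ` {\<delta>.
     \<forall>f \<in> F_N N \<inter> densities \<inter> BK K. \<forall>k \<in> F_N N \<inter> densities \<inter> BK K.
       Wnorm 1 (\<lambda>x. f x - k x) \<le> \<delta> \<longrightarrow>
       opnorm_on (F_N N) (\<lambda>h x. D_sc T g \<epsilon> N f h x - D_sc T g \<epsilon> N k h x) \<le> ereal (1 / (4 * \<Lambda>))})"

text \<open>\<open>\<Lambda>\<close> and \<open>\<beta>\<close> are possible choices of \<open>\<Lambda>\<^sub>K\<^sub>,\<^sub>N\<close> and \<open>\<beta>\<^sub>K\<^sub>,\<^sub>N\<close>. The first conjunct says that the
  inverses in the definition of \<open>\<Lambda>\<^sub>K\<^sub>,\<^sub>N\<close> exist.\<close>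

definition admissible ::
  "(real \<Rightarrow> real) \<Rightarrow> (real \<Rightarrow> real \<Rightarrow> real) \<Rightarrow> real \<Rightarrow> nat \<Rightarrow> real \<Rightarrow> real \<Rightarrow> real \<Rightarrow> bool" where
  "admissible T g \<epsilon> N K \<Lambda> \<beta> \<longleftrightarrow>
     (\<forall>f \<in> BK K \<inter> F_N N. newton_defined_at T g \<epsilon> N f) \<and>
     inverse_bound T g \<epsilon> N K < ereal \<Lambda> \<and>
     0 < \<beta> \<and> ereal \<beta> \<le> min 1 (delta_KN T g \<epsilon> N K \<Lambda>)"

definition B_prime ::
  "(real \<Rightarrow> real) \<Rightarrow> (real \<Rightarrow> real \<Rightarrow> real) \<Rightarrow> real \<Rightarrow> nat \<Rightarrow> real \<Rightarrow> real \<Rightarrow> real \<Rightarrow>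
   (real \<Rightarrow> real) set" where
  "B_prime T g \<epsilon> N K \<Lambda> \<beta> = {h \<in> densities \<inter> F_N N.
     densities \<inter> F_N N \<inter> W11_ball h \<beta> \<subseteq> BK K \<and>
     Wnorm 1 (\<lambda>x. h x - sc_transfer_N T g \<epsilon> N h x) < \<beta> / (2 * \<Lambda>)}"

definition newton_step ::
  "(real \<Rightarrow> real) \<Rightarrow> (real \<Rightarrow> real \<Rightarrow> real) \<Rightarrow> real \<Rightarrow> nat \<Rightarrow> (real \<Rightarrow> real) \<Rightarrow> real \<Rightarrow> real" where
  "newton_step T g \<epsilon> N h =
     (\<lambda>x. h x - inv_I_minus_D T g \<epsilon> N h (\<lambda>y. h y - sc_transfer_N T g \<epsilon> N h y) x)"

end

theory Submission
  imports Defs "HOL-Library.Function_Algebras"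
begin

text \<open>Write \<open>S\<^sub>f\<close> for \<open>T\<^sub>\<epsilon>\<^sub>,\<^sub>f\<close> and \<open>G h (x) = \<integral> g(x,y) h(y) dy\<close>. Everything happens on the
  finite-dimensional space \<open>F_N\<close>, where the discretised operator and its derivative are explicit convolutions
  with the Fejer kernel \<open>K\<close>:
  \<open>\<Phi> f (x) = \<integral> K(x - S\<^sub>f y) f(y) dy\<close> and
  \<open>D\<^sub>f h (x) = \<integral> K(x - S\<^sub>f y) h(y) dy - \<epsilon> \<integral> K'(x - S\<^sub>f y) (G h)(T y) f(y) dy\<close>.
  These formulas (\<open>disc_op\<close>, \<open>disc_deriv\<close>) show that \<open>D\<^sub>f\<close> is the Frechet derivative with a quadratic remainder and
  that it is Lipschitz in \<open>f\<close>, with constants that depend on \<open>N\<close>.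

  \<^emph>\<open>Invertibility.\<close> Integration by parts removes the derivative from \<open>K'\<close>, so for \<open>f\<close> bounded in \<open>W\<^sup>2\<^sup>,\<^sup>1\<close> the
  operator \<open>D\<^sub>f\<close> differs from \<open>\<Pi>\<^sub>N \<L>\<^sub>S\<^sub>f\<close> by \<open>O(\<epsilon>)\<close>. A mean-zero \<open>h\<close> with \<open>h - D\<^sub>f h\<close> small is therefore nearly fixed
  by \<open>\<L>\<^sub>S\<^sub>f\<close>, hence by its powers, and these contract. This bounds \<open>(I - D\<^sub>f)\<^sup>-\<^sup>1\<close> on \<open>BK K\<close> uniformly in \<open>N\<close>
  (\<open>uniform_inverse_bound\<close>), which yields \<open>\<epsilon>7\<close> and the admissible constants.

  \<^emph>\<open>Newton's method.\<close> Within distance \<open>\<beta>\<close> of the fixed point the derivative varies by at most \<open>1 / (4 \<Lambda>)\<close>, so a step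
  shrinks the error by the factor \<open>4\<close>; the quadratic remainder upgrades this to order two
  (\<open>newton_step_contracts\<close>, \<open>newton_converges\<close>). This needs that all iterates stay in \<open>BK Kt\<close>, for every
  admissible pair \<open>\<Lambda>\<close>, \<open>\<beta>\<close>. It suffices that the densities of \<open>F_N\<close> within \<open>\<beta>\<close> of the fixed point lie
  in \<open>BK Kt\<close> and that the iterates are nonnegative. For the latter, fixed points are bounded below by a constant
  \<open>c\<close> independent of \<open>N\<close> (\<open>uniform_positivity\<close>), so \<open>\<beta> \<le> c\<close> is enough.

  \<^emph>\<open>Choice of \<open>Kt\<close>.\<close> For fixed \<open>N\<close> all densities of \<open>F_N\<close> lie in one ball \<open>BK KM\<close>. If \<open>I - D\<^sub>f\<close> is uniformly
  invertible on all of them, \<open>Kt = KM\<close> works: no density is excluded, and \<open>\<beta> \<le> c\<close> is automatic for large \<open>N\<close>,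
  because \<open>D\<^sub>f\<close> involves one derivative more than the \<open>W\<^sup>1\<^sup>,\<^sup>1\<close> norm of \<open>f\<close> controls, so densities at
  bounded distance have arbitrarily different derivatives (\<open>admissible_radius_small\<close>). The exception is
  \<open>\<epsilon> g = 0\<close>, where the operator is linear and one step lands on the fixed point. If invertibility
  fails somewhere, take \<open>Kt\<close> just below the first radius of failure: there the inverses are huge, so \<open>\<Lambda>\<close> is
  huge, and a huge \<open>\<Lambda>\<close> forces a small \<open>\<beta>\<close> (\<open>small_radius_before_failure\<close>).\<close>

section \<open>Integration over the circle\<close>

abbreviation circ :: "real measure" where
  "circ \<equiv> restrict_space lborel {0..1}"

lemma space_circ [simp]: "space circ = {0..1}"
  by (simp add: space_restrict_space)

lemma emeasure_circ: "emeasure circ (space circ) = 1"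
  by (simp add: emeasure_restrict_space space_restrict_space)

lemma finite_measure_circ: "finite_measure circ"
  by (rule finite_measureI) (simp only: emeasure_circ, simp)

interpretation circ: finite_measure circ
  by (rule finite_measure_circ)

interpretation circ2: pair_sigma_finite circ circ
  by unfold_locales

abbreviation L1norm :: "(real \<Rightarrow> real) \<Rightarrow> real" where
  "L1norm f \<equiv> cint (\<lambda>x. \<bar>f x\<bar>)"

lemma cint_circ: "cint f = integral\<^sup>L circ f"
  unfolding cint_def set_lebesgue_integral_def
  by (subst integral_restrict_space) simp_all

lemma set_integrable_circ: "set_integrable lborel {0..1} f \<longleftrightarrow> integrable circ f"
  for f :: "real \<Rightarrow> real"
  unfolding set_integrable_def by (subst integrable_restrict_space) simp_all

lemma L1_iff: "f \<in> L1 \<longleftrightarrow> periodic1 f \<and> integrable circ f"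
  by (simp add: L1_def set_integrable_circ)

lemma measurable_circ: "f \<in> borel_measurable borel \<Longrightarrow> f \<in> borel_measurable circ"
  by (intro measurable_restrict_space1) simp

lemma integrable_circ_bounded:
  fixes f :: "real \<Rightarrow> real"
  assumes "f \<in> borel_measurable borel" "\<And>x. x \<in> {0..1} \<Longrightarrow> \<bar>f x\<bar> \<le> B"
  shows "integrable circ f"
  by (rule circ.integrable_const_bound[where B = B])
     (use assms in \<open>auto intro!: AE_I2 measurable_circ\<close>)

lemma integrable_circ_cont:
  fixes f :: "real \<Rightarrow> real"
  assumes "continuous_on UNIV f"
  shows "integrable circ f"
proof -
  have "set_integrable lborel {0..1} f"
    by (rule borel_integrable_atLeastAtMost') (use assms continuous_on_subset in blast)
  thus ?thesis by (simp add: set_integrable_circ)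
qed

lemma integrable_circ_mult:
  fixes f \<phi> :: "real \<Rightarrow> real"
  assumes "integrable circ f" "\<phi> \<in> borel_measurable borel" "\<And>x. x \<in> {0..1} \<Longrightarrow> \<bar>\<phi> x\<bar> \<le> B"
  shows "integrable circ (\<lambda>x. \<phi> x * f x)"
proof (rule Bochner_Integration.integrable_bound[where f = "\<lambda>x. B * f x"])
  show "integrable circ (\<lambda>x. B * f x)" using assms(1) by simp
  show "(\<lambda>x. \<phi> x * f x) \<in> borel_measurable circ"
    using assms(1) measurable_circ[OF assms(2)] by (intro borel_measurable_times) auto
  show "AE x in circ. norm (\<phi> x * f x) \<le> norm (B * f x)"
  proof (rule AE_I2)
    fix x assume "x \<in> space circ"
    hence "\<bar>\<phi> x\<bar> \<le> B" using assms(3) by simp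
    hence "\<bar>\<phi> x\<bar> \<le> \<bar>B\<bar>" by linarith
    thus "norm (\<phi> x * f x) \<le> norm (B * f x)"
      by (simp add: abs_mult mult_right_mono)
  qed
qed

lemma integrable_circ_cmult:
  fixes f \<phi> :: "real \<Rightarrow> real"
  assumes "integrable circ f" "continuous_on UNIV \<phi>"
  shows "integrable circ (\<lambda>x. \<phi> x * f x)"
proof -
  have "compact (\<phi> ` {0..1})"
    by (intro compact_continuous_image continuous_on_subset[OF assms(2)]) auto
  then obtain B where "\<And>x. x \<in> {0..1} \<Longrightarrow> \<bar>\<phi> x\<bar> \<le> B"
    using compact_imp_bounded bounded_iff by (metis imageI real_norm_def)
  thus ?thesis using assms borel_measurable_continuous_onI
    by (intro integrable_circ_mult) auto
qed

lemma cint_cong: "(\<And>x. x \<in> {0..1} \<Longrightarrow> f x = g x) \<Longrightarrow> cint f = cint g"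
  unfolding cint_circ by (rule Bochner_Integration.integral_cong) auto

lemma cint_add: "integrable circ f \<Longrightarrow> integrable circ g \<Longrightarrow> cint (\<lambda>x. f x + g x) = cint f + cint g"
  by (simp add: cint_circ)

lemma cint_diff: "integrable circ f \<Longrightarrow> integrable circ g \<Longrightarrow> cint (\<lambda>x. f x - g x) = cint f - cint g"
  by (simp add: cint_circ)

lemma cint_minus: "cint (\<lambda>x. - f x) = - cint f"
  by (simp add: cint_circ)

lemma cint_cmult: "cint (\<lambda>x. c * f x) = c * cint f"
  by (simp add: cint_circ)

lemma cint_multc: "cint (\<lambda>x. f x * c) = cint f * c"
  by (simp add: cint_circ)

lemma cint_const: "cint (\<lambda>x. c) = c"
proof -
  have "measure circ {0..1} = 1"
    using emeasure_circ by (simp add: measure_def)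
  thus ?thesis by (simp add: cint_circ)
qed

lemma cint_sum: "(\<And>i. i \<in> I \<Longrightarrow> integrable circ (f i)) \<Longrightarrow>
    cint (\<lambda>x. \<Sum>i\<in>I. f i x) = (\<Sum>i\<in>I. cint (f i))"
  unfolding cint_circ by (rule Bochner_Integration.integral_sum) auto

lemma cint_mono: "integrable circ f \<Longrightarrow> integrable circ g \<Longrightarrow> (\<And>x. x \<in> {0..1} \<Longrightarrow> f x \<le> g x) \<Longrightarrow> cint f \<le> cint g"
  unfolding cint_circ by (rule integral_mono) auto

lemma cint_nonneg: "(\<And>x. x \<in> {0..1} \<Longrightarrow> 0 \<le> f x) \<Longrightarrow> 0 \<le> cint f"
  unfolding cint_circ by (rule integral_nonneg_AE) auto

lemma cint_abs_le: "\<bar>cint f\<bar> \<le> L1norm f"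
  unfolding cint_circ using integral_norm_bound[of circ f] by simp

lemma cint_le_bound:
  assumes "integrable circ f" "\<And>x. x \<in> {0..1} \<Longrightarrow> f x \<le> B"
  shows "cint f \<le> B"
  using cint_mono[OF assms(1), of "\<lambda>x. B"] assms(2) by (simp add: cint_const)

lemma cint_abs_triangle:
  assumes "integrable circ f" "integrable circ g"
  shows "cint (\<lambda>x. \<bar>f x + g x\<bar>) \<le> L1norm f + L1norm g"
  using assms by (subst cint_add[symmetric]) (auto intro!: cint_mono)

lemma cint_abs_cmult: "cint (\<lambda>x. \<bar>c * f x\<bar>) = \<bar>c\<bar> * L1norm f"
  by (simp add: cint_cmult abs_mult)

lemma cint_abs_mult_le:
  assumes "integrable circ f" "\<phi> \<in> borel_measurable borel" "\<And>x. x \<in> {0..1} \<Longrightarrow> \<bar>\<phi> x\<bar> \<le> B"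
  shows "cint (\<lambda>x. \<bar>\<phi> x * f x\<bar>) \<le> B * L1norm f"
proof -
  have "cint (\<lambda>x. \<bar>\<phi> x * f x\<bar>) \<le> cint (\<lambda>x. B * \<bar>f x\<bar>)"
    using assms(1,3) Bochner_Integration.integrable_abs[OF integrable_circ_mult[OF assms]]
    by (intro cint_mono) (auto simp: abs_mult intro!: mult_right_mono)
  thus ?thesis by (simp add: cint_cmult)
qed

lemma cint_mult_le:
  assumes "integrable circ f" "\<phi> \<in> borel_measurable borel" "\<And>x. x \<in> {0..1} \<Longrightarrow> \<bar>\<phi> x\<bar> \<le> B"
  shows "\<bar>cint (\<lambda>x. \<phi> x * f x)\<bar> \<le> B * L1norm f"
  using cint_abs_le[of "\<lambda>x. \<phi> x * f x"] cint_abs_mult_le[OF assms] by linarith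

lemma deriv_imp_cont: "(\<And>x::real. (f has_real_derivative f' x) (at x)) \<Longrightarrow> continuous_on UNIV f"
  by (meson DERIV_isCont continuous_at_imp_continuous_on)

lemma cint_FTC:
  assumes "\<And>x. (F has_real_derivative f x) (at x)" "continuous_on UNIV f"
  shows "cint f = F 1 - F 0"
proof -
  have "(\<integral>x. indicator {0..1} x *\<^sub>R f x \<partial>lborel) = F 1 - F 0"
    using assms(1) continuous_on_subset[OF assms(2), of "{0..1}"]
    by (intro integral_FTC_Icc) (auto simp: has_real_derivative_iff_has_vector_derivative intro: has_vector_derivative_at_within)
  thus ?thesis by (simp add: cint_def set_lebesgue_integral_def)
qed

lemma cint_HK:
  assumes "continuous_on UNIV f"
  shows "cint f = integral {0..1} f"
  unfolding cint_def
  by (rule set_borel_integral_eq_integral(2)) (simp add: set_integrable_circ integrable_circ_cont assms)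

text \<open>The kernel is continuous, hence bounded on the unit square, which makes the product integrable although \<open>r\<close> is
  only in \<open>L\<^sup>1\<close>.\<close>

lemma cint_Fubini:
  fixes H :: "real \<times> real \<Rightarrow> real"
  assumes H: "continuous_on UNIV H" and r: "integrable circ r"
  shows "cint (\<lambda>x. cint (\<lambda>y. H (x, y) * r y)) = cint (\<lambda>y. cint (\<lambda>x. H (x, y)) * r y)"
    and "integrable circ (\<lambda>x. cint (\<lambda>y. H (x, y) * r y))"
proof -
  have "compact (H ` ({0..1} \<times> {0..1}))"
    by (intro compact_continuous_image continuous_on_subset[OF H] compact_Times) auto
  then obtain B where "\<forall>z\<in>H ` ({0..1} \<times> {0..1}). norm z \<le> B"
    using compact_imp_bounded bounded_iff by metis
  hence B: "\<And>x y. x \<in> {0..1} \<Longrightarrow> y \<in> {0..1} \<Longrightarrow> \<bar>H (x, y)\<bar> \<le> B"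
    by (metis SigmaI imageI real_norm_def)
  have Hm: "H \<in> borel_measurable borel" by (rule borel_measurable_continuous_onI[OF H])
  have slice: "integrable circ (\<lambda>y. H (x, y) * r y)" for x
    by (rule integrable_circ_cmult[OF r])
       (intro continuous_on_compose2[OF H] continuous_intros, auto)
  have id: "(\<lambda>x. x) \<in> measurable circ borel"
    by (rule measurable_circ) simp
  have f: "fst \<in> measurable (circ \<Otimes>\<^sub>M circ) borel" "snd \<in> measurable (circ \<Otimes>\<^sub>M circ) borel"
    by (rule measurable_compose[OF measurable_fst id], rule measurable_compose[OF measurable_snd id])
  have meas: "(\<lambda>p. H p * r (snd p)) \<in> borel_measurable (circ \<Otimes>\<^sub>M circ)"
  proof (intro borel_measurable_times)
    have "(\<lambda>p. (fst p, snd p)) \<in> measurable (circ \<Otimes>\<^sub>M circ) (borel \<Otimes>\<^sub>M borel)"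
      using f by (intro measurable_Pair)
    from measurable_compose[OF this, of H borel] show "H \<in> borel_measurable (circ \<Otimes>\<^sub>M circ)"
      using Hm by (simp add: borel_prod)
    show "(\<lambda>p. r (snd p)) \<in> borel_measurable (circ \<Otimes>\<^sub>M circ)"
      using r by (intro measurable_compose[OF measurable_snd]) auto
  qed
  have int: "integrable (circ \<Otimes>\<^sub>M circ) (\<lambda>p. H p * r (snd p))"
  proof (rule circ2.Fubini_integrable[OF meas])
    show "AE x in circ. integrable circ (\<lambda>y. H (x, y) * r (snd (x, y)))"
      using slice by simp
    show "integrable circ (\<lambda>x. LINT y|circ. norm (H (x, y) * r (snd (x, y))))"
    proof (rule circ.integrable_const_bound[where B = "B * L1norm r"])
      show "(\<lambda>x. LINT y|circ. norm (H (x, y) * r (snd (x, y)))) \<in> borel_measurable circ"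
        using meas by (intro circ.borel_measurable_lebesgue_integral) (simp add: case_prod_beta')
      show "AE x in circ. norm (LINT y|circ. norm (H (x, y) * r (snd (x, y)))) \<le> B * L1norm r"
      proof (rule AE_I2)
        fix x assume x: "x \<in> space circ"
        have "cint (\<lambda>y. \<bar>H (x, y) * r y\<bar>) \<le> B * L1norm r"
          using r x B by (intro cint_abs_mult_le borel_measurable_continuous_onI continuous_on_compose2[OF H] continuous_intros) auto
        moreover have "0 \<le> cint (\<lambda>y. \<bar>H (x, y) * r y\<bar>)" by (rule cint_nonneg) simp
        ultimately show "norm (LINT y|circ. norm (H (x, y) * r (snd (x, y)))) \<le> B * L1norm r"
          by (simp add: cint_circ)
      qed
    qed
  qed
  have int2: "integrable (circ \<Otimes>\<^sub>M circ) (\<lambda>(x, y). H (x, y) * r y)"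
    using int by (simp add: case_prod_beta')
  have eq: "(\<lambda>y. LINT x|circ. H (x, y) * r y) = (\<lambda>y. (LINT x|circ. H (x, y)) * r y)"
    by simp
  show "cint (\<lambda>x. cint (\<lambda>y. H (x, y) * r y)) = cint (\<lambda>y. cint (\<lambda>x. H (x, y)) * r y)"
    using circ2.Fubini_integral[OF int2] eq by (simp add: cint_circ)
  show "integrable circ (\<lambda>x. cint (\<lambda>y. H (x, y) * r y))"
    using circ2.integrable_fst[OF int2] by (simp add: cint_circ)
qed

lemma periodic1_int: "periodic1 f \<Longrightarrow> f (x + of_int n) = f x"
proof (induction n arbitrary: x rule: int_induct[where k = 0])
  case (step1 i)
  have "f (x + of_int (i + 1)) = f ((x + of_int i) + 1)" by (simp add: algebra_simps)
  thus ?case using step1 unfolding periodic1_def by simp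
next
  case (step2 i)
  have "f (x + of_int (i - 1)) = f ((x + of_int (i - 1)) + 1)"
    using step2.prems unfolding periodic1_def by metis
  also have "(x + of_int (i - 1)) + 1 = x + of_int i" by simp
  finally show ?case using step2 by simp
qed simp

lemma periodic1_frac: "periodic1 f \<Longrightarrow> f (frac x) = f x"
  using periodic1_int[of f x "- \<lfloor>x\<rfloor>"] by (simp add: frac_def)

lemma frac01: "frac x \<in> {0..1::real}"
  using frac_lt_1[of x] by (simp add: less_imp_le)

lemma periodic1_all:
  assumes "periodic1 f" "\<And>x. x \<in> {0..1} \<Longrightarrow> P (f x)"
  shows "P (f x)"
  using assms(2)[OF frac01[of x]] periodic1_frac[OF assms(1), of x] by simp

lemma periodic_bounded:
  assumes "periodic1 f" "continuous_on UNIV f"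
  obtains B where "B > 0" "\<And>x. \<bar>f x\<bar> \<le> B"
proof -
  have "compact (f ` {0..1})"
    by (intro compact_continuous_image continuous_on_subset[OF assms(2)]) auto
  then obtain B where "B > 0" "\<forall>z\<in>f ` {0..1}. norm z \<le> B"
    using compact_imp_bounded bounded_pos by metis
  hence "\<And>x. x \<in> {0..1} \<Longrightarrow> \<bar>f x\<bar> \<le> B" by auto
  hence "\<And>x. \<bar>f x\<bar> \<le> B" using periodic1_all[OF assms(1), of "\<lambda>z. \<bar>z\<bar> \<le> B"] by simp
  thus ?thesis using that \<open>B > 0\<close> by blast
qed

lemma periodic_measurable:
  assumes "periodic1 f" "integrable circ f"
  shows "f \<in> borel_measurable borel"
proof -
  have "(\<lambda>x. indicator {0..1} x *\<^sub>R f x) \<in> borel_measurable borel"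
    using assms(2) by (simp add: set_integrable_circ[symmetric] set_integrable_def)
  moreover have "frac \<in> borel_measurable (borel :: real measure)"
    unfolding frac_def by measurable
  ultimately have "(\<lambda>x. indicator {0..1} (frac x) *\<^sub>R f (frac x)) \<in> borel_measurable borel"
    using measurable_compose by blast
  thus ?thesis using frac01 periodic1_frac[OF assms(1)] by (simp add: indicator_def)
qed

lemma cint_zero_cont:
  assumes "continuous_on UNIV f" "periodic1 f" "L1norm f = 0"
  shows "f x = 0"
proof -
  have c: "continuous_on UNIV (\<lambda>x. \<bar>f x\<bar>)" using assms(1) by (intro continuous_intros)
  have "integral {0..1} (\<lambda>x. \<bar>f x\<bar>) = 0" using assms(3) cint_HK[OF c] by simp
  hence "\<forall>x\<in>{0..1}. \<bar>f x\<bar> = 0"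
    using integral_eq_0_iff[of 0 1 "\<lambda>x. \<bar>f x\<bar>"] continuous_on_subset[OF c] by auto
  thus ?thesis using periodic1_all[OF assms(2), of "\<lambda>z. z = 0"] by simp
qed

lemma cint_reflect:
  fixes f :: "real \<Rightarrow> real"
  assumes "periodic1 f"
  shows "cint (\<lambda>x. f (- x)) = cint f" "integrable circ f \<Longrightarrow> integrable circ (\<lambda>x. f (- x))"
proof -
  have p: "f (- x) = f (1 - x)" for x using assms unfolding periodic1_def by (metis add.commute diff_conv_add_uminus)
  have i: "indicator {0..1} (1 - x) = (indicator {0..1} x :: real)" for x :: real by (auto simp: indicator_def)
  have "(\<integral>x. indicator {0..1} x *\<^sub>R f x \<partial>lborel) = (\<integral>x. indicator {0..1} x *\<^sub>R f (1 - x) \<partial>lborel)"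
    using lborel_integral_real_affine[of "-1" "\<lambda>x. indicator {0..1} x *\<^sub>R f x" 1] by (simp add: i)
  thus "cint (\<lambda>x. f (- x)) = cint f" by (simp add: cint_def set_lebesgue_integral_def p)
  assume "integrable circ f"
  hence "integrable lborel (\<lambda>x. indicator {0..1} x *\<^sub>R f x)"
    by (simp add: set_integrable_circ[symmetric] set_integrable_def)
  from lborel_integrable_real_affine[OF this, of "-1" 1]
  show "integrable circ (\<lambda>x. f (- x))"
    by (simp add: set_integrable_circ[symmetric] set_integrable_def i p)
qed

lemma cint_shift:
  assumes p: "periodic1 f" and fi: "integrable circ f"
  shows "cint (\<lambda>x. f (x + a)) = cint f" "integrable circ (\<lambda>x. f (x + a))"
proof -
  define b where "b = frac a"
  have b: "0 \<le> b" "b < 1" by (auto simp: b_def frac_lt_1)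
  have fa: "f (x + a) = f (x + b)" for x
    using periodic1_int[OF p, of "x + b" "\<lfloor>a\<rfloor>"] by (simp add: b_def frac_def)
  have I: "integrable lborel (\<lambda>x. indicator A x *\<^sub>R f x)" if "A \<in> sets borel" "A \<subseteq> {0..1}" for A
    using set_integrable_subset[of lborel "{0..1}" f A] fi that
    by (simp add: set_integrable_circ[symmetric]) (simp add: set_integrable_def)
  let ?A = "{b..1}" and ?B = "{0<..b}"
  have IA: "integrable lborel (\<lambda>x. indicator ?A x *\<^sub>R f x)" using b by (intro I) auto
  have IB: "integrable lborel (\<lambda>x. indicator ?B x *\<^sub>R f x)" using b by (intro I) auto
  have eq: "indicator {0..1} x *\<^sub>R f (x + a) = indicator ?A (b + x) *\<^sub>R f (b + x) + indicator ?B (b - 1 + x) *\<^sub>R f (b - 1 + x)" for x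
  proof -
    have "f (b - 1 + x) = f (x + b)"
      using periodic1_int[OF p, of "b - 1 + x" 1] by (simp add: algebra_simps)
    thus ?thesis using b by (auto simp: indicator_def fa add.commute[of x b])
  qed
  have IA': "integrable lborel (\<lambda>x. indicator ?A (b + x) *\<^sub>R f (b + x))"
    using lborel_integrable_real_affine[OF IA, of 1 b] by simp
  have IB': "integrable lborel (\<lambda>x. indicator ?B (b - 1 + x) *\<^sub>R f (b - 1 + x))"
    using lborel_integrable_real_affine[OF IB, of 1 "b - 1"] by simp
  show "integrable circ (\<lambda>x. f (x + a))"
    unfolding set_integrable_circ[symmetric] set_integrable_def eq
    by (rule Bochner_Integration.integrable_add[OF IA' IB'])
  have "cint (\<lambda>x. f (x + a)) = (\<integral>x. indicator ?A (b + x) *\<^sub>R f (b + x) \<partial>lborel) + (\<integral>x. indicator ?B (b - 1 + x) *\<^sub>R f (b - 1 + x) \<partial>lborel)"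
    unfolding cint_def set_lebesgue_integral_def eq
    by (rule Bochner_Integration.integral_add[OF IA' IB'])
  also have "\<dots> = (\<integral>x. indicator ?A x *\<^sub>R f x \<partial>lborel) + (\<integral>x. indicator ?B x *\<^sub>R f x \<partial>lborel)"
    using lborel_integral_real_affine[of 1 "\<lambda>x. indicator ?A x *\<^sub>R f x" b]
      lborel_integral_real_affine[of 1 "\<lambda>x. indicator ?B x *\<^sub>R f x" "b - 1"] by simp
  also have "\<dots> = (\<integral>x. indicator ?A x *\<^sub>R f x + indicator ?B x *\<^sub>R f x \<partial>lborel)"
    by (rule Bochner_Integration.integral_add[OF IA IB, symmetric])
  also have "\<dots> = (\<integral>x. indicator {0..1} x *\<^sub>R f x \<partial>lborel)"
  proof (rule integral_cong_AE)
    have "AE x in lborel. x \<noteq> 0 \<and> x \<noteq> b"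
      by (intro AE_conjI AE_lborel_singleton)
    thus "AE x in lborel. indicator ?A x *\<^sub>R f x + indicator ?B x *\<^sub>R f x = indicator {0..1} x *\<^sub>R f x"
      by eventually_elim (use b in \<open>auto simp: indicator_def\<close>)
  qed (use IA IB I[of "{0..1}"] in auto)
  finally show "cint (\<lambda>x. f (x + a)) = cint f" by (simp add: cint_def set_lebesgue_integral_def)
qed

lemma cint_parts:
  assumes "\<And>x. (u has_real_derivative u' x) (at x)" "\<And>x. (v has_real_derivative v' x) (at x)"
    "continuous_on UNIV u'" "continuous_on UNIV v'" "periodic1 u" "periodic1 v"
  shows "cint (\<lambda>x. u x * v' x) = - cint (\<lambda>x. u' x * v x)"
proof -
  have c: "continuous_on UNIV u" "continuous_on UNIV v"
    using assms(1,2) by (meson DERIV_isCont continuous_at_imp_continuous_on)+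
  have "cint (\<lambda>x. u x * v' x + u' x * v x) = u 1 * v 1 - u 0 * v 0"
    using assms c by (intro cint_FTC continuous_intros) (auto intro!: derivative_eq_intros)
  also have "\<dots> = 0" using assms(5,6) unfolding periodic1_def by (metis add_0 right_minus_eq)
  finally show ?thesis using assms c
    by (subst (asm) cint_add) (auto intro!: integrable_circ_cont continuous_intros)
qed

lemma periodic1_deriv:
  assumes "periodic1 f" "\<And>x. (f has_real_derivative f' x) (at x)"
  shows "periodic1 f'"
  unfolding periodic1_def
proof
  fix x
  have "((\<lambda>x. f (x + 1)) has_real_derivative f' (x + 1)) (at x)"
    using assms(2)[of "x + 1"] by (simp only: DERIV_shift)
  moreover have "(\<lambda>x. f (x + 1)) = f" using assms(1) by (auto simp: periodic1_def)
  ultimately show "f' (x + 1) = f' x" using assms(2) DERIV_unique by metis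
qed

section \<open>Trigonometric polynomials and the Fejer kernel\<close>

lemma e_fun_cis: "e_fun k x = cis (2 * pi * of_int k * x)"
  unfolding e_fun_def cis_conv_exp by (simp add: mult_ac)

lemma e_fun_simps [simp]: "norm (e_fun k x) = 1" "e_fun 0 x = 1"
  "Re (e_fun k x) = cos (2 * pi * of_int k * x)" "Im (e_fun k x) = sin (2 * pi * of_int k * x)"
  by (simp_all add: e_fun_cis)

lemma e_fun_add: "e_fun (j + k) x = e_fun j x * e_fun k x"
  by (simp add: e_fun_cis cis_mult algebra_simps)

lemma e_fun_diff: "e_fun k (x - y) = e_fun k x * e_fun (- k) y"
  by (simp add: e_fun_cis cis_mult algebra_simps)

lemma e_fun_cnj: "cnj (e_fun k x) = e_fun (- k) x"
  by (simp add: e_fun_cis cis_cnj)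

lemma cis_2pi_int: "cis (2 * pi * of_int k) = 1"
  using cos_int_2pin[of k] sin_int_2pin[of k] by (simp add: complex_eq_iff)

lemma e_fun_periodic: "e_fun k (x + 1) = e_fun k x"
proof -
  have "e_fun k (x + 1) = cis (2 * pi * of_int k * x) * cis (2 * pi * of_int k)"
    by (simp add: e_fun_cis cis_mult algebra_simps)
  thus ?thesis by (simp add: cis_2pi_int e_fun_cis)
qed

lemma e_fun_deriv: "(e_fun k has_vector_derivative (2 * pi * of_int k * \<i>) * e_fun k x) (at x)"
proof -
  define w :: complex where "w = 2 * pi * of_int k * \<i>"
  have eq: "exp (of_real x * w) = e_fun k x" for x by (simp add: e_fun_def w_def mult_ac)
  have "((\<lambda>x. exp (of_real x * w)) has_vector_derivative w * exp (of_real x * w)) (at x)"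
    using exp_scaleR_has_vector_derivative_right[of w x UNIV]
    by (simp add: scaleR_conv_of_real mult.commute)
  hence "(e_fun k has_vector_derivative w * e_fun k x) (at x)" by (simp only: eq)
  thus ?thesis by (simp only: w_def)
qed

lemma e_fun_continuous: "continuous_on UNIV (e_fun k)"
  unfolding e_fun_def by (intro continuous_intros)

lemma cint_cos: "cint (\<lambda>x. cos (2 * pi * of_int k * x)) = (if k = 0 then 1 else 0)"
proof (cases "k = 0")
  case False
  have "cint (\<lambda>x. cos (2 * pi * of_int k * x)) = sin (2 * pi * of_int k * 1) / (2 * pi * of_int k) - sin (2 * pi * of_int k * 0) / (2 * pi * of_int k)"
    using False by (intro cint_FTC continuous_intros) (auto intro!: derivative_eq_intros)
  thus ?thesis using False sin_int_2pin[of k] by (simp add: mult_ac)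
qed (simp add: cint_const)

lemma cint_sin: "cint (\<lambda>x. sin (2 * pi * of_int k * x)) = 0"
proof (cases "k = 0")
  case False
  have "cint (\<lambda>x. sin (2 * pi * of_int k * x)) = - cos (2 * pi * of_int k * 1) / (2 * pi * of_int k) - - cos (2 * pi * of_int k * 0) / (2 * pi * of_int k)"
    using False by (intro cint_FTC continuous_intros) (auto intro!: derivative_eq_intros)
  thus ?thesis using False cos_int_2pin[of k] by (simp add: mult_ac)
qed (simp add: cint_const)

definition trig_coeffs :: "nat \<Rightarrow> (int \<Rightarrow> complex) \<Rightarrow> (real \<Rightarrow> real) \<Rightarrow> bool" where
  "trig_coeffs N c f \<longleftrightarrow> (\<forall>x. complex_of_real (f x) = (\<Sum>k\<in>{- int N + 1..int N}. c k * e_fun k x))"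

lemma F_N_coeffs: "f \<in> F_N N \<longleftrightarrow> (\<exists>c. trig_coeffs N c f)"
  by (simp add: F_N_def trig_coeffs_def)

lemma trig_coeffs_deriv:
  assumes "trig_coeffs N c f"
  shows "(f has_real_derivative deriv f x) (at x)"
    and "trig_coeffs N (\<lambda>k. 2 * pi * of_int k * \<i> * c k) (deriv f)"
proof -
  define D where "D x = (\<Sum>k\<in>{- int N + 1..int N}. 2 * pi * of_int k * \<i> * c k * e_fun k x)" for x
  have d: "((\<lambda>x. complex_of_real (f x)) has_vector_derivative D x) (at x)" for x
  proof -
    have "((\<lambda>x. \<Sum>k\<in>{- int N + 1..int N}. c k * e_fun k x) has_vector_derivative
      (\<Sum>k\<in>{- int N + 1..int N}. c k * ((2 * pi * of_int k * \<i>) * e_fun k x))) (at x)"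
      by (intro has_vector_derivative_sum has_vector_derivative_mult_right e_fun_deriv)
    moreover have "(\<Sum>k\<in>{- int N + 1..int N}. c k * ((2 * pi * of_int k * \<i>) * e_fun k x)) = D x"
      by (simp add: D_def mult_ac)
    ultimately show ?thesis using assms by (simp add: trig_coeffs_def)
  qed
  have re: "(f has_real_derivative Re (D x)) (at x)" for x
    using bounded_linear.has_vector_derivative[OF bounded_linear_Re d[of x]]
    by (simp add: has_real_derivative_iff_has_vector_derivative)
  have im: "((\<lambda>x. 0::real) has_vector_derivative Im (D x)) (at x)" for x
    using bounded_linear.has_vector_derivative[OF bounded_linear_Im d[of x]] by simp
  have "Im (D x) = 0" for x
    using vector_derivative_unique_at[OF im[of x] has_vector_derivative_const[of 0]] by simp
  moreover have df: "deriv f x = Re (D x)" for x using re DERIV_imp_deriv by blast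
  ultimately have "complex_of_real (deriv f x) = D x" for x by (simp add: complex_eq_iff)
  thus "trig_coeffs N (\<lambda>k. 2 * pi * of_int k * \<i> * c k) (deriv f)"
    by (simp add: trig_coeffs_def D_def)
  show "(f has_real_derivative deriv f x) (at x)" using re df by simp
qed

lemma F_N_deriv:
  assumes "f \<in> F_N N"
  shows "(f has_real_derivative deriv f x) (at x)" "deriv f \<in> F_N N"
  using assms trig_coeffs_deriv unfolding F_N_coeffs by blast+

lemma F_N_cont: "f \<in> F_N N \<Longrightarrow> continuous_on UNIV f"
  by (rule deriv_imp_cont[OF F_N_deriv(1)])

lemma F_N_periodic:
  assumes "f \<in> F_N N" shows "periodic1 f"
  unfolding periodic1_def
proof
  fix x
  obtain c where "trig_coeffs N c f" using assms F_N_coeffs by blast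
  hence "complex_of_real (f (x + 1)) = complex_of_real (f x)"
    unfolding trig_coeffs_def by (simp only: e_fun_periodic)
  thus "f (x + 1) = f x" by simp
qed

lemma F_N_iter: "f \<in> F_N N \<Longrightarrow> (deriv ^^ j) f \<in> F_N N"
  by (induction j) (auto intro: F_N_deriv)

lemma F_N_test: "f \<in> F_N N \<Longrightarrow> test_function f"
  unfolding test_function_def C_k_def
  using F_N_periodic F_N_iter F_N_cont F_N_deriv(1) field_differentiable_def by blast

lemma F_N_integrable: "f \<in> F_N N \<Longrightarrow> integrable circ f"
  by (intro integrable_circ_cont F_N_cont)

lemma F_N_lin:
  assumes "f \<in> F_N N" "g \<in> F_N N"
  shows "(\<lambda>x. a * f x + b * g x) \<in> F_N N"
proof -
  obtain c d where "trig_coeffs N c f" "trig_coeffs N d g" using assms F_N_coeffs by blast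
  hence "trig_coeffs N (\<lambda>k. of_real a * c k + of_real b * d k) (\<lambda>x. a * f x + b * g x)"
    by (simp add: trig_coeffs_def sum.distrib sum_distrib_left algebra_simps)
  thus ?thesis using F_N_coeffs by blast
qed

lemma F_N_add: "f \<in> F_N N \<Longrightarrow> g \<in> F_N N \<Longrightarrow> (\<lambda>x. f x + g x) \<in> F_N N"
  using F_N_lin[of f N g 1 1] by simp

lemma F_N_diff: "f \<in> F_N N \<Longrightarrow> g \<in> F_N N \<Longrightarrow> (\<lambda>x. f x - g x) \<in> F_N N"
  using F_N_lin[of f N g 1 "-1"] by simp

lemma F_N_scale: "f \<in> F_N N \<Longrightarrow> (\<lambda>x. a * f x) \<in> F_N N"
  using F_N_lin[of f N f a 0] by simp

lemma F_N_zero: "(\<lambda>x. 0) \<in> F_N N"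
  by (auto simp: F_N_def intro!: exI[of _ "\<lambda>k. 0"])

lemma F_N_deriv_lin:
  assumes "f \<in> F_N N" "g \<in> F_N N"
  shows "deriv (\<lambda>x. a * f x + b * g x) = (\<lambda>x. a * deriv f x + b * deriv g x)"
  using F_N_deriv(1)[OF assms(1)] F_N_deriv(1)[OF assms(2)]
  by (intro ext DERIV_imp_deriv) (auto intro!: derivative_eq_intros)

lemma F_N_cos: "m < N \<Longrightarrow> (\<lambda>x. cos (2 * pi * real m * x)) \<in> F_N N"
  unfolding F_N_def
  by (intro CollectI exI[of _ "\<lambda>k. (if k = int m then 1/2 else 0) + (if k = - int m then 1/2 else 0)"])
     (auto simp: distrib_right sum.distrib if_distrib[of "\<lambda>c. c * _"] sum.delta e_fun_cis complex_eq_iff cong: if_cong)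

lemma F_N_sin: "m < N \<Longrightarrow> (\<lambda>x. sin (2 * pi * real m * x)) \<in> F_N N"
  unfolding F_N_def
  by (intro CollectI exI[of _ "\<lambda>k. (if k = int m then - \<i>/2 else 0) + (if k = - int m then \<i>/2 else 0)"])
     (auto simp: distrib_right sum.distrib if_distrib[of "\<lambda>c. c * _"] sum.delta e_fun_cis complex_eq_iff cong: if_cong)

lemma F_N_const: "0 < N \<Longrightarrow> (\<lambda>x. a) \<in> F_N N"
  using F_N_scale[OF F_N_cos[of 0 N], of a] by simp

lemma integral_e_fun: "integral\<^sup>L circ (e_fun k) = (if k = 0 then 1 else 0)"
proof -
  have "integrable circ (e_fun k)"
    by (rule circ.integrable_const_bound[where B = 1])
       (auto intro!: measurable_restrict_space1 borel_measurable_continuous_onI e_fun_continuous)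
  hence "integral\<^sup>L circ (e_fun k) = Complex (cint (\<lambda>x. Re (e_fun k x))) (cint (\<lambda>x. Im (e_fun k x)))"
    by (simp add: cint_circ complex_eq_iff del: e_fun_simps)
  thus ?thesis by (simp add: cint_cos cint_sin complex_eq_iff)
qed

lemma integrable_e_mult:
  assumes "integrable circ r" "S \<in> borel_measurable borel"
  shows "integrable circ (\<lambda>y. e_fun k (S y) * of_real (r y))"
proof (rule Bochner_Integration.integrable_bound[OF assms(1)])
  have "(\<lambda>y. e_fun k (S y)) \<in> borel_measurable borel"
    using assms(2) borel_measurable_continuous_onI[OF e_fun_continuous] measurable_compose by blast
  hence "(\<lambda>y. e_fun k (S y)) \<in> borel_measurable circ" by (intro measurable_restrict_space1) auto
  thus "(\<lambda>y. e_fun k (S y) * of_real (r y)) \<in> borel_measurable circ"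
    using assms(1) by (intro borel_measurable_times) auto
qed (auto simp: norm_mult)

text \<open>Convolution along any map \<open>S\<close> only multiplies the coefficients of the kernel. Hence the range of the
  discretised operators is in \<open>F_N\<close> whatever the dynamics, and derivatives fall on the kernel.\<close>

lemma trig_coeffs_conv:
  assumes "trig_coeffs N c \<kappa>" "integrable circ r" "S \<in> borel_measurable borel"
  shows "trig_coeffs N (\<lambda>k. c k * integral\<^sup>L circ (\<lambda>y. e_fun (- k) (S y) * of_real (r y)))
    (\<lambda>x. cint (\<lambda>y. \<kappa> (x - S y) * r y))"
  unfolding trig_coeffs_def
proof
  fix x
  have "complex_of_real (cint (\<lambda>y. \<kappa> (x - S y) * r y)) = (\<integral>y. complex_of_real (\<kappa> (x - S y)) * complex_of_real (r y) \<partial>circ)"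
    by (simp add: cint_circ flip: integral_complex_of_real of_real_mult)
  also have "\<dots> = (\<integral>y. (\<Sum>k\<in>{- int N + 1..int N}. (c k * e_fun k x) * (e_fun (- k) (S y) * of_real (r y))) \<partial>circ)"
    using assms(1) by (simp add: trig_coeffs_def e_fun_diff sum_distrib_left mult_ac)
  also have "\<dots> = (\<Sum>k\<in>{- int N + 1..int N}. (\<integral>y. (c k * e_fun k x) * (e_fun (- k) (S y) * of_real (r y)) \<partial>circ))"
    using integrable_e_mult[OF assms(2,3)]
    by (intro Bochner_Integration.integral_sum integrable_mult_right) auto
  finally show "complex_of_real (cint (\<lambda>y. \<kappa> (x - S y) * r y)) = (\<Sum>k\<in>{- int N + 1..int N}.
     c k * integral\<^sup>L circ (\<lambda>y. e_fun (- k) (S y) * of_real (r y)) * e_fun k x)"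
    by (simp add: mult_ac)
qed

lemma F_N_conv:
  assumes "\<kappa> \<in> F_N N" "integrable circ r" "S \<in> borel_measurable borel"
  shows "(\<lambda>x. cint (\<lambda>y. \<kappa> (x - S y) * r y)) \<in> F_N N"
    and "deriv (\<lambda>x. cint (\<lambda>y. \<kappa> (x - S y) * r y)) = (\<lambda>x. cint (\<lambda>y. deriv \<kappa> (x - S y) * r y))"
proof -
  obtain c where c: "trig_coeffs N c \<kappa>" using assms(1) F_N_coeffs by blast
  note 1 = trig_coeffs_conv[OF c assms(2,3)]
  show "(\<lambda>x. cint (\<lambda>y. \<kappa> (x - S y) * r y)) \<in> F_N N" using 1 F_N_coeffs by blast
  note 2 = trig_coeffs_deriv(2)[OF 1]
  note 3 = trig_coeffs_conv[OF trig_coeffs_deriv(2)[OF c] assms(2,3)]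
  have "complex_of_real (deriv (\<lambda>x. cint (\<lambda>y. \<kappa> (x - S y) * r y)) x) =
    complex_of_real (cint (\<lambda>y. deriv \<kappa> (x - S y) * r y))" for x
    using 2 3 unfolding trig_coeffs_def by (simp only: mult.assoc)
  thus "deriv (\<lambda>x. cint (\<lambda>y. \<kappa> (x - S y) * r y)) = (\<lambda>x. cint (\<lambda>y. deriv \<kappa> (x - S y) * r y))" by auto
qed

lemma trig_coeffs_integral:
  assumes "trig_coeffs N c f" "k \<in> {- int N + 1..int N}"
  shows "c k = integral\<^sup>L circ (\<lambda>y. e_fun (- k) y * of_real (f y))"
proof -
  have i: "integrable circ (e_fun j)" for j
    by (rule circ.integrable_const_bound[where B = 1])
       (auto intro!: measurable_restrict_space1 borel_measurable_continuous_onI e_fun_continuous)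
  have "(\<integral>y. e_fun (- k) y * of_real (f y) \<partial>circ) = (\<integral>y. (\<Sum>j\<in>{- int N + 1..int N}. c j * e_fun (j + - k) y) \<partial>circ)"
    using assms(1) by (simp add: trig_coeffs_def sum_distrib_left e_fun_add mult_ac del: add_uminus_conv_diff)
  also have "\<dots> = (\<Sum>j\<in>{- int N + 1..int N}. c j * (if j = k then 1 else 0))"
    using i by (subst Bochner_Integration.integral_sum) (auto simp: integral_e_fun)
  also have "\<dots> = c k" using assms(2) by (simp add: if_distrib cong: if_cong)
  finally show ?thesis by simp
qed

text \<open>Each Fourier coefficient is bounded by the \<open>L\<^sup>1\<close> norm. Applied repeatedly, this bounds every Sobolev norm on
  \<open>F_N\<close> by the \<open>L\<^sup>1\<close> norm, for fixed \<open>N\<close>.\<close>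

lemma F_N_bernstein:
  obtains B where "B > 0" "\<And>f x. f \<in> F_N N \<Longrightarrow> \<bar>deriv f x\<bar> \<le> B * L1norm f"
proof -
  define Z where "Z = {- int N + 1..int N}"
  have cb: "norm (c k) \<le> L1norm f" if "trig_coeffs N c f" "k \<in> Z" for c f k
  proof -
    have "c k = integral\<^sup>L circ (\<lambda>y. e_fun (- k) y * of_real (f y))"
      using trig_coeffs_integral that by (simp add: Z_def)
    moreover have "norm (integral\<^sup>L circ (\<lambda>y. e_fun (- k) y * of_real (f y))) \<le> (\<integral>y. norm (e_fun (- k) y * of_real (f y)) \<partial>circ)"
      by (rule integral_norm_bound)
    ultimately show ?thesis by (simp add: norm_mult cint_circ)
  qed
  have est: "\<bar>f x\<bar> \<le> (\<Sum>k\<in>Z. norm (c k))" if "trig_coeffs N c f" for c f x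
  proof -
    have "\<bar>f x\<bar> = norm (complex_of_real (f x))" by simp
    also have "\<dots> \<le> (\<Sum>k\<in>Z. norm (c k * e_fun k x))"
      using that unfolding trig_coeffs_def Z_def by (simp only:) (rule norm_sum)
    finally show ?thesis by (simp add: norm_mult)
  qed
  define B where "B = (\<Sum>k\<in>Z. 2 * pi * \<bar>of_int k\<bar>) + 1"
  show ?thesis
  proof (rule that[of B])
    have "(\<Sum>k\<in>Z. 2 * pi * \<bar>real_of_int k\<bar>) \<ge> 0" by (intro sum_nonneg) auto
    thus "B > 0" by (simp add: B_def)
    fix f x assume f: "f \<in> F_N N"
    obtain c where c: "trig_coeffs N c f" using f F_N_coeffs by blast
    define I where "I = L1norm f"
    have I: "I \<ge> 0" unfolding I_def by (rule cint_nonneg) simp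
    have "\<bar>deriv f x\<bar> \<le> (\<Sum>k\<in>Z. norm (2 * pi * of_int k * \<i> * c k))"
      by (rule est[OF trig_coeffs_deriv(2)[OF c]])
    also have "\<dots> = (\<Sum>k\<in>Z. 2 * pi * \<bar>of_int k\<bar> * norm (c k))" by (simp add: norm_mult)
    also have "\<dots> \<le> (\<Sum>k\<in>Z. 2 * pi * \<bar>of_int k\<bar> * I)" using cb[OF c] by (intro sum_mono mult_left_mono) (auto simp: I_def)
    also have "\<dots> \<le> B * I" using I by (simp add: B_def sum_distrib_right[symmetric] distrib_right)
    finally show "\<bar>deriv f x\<bar> \<le> B * L1norm f" by (simp add: I_def)
  qed
qed

lemma sum_symmetric_int: "(\<Sum>k\<in>{- int n..int n}. f k) = f 0 + (\<Sum>l<n. f (int l + 1) + f (- (int l + 1)))"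
  for f :: "int \<Rightarrow> 'a::comm_monoid_add"
proof (induction n)
  case (Suc n)
  have "{- int (Suc n)..int (Suc n)} = insert (int n + 1) (insert (- (int n + 1)) {- int n..int n})" by auto
  thus ?case using Suc by (simp add: add_ac)
qed simp

lemma fejer_set: "{k::int. \<bar>k\<bar> \<le> int N - 1} = {1 - int N..int N - 1}"
  by auto

text \<open>The Fejer kernel is a multiple of the squared modulus of \<open>e\<^sub>0 + \<dots> + e\<^sub>N\<^sub>-\<^sub>1\<close>, whence its positivity.\<close>

lemma dirichlet_square:
  "(\<Sum>l<N. e_fun (int l) x) * cnj (\<Sum>l<N. e_fun (int l) x)
    = (\<Sum>k\<in>{1 - int N..int N - 1}. of_real (real N - \<bar>of_int k\<bar>) * e_fun k x)"
proof (induction N)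
  case (Suc N)
  let ?Z = "\<Sum>l<N. e_fun (int l) x" and ?e = "e_fun (int N) x"
  have r: "(\<Sum>l<N. f (int N - int l)) = (\<Sum>l<N. f (int l + 1))" for f :: "int \<Rightarrow> complex"
  proof -
    have "(\<Sum>l<N. f (int l + 1)) = (\<Sum>l<N. f (int (N - Suc l) + 1))"
      by (rule sum.nat_diff_reindex[symmetric])
    also have "\<dots> = (\<Sum>l<N. f (int N - int l))" by (intro sum.cong) (auto simp: algebra_simps of_nat_diff)
    finally show ?thesis by simp
  qed
  have 1: "?e * cnj ?Z = (\<Sum>l<N. e_fun (int l + 1) x)"
    using r[of "\<lambda>k. e_fun k x"] by (simp add: sum_distrib_left e_fun_cnj flip: e_fun_add)
  have 2: "?Z * cnj ?e = (\<Sum>l<N. e_fun (- (int l + 1)) x)"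
    using r[of "\<lambda>k. e_fun (- k) x"] by (simp add: sum_distrib_right e_fun_cnj flip: e_fun_add)
  have 3: "?e * cnj ?e = 1" by (simp add: e_fun_cnj flip: e_fun_add)
  have "(\<Sum>l<Suc N. e_fun (int l) x) * cnj (\<Sum>l<Suc N. e_fun (int l) x)
     = ?Z * cnj ?Z + ?e * cnj ?Z + ?Z * cnj ?e + ?e * cnj ?e" by (simp add: algebra_simps)
  also have "\<dots> = (\<Sum>k\<in>{1 - int N..int N - 1}. of_real (real N - \<bar>of_int k\<bar>) * e_fun k x) + (\<Sum>k\<in>{- int N..int N}. e_fun k x)"
    unfolding 1 2 3 Suc sum_symmetric_int by (simp add: sum.distrib)
  also have "(\<Sum>k\<in>{1 - int N..int N - 1}. of_real (real N - \<bar>of_int k\<bar>) * e_fun k x) = (\<Sum>k\<in>{- int N..int N}. of_real (real N - \<bar>of_int k\<bar>) * e_fun k x)"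
  proof (rule sum.mono_neutral_left)
    have "k = int N \<or> k = - int N" if "k \<in> {- int N..int N} - {1 - int N..int N - 1}" for k using that by auto
    thus "\<forall>k\<in>{- int N..int N} - {1 - int N..int N - 1}. of_real (real N - \<bar>of_int k\<bar>) * e_fun k x = 0"
      by fastforce
  qed auto
  finally show ?case by (simp add: sum.distrib[symmetric] algebra_simps)
qed simp

lemma fejer_complex:
  assumes "0 < N"
  shows "complex_of_real (fejer N x) = (\<Sum>k\<in>{1 - int N..int N - 1}. of_real (1 - \<bar>of_int k\<bar> / real N) * e_fun k x)"
    and "fejer N x = (norm (\<Sum>l<N. e_fun (int l) x))\<^sup>2 / real N"
proof -
  let ?F = "\<Sum>k\<in>{1 - int N..int N - 1}. complex_of_real (1 - \<bar>of_int k\<bar> / real N) * e_fun k x"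
  have "of_real (real N) * ?F = (\<Sum>k\<in>{1 - int N..int N - 1}. of_real (real N - \<bar>of_int k\<bar>) * e_fun k x)"
    using assms unfolding sum_distrib_left
    by (intro sum.cong) (auto simp: field_simps simp flip: of_real_mult)
  also have "\<dots> = of_real ((norm (\<Sum>l<N. e_fun (int l) x))\<^sup>2)"
    unfolding dirichlet_square[symmetric] by (rule complex_norm_square[symmetric])
  finally have F: "?F = of_real ((norm (\<Sum>l<N. e_fun (int l) x))\<^sup>2 / real N)"
    using assms by (simp add: field_simps)
  have "fejer N x = Re ?F" by (simp only: fejer_def fejer_set of_real_of_nat_eq)
  thus "fejer N x = (norm (\<Sum>l<N. e_fun (int l) x))\<^sup>2 / real N" "complex_of_real (fejer N x) = ?F"
    unfolding F by simp_all
qed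

lemma fejer_nonneg: "0 < N \<Longrightarrow> 0 \<le> fejer N x"
  by (simp add: fejer_complex(2))

lemma trig_coeffs_fejer:
  "0 < N \<Longrightarrow> trig_coeffs N (\<lambda>k. if k = int N then 0 else of_real (1 - \<bar>of_int k\<bar> / real N)) (fejer N)"
  unfolding trig_coeffs_def fejer_complex(1)
proof
  fix x assume "0 < N"
  have "{- int N + 1..int N} = insert (int N) {1 - int N..int N - 1}" using \<open>0 < N\<close> by auto
  thus "(\<Sum>k\<in>{1 - int N..int N - 1}. complex_of_real (1 - \<bar>real_of_int k\<bar> / real N) * e_fun k x) =
         (\<Sum>k\<in>{- int N + 1..int N}. (if k = int N then 0 else complex_of_real (1 - \<bar>real_of_int k\<bar> / real N)) * e_fun k x)"
    by (simp cong: sum.cong) (intro sum.cong, auto)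
qed

lemma fejer_F_N: "0 < N \<Longrightarrow> fejer N \<in> F_N N"
  using trig_coeffs_fejer F_N_coeffs by blast

lemma fejer_real: "fejer N x = (\<Sum>k\<in>{1 - int N..int N - 1}. (1 - \<bar>of_int k\<bar> / real N) * cos (2 * pi * of_int k * x))"
  unfolding fejer_def fejer_set Re_sum
  by (intro sum.cong) (auto simp del: of_real_diff of_real_divide)

lemma fejer_even: "fejer N (- x) = fejer N x"
  by (simp add: fejer_real)

lemma fejer_cont: "continuous_on UNIV (fejer N)"
  unfolding fejer_real by (intro continuous_intros)

lemma fejer_periodic: "0 < N \<Longrightarrow> periodic1 (fejer N)"
  by (rule F_N_periodic[OF fejer_F_N])

lemma cint_fejer: "0 < N \<Longrightarrow> cint (fejer N) = 1"
proof -
  assume N: "0 < N"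
  have "cint (fejer N) = (\<Sum>k\<in>{1 - int N..int N - 1}. (1 - \<bar>of_int k\<bar> / real N) * (if k = 0 then 1 else 0))"
    unfolding fejer_real
    by (subst cint_sum) (auto simp: cint_cmult cint_cos intro!: integrable_circ_cont continuous_intros)
  also have "\<dots> = 1" using N by (simp add: if_distrib cong: if_cong)
  finally show ?thesis .
qed

lemma cint_fejer_cos: "0 < N \<Longrightarrow> cint (\<lambda>x. cos (2 * pi * x) * fejer N x) = 1 - 1 / real N"
proof -
  assume N: "0 < N"
  have eq: "cos (2 * pi * x) * fejer N x = (\<Sum>k\<in>{1 - int N..int N - 1}. (1 - \<bar>of_int k\<bar> / real N) / 2 *
     (cos (2 * pi * of_int (k - 1) * x) + cos (2 * pi * of_int (k + 1) * x)))" for x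
  proof -
    have "cos (2 * pi * x) * cos (2 * pi * of_int k * x) = (cos (2 * pi * of_int (k - 1) * x) + cos (2 * pi * of_int (k + 1) * x)) / 2" for k :: int
      by (simp add: cos_diff cos_add algebra_simps)
    thus ?thesis unfolding fejer_real sum_distrib_left
      by (intro sum.cong) (auto simp: field_simps)
  qed
  have "cint (\<lambda>x. cos (2 * pi * x) * fejer N x) = (\<Sum>k\<in>{1 - int N..int N - 1}. (1 - \<bar>of_int k\<bar> / real N) / 2 *
     ((if k = 1 then 1 else 0) + (if k = - 1 then 1 else 0)))"
    unfolding eq
    by (subst cint_sum, (intro integrable_circ_cont continuous_intros; fail), subst cint_cmult, subst cint_add,
        (intro integrable_circ_cont continuous_intros; fail)+, subst (1 2) cint_cos)
       (auto intro!: sum.cong)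
  also have "\<dots> = (\<Sum>k\<in>{1 - int N..int N - 1}. (if k = 1 then (1 - 1 / real N) / 2 else 0) + (if k = - 1 then (1 - 1 / real N) / 2 else 0))"
    by (intro sum.cong) auto
  also have "\<dots> = 1 - 1 / real N"
  proof (cases "N = 1")
    case False
    thus ?thesis using N by (simp add: sum.distrib)
  qed simp
  finally show ?thesis .
qed

text \<open>Only the coefficients of index \<open>0\<close> and \<open>\<plusminus>1\<close> enter. This second moment is the sole quantitative information on
  the concentration of the kernel at \<open>0\<close> that is used.\<close>

lemma cint_fejer_sin2: "0 < N \<Longrightarrow> cint (\<lambda>x. (sin (pi * x))\<^sup>2 * fejer N x) = 1 / (2 * real N)"
proof -
  assume N: "0 < N"
  have eq: "(sin (pi * x))\<^sup>2 * fejer N x = (1/2) * (fejer N x - cos (2 * pi * x) * fejer N x)" for x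
  proof -
    have "cos (2 * pi * x) = 1 - 2 * (sin (pi * x))\<^sup>2" using cos_double_sin[of "pi * x"] by (simp add: mult.assoc)
    thus ?thesis by (simp only:) (simp add: algebra_simps)
  qed
  show ?thesis unfolding eq
    by (subst cint_cmult, subst cint_diff)
       (auto simp: cint_fejer cint_fejer_cos N intro!: integrable_circ_cont continuous_intros fejer_cont)
qed

lemma cint_flip:
  assumes "periodic1 F" "integrable circ F"
  shows "cint (\<lambda>y. F (x - y)) = cint F" "integrable circ (\<lambda>y. F (x - y))"
proof -
  have p: "periodic1 (\<lambda>z. F (- z))" using assms(1) unfolding periodic1_def
    by (metis add.commute add_uminus_conv_diff diff_add_cancel minus_add_distrib)
  have i: "integrable circ (\<lambda>z. F (- z))" by (rule cint_reflect(2)[OF assms])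
  show "cint (\<lambda>y. F (x - y)) = cint F"
    using cint_shift(1)[OF p i, of "- x"] cint_reflect(1)[OF assms(1)] by simp
  show "integrable circ (\<lambda>y. F (x - y))"
    using cint_shift(2)[OF p i, of "- x"] by simp
qed

text \<open>A modulus of continuity that is at most \<open>a\<close> plus a multiple of \<open>sin\<^sup>2\<close> integrates to an explicit error by the
  second moment of the kernel. The two instances below choose \<open>a\<close> and \<open>b\<close>.\<close>

lemma Pi_N_approx:
  assumes N: "0 < N" and c: "continuous_on UNIV \<phi>"
    and le: "\<And>y. \<bar>\<phi> y - \<phi> x\<bar> \<le> a + b * (sin (pi * (x - y)))\<^sup>2"
  shows "\<bar>Pi_N N \<phi> x - \<phi> x\<bar> \<le> a + b / (2 * real N)"
proof -
  let ?K = "fejer N"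
  have cK: "continuous_on UNIV (\<lambda>y. ?K (x - y))"
    by (intro continuous_on_compose2[OF fejer_cont] continuous_intros) auto
  note pK = fejer_periodic[OF N]
  have iK: "integrable circ ?K" by (intro integrable_circ_cont fejer_cont)
  have 1: "cint (\<lambda>y. ?K (x - y)) = 1" using cint_flip(1)[OF pK iK] cint_fejer[OF N] by simp
  have ps: "periodic1 (\<lambda>z. (sin (pi * z))\<^sup>2 * ?K z)" using pK unfolding periodic1_def
    by (simp add: distrib_left)
  have 2: "cint (\<lambda>y. (sin (pi * (x - y)))\<^sup>2 * ?K (x - y)) = 1 / (2 * real N)"
    using cint_flip(1)[OF ps] cint_fejer_sin2[OF N] by (simp add: integrable_circ_cont fejer_cont continuous_intros)
  have "Pi_N N \<phi> x - \<phi> x = cint (\<lambda>y. ?K (x - y) * (\<phi> y - \<phi> x))"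
    unfolding Pi_N_def right_diff_distrib
    by (subst cint_diff) (auto simp: cint_multc 1 intro!: integrable_circ_cont continuous_intros c cK)
  also have "\<bar>\<dots>\<bar> \<le> cint (\<lambda>y. \<bar>?K (x - y) * (\<phi> y - \<phi> x)\<bar>)" by (rule cint_abs_le)
  also have "\<dots> \<le> cint (\<lambda>y. a * ?K (x - y) + b * ((sin (pi * (x - y)))\<^sup>2 * ?K (x - y)))"
  proof (rule cint_mono)
    fix y
    have "?K (x - y) * \<bar>\<phi> y - \<phi> x\<bar> \<le> ?K (x - y) * (a + b * (sin (pi * (x - y)))\<^sup>2)"
      using le fejer_nonneg[OF N] by (intro mult_left_mono) auto
    moreover have "\<bar>?K (x - y) * (\<phi> y - \<phi> x)\<bar> = ?K (x - y) * \<bar>\<phi> y - \<phi> x\<bar>"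
      using fejer_nonneg[OF N] by (simp only: abs_mult abs_of_nonneg)
    ultimately show "\<bar>?K (x - y) * (\<phi> y - \<phi> x)\<bar> \<le> a * ?K (x - y) + b * ((sin (pi * (x - y)))\<^sup>2 * ?K (x - y))"
      by (simp only: distrib_left mult_ac)
  qed (intro integrable_circ_cont continuous_intros c cK)+
  also have "\<dots> = a + b / (2 * real N)"
    by (subst cint_add) (auto simp: cint_cmult 1 2 intro!: integrable_circ_cont continuous_intros cK)
  finally show ?thesis .
qed

lemma sin_pi_ge: "\<bar>t\<bar> \<le> 1/2 \<Longrightarrow> 2 * \<bar>t\<bar> \<le> \<bar>sin (pi * t)\<bar>"
proof -
  have pos: "2 * t \<le> sin (pi * t)" if t: "0 \<le> t" "t \<le> 1/2" for t :: real
  proof -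
    have "concave_on {0..pi} sin"
    proof (rule f''_le0_imp_concave)
      show "convex {0..pi}" by simp
      show "DERIV sin x :> cos x" for x :: real by simp
      show "DERIV cos x :> - sin x" for x :: real by simp
      show "- sin x \<le> 0" if "x \<in> {0..pi}" for x using that sin_ge_zero by simp
    qed
    hence "sin ((1 - 2 * t) *\<^sub>R 0 + (2 * t) *\<^sub>R (pi/2)) \<ge> (1 - 2 * t) * sin 0 + (2 * t) * sin (pi/2)"
      using t by (intro concave_onD) auto
    thus ?thesis by (simp add: mult.commute)
  qed
  assume "\<bar>t\<bar> \<le> 1/2"
  thus ?thesis using pos[of "\<bar>t\<bar>"] by (cases "t \<ge> 0") auto
qed

lemma near_integer: obtains n :: int where "\<bar>t - of_int n\<bar> \<le> (1/2::real)"
  using of_int_round_abs_le[of t] by (metis abs_minus_commute)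

lemma sin_pi_shift: "\<bar>sin (pi * (t - of_int n))\<bar> = \<bar>sin (pi * t)\<bar>"
proof -
  have s: "sin (pi * of_int n) = 0" by (simp add: sin_zero_iff_int2)
  hence "\<bar>cos (pi * of_int n)\<bar> = 1" using sin_cos_squared_add[of "pi * of_int n"] by (simp add: power2_eq_1_iff)
  thus ?thesis using s by (simp add: right_diff_distrib sin_diff abs_mult)
qed

lemma Pi_N_lipschitz:
  assumes N: "0 < N" and p: "periodic1 \<phi>" and L: "\<And>x y. \<bar>\<phi> x - \<phi> y\<bar> \<le> L * \<bar>x - y\<bar>"
  shows "\<bar>Pi_N N \<phi> x - \<phi> x\<bar> \<le> L / sqrt (real N)"
proof -
  have L0: "L \<ge> 0" using L[of 1 0] abs_ge_zero[of "\<phi> 1 - \<phi> 0"] by simp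
  have c: "continuous_on UNIV \<phi>"
  proof (rule lipschitz_on_continuous_on)
    show "L-lipschitz_on UNIV \<phi>" using L L0 by (auto simp: lipschitz_on_def dist_real_def)
  qed
  define s where "s = sqrt (real N)"
  have s: "s > 0" "s * s = real N" using N by (auto simp: s_def)
  have "\<bar>Pi_N N \<phi> x - \<phi> x\<bar> \<le> L / (4 * s) + (L * s / 4) / (2 * real N)"
  proof (rule Pi_N_approx[OF N c])
    fix y
    obtain n :: int where n: "\<bar>(x - y) - of_int n\<bar> \<le> 1/2" using near_integer .
    have "\<phi> y = \<phi> (y + of_int n)" using periodic1_int[OF p] by simp
    hence "\<bar>\<phi> y - \<phi> x\<bar> \<le> L * \<bar>(x - y) - of_int n\<bar>"
      using L[of "y + of_int n" x] by (simp add: abs_minus_commute algebra_simps)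
    also have "\<dots> \<le> L * (\<bar>sin (pi * (x - y))\<bar> / 2)"
      using sin_pi_ge[OF n] sin_pi_shift L0 by (intro mult_left_mono) auto
    also have "\<bar>sin (pi * (x - y))\<bar> / 2 \<le> 1 / (4 * s) + s / 4 * (sin (pi * (x - y)))\<^sup>2"
    proof -
      define z where "z = \<bar>sin (pi * (x - y))\<bar>"
      have "0 \<le> (s * z - 1)\<^sup>2" by simp
      hence "2 * (s * z) \<le> 1 + s\<^sup>2 * z\<^sup>2" by (simp add: power2_diff power_mult_distrib)
      hence "z / 2 \<le> 1 / (4 * s) + s / 4 * z\<^sup>2" using s(1) by (simp add: field_simps power2_eq_square)
      thus ?thesis by (simp add: z_def)
    qed
    hence "L * (\<bar>sin (pi * (x - y))\<bar> / 2) \<le> L * (1 / (4 * s) + s / 4 * (sin (pi * (x - y)))\<^sup>2)"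
      using L0 by (intro mult_left_mono)
    also have "\<dots> = L / (4 * s) + (L * s / 4) * (sin (pi * (x - y)))\<^sup>2" by (simp add: algebra_simps)
    finally show "\<bar>\<phi> y - \<phi> x\<bar> \<le> L / (4 * s) + (L * s / 4) * (sin (pi * (x - y)))\<^sup>2" .
  qed
  also have "\<dots> = (3/8) * (L / s)" using s N by (simp add: field_simps flip: s(2))
  also have "\<dots> \<le> L / s" using divide_nonneg_pos[OF L0 s(1)] by linarith
  finally show ?thesis by (simp add: s_def)
qed

lemma Pi_N_uniform:
  assumes p: "periodic1 \<phi>" and c: "continuous_on UNIV \<phi>" and e: "e > 0"
  obtains M where "0 < M" "\<And>N x. N \<ge> M \<Longrightarrow> \<bar>Pi_N N \<phi> x - \<phi> x\<bar> \<le> e"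
proof -
  obtain B where B: "B > 0" "\<And>x. \<bar>\<phi> x\<bar> \<le> B" using periodic_bounded[OF p c] by blast
  have "uniformly_continuous_on {-1..2} \<phi>"
    by (rule compact_uniformly_continuous) (auto intro: continuous_on_subset[OF c])
  then obtain d where d: "d > 0" "\<And>x y. x \<in> {-1..2} \<Longrightarrow> y \<in> {-1..2} \<Longrightarrow> \<bar>y - x\<bar> < d \<Longrightarrow> \<bar>\<phi> y - \<phi> x\<bar> < e/2"
    using e unfolding uniformly_continuous_on_def dist_real_def by (metis half_gt_zero)
  define \<eta> where "\<eta> = min d (1/2)"
  have eta: "\<eta> > 0" using d by (simp add: \<eta>_def)
  define b where "b = 2 * B / (2 * \<eta>)\<^sup>2"
  have b: "b > 0" using B eta by (simp add: b_def)
  define M where "M = nat \<lceil>b / e\<rceil> + 1"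
  have le: "\<bar>\<phi> y - \<phi> x\<bar> \<le> e/2 + b * (sin (pi * (x - y)))\<^sup>2" for x y
  proof -
    define x' where "x' = frac x"
    obtain n :: int where n: "\<bar>(x - y) - of_int n\<bar> \<le> 1/2" using near_integer .
    define y' where "y' = x' - ((x - y) - of_int n)"
    have "y' = y + of_int (n - \<lfloor>x\<rfloor>)" by (simp add: y'_def x'_def frac_def)
    hence py: "\<phi> y' = \<phi> y" using periodic1_int[OF p] by (simp only:)
    have px: "\<phi> x' = \<phi> x" unfolding x'_def by (rule periodic1_frac[OF p])
    have x': "x' \<in> {0..1}" unfolding x'_def by (rule frac01)
    show ?thesis
    proof (cases "\<bar>(x - y) - of_int n\<bar> < \<eta>")
      case True
      have "\<bar>\<phi> y' - \<phi> x'\<bar> < e/2"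
        using True n x' by (intro d(2)) (auto simp: y'_def \<eta>_def abs_if split: if_splits)
      thus ?thesis using py px b by (smt (verit) zero_le_power2 mult_nonneg_nonneg)
    next
      case False
      have "2 * \<eta> \<le> \<bar>sin (pi * (x - y))\<bar>" using sin_pi_ge[OF n] False sin_pi_shift[of "x - y" n] by simp
      hence "(2 * \<eta>)\<^sup>2 \<le> (sin (pi * (x - y)))\<^sup>2" using eta by (metis abs_le_square_iff abs_of_pos mult_pos_pos zero_less_numeral)
      hence "2 * B \<le> b * (sin (pi * (x - y)))\<^sup>2" using B eta by (simp add: b_def field_simps)
      moreover have "\<bar>\<phi> y - \<phi> x\<bar> \<le> 2 * B" using B(2)[of x] B(2)[of y] by linarith
      ultimately show ?thesis using e by linarith
    qed
  qed
  show ?thesis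
  proof (rule that[of M])
    show "0 < M" by (simp add: M_def)
    fix N x assume N: "M \<le> N"
    have N0: "0 < N" using N by (simp add: M_def)
    have "b / e \<le> real N" using N by (simp add: M_def) linarith
    hence "b / (2 * real N) \<le> e / 2" using e N0 by (simp add: field_simps)
    thus "\<bar>Pi_N N \<phi> x - \<phi> x\<bar> \<le> e" using Pi_N_approx[OF N0 c le, of x] by linarith
  qed
qed

section \<open>Weak derivatives and the Sobolev norms\<close>

lemma cint_test_continuous:
  assumes r: "integrable circ r" and 0: "\<And>\<phi>. test_function \<phi> \<Longrightarrow> cint (\<lambda>x. r x * \<phi> x) = 0"
    and p: "periodic1 \<phi>" and c: "continuous_on UNIV \<phi>"
  shows "cint (\<lambda>x. r x * \<phi> x) = 0"
proof -
  have "\<bar>cint (\<lambda>x. r x * \<phi> x)\<bar> \<le> e * L1norm r" if e: "e > 0" for e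
  proof -
    obtain M where M: "0 < M" "\<And>N x. N \<ge> M \<Longrightarrow> \<bar>Pi_N N \<phi> x - \<phi> x\<bar> \<le> e"
      using Pi_N_uniform[OF p c e] by metis
    have F: "Pi_N M \<phi> \<in> F_N M"
      using F_N_conv(1)[OF fejer_F_N[OF M(1)] integrable_circ_cont[OF c], of "\<lambda>y. y"] by (simp add: Pi_N_def[abs_def])
    have i: "integrable circ (\<lambda>x. \<psi> x * r x)" if "continuous_on UNIV \<psi>" for \<psi>
      using integrable_circ_cmult[OF r that] .
    have "cint (\<lambda>x. r x * \<phi> x) = cint (\<lambda>x. (\<phi> x - Pi_N M \<phi> x) * r x)"
      unfolding left_diff_distrib
      using 0[OF F_N_test[OF F]] i[OF c] i[OF F_N_cont[OF F]]
      by (subst cint_diff) (auto simp: mult.commute)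
    also have "\<bar>\<dots>\<bar> \<le> e * L1norm r"
      using M(2)[of M] r by (intro cint_mult_le borel_measurable_continuous_onI continuous_intros c F_N_cont[OF F])
        (auto simp: abs_minus_commute)
    finally show ?thesis .
  qed
  hence *: "\<bar>cint (\<lambda>x. r x * \<phi> x)\<bar> \<le> e * L1norm r" if "e > 0" for e using that by blast
  have I: "L1norm r \<ge> 0" by (rule cint_nonneg) simp
  have "\<bar>cint (\<lambda>x. r x * \<phi> x)\<bar> \<le> 0 + e" if "e > 0" for e
  proof -
    have "\<bar>cint (\<lambda>x. r x * \<phi> x)\<bar> \<le> (e / (L1norm r + 1)) * L1norm r"
      using I that by (intro *) simp
    also have "\<dots> \<le> e" using I that by (simp add: field_simps)
    finally show ?thesis by simp
  qed
  thus ?thesis using field_le_epsilon[of "\<bar>cint (\<lambda>x. r x * \<phi> x)\<bar>" 0] by simp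
qed

text \<open>The indicator of the arc is a dominated limit of continuous periodic functions. Describing arcs by \<open>cos\<close> keeps
  these functions periodic without case distinctions.\<close>

lemma cint_test_arc:
  assumes r: "integrable circ r" and 0: "\<And>\<phi>. test_function \<phi> \<Longrightarrow> cint (\<lambda>x. r x * \<phi> x) = 0"
  shows "cint (\<lambda>x. r x * indicator {x. cos (2 * pi * (x - c)) > \<rho>} x) = 0"
proof -
  define \<phi> where "\<phi> n x = min 1 (max 0 (real n * (cos (2 * pi * (x - c)) - \<rho>)))" for n x
  have p: "periodic1 (\<phi> n)" for n
    unfolding periodic1_def \<phi>_def using cos_periodic by (simp add: algebra_simps) (metis add.assoc add.commute add_diff_eq)
  have cn: "continuous_on UNIV (\<phi> n)" for n unfolding \<phi>_def by (intro continuous_intros)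
  have z: "cint (\<lambda>x. r x * \<phi> n x) = 0" for n by (rule cint_test_continuous[OF r 0 p cn])
  have "(\<lambda>n. integral\<^sup>L circ (\<lambda>x. r x * \<phi> n x)) \<longlonglongrightarrow> integral\<^sup>L circ (\<lambda>x. r x * indicator {x. cos (2 * pi * (x - c)) > \<rho>} x)"
  proof (rule integral_dominated_convergence[where w = "\<lambda>x. \<bar>r x\<bar>"])
    have "open {x. cos (2 * pi * (x - c)) > \<rho>}" by (intro open_Collect_less continuous_intros)
    hence "indicat_real {x. cos (2 * pi * (x - c)) > \<rho>} \<in> borel_measurable borel" by simp
    hence "indicat_real {x. cos (2 * pi * (x - c)) > \<rho>} \<in> borel_measurable circ" by (rule measurable_circ)
    thus "(\<lambda>x. r x * indicator {x. cos (2 * pi * (x - c)) > \<rho>} x) \<in> borel_measurable circ" using r by auto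
    show "(\<lambda>x. r x * \<phi> n x) \<in> borel_measurable circ" for n
      using r measurable_circ[OF borel_measurable_continuous_onI[OF cn]] by (intro borel_measurable_times) auto
    show "AE x in circ. norm (r x * \<phi> n x) \<le> \<bar>r x\<bar>" for n
      by (rule AE_I2) (simp add: abs_mult mult_left_le \<phi>_def)
    show "AE x in circ. (\<lambda>n. r x * \<phi> n x) \<longlonglongrightarrow> r x * indicator {x. cos (2 * pi * (x - c)) > \<rho>} x"
    proof (intro AE_I2 tendsto_mult tendsto_const)
      fix x
      define s where "s = cos (2 * pi * (x - c)) - \<rho>"
      show "(\<lambda>n. \<phi> n x) \<longlonglongrightarrow> indicator {x. cos (2 * pi * (x - c)) > \<rho>} x"
      proof (cases "s > 0")
        case True
        have "eventually (\<lambda>n. \<phi> n x = 1) sequentially"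
        proof (rule eventually_sequentiallyI)
          fix n assume n: "nat \<lceil>1/s\<rceil> \<le> n"
          hence "1 / s \<le> real n" by linarith
          hence "1 \<le> real n * s" using True by (simp add: field_simps)
          thus "\<phi> n x = 1" by (simp add: \<phi>_def s_def)
        qed
        thus ?thesis using True by (auto simp: s_def intro: tendsto_eventually)
      next
        case False
        hence "real n * s \<le> 0" for n by (simp add: mult_nonneg_nonpos)
        hence "\<phi> n x = 0" for n by (simp add: \<phi>_def s_def max_absorb1)
        thus ?thesis using False by (simp add: s_def)
      qed
    qed
  qed (use r in auto)
  hence "(\<lambda>n. 0::real) \<longlonglongrightarrow> integral\<^sup>L circ (\<lambda>x. r x * indicator {x. cos (2 * pi * (x - c)) > \<rho>} x)"
    using z by (simp add: cint_circ)
  thus ?thesis using LIMSEQ_unique tendsto_const unfolding cint_circ by blast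
qed

lemma arc_interval:
  assumes "0 \<le> a" "a < b" "b \<le> 1" "x \<in> {0..1}"
  shows "cos (2 * pi * (x - (a + b) / 2)) > cos (pi * (b - a)) \<longleftrightarrow> a < x \<and> x < b"
proof -
  define t where "t = \<bar>x - (a + b) / 2\<bar>"
  have ct: "cos (2 * pi * (x - (a + b) / 2)) = cos (2 * pi * t)"
  proof (cases "x \<ge> (a + b)/2")
    case False
    hence "2 * pi * (x - (a + b) / 2) = - (2 * pi * t)" by (simp add: t_def algebra_simps)
    thus ?thesis by (simp only: cos_minus)
  qed (simp add: t_def)
  have "x - (a + b) / 2 \<le> 1" "- (x - (a + b) / 2) \<le> 1" using assms by (simp_all add: field_simps)
  hence t: "0 \<le> t" "t \<le> 1" unfolding t_def by (simp_all only: abs_le_iff abs_ge_zero simp_thms)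
  have ab: "a < x \<and> x < b \<longleftrightarrow> t < (b - a) / 2" unfolding t_def abs_less_iff by (auto simp: field_simps)
  have mono: "cos (2 * pi * s) > cos (pi * (b - a)) \<longleftrightarrow> s < (b - a) / 2" if "0 \<le> s" "s \<le> 1/2" for s
  proof -
    have "cos (2 * pi * s) > cos (pi * (b - a)) \<longleftrightarrow> 2 * pi * s < pi * (b - a)"
      using that assms by (intro cos_mono_less_eq) (auto simp: mult_le_cancel_left1)
    also have "\<dots> \<longleftrightarrow> pi * (2 * s) < pi * (b - a)" by (simp only: mult_ac)
    also have "\<dots> \<longleftrightarrow> 2 * s < b - a" by (rule mult_less_cancel_left_pos[OF pi_gt_zero])
    finally show ?thesis by auto
  qed
  show ?thesis
  proof (cases "t \<le> 1/2")
    case True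
    thus ?thesis using mono[of t] t ab ct by simp
  next
    case False
    have "cos (2 * pi * t) = cos (2 * pi * (1 - t))"
      using cos_periodic[of "- (2 * pi * t)"] by (simp add: algebra_simps)
    moreover have "\<not> 1 - t < (b - a) / 2"
    proof (cases "x \<ge> (a + b) / 2")
      case True
      hence "t = x - (a + b) / 2" by (simp add: t_def)
      thus ?thesis using assms by (simp add: field_simps)
    next
      case False
      hence "t = (a + b) / 2 - x" by (simp add: t_def)
      thus ?thesis using assms by (simp add: field_simps)
    qed
    moreover have "\<not> t < (b - a) / 2" using False assms by simp
    ultimately show ?thesis using mono[of "1 - t"] t False ab ct by simp
  qed
qed

text \<open>Arcs generate the Borel sets of the circle, so a function that annihilates all test functions has vanishing
  integral over all of them.\<close>

lemma weak_unique:
  assumes r: "integrable circ r" and 0: "\<And>\<phi>. test_function \<phi> \<Longrightarrow> cint (\<lambda>x. r x * \<phi> x) = 0"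
  shows "AE x in circ. r x = 0"
proof -
  define r' where "r' x = indicator {0..1} x * r x" for x :: real
  have r': "integrable lborel r'"
    using r unfolding r'_def set_integrable_circ[symmetric] set_integrable_def by simp
  have si: "set_integrable lborel A r'" if "A \<in> sets lborel" for A
    unfolding set_integrable_def using r' that by (intro integrable_mult_indicator)
  have ivl: "(LINT x:{a<..<b}|lborel. r' x) = 0" for a b
  proof (cases "max a 0 < min b 1")
    case True
    let ?a = "max a 0" and ?b = "min b 1"
    have "(LINT x:{a<..<b}|lborel. r' x) = (LINT x:{0..1}|lborel. r x * indicator {x. cos (2 * pi * (x - (?a + ?b) / 2)) > cos (pi * (?b - ?a))} x)"
      unfolding set_lebesgue_integral_def
    proof (rule integral_cong_AE)
      have "AE x in lborel. x \<noteq> 0 \<and> x \<noteq> (1::real)"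
        by (intro AE_conjI AE_lborel_singleton)
      thus "AE x in lborel. indicator {a<..<b} x *\<^sub>R r' x = indicator {0..1} x *\<^sub>R (r x * indicator {x. cos (2 * pi * (x - (?a + ?b) / 2)) > cos (pi * (?b - ?a))} x)"
      proof eventually_elim
        case (elim x)
        show ?case
        proof (cases "x \<in> {0..1}")
          case True
          have "cos (2 * pi * (x - (?a + ?b) / 2)) > cos (pi * (?b - ?a)) \<longleftrightarrow> ?a < x \<and> x < ?b"
            using \<open>max a 0 < min b 1\<close> True by (intro arc_interval) auto
          also have "\<dots> \<longleftrightarrow> x \<in> {a<..<b}" using True elim by auto
          finally show ?thesis using True by (simp add: r'_def indicator_def)
        qed (simp add: r'_def)
      qed
      show "(\<lambda>x. indicator {a<..<b} x *\<^sub>R r' x) \<in> borel_measurable lborel" using r' by auto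
      have "(\<lambda>x. r' x * indicator {x. cos (2 * pi * (x - (?a + ?b) / 2)) > cos (pi * (?b - ?a))} x) \<in> borel_measurable lborel"
      proof (intro borel_measurable_times)
        have "open {x. cos (2 * pi * (x - (?a + ?b) / 2)) > cos (pi * (?b - ?a))}"
          by (intro open_Collect_less continuous_intros)
        thus "indicat_real {x. cos (2 * pi * (x - (?a + ?b) / 2)) > cos (pi * (?b - ?a))} \<in> borel_measurable lborel" by simp
      qed (use r' in auto)
      thus "(\<lambda>x. indicator {0..1} x *\<^sub>R (r x * indicator {x. cos (2 * pi * (x - (?a + ?b) / 2)) > cos (pi * (?b - ?a))} x)) \<in> borel_measurable lborel"
        by (simp add: r'_def mult.assoc)
    qed
    also have "\<dots> = 0" using cint_test_arc[OF r 0] unfolding cint_def by simp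
    finally show ?thesis .
  next
    case False
    have "(LINT x:{a<..<b}|lborel. r' x) = (LINT x::real|lborel. 0::real)"
      unfolding set_lebesgue_integral_def
    proof (rule integral_cong_AE)
      have "AE x in lborel. x \<noteq> 0 \<and> x \<noteq> (1::real)"
        by (intro AE_conjI AE_lborel_singleton)
      thus "AE x in lborel. indicator {a<..<b} x *\<^sub>R r' x = 0"
        by eventually_elim (use False in \<open>auto simp: r'_def indicator_def\<close>)
    qed (use r' in auto)
    thus ?thesis by simp
  qed
  have tot: "(LINT x:UNIV|lborel. r' x) = 0"
  proof -
    have "test_function (\<lambda>x. 1)" using F_N_test[OF F_N_const[of 1]] by simp
    from 0[OF this] have "cint r = 0" by simp
    thus ?thesis by (simp add: cint_def set_lebesgue_integral_def r'_def)
  qed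
  have sb: "sets (borel :: real measure) = sigma_sets UNIV (range (\<lambda>(a, b). {a<..<b::real}))"
    unfolding borel_eq_box box_real by (rule sets_measure_of) simp
  have "set_lebesgue_integral lborel A r' = 0" if A: "A \<in> sets lborel" for A
  proof -
    let ?G = "range (\<lambda>(a, b). {a<..<b::real})"
    have Asig: "A \<in> sigma_sets UNIV ?G"
      using A unfolding sets_lborel sb .
    have IS: "Int_stable ?G"
    proof (rule Int_stableI)
      fix A B :: "real set" assume "A \<in> ?G" "B \<in> ?G"
      then obtain a b c d where "A = {a<..<b}" "B = {c<..<d}" by auto
      hence "A \<inter> B = {max a c<..<min b d}" by auto
      thus "A \<inter> B \<in> ?G" by auto
    qed
    have "?G \<subseteq> Pow UNIV" by simp
    from IS this Asig show ?thesis
    proof (induction A rule: sigma_sets_induct_disjoint)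
      case (compl A)
      have A: "A \<in> sets lborel"
        using compl unfolding sets_lborel sb by simp
      have "set_lebesgue_integral lborel (UNIV - A \<union> A) r' = set_lebesgue_integral lborel (UNIV - A) r' + set_lebesgue_integral lborel A r'"
        using A by (intro set_integral_Un si) auto
      thus ?case using tot compl by simp
    next
      case (union A)
      have A: "A i \<in> sets lborel" for i
        using union unfolding sets_lborel sb by auto
      have "set_lebesgue_integral lborel (\<Union>i. A i) r' = (\<Sum>i. set_lebesgue_integral lborel (A i) r')"
        using union A by (intro lebesgue_integral_countable_add si) (auto simp: disjoint_family_on_def)
      thus ?case using union by simp
    qed (use ivl in \<open>auto simp: set_lebesgue_integral_def\<close>)
  qed
  from sigma_finite_measure.density_zero[OF sigma_finite_lborel r' this] have "AE x in lborel. r' x = 0" .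
  hence "AE x in lborel. x \<in> {0..1} \<longrightarrow> r x = 0"
    by eventually_elim (auto simp: r'_def)
  thus ?thesis by (subst AE_restrict_space_iff) auto
qed

lemma test_function_deriv:
  assumes "test_function \<phi>"
  shows "(\<phi> has_real_derivative deriv \<phi> x) (at x)" "test_function (deriv \<phi>)" "continuous_on UNIV \<phi>" "periodic1 \<phi>"
proof -
  have C: "C_k k \<phi>" for k using assms by (simp add: test_function_def)
  show p: "periodic1 \<phi>" using assms by (simp add: test_function_def)
  show d: "(\<phi> has_real_derivative deriv \<phi> x) (at x)" for x
    using C[of 1] by (simp add: C_k_def DERIV_deriv_iff_field_differentiable)
  have "C_k k (deriv \<phi>)" for k
    using C[of "Suc k"] unfolding C_k_def by (metis Suc_less_eq comp_apply funpow_Suc_right)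
  thus "test_function (deriv \<phi>)" using periodic1_deriv[OF p d] by (simp add: test_function_def)
  show "continuous_on UNIV \<phi>" using C[of 0] by (simp add: C_k_def)
qed

lemma test_function_antideriv:
  assumes d: "\<And>x. (\<Theta> has_real_derivative \<theta> x) (at x)" and "test_function \<theta>" "periodic1 \<Theta>"
  shows "test_function \<Theta>"
proof -
  have eq: "deriv \<Theta> = \<theta>" using d by (intro ext DERIV_imp_deriv)
  have "C_k k \<Theta>" for k
  proof (cases k)
    case 0
    thus ?thesis using d by (auto simp: C_k_def intro!: continuous_at_imp_continuous_on DERIV_isCont)
  next
    case (Suc j)
    have C: "C_k j \<theta>" using assms(2) by (simp add: test_function_def)
    have it: "(deriv ^^ Suc i) \<Theta> = (deriv ^^ i) \<theta>" for i by (simp only: funpow_Suc_right comp_apply eq)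
    show ?thesis unfolding C_k_def
    proof (intro conjI allI impI)
      fix i x assume i: "i < k"
      show "(deriv ^^ i) \<Theta> field_differentiable at x"
      proof (cases i)
        case 0 thus ?thesis using d by (auto simp: field_differentiable_def)
      next
        case (Suc l)
        have "(deriv ^^ l) \<theta> field_differentiable at x"
          using C i Suc \<open>k = Suc j\<close> by (auto simp: C_k_def)
        thus ?thesis unfolding Suc it .
      qed
    next
      show "continuous_on UNIV ((deriv ^^ k) \<Theta>)" unfolding Suc it using C by (simp add: C_k_def)
    qed
  qed
  thus ?thesis using assms(3) by (simp add: test_function_def)
qed

lemma is_weak_deriv_unique:
  assumes "is_weak_deriv j f u" "is_weak_deriv j f v"
  shows "AE x in circ. u x = v x"
proof -
  have L: "integrable circ u" "integrable circ v" using assms by (auto simp: is_weak_deriv_def L1_iff)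
  have "AE x in circ. u x - v x = 0"
  proof (rule weak_unique)
    show "integrable circ (\<lambda>x. u x - v x)" using L by simp
    fix \<phi> assume t: "test_function \<phi>"
    have i: "integrable circ (\<lambda>x. w x * \<phi> x)" if "integrable circ w" for w
      using integrable_circ_cmult[OF that test_function_deriv(3)[OF t]] by (simp add: mult.commute)
    have "(-1) ^ j * cint (\<lambda>x. u x * \<phi> x) = (-1) ^ j * cint (\<lambda>x. v x * \<phi> x)"
      using assms t unfolding is_weak_deriv_def by metis
    thus "cint (\<lambda>x. (u x - v x) * \<phi> x) = 0"
      using i L by (simp add: left_diff_distrib cint_diff)
  qed
  thus ?thesis by simp
qed

text \<open>The choice in the definition of the weak derivative is immaterial for norms, because two choices agree almost
  everywhere.\<close>

lemma weak_deriv_eq: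
  assumes "is_weak_deriv j f u"
  shows "is_weak_deriv j f (weak_deriv j f)" "cint (\<lambda>x. \<bar>weak_deriv j f x\<bar>) = L1norm u"
proof -
  show w: "is_weak_deriv j f (weak_deriv j f)"
    unfolding weak_deriv_def by (rule someI[of "is_weak_deriv j f", OF assms])
  have "AE x in circ. weak_deriv j f x = u x" by (rule is_weak_deriv_unique[OF w assms])
  thus "cint (\<lambda>x. \<bar>weak_deriv j f x\<bar>) = L1norm u"
    unfolding cint_circ using w assms
    by (intro integral_cong_AE) (auto simp: is_weak_deriv_def L1_iff)
qed

lemma is_weak_deriv_0: "f \<in> L1 \<Longrightarrow> is_weak_deriv 0 f f"
  by (simp add: is_weak_deriv_def)

lemma F_N_L1: "f \<in> F_N N \<Longrightarrow> f \<in> L1"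
  by (simp add: L1_iff F_N_periodic F_N_integrable)

lemma F_N_weak_deriv:
  assumes f: "f \<in> F_N N"
  shows "is_weak_deriv j f ((deriv ^^ j) f)"
proof -
  have "cint (\<lambda>x. f x * (deriv ^^ j) \<phi> x) = (-1) ^ j * cint (\<lambda>x. (deriv ^^ j) f x * \<phi> x)"
    if "test_function \<phi>" for \<phi>
    using that
  proof (induction j arbitrary: \<phi>)
    case (Suc j)
    note t = test_function_deriv[OF Suc.prems] and fj = F_N_iter[OF f, of j]
    have "cint (\<lambda>x. f x * (deriv ^^ Suc j) \<phi> x) = (-1) ^ j * cint (\<lambda>x. (deriv ^^ j) f x * deriv \<phi> x)"
      using Suc.IH[OF t(2)] by (simp only: funpow_Suc_right comp_apply)
    also have "cint (\<lambda>x. (deriv ^^ j) f x * deriv \<phi> x) = - cint (\<lambda>x. deriv ((deriv ^^ j) f) x * \<phi> x)"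
      using F_N_deriv[OF fj] F_N_periodic[OF fj] t test_function_deriv(3)[OF t(2)] F_N_cont
      by (intro cint_parts) auto
    finally show ?case by simp
  qed simp
  thus ?thesis using F_N_L1[OF F_N_iter[OF f]] by (simp add: is_weak_deriv_def)
qed

lemma F_N_W: "f \<in> F_N N \<Longrightarrow> f \<in> W i"
  using F_N_L1 F_N_weak_deriv unfolding W_def by blast

lemma Wnorm_F_N: "f \<in> F_N N \<Longrightarrow> Wnorm i f = (\<Sum>j\<le>i. cint (\<lambda>x. \<bar>(deriv ^^ j) f x\<bar>))"
  unfolding Wnorm_def by (intro sum.cong weak_deriv_eq(2) F_N_weak_deriv) auto

lemma Wnorm1_F_N: "f \<in> F_N N \<Longrightarrow> Wnorm 1 f = L1norm f + L1norm (deriv f)"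
  by (simp add: Wnorm_F_N)

lemma Wnorm2_F_N: "f \<in> F_N N \<Longrightarrow> Wnorm 2 f = L1norm f + L1norm (deriv f) + L1norm (deriv (deriv f))"
  by (simp add: Wnorm_F_N numeral_2_eq_2)

lemma Wnorm0_F_N: "f \<in> F_N N \<Longrightarrow> Wnorm 0 f = L1norm f"
  by (simp add: Wnorm_F_N)

lemma cint_weak_deriv_le:
  assumes "j \<le> i" shows "cint (\<lambda>x. \<bar>weak_deriv j f x\<bar>) \<le> Wnorm i f"
  unfolding Wnorm_def by (rule member_le_sum) (use assms in \<open>auto intro: cint_nonneg\<close>)

lemma Wnorm1: "Wnorm 1 f = cint (\<lambda>x. \<bar>weak_deriv 0 f x\<bar>) + cint (\<lambda>x. \<bar>weak_deriv 1 f x\<bar>)"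
  by (simp add: Wnorm_def)

lemma cint_le_Wnorm: "f \<in> L1 \<Longrightarrow> L1norm f \<le> Wnorm i f"
  using cint_weak_deriv_le[of 0 i f] weak_deriv_eq(2)[OF is_weak_deriv_0] by simp

section \<open>Fejer means in the Sobolev norms\<close>

lemma F_N_mono: "N \<le> M \<Longrightarrow> f \<in> F_N N \<Longrightarrow> f \<in> F_N M"
proof -
  assume NM: "N \<le> M" and "f \<in> F_N N"
  then obtain c where c: "trig_coeffs N c f" using F_N_coeffs by blast
  have "trig_coeffs M (\<lambda>k. if k \<in> {- int N + 1..int N} then c k else 0) f"
    unfolding trig_coeffs_def
  proof
    fix x
    have "(\<Sum>k\<in>{- int M + 1..int M}. (if k \<in> {- int N + 1..int N} then c k else 0) * e_fun k x)
        = (\<Sum>k\<in>{- int N + 1..int N}. (if k \<in> {- int N + 1..int N} then c k else 0) * e_fun k x)"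
      using NM by (intro sum.mono_neutral_right) auto
    also have "\<dots> = (\<Sum>k\<in>{- int N + 1..int N}. c k * e_fun k x)" by (intro sum.cong) auto
    also have "\<dots> = complex_of_real (f x)" using c by (simp only: trig_coeffs_def)
    finally show "complex_of_real (f x) = (\<Sum>k\<in>{- int M + 1..int M}. (if k \<in> {- int N + 1..int N} then c k else 0) * e_fun k x)" ..
  qed
  thus "f \<in> F_N M" using F_N_coeffs by blast
qed

lemma F_N_shift: "f \<in> F_N N \<Longrightarrow> (\<lambda>x. f (x + a)) \<in> F_N N"
proof -
  assume "f \<in> F_N N"
  then obtain c where c: "trig_coeffs N c f" using F_N_coeffs by blast
  have "e_fun k (x + a) = e_fun k x * e_fun k a" for k x
    by (simp add: e_fun_cis cis_mult algebra_simps)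
  hence "trig_coeffs N (\<lambda>k. c k * e_fun k a) (\<lambda>x. f (x + a))"
    using c by (simp add: trig_coeffs_def mult_ac)
  thus ?thesis using F_N_coeffs by blast
qed

lemma Pi_N_conv: "Pi_N N f = (\<lambda>x. cint (\<lambda>y. fejer N (x - y) * f y))"
  by (auto simp: Pi_N_def)

lemma Pi_N_F_N: "0 < N \<Longrightarrow> integrable circ f \<Longrightarrow> Pi_N N f \<in> F_N N"
  using F_N_conv(1)[OF fejer_F_N, of N f "\<lambda>y. y"] by (simp add: Pi_N_conv)

text \<open>Fubini and \<open>K \<ge> 0\<close>, \<open>\<integral> K = 1\<close>.\<close>

lemma cint_conv_abs_le:
  assumes N: "0 < N" and S: "continuous_on UNIV S" and r: "integrable circ r"
  shows "cint (\<lambda>x. \<bar>cint (\<lambda>y. fejer N (x - S y) * r y)\<bar>) \<le> L1norm r"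
proof -
  let ?H = "\<lambda>p. fejer N (fst p - S (snd p))"
  have H: "continuous_on UNIV ?H"
    by (intro continuous_on_compose2[OF fejer_cont] continuous_on_compose2[OF S] continuous_intros) auto
  have sl: "continuous_on UNIV (\<lambda>y. fejer N (x - S y))" for x
    by (intro continuous_on_compose2[OF fejer_cont] continuous_on_compose2[OF S] continuous_intros) auto
  have ra: "integrable circ (\<lambda>y. \<bar>r y\<bar>)" using r by simp
  have 1: "cint (\<lambda>x. fejer N (x - a)) = 1" for a
    using cint_shift(1)[OF fejer_periodic[OF N] integrable_circ_cont[OF fejer_cont], of "- a"] cint_fejer[OF N] by simp
  have "cint (\<lambda>x. \<bar>cint (\<lambda>y. fejer N (x - S y) * r y)\<bar>) \<le> cint (\<lambda>x. cint (\<lambda>y. fejer N (x - S y) * \<bar>r y\<bar>))"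
  proof (rule cint_mono)
    show "integrable circ (\<lambda>x. \<bar>cint (\<lambda>y. fejer N (x - S y) * r y)\<bar>)"
      using cint_Fubini(2)[OF H r] by simp
    show "integrable circ (\<lambda>x. cint (\<lambda>y. fejer N (x - S y) * \<bar>r y\<bar>))"
      using cint_Fubini(2)[OF H ra] by simp
    fix x
    have "\<bar>fejer N (x - S y) * r y\<bar> = fejer N (x - S y) * \<bar>r y\<bar>" for y
      using fejer_nonneg[OF N] by (simp add: abs_mult)
    thus "\<bar>cint (\<lambda>y. fejer N (x - S y) * r y)\<bar> \<le> cint (\<lambda>y. fejer N (x - S y) * \<bar>r y\<bar>)"
      using cint_abs_le[of "\<lambda>y. fejer N (x - S y) * r y"] by simp
  qed
  also have "\<dots> = cint (\<lambda>y. cint (\<lambda>x. fejer N (x - S y)) * \<bar>r y\<bar>)"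
    using cint_Fubini(1)[OF H ra] by simp
  also have "\<dots> = L1norm r" by (simp add: 1)
  finally show ?thesis .
qed

lemma Pi_N_L1: "0 < N \<Longrightarrow> integrable circ r \<Longrightarrow> cint (\<lambda>x. \<bar>Pi_N N r x\<bar>) \<le> L1norm r"
  using cint_conv_abs_le[of N "\<lambda>y. y" r] by (simp add: Pi_N_conv)

text \<open>The kernel is even, so \<open>\<Pi>\<^sub>N\<close> is self-adjoint.\<close>

lemma Pi_N_adjoint:
  assumes N: "0 < N" and \<phi>: "continuous_on UNIV \<phi>" and r: "integrable circ r"
  shows "cint (\<lambda>x. Pi_N N r x * \<phi> x) = cint (\<lambda>y. r y * Pi_N N \<phi> y)"
proof -
  let ?H = "\<lambda>p. fejer N (fst p - snd p) * \<phi> (fst p)"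
  have H: "continuous_on UNIV ?H"
    by (intro continuous_on_compose2[OF fejer_cont] continuous_on_compose2[OF \<phi>] continuous_intros) auto
  have "cint (\<lambda>x. Pi_N N r x * \<phi> x) = cint (\<lambda>x. cint (\<lambda>y. ?H (x, y) * r y))"
    unfolding Pi_N_def cint_multc[symmetric] by (simp add: mult_ac)
  also have "\<dots> = cint (\<lambda>y. cint (\<lambda>x. ?H (x, y)) * r y)" by (rule cint_Fubini(1)[OF H r])
  also have "\<dots> = cint (\<lambda>y. r y * Pi_N N \<phi> y)"
    unfolding Pi_N_def fst_conv snd_conv using fejer_even[of N "_ - _"] by (simp add: mult_ac)
  finally show ?thesis .
qed

lemma cint_Pi_N: "0 < N \<Longrightarrow> integrable circ r \<Longrightarrow> cint (Pi_N N r) = cint r"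
proof -
  assume N: "0 < N" and r: "integrable circ r"
  have "Pi_N N (\<lambda>x. 1) y = 1" for y
    using cint_flip(1)[OF fejer_periodic[OF N] integrable_circ_cont[OF fejer_cont]] cint_fejer[OF N] by (simp add: Pi_N_def)
  thus ?thesis using Pi_N_adjoint[OF N continuous_on_const r, of 1] by simp
qed

lemma fejer_diff_test:
  assumes N: "0 < N"
  shows "test_function (\<lambda>y. fejer N (x - y))" "deriv (\<lambda>y. fejer N (x - y)) = (\<lambda>y. - deriv (fejer N) (x - y))"
proof -
  have eq: "(\<lambda>y. fejer N (x - y)) = (\<lambda>y. fejer N (y + - x))"
    using fejer_even[of N "x - _"] by (auto simp: fun_eq_iff)
  show "test_function (\<lambda>y. fejer N (x - y))"
    unfolding eq by (rule F_N_test[OF F_N_shift[OF fejer_F_N[OF N]]])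
  have d: "(fejer N has_real_derivative deriv (fejer N) z) (at z)" for z by (rule F_N_deriv(1)[OF fejer_F_N[OF N]])
  show "deriv (\<lambda>y. fejer N (x - y)) = (\<lambda>y. - deriv (fejer N) (x - y))"
  proof (intro ext DERIV_imp_deriv)
    fix y
    have "((\<lambda>y. fejer N (x - y)) has_real_derivative deriv (fejer N) (x - y) * (0 - 1)) (at y)"
      by (rule DERIV_chain2[OF d]) (auto intro!: derivative_eq_intros)
    thus "((\<lambda>y. fejer N (x - y)) has_real_derivative - deriv (fejer N) (x - y)) (at y)" by simp
  qed
qed

text \<open>The kernel \<open>K(x - \<cdot>)\<close> is itself a test function.\<close>

lemma Pi_N_deriv:
  assumes N: "0 < N" and v: "v \<in> L1" and u: "is_weak_deriv 1 v u"
  shows "deriv (Pi_N N v) = Pi_N N u"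
proof
  fix x
  have "deriv (Pi_N N v) x = cint (\<lambda>y. deriv (fejer N) (x - y) * v y)"
    using F_N_conv(2)[OF fejer_F_N[OF N], of v "\<lambda>y. y"] v by (simp add: Pi_N_conv L1_iff)
  also have "\<dots> = - cint (\<lambda>y. v y * (deriv ^^ 1) (\<lambda>y. fejer N (x - y)) y)"
    by (simp add: fejer_diff_test(2)[OF N] cint_minus[symmetric] mult.commute)
  also have "\<dots> = Pi_N N u x"
    using u fejer_diff_test(1)[OF N, of x] by (simp add: is_weak_deriv_def Pi_N_def mult.commute)
  finally show "deriv (Pi_N N v) x = Pi_N N u x" .
qed

lemma W_weak_deriv: "v \<in> W i \<Longrightarrow> j \<le> i \<Longrightarrow> is_weak_deriv j v (weak_deriv j v)"
  unfolding W_def using weak_deriv_eq(1) by blast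

lemma Wnorm1_Pi_N:
  assumes N: "0 < N" and v: "v \<in> W 1"
  shows "Wnorm 1 (Pi_N N v) \<le> Wnorm 1 v"
proof -
  have L: "v \<in> L1" using v by (simp add: W_def)
  have u: "is_weak_deriv 1 v (weak_deriv 1 v)" by (rule W_weak_deriv[OF v]) simp
  have i: "integrable circ v" "integrable circ (weak_deriv 1 v)" using L u by (auto simp: L1_iff is_weak_deriv_def)
  have "Wnorm 1 (Pi_N N v) = cint (\<lambda>x. \<bar>Pi_N N v x\<bar>) + cint (\<lambda>x. \<bar>Pi_N N (weak_deriv 1 v) x\<bar>)"
    unfolding Wnorm1_F_N[OF Pi_N_F_N[OF N i(1)]] Pi_N_deriv[OF N L u] ..
  moreover have "Wnorm 1 v = L1norm v + cint (\<lambda>x. \<bar>weak_deriv 1 v x\<bar>)"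
    unfolding Wnorm1 weak_deriv_eq(2)[OF is_weak_deriv_0[OF L]] ..
  ultimately show ?thesis using Pi_N_L1[OF N i(1)] Pi_N_L1[OF N i(2)] by linarith
qed

lemma F_N_antideriv:
  assumes "f \<in> F_N N"
  obtains F where "\<And>x. (F has_real_derivative f x - cint f) (at x)" "periodic1 F"
proof -
  obtain c where c: "trig_coeffs N c f" using assms F_N_coeffs by blast
  define d where "d k = (if k = 0 then 0 else c k / (2 * pi * of_int k * \<i>))" for k :: int
  define Z where "Z = {- int N + 1..int N}"
  define F where "F x = Re (\<Sum>k\<in>Z. d k * e_fun k x)" for x
  define m where "m = (if 0 \<in> Z then Re (c 0) else 0)"
  have dF: "(F has_real_derivative f x - m) (at x)" for x
  proof -
    have "((\<lambda>x. \<Sum>k\<in>Z. d k * e_fun k x) has_vector_derivative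
      (\<Sum>k\<in>Z. d k * ((2 * pi * of_int k * \<i>) * e_fun k x))) (at x)"
      by (intro has_vector_derivative_sum has_vector_derivative_mult_right e_fun_deriv)
    from bounded_linear.has_vector_derivative[OF bounded_linear_Re this]
    have dd: "(F has_real_derivative Re (\<Sum>k\<in>Z. d k * ((2 * pi * of_int k * \<i>) * e_fun k x))) (at x)"
      by (simp add: has_real_derivative_iff_has_vector_derivative F_def[abs_def])
    have h1: "(\<Sum>k\<in>Z. d k * ((2 * pi * of_int k * \<i>) * e_fun k x)) = (\<Sum>k\<in>Z. c k * e_fun k x - (if k = 0 then c 0 else 0))"
    proof (intro sum.cong refl)
      fix k
      have cancel: "a / b * (b * e) = a * e" if "b \<noteq> 0" for a b e :: complex using that by simp
      show "d k * ((2 * pi * of_int k * \<i>) * e_fun k x) = c k * e_fun k x - (if k = 0 then c 0 else 0)"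
      proof (cases "k = 0")
        case False
        hence "complex_of_real (2 * pi * of_int k) * \<i> \<noteq> 0" by simp
        from cancel[OF this, of "c k" "e_fun k x"] False show ?thesis
          unfolding d_def by (simp only: if_False diff_zero)
      qed (simp add: d_def)
    qed
    have h2: "(\<Sum>k\<in>Z. c k * e_fun k x - (if k = 0 then c 0 else 0)) = complex_of_real (f x) - (if 0 \<in> Z then c 0 else 0)"
      using c by (simp add: sum_subtractf trig_coeffs_def Z_def)
    have "Re (\<Sum>k\<in>Z. d k * ((2 * pi * of_int k * \<i>) * e_fun k x)) = f x - m"
      unfolding h1 h2 by (simp add: m_def)
    with dd show ?thesis by (simp only:)
  qed
  have p: "periodic1 F" unfolding periodic1_def F_def by (simp only: e_fun_periodic) simp
  have "cint (\<lambda>x. f x - m) = F 1 - F 0"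
    by (rule cint_FTC[OF dF]) (intro continuous_intros F_N_cont[OF assms])
  also have "\<dots> = 0" using p unfolding periodic1_def by (metis add_0 right_minus_eq)
  finally have "m = cint f" using F_N_integrable[OF assms] by (simp add: cint_diff cint_const)
  thus ?thesis using that[of F] dF p by simp
qed

lemma is_weak_deriv_classical:
  assumes "\<And>x. (F has_real_derivative f x) (at x)" "continuous_on UNIV f" "periodic1 F"
  shows "is_weak_deriv 1 F f" "F \<in> L1"
proof -
  have c: "continuous_on UNIV F" by (rule deriv_imp_cont[OF assms(1)])
  show "F \<in> L1" using c assms by (simp add: L1_iff integrable_circ_cont)
  have "cint (\<lambda>x. F x * deriv \<phi> x) = - cint (\<lambda>x. f x * \<phi> x)" if t: "test_function \<phi>" for \<phi>
    using test_function_deriv[OF t] test_function_deriv(3)[OF test_function_deriv(2)[OF t]] assms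
    by (intro cint_parts) auto
  thus "is_weak_deriv 1 F f"
    using periodic1_deriv[OF assms(3,1)] assms(2) by (simp add: is_weak_deriv_def L1_iff integrable_circ_cont)
qed

lemma lipschitz_from_deriv:
  assumes "\<And>x. (F has_real_derivative f x) (at x)" "\<And>x. \<bar>f x\<bar> \<le> L"
  shows "\<bar>F x - F y\<bar> \<le> L * \<bar>x - y\<bar>"
  using field_differentiable_bound[of UNIV F f L x y] assms by simp

lemma Pi_N_sup:
  assumes N: "0 < N" and w: "continuous_on UNIV w" "\<And>x. \<bar>w x\<bar> \<le> a"
  shows "\<bar>Pi_N N w x\<bar> \<le> a"
proof -
  have c: "continuous_on UNIV (\<lambda>y. fejer N (x - y))" by (intro continuous_on_compose2[OF fejer_cont] continuous_intros) auto
  have "Pi_N N w x = cint (\<lambda>y. w y * fejer N (x - y))" by (simp add: Pi_N_def mult.commute)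
  also have "\<bar>\<dots>\<bar> \<le> a * cint (\<lambda>y. \<bar>fejer N (x - y)\<bar>)"
    by (rule cint_mult_le[OF integrable_circ_cont[OF c] borel_measurable_continuous_onI[OF w(1)]]) (rule w(2))
  also have "cint (\<lambda>y. \<bar>fejer N (x - y)\<bar>) = 1"
    using cint_flip(1)[OF fejer_periodic[OF N] integrable_circ_cont[OF fejer_cont]] cint_fejer[OF N] fejer_nonneg[OF N] by simp
  finally show ?thesis by simp
qed

text \<open>Testing \<open>\<Pi>\<^sub>N v - v\<close> against a trigonometric polynomial moves the defect onto a primitive of the
  polynomial, which is Lipschitz and hence uniformly close to its Fejer means.\<close>

lemma Pi_N_defect_test:
  assumes N: "0 < N" and v: "v \<in> L1" and u: "is_weak_deriv 1 v u"
    and psi: "\<psi> \<in> F_N M" and b: "\<And>x. \<bar>\<psi> x\<bar> \<le> 1"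
  shows "\<bar>cint (\<lambda>x. (Pi_N N v x - v x) * \<psi> x)\<bar> \<le> 2 / sqrt (real N) * L1norm u"
proof -
  obtain F where F: "\<And>x. (F has_real_derivative \<psi> x - cint \<psi>) (at x)" "periodic1 F"
    using F_N_antideriv[OF psi] by blast
  have c\<psi>: "continuous_on UNIV \<psi>" by (rule F_N_cont[OF psi])
  have i\<psi>: "integrable circ \<psi>" by (rule F_N_integrable[OF psi])
  have iv: "integrable circ v" "integrable circ u" using v u by (auto simp: L1_iff is_weak_deriv_def)
  have m: "\<bar>cint \<psi>\<bar> \<le> 1" using cint_abs_le[of \<psi>] cint_le_bound[of "\<lambda>x. \<bar>\<psi> x\<bar>" 1] b i\<psi> by force
  have b2: "\<bar>\<psi> x - cint \<psi>\<bar> \<le> 2" for x using b[of x] m by linarith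
  have c2: "continuous_on UNIV (\<lambda>x. \<psi> x - cint \<psi>)" by (intro continuous_intros c\<psi>)
  note wF = is_weak_deriv_classical[OF F(1) c2 F(2)]
  have P1: "Pi_N N (\<lambda>x. \<psi> x - cint \<psi>) x = Pi_N N \<psi> x - cint \<psi>" for x
  proof -
    have cK: "continuous_on UNIV (\<lambda>y. fejer N (x - y))"
      by (intro continuous_on_compose2[OF fejer_cont] continuous_intros) auto
    have "cint (\<lambda>y. fejer N (x - y)) = 1"
      using cint_flip(1)[OF fejer_periodic[OF N] integrable_circ_cont[OF fejer_cont]] cint_fejer[OF N] by simp
    thus ?thesis unfolding Pi_N_def right_diff_distrib
      by (subst cint_diff) (auto simp: cint_multc intro!: integrable_circ_cont continuous_intros cK c\<psi>)
  qed
  define \<Theta> where "\<Theta> x = Pi_N N F x - F x" for x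
  have PF: "Pi_N N F \<in> F_N N" using Pi_N_F_N[OF N] wF(2) by (simp add: L1_iff)
  have d\<Theta>: "(\<Theta> has_real_derivative Pi_N N \<psi> x - \<psi> x) (at x)" for x
  proof -
    have "(\<Theta> has_real_derivative deriv (Pi_N N F) x - (\<psi> x - cint \<psi>)) (at x)"
      unfolding \<Theta>_def by (intro DERIV_diff F_N_deriv(1)[OF PF] F)
    moreover have "deriv (Pi_N N F) x = Pi_N N \<psi> x - cint \<psi>"
      using Pi_N_deriv[OF N wF(2,1)] P1 by simp
    ultimately show ?thesis by simp
  qed
  have PP: "Pi_N N \<psi> \<in> F_N N" by (rule Pi_N_F_N[OF N i\<psi>])
  have D: "(\<lambda>x. Pi_N N \<psi> x - \<psi> x) \<in> F_N (max N M)"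
    by (intro F_N_diff F_N_mono[OF _ PP] F_N_mono[OF _ psi]) auto
  have p\<Theta>: "periodic1 \<Theta>" using F_N_periodic[OF PF] F(2) by (simp add: periodic1_def \<Theta>_def)
  have t: "test_function \<Theta>" by (rule test_function_antideriv[OF d\<Theta> F_N_test[OF D] p\<Theta>])
  have d: "deriv \<Theta> = (\<lambda>x. Pi_N N \<psi> x - \<psi> x)" using d\<Theta> by (intro ext DERIV_imp_deriv)
  have i: "integrable circ (\<lambda>x. \<phi> x * v x)" if "continuous_on UNIV \<phi>" for \<phi> using integrable_circ_cmult[OF iv(1) that] .
  have "cint (\<lambda>x. (Pi_N N v x - v x) * \<psi> x) = cint (\<lambda>x. Pi_N N v x * \<psi> x) - cint (\<lambda>x. v x * \<psi> x)"
    unfolding left_diff_distrib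
    using i[OF c\<psi>] integrable_circ_cont[OF continuous_on_mult[OF F_N_cont[OF Pi_N_F_N[OF N iv(1)]] c\<psi>]]
    by (subst cint_diff) (auto simp: mult.commute)
  also have "\<dots> = cint (\<lambda>x. v x * (deriv ^^ 1) \<Theta> x)"
    unfolding Pi_N_adjoint[OF N c\<psi> iv(1)] using i[OF c\<psi>] i[OF F_N_cont[OF PP]]
    by (simp add: d right_diff_distrib) (subst cint_diff, auto simp: mult.commute)
  also have "\<dots> = - cint (\<lambda>x. \<Theta> x * u x)" using u t by (simp add: is_weak_deriv_def mult.commute)
  also have "\<bar>\<dots>\<bar> \<le> 2 / sqrt (real N) * L1norm u"
    unfolding abs_minus_cancel
  proof (rule cint_mult_le[OF iv(2)])
    show "\<Theta> \<in> borel_measurable borel"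
      by (rule borel_measurable_continuous_onI[OF test_function_deriv(3)[OF t]])
    show "\<bar>\<Theta> x\<bar> \<le> 2 / sqrt (real N)" for x
      unfolding \<Theta>_def by (rule Pi_N_lipschitz[OF N F(2) lipschitz_from_deriv[OF F(1) b2]])
  qed
  finally show ?thesis .
qed

text \<open>The \<open>L\<^sup>1\<close> norm is attained, up to a small error, by testing against a polynomial that approximates the sign of
  the defect. A continuous representative \<open>w\<close> of \<open>v\<close> is what makes this sign approximable uniformly.\<close>

lemma Pi_N_defect:
  assumes N: "0 < N" and v: "v \<in> L1" and u: "is_weak_deriv 1 v u"
    and w: "continuous_on UNIV w" "periodic1 w" "AE x in circ. v x = w x"
  shows "cint (\<lambda>x. \<bar>Pi_N N v x - v x\<bar>) \<le> 2 / sqrt (real N) * L1norm u"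
proof -
  have iv: "integrable circ v" using v by (simp add: L1_iff)
  have PF: "Pi_N N v \<in> F_N N" by (rule Pi_N_F_N[OF N iv])
  define z where "z x = Pi_N N v x - w x" for x
  have cz: "continuous_on UNIV z" unfolding z_def by (intro continuous_intros F_N_cont[OF PF] w)
  have pz: "periodic1 z" using F_N_periodic[OF PF] w(2) by (simp add: periodic1_def z_def)
  let ?A = "2 / sqrt (real N) * L1norm u" and ?I = "L1norm z"
  have iz: "integrable circ z" by (rule integrable_circ_cont[OF cz])
  have eqz: "cint (\<lambda>x. (Pi_N N v x - v x) * \<psi> x) = cint (\<lambda>x. z x * \<psi> x)" if "continuous_on UNIV \<psi>" for \<psi>
    unfolding cint_circ
  proof (rule integral_cong_AE)
    show "AE x in circ. (Pi_N N v x - v x) * \<psi> x = z x * \<psi> x"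
      using w(3) by eventually_elim (simp add: z_def)
    show "(\<lambda>x. (Pi_N N v x - v x) * \<psi> x) \<in> borel_measurable circ"
      using iv F_N_integrable[OF PF] measurable_circ[OF borel_measurable_continuous_onI[OF that]]
      by (intro borel_measurable_times borel_measurable_diff) auto
    show "(\<lambda>x. z x * \<psi> x) \<in> borel_measurable circ"
      using iz measurable_circ[OF borel_measurable_continuous_onI[OF that]]
      by (intro borel_measurable_times) auto
  qed
  have I0: "?I \<ge> 0" by (rule cint_nonneg) simp
  have main: "?I \<le> ?A + e * (?I + 1)" if e: "e > 0" for e
  proof -
    \<comment> \<open>A continuous substitute for the sign of \<open>z\<close>, wrong only where \<open>\<bar>z\<bar> < e\<close>.\<close>
    define \<psi> where "\<psi> x = max (-1) (min 1 (z x / e))" for x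
    have c: "continuous_on UNIV \<psi>" unfolding \<psi>_def using e by (intro continuous_intros cz) auto
    have p: "periodic1 \<psi>" using pz by (simp add: periodic1_def \<psi>_def)
    have b: "\<bar>\<psi> x\<bar> \<le> 1" for x by (auto simp: \<psi>_def)
    obtain M where M: "0 < M" "\<And>N x. N \<ge> M \<Longrightarrow> \<bar>Pi_N N \<psi> x - \<psi> x\<bar> \<le> e" using Pi_N_uniform[OF p c e] by metis
    have PM: "Pi_N M \<psi> \<in> F_N M" by (rule Pi_N_F_N[OF M(1) integrable_circ_cont[OF c]])
    have bM: "\<bar>Pi_N M \<psi> x\<bar> \<le> 1" for x by (rule Pi_N_sup[OF M(1) c b])
    have ptw: "\<bar>z x\<bar> \<le> z x * \<psi> x + e" for x
    proof (cases "\<bar>z x\<bar> \<le> e")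
      case True
      hence "z x * \<psi> x \<ge> 0" using e
        by (auto simp: \<psi>_def zero_le_mult_iff max_def min_def field_simps)
      thus ?thesis using True by linarith
    next
      case False
      hence "z x * \<psi> x = \<bar>z x\<bar>" using e by (auto simp: \<psi>_def max_def min_def field_simps abs_if split: if_splits)
      thus ?thesis using e by simp
    qed
    have "?I \<le> cint (\<lambda>x. z x * Pi_N M \<psi> x + (e * \<bar>z x\<bar> + e))"
    proof (rule cint_mono)
      fix x
      have "\<bar>z x * \<psi> x - z x * Pi_N M \<psi> x\<bar> \<le> e * \<bar>z x\<bar>"
      proof -
        have "\<bar>z x * \<psi> x - z x * Pi_N M \<psi> x\<bar> = \<bar>Pi_N M \<psi> x - \<psi> x\<bar> * \<bar>z x\<bar>"
          unfolding right_diff_distrib[symmetric] abs_mult by (simp add: abs_minus_commute mult.commute)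
        thus ?thesis using M(2)[of M x] by (simp add: mult_right_mono)
      qed
      thus "\<bar>z x\<bar> \<le> z x * Pi_N M \<psi> x + (e * \<bar>z x\<bar> + e)" using ptw[of x] by linarith
    qed (intro integrable_circ_cont continuous_intros cz F_N_cont[OF PM])+
    also have "\<dots> = cint (\<lambda>x. z x * Pi_N M \<psi> x) + (e * ?I + e)"
      by (subst cint_add, (intro integrable_circ_cont continuous_intros cz F_N_cont[OF PM])+)
         (subst cint_add, auto simp: cint_cmult cint_const intro!: integrable_circ_cont continuous_intros cz)
    also have "cint (\<lambda>x. z x * Pi_N M \<psi> x) \<le> ?A"
      using Pi_N_defect_test[OF N v u PM bM] eqz[OF F_N_cont[OF PM]] by linarith
    finally show ?thesis by (simp add: algebra_simps)
  qed
  have "?I \<le> ?A + e" if e: "e > 0" for e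
    using main[of "e / (?I + 1)"] I0 e by simp
  hence "?I \<le> ?A" by (rule field_le_epsilon)
  moreover have "cint (\<lambda>x. \<bar>Pi_N N v x - v x\<bar>) = ?I"
    unfolding cint_circ
  proof (rule integral_cong_AE)
    show "AE x in circ. \<bar>Pi_N N v x - v x\<bar> = \<bar>z x\<bar>"
      using w(3) by eventually_elim (simp add: z_def)
  qed (use iv F_N_integrable[OF PF] iz in auto)
  ultimately show ?thesis by simp
qed

section \<open>Transfer operators\<close>

text \<open>Duality tested only against functions that are bounded everywhere, which is what the change of variables gives.
  Passing to essentially bounded test functions is a separate step.\<close>

definition bounded_transfer :: "(real \<Rightarrow> real) \<Rightarrow> (real \<Rightarrow> real) \<Rightarrow> (real \<Rightarrow> real) \<Rightarrow> bool" where
  "bounded_transfer S \<psi> u \<longleftrightarrow> u \<in> L1 \<and>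
     (\<forall>\<phi>. periodic1 \<phi> \<longrightarrow> \<phi> \<in> borel_measurable borel \<longrightarrow> (\<exists>B. \<forall>x. \<bar>\<phi> x\<bar> \<le> B) \<longrightarrow>
        cint (\<lambda>x. \<phi> (S x) * \<psi> x) = cint (\<lambda>x. \<phi> x * u x))"

lemma AE_circ: "(AE x in lborel. P x) \<Longrightarrow> (AE x in circ. P x)"
  by (subst AE_restrict_space_iff) auto

lemma LINT_unit:
  assumes "set_integrable lborel {a..a+1} H"
  shows "integrable circ (\<lambda>x. H (x + a))" "(LINT y:{a..a+1}|lborel. H y) = cint (\<lambda>x. H (x + a))"
proof -
  have i: "indicator {a..1+a} (x + a) = (indicator {0..1} x :: real)" for x by (auto simp: indicator_def)
  show "integrable circ (\<lambda>x. H (x + a))"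
    using lborel_integrable_real_affine[of "\<lambda>y. indicator {a..a+1} y *\<^sub>R H y" 1 a] assms
    by (simp add: set_integrable_circ[symmetric] set_integrable_def i add.commute)
  show "(LINT y:{a..a+1}|lborel. H y) = cint (\<lambda>x. H (x + a))"
    using lborel_integral_real_affine[of 1 "\<lambda>y. indicator {a..a+1} y *\<^sub>R H y" a]
    by (simp add: cint_def set_lebesgue_integral_def i add.commute)
qed

lemma LINT_split:
  assumes "set_integrable lborel {c..c + real d} H"
  shows "(\<forall>j<d. integrable circ (\<lambda>x. H (x + (c + real j)))) \<and>
    (LINT y:{c..c + real d}|lborel. H y) = (\<Sum>j<d. cint (\<lambda>x. H (x + (c + real j))))"
  using assms
proof (induction d)
  case 0
  have "(LINT y:{c..c}|lborel. H y) = (LINT y::real|lborel. (0::real))"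
    unfolding set_lebesgue_integral_def
  proof (rule integral_cong_AE)
    show "AE x in lborel. indicator {c..c} x *\<^sub>R H x = 0"
      using AE_lborel_singleton[of c] by eventually_elim auto
  qed (use 0 in \<open>auto simp: set_integrable_def\<close>)
  thus ?case by simp
next
  case (Suc d)
  let ?A = "{c..c + real d}" and ?B = "{c + real d..(c + real d) + 1}"
  have sA: "set_integrable lborel ?A H" and sB: "set_integrable lborel ?B H"
    by (rule set_integrable_subset[OF Suc.prems]; auto)+
  note IH = Suc.IH[OF sA]
  have "(LINT y:{c..c + real (Suc d)}|lborel. H y) = (LINT y:?A|lborel. H y) + (LINT y:?B|lborel. H y)"
    unfolding set_lebesgue_integral_def
  proof (subst Bochner_Integration.integral_add[symmetric])
    show "(LINT x|lborel. indicator {c..c + real (Suc d)} x *\<^sub>R H x) =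
      (LINT x|lborel. indicator ?A x *\<^sub>R H x + indicator ?B x *\<^sub>R H x)"
    proof (rule integral_cong_AE)
      show "AE x in lborel. indicator {c..c + real (Suc d)} x *\<^sub>R H x = indicator ?A x *\<^sub>R H x + indicator ?B x *\<^sub>R H x"
        using AE_lborel_singleton[of "c + real d"]
        by eventually_elim (auto simp: indicator_def)
    qed (use sA sB Suc.prems in \<open>auto simp: set_integrable_def\<close>)
  qed (use sA sB in \<open>auto simp: set_integrable_def\<close>)
  thus ?case using IH LINT_unit[OF sB] by (auto simp: less_Suc_eq)
qed

text \<open>With \<open>R = S\<^sup>-\<^sup>1\<close> on \<open>\<real>\<close>, substitution turns an integral over a unit interval into one over an interval of length
  \<open>d\<close>; folding it back adds up the \<open>d\<close> inverse branches, so \<open>u y\<close> is the sum of \<open>\<psi> (R (y + j)) R' (y + j)\<close>.\<close>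

lemma increasing_lift_transfer:
  assumes lift: "\<And>x. S (x + 1) = S x + of_int d" and dS: "\<And>x. (S has_real_derivative S' x) (at x)"
    and cS': "continuous_on UNIV S'" and pos: "\<And>x. 0 < S' x"
    and \<psi>: "\<psi> \<in> L1"
  shows "\<exists>u. bounded_transfer S \<psi> u \<and> (continuous_on UNIV \<psi> \<longrightarrow> continuous_on UNIV u)"
proof -
  have mono: "x < y \<Longrightarrow> S x < S y" for x y
    by (rule DERIV_pos_imp_increasing) (use dS pos in auto)
  have inj: "inj S" by (rule injI) (metis mono less_irrefl linorder_neqE)
  have "0 < d" using lift[of 0] mono[of 0 1] by simp
  have liftn: "S (x + real n) = S x + real n * of_int d" for x n
  proof (induction n)
    case (Suc n)
    have "S (x + real (Suc n)) = S ((x + real n) + 1)" by (simp add: algebra_simps)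
    thus ?case using Suc lift[of "x + real n"] by (simp add: algebra_simps)
  qed simp
  have cS: "continuous_on UNIV S" by (rule deriv_imp_cont[OF dS])
  have surj: "\<exists>x. S x = y" for y
  proof -
    define n where "n = nat \<lceil>\<bar>y - S 0\<bar>\<rceil>"
    have n: "real n \<ge> \<bar>y - S 0\<bar>" unfolding n_def by linarith
    have nd: "real n * of_int d \<ge> real n" using \<open>0 < d\<close> by (simp add: mult_le_cancel_left1)
    have "S (- real n) = S 0 - real n * of_int d" using liftn[of "- real n" n] by simp
    hence "S (- real n) \<le> y" using n nd by linarith
    moreover have "y \<le> S (real n)" using liftn[of 0 n] n nd by simp
    ultimately show ?thesis
      using IVT'[of S "- real n" y "real n"] continuous_on_subset[OF cS] by auto
  qed
  define R where "R = inv S"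
  have SR: "S (R y) = y" for y
  proof -
    have "y \<in> range S" using surj[of y] by (metis rangeI)
    thus ?thesis unfolding R_def by (rule f_inv_into_f)
  qed
  have RS: "R (S x) = x" for x unfolding R_def using inj by simp
  have dSc: "isCont S x" for x using dS DERIV_isCont by blast
  have cR: "isCont R y" for y
    using isCont_inverse_function[of 1 "R y" R S] RS dSc SR[of y] by simp
  have cRU: "continuous_on UNIV R" using cR by (simp add: continuous_at_imp_continuous_on)
  define R' where "R' y = inverse (S' (R y))" for y
  have dR: "(R has_real_derivative R' y) (at y)" for y
    unfolding R'_def
    by (rule DERIV_inverse_function[where a = "y - 1" and b = "y + 1", OF dS])
       (use pos[of "R y"] SR cR in auto)
  have R'pos: "R' y > 0" for y using pos[of "R y"] by (simp add: R'_def)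
  have cR': "continuous_on UNIV R'"
    unfolding R'_def using pos
    by (intro continuous_intros continuous_on_compose2[OF cS'] cRU) (auto simp: less_imp_neq[symmetric])
  have Rd: "R (y + of_int d) = R y + 1" for y using RS lift[of "R y"] SR[of y] by metis
  have S'p: "S' (x + 1) = S' x" for x
  proof -
    have "((\<lambda>x. S (x + 1)) has_real_derivative S' (x + 1)) (at x)"
      using dS[of "x + 1"] by (simp only: DERIV_shift)
    moreover have "((\<lambda>x. S x + of_int d) has_real_derivative S' x) (at x)"
      using dS[of x] by (auto intro!: derivative_eq_intros)
    ultimately show ?thesis using lift DERIV_unique by simp
  qed
  define m where "m = nat d"
  have m: "real m = of_int d" using \<open>0 < d\<close> by (simp add: m_def)
  define c where "c = S 0"
  have R0: "R c = 0" "R (c + real m) = 1" using RS lift[of 0] RS[of 1] by (auto simp: c_def m)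
  have key: "(\<forall>j<m. integrable circ (\<lambda>x. F (R (x + (c + real j))) * R' (x + (c + real j)))) \<and>
     cint F = (\<Sum>j<m. cint (\<lambda>x. F (R (x + (c + real j))) * R' (x + (c + real j))))"
    if F: "integrable circ F" for F
  proof -
    have sF: "set_integrable lborel {R c..R (c + real m)} F" using F by (simp add: R0 set_integrable_circ)
    note sub = integral_substitution[OF sF dR continuous_on_subset[OF cR'] less_imp_le[OF R'pos]]
    have 1: "set_integrable lborel {c..c + real m} (\<lambda>x. F (R x) * R' x)" by (rule sub(1)) auto
    have "(LBINT x. F x * indicator {R c..R (c + real m)} x) = (LBINT x. F (R x) * R' x * indicator {c..c + real m} x)"
      by (rule sub(2)) auto
    hence "cint F = (LINT x:{c..c + real m}|lborel. F (R x) * R' x)"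
      by (simp add: R0 cint_def set_lebesgue_integral_def mult_ac)
    thus ?thesis using LINT_split[OF 1] by simp
  qed
  define \<zeta> where "\<zeta> y = \<psi> (R y) * R' y" for y
  define u where "u y = (\<Sum>j<m. \<zeta> (y + real j))" for y
  have p\<psi>: "periodic1 \<psi>" and i\<psi>: "integrable circ \<psi>" using \<psi> by (auto simp: L1_iff)
  have \<zeta>p: "\<zeta> (y + real m) = \<zeta> y" for y
    using p\<psi> by (simp add: \<zeta>_def m R'_def Rd S'p periodic1_def)
  have pu: "periodic1 u"
    unfolding periodic1_def
  proof
    fix y
    have "u (y + 1) = (\<Sum>j<m. \<zeta> (y + real (Suc j)))" unfolding u_def by (intro sum.cong) (auto simp: algebra_simps)
    also have "\<dots> = (\<Sum>j<Suc m. \<zeta> (y + real j)) - \<zeta> (y + real 0)" by (simp only: sum.lessThan_Suc_shift)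
    also have "\<dots> = u y" using \<zeta>p by (simp add: u_def)
    finally show "u (y + 1) = u y" .
  qed
  have uc: "integrable circ (\<lambda>x. u (x + c))"
    using key[OF i\<psi>] unfolding u_def \<zeta>_def by (intro Bochner_Integration.integrable_sum) (auto simp: add.assoc)
  have puc: "periodic1 (\<lambda>x. u (x + c))" unfolding periodic1_def
  proof
    fix x show "u (x + 1 + c) = u (x + c)"
      using pu[unfolded periodic1_def, rule_format, of "x + c"] by (simp add: add_ac)
  qed
  have iu: "integrable circ u" using cint_shift(2)[OF puc uc, of "- c"] by simp
  have tr: "cint (\<lambda>x. \<phi> (S x) * \<psi> x) = cint (\<lambda>x. \<phi> x * u x)"
    if p: "periodic1 \<phi>" and b: "\<phi> \<in> borel_measurable borel" "\<And>x. \<bar>\<phi> x\<bar> \<le> B" for \<phi> B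
  proof -
    have bS: "(\<lambda>x. \<phi> (S x)) \<in> borel_measurable borel"
      using measurable_compose[OF borel_measurable_continuous_onI[OF cS] b(1)] .
    have F: "integrable circ (\<lambda>x. \<phi> (S x) * \<psi> x)" by (rule integrable_circ_mult[OF i\<psi> bS b(2)])
    have eq: "\<phi> (S (R (x + (c + real j)))) * \<psi> (R (x + (c + real j))) * R' (x + (c + real j)) = \<phi> (x + c) * \<zeta> (x + c + real j)" for x j
      using periodic1_int[OF p, of "x + c" "int j"] by (simp add: SR \<zeta>_def add.assoc mult.assoc)
    have pp: "periodic1 (\<lambda>x. \<phi> x * u x)" using p pu by (simp add: periodic1_def)
    have pi: "integrable circ (\<lambda>x. \<phi> x * u x)" by (rule integrable_circ_mult[OF iu b])
    have "cint (\<lambda>x. \<phi> (S x) * \<psi> x) = (\<Sum>j<m. cint (\<lambda>x. \<phi> (x + c) * \<zeta> (x + c + real j)))"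
      using key[OF F] unfolding eq by simp
    also have "\<dots> = cint (\<lambda>x. \<Sum>j<m. \<phi> (x + c) * \<zeta> (x + c + real j))"
      using key[OF F] unfolding eq by (intro cint_sum[symmetric]) auto
    also have "\<dots> = cint (\<lambda>x. \<phi> (x + c) * u (x + c))" by (simp add: u_def sum_distrib_left)
    also have "\<dots> = cint (\<lambda>x. \<phi> x * u x)" using cint_shift(1)[OF pp pi, of c] by simp
    finally show ?thesis .
  qed
  have "bounded_transfer S \<psi> u"
    unfolding bounded_transfer_def L1_iff using pu iu tr by blast
  moreover have "continuous_on UNIV u" if "continuous_on UNIV \<psi>"
    unfolding u_def \<zeta>_def
    by (intro continuous_intros continuous_on_compose2[OF that] continuous_on_compose2[OF cRU] continuous_on_compose2[OF cR']) auto
  ultimately show ?thesis by blast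
qed

text \<open>A derivative without zeros has constant sign, and a decreasing lift becomes increasing after reflection of the circle.\<close>

lemma lift_bounded_transfer:
  assumes lift: "circle_map_lift S" and dS: "\<And>x. (S has_real_derivative S' x) (at x)"
    and cS': "continuous_on UNIV S'" and nz: "\<And>x. S' x \<noteq> 0" and \<psi>: "\<psi> \<in> L1"
  shows "\<exists>u. bounded_transfer S \<psi> u \<and> (continuous_on UNIV \<psi> \<longrightarrow> continuous_on UNIV u)"
proof -
  obtain d where d: "\<And>x. S (x + 1) = S x + of_int d" using lift by (auto simp: circle_map_lift_def)
  have "(\<forall>x. S' x > 0) \<or> (\<forall>x. S' x < 0)"
  proof (rule ccontr)
    assume "\<not> ?thesis"
    then obtain x y where xy: "S' x < 0" "S' y > 0" using nz by (metis linorder_neqE)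
    have "connected (range S')" by (intro connected_continuous_image cS') auto
    hence "0 \<in> range S'" using xy by (meson connectedD_interval less_imp_le rangeI)
    thus False using nz by (metis imageE)
  qed
  thus ?thesis
  proof
    assume "\<forall>x. S' x > 0"
    thus ?thesis using increasing_lift_transfer[OF d dS cS' _ \<psi>] by blast
  next
    assume neg: "\<forall>x. S' x < 0"
    have "\<exists>u. bounded_transfer (\<lambda>x. - S x) \<psi> u \<and> (continuous_on UNIV \<psi> \<longrightarrow> continuous_on UNIV u)"
    proof (rule increasing_lift_transfer[where d = "- d"])
      show "- S (x + 1) = - S x + of_int (- d)" for x using d by simp
      show "((\<lambda>x. - S x) has_real_derivative - S' x) (at x)" for x by (intro derivative_intros dS)
      show "0 < - S' x" for x using neg by simp
    qed (intro continuous_intros cS' \<psi>)+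
    then obtain u where u: "bounded_transfer (\<lambda>x. - S x) \<psi> u" "continuous_on UNIV \<psi> \<longrightarrow> continuous_on UNIV u" by blast
    have pu: "periodic1 u" and iu: "integrable circ u" using u(1) by (auto simp: bounded_transfer_def L1_iff)
    have neg_p: "periodic1 (\<lambda>x. f (- x))" if "periodic1 f" for f
      unfolding periodic1_def
    proof
      fix x show "f (- (x + 1)) = f (- x)"
        using that[unfolded periodic1_def, rule_format, of "- x - 1"] by simp
    qed
    have "bounded_transfer S \<psi> (\<lambda>x. u (- x))"
      unfolding bounded_transfer_def L1_iff
    proof (intro conjI allI impI neg_p[OF pu] cint_reflect(2)[OF pu iu])
      fix \<phi> :: "real \<Rightarrow> real"
      assume p: "periodic1 \<phi>" and b: "\<phi> \<in> borel_measurable borel" "\<exists>B. \<forall>x. \<bar>\<phi> x\<bar> \<le> B"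
      have pp: "periodic1 (\<lambda>x. \<phi> (- x) * u x)" using neg_p[OF p] pu by (simp add: periodic1_def)
      have "(\<lambda>x. \<phi> (- x)) \<in> borel_measurable borel"
        using measurable_compose[of "\<lambda>x. - x" borel borel \<phi> borel] b(1) by simp
      hence "cint (\<lambda>x. \<phi> (- (- S x)) * \<psi> x) = cint (\<lambda>x. \<phi> (- x) * u x)"
        using u(1)[unfolded bounded_transfer_def, THEN conjunct2, rule_format, of "\<lambda>x. \<phi> (- x)"] neg_p[OF p] b(2) by blast
      also have "\<dots> = cint (\<lambda>x. \<phi> x * u (- x))" using cint_reflect(1)[OF pp] by simp
      finally show "cint (\<lambda>x. \<phi> (S x) * \<psi> x) = cint (\<lambda>x. \<phi> x * u (- x))" by simp
    qed
    moreover have "continuous_on UNIV \<psi> \<longrightarrow> continuous_on UNIV (\<lambda>x. u (- x))"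
      using u(2) by (auto intro!: continuous_on_compose2[of UNIV u] continuous_intros)
    ultimately show ?thesis by blast
  qed
qed

text \<open>An essentially bounded \<open>\<phi>\<close> agrees almost everywhere with a bounded one, but \<open>\<phi> \<circ> S\<close> inherits this only if \<open>S\<close> pulls
  null sets back to null sets. The transfer of the constant function shows that it does.\<close>

lemma bounded_transfer_is_transfer:
  assumes u: "bounded_transfer S \<psi> u" and u1: "bounded_transfer S (\<lambda>x. 1) u1"
    and S: "S \<in> borel_measurable borel" and \<psi>: "\<psi> \<in> L1"
  shows "is_transfer S \<psi> u"
  unfolding is_transfer_def
proof (intro conjI ballI)
  show uL: "u \<in> L1" using u by (simp add: bounded_transfer_def)
  fix \<phi> assume "\<phi> \<in> Linf"
  then obtain B where p: "periodic1 \<phi>" and b: "\<phi> \<in> borel_measurable borel" and B: "AE x in lborel. \<bar>\<phi> x\<bar> \<le> B"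
    by (auto simp: Linf_def)
  \<comment> \<open>Truncation gives an everywhere bounded version, and \<open>ch\<close> marks the null set where it differs.\<close>
  define \<phi>' where "\<phi>' x = max (- \<bar>B\<bar>) (min \<bar>B\<bar> (\<phi> x))" for x
  have p': "periodic1 \<phi>'" using p by (simp add: periodic1_def \<phi>'_def)
  have b': "\<phi>' \<in> borel_measurable borel" unfolding \<phi>'_def using b by measurable
  have B': "\<bar>\<phi>' x\<bar> \<le> \<bar>B\<bar>" for x by (auto simp: \<phi>'_def)
  have eq: "AE x in lborel. \<phi>' x = \<phi> x" using B by eventually_elim (auto simp: \<phi>'_def)
  define ch where "ch x = (if \<phi>' x = \<phi> x then 0 else 1 :: real)" for x
  have pch: "periodic1 ch" using p p' by (simp add: periodic1_def ch_def)
  have bch: "ch \<in> borel_measurable borel" unfolding ch_def using b b' by measurable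
  have bS: "(\<lambda>x. f (S x)) \<in> borel_measurable borel" if "f \<in> borel_measurable borel" for f :: "real \<Rightarrow> real"
    using measurable_compose[OF S that] .
  have "cint (\<lambda>x. ch (S x)) = cint (\<lambda>x. ch x * u1 x)"
  proof -
    have "\<exists>B. \<forall>x. \<bar>ch x\<bar> \<le> B" by (rule exI[of _ 1]) (simp add: ch_def)
    thus ?thesis using u1[unfolded bounded_transfer_def, THEN conjunct2, rule_format, of ch] pch bch by simp
  qed
  also have "\<dots> = 0" unfolding cint_circ
    by (rule integral_eq_zero_AE) (use AE_circ[OF eq] in \<open>eventually_elim, simp add: ch_def\<close>)
  finally have z: "(\<integral>x. ch (S x) \<partial>circ) = 0" by (simp add: cint_circ)
  have ich: "integrable circ (\<lambda>x. ch (S x))"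
    by (rule integrable_circ_bounded[OF bS[OF bch], of 1]) (simp add: ch_def)
  have "AE x in circ. ch (S x) = 0"
    using integral_nonneg_eq_0_iff_AE[OF ich] z by (simp add: ch_def)
  hence AES: "AE x in circ. \<phi> (S x) = \<phi>' (S x)" by eventually_elim (simp add: ch_def split: if_splits)
  have "cint (\<lambda>x. \<phi> (S x) * \<psi> x) = cint (\<lambda>x. \<phi>' (S x) * \<psi> x)"
    unfolding cint_circ
  proof (rule integral_cong_AE)
    show "AE x in circ. \<phi> (S x) * \<psi> x = \<phi>' (S x) * \<psi> x" using AES by eventually_elim simp
  qed (use \<psi> measurable_circ[OF bS[OF b]] measurable_circ[OF bS[OF b']] in \<open>auto simp: L1_iff intro!: borel_measurable_times\<close>)
  also have "\<dots> = cint (\<lambda>x. \<phi>' x * u x)"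
    using u[unfolded bounded_transfer_def, THEN conjunct2, rule_format, of \<phi>'] p' b' B' by blast
  also have "\<dots> = cint (\<lambda>x. \<phi> x * u x)"
    unfolding cint_circ
  proof (rule integral_cong_AE)
    show "AE x in circ. \<phi>' x * u x = \<phi> x * u x" using AE_circ[OF eq] by eventually_elim simp
  qed (use uL measurable_circ[OF b] measurable_circ[OF b'] in \<open>auto simp: L1_iff intro!: borel_measurable_times\<close>)
  finally show "cint (\<lambda>x. \<phi> (S x) * \<psi> x) = cint (\<lambda>x. \<phi> x * u x)" .
qed

lemma transfer_exists:
  assumes lift: "circle_map_lift S" and dS: "\<And>x. (S has_real_derivative S' x) (at x)"
    and cS': "continuous_on UNIV S'" and nz: "\<And>x. S' x \<noteq> 0" and \<psi>: "\<psi> \<in> L1"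
  obtains u where "is_transfer S \<psi> u" "continuous_on UNIV \<psi> \<Longrightarrow> continuous_on UNIV u"
proof -
  have cS: "continuous_on UNIV S" by (rule deriv_imp_cont[OF dS])
  have 1: "(\<lambda>x. 1) \<in> L1" using F_N_L1[OF F_N_const[of 1]] by simp
  obtain u where u: "bounded_transfer S \<psi> u" "continuous_on UNIV \<psi> \<longrightarrow> continuous_on UNIV u"
    using lift_bounded_transfer[OF lift dS cS' nz \<psi>] by blast
  obtain u1 where "bounded_transfer S (\<lambda>x. 1) u1" using lift_bounded_transfer[OF lift dS cS' nz 1] by blast
  from bounded_transfer_is_transfer[OF u(1) this borel_measurable_continuous_onI[OF cS] \<psi>] u(2)
  show ?thesis using that by blast
qed

lemma is_transfer_transfer: "is_transfer S \<psi> u \<Longrightarrow> is_transfer S \<psi> (transfer S \<psi>)"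
  unfolding transfer_def by (rule someI[of "is_transfer S \<psi>"])

lemma cont_Linf:
  assumes "periodic1 \<phi>" "continuous_on UNIV \<phi>" shows "\<phi> \<in> Linf"
proof -
  obtain B where "\<And>x. \<bar>\<phi> x\<bar> \<le> B" using periodic_bounded[OF assms] by blast
  thus ?thesis using assms borel_measurable_continuous_onI by (auto simp: Linf_def)
qed

lemma is_transfer_Pi_N:
  assumes "0 < N" "is_transfer S \<psi> u"
  shows "Pi_N N u = (\<lambda>x. cint (\<lambda>y. fejer N (x - S y) * \<psi> y))"
proof
  fix x
  have t: "test_function (\<lambda>y. fejer N (x - y))" by (rule fejer_diff_test(1)[OF assms(1)])
  have "(\<lambda>y. fejer N (x - y)) \<in> Linf" using test_function_deriv[OF t] by (intro cont_Linf)
  thus "Pi_N N u x = cint (\<lambda>y. fejer N (x - S y) * \<psi> y)"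
    using assms(2)[unfolded is_transfer_def, THEN conjunct2, rule_format, of "\<lambda>y. fejer N (x - y)"]
    by (simp add: Pi_N_def)
qed

text \<open>Test against the sign of \<open>u - v\<close>.\<close>

lemma is_transfer_nonexpansive:
  assumes u: "is_transfer S \<psi> u" and v: "is_transfer S \<phi> v"
    and S: "S \<in> borel_measurable borel" and i: "integrable circ \<psi>" "integrable circ \<phi>"
  shows "cint (\<lambda>x. \<bar>u x - v x\<bar>) \<le> cint (\<lambda>x. \<bar>\<psi> x - \<phi> x\<bar>)"
proof -
  have uv: "periodic1 u" "integrable circ u" "periodic1 v" "integrable circ v"
    using u v by (auto simp: is_transfer_def L1_iff)
  define s where "s x = sgn (u x - v x)" for x
  have ps: "periodic1 s" using uv by (simp add: periodic1_def s_def)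
  have bs: "s \<in> borel_measurable borel"
    using periodic_measurable[OF uv(1,2)] periodic_measurable[OF uv(3,4)]
    unfolding s_def sgn_if by measurable
  have s1: "\<bar>s x\<bar> \<le> 1" for x by (simp add: s_def sgn_if)
  have sL: "s \<in> Linf" using ps bs s1 by (auto simp: Linf_def)
  have bS: "(\<lambda>x. s (S x)) \<in> borel_measurable borel" by (rule measurable_compose[OF S bs])
  have iu: "integrable circ (\<lambda>x. s x * w x)" if "integrable circ w" for w
    by (rule integrable_circ_mult[OF that bs s1])
  have iS: "integrable circ (\<lambda>x. s (S x) * w x)" if "integrable circ w" for w
    by (rule integrable_circ_mult[OF that bS s1])
  have "cint (\<lambda>x. \<bar>u x - v x\<bar>) = cint (\<lambda>x. s x * (u x - v x))"
    by (intro cint_cong) (simp add: s_def abs_sgn mult.commute)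
  also have "\<dots> = cint (\<lambda>x. s x * u x) - cint (\<lambda>x. s x * v x)"
    unfolding right_diff_distrib by (rule cint_diff[OF iu[OF uv(2)] iu[OF uv(4)]])
  also have "\<dots> = cint (\<lambda>x. s (S x) * \<psi> x) - cint (\<lambda>x. s (S x) * \<phi> x)"
    using u[unfolded is_transfer_def, THEN conjunct2, rule_format, OF sL]
      v[unfolded is_transfer_def, THEN conjunct2, rule_format, OF sL] by simp
  also have "\<dots> = cint (\<lambda>x. s (S x) * (\<psi> x - \<phi> x))"
    unfolding right_diff_distrib by (rule cint_diff[OF iS[OF i(1)] iS[OF i(2)], symmetric])
  also have "\<dots> \<le> 1 * cint (\<lambda>x. \<bar>\<psi> x - \<phi> x\<bar>)"
    using cint_mult_le[of "\<lambda>x. \<psi> x - \<phi> x" "\<lambda>x. s (S x)" 1] i bS s1 by simp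
  finally show ?thesis by simp
qed

section \<open>The coupled maps\<close>

definition dx :: "(real \<times> real \<Rightarrow> real) \<Rightarrow> real \<times> real \<Rightarrow> real" where
  "dx f p = deriv (\<lambda>x. f (x, snd p)) (fst p)"

definition periodic2 :: "(real \<times> real \<Rightarrow> real) \<Rightarrow> bool" where
  "periodic2 f \<longleftrightarrow> (\<forall>x y. f (x + 1, y) = f (x, y) \<and> f (x, y + 1) = f (x, y))"

text \<open>The first of the two functions hidden in the recursive definition is the partial derivative.\<close>

lemma C_k2_partial:
  assumes "C_k2 (Suc k) f"
  shows "((\<lambda>x. f (x, y)) has_real_derivative dx f (x, y)) (at x)" "C_k2 k (dx f)" "continuous_on UNIV f"
proof -
  obtain f1 f2 where f: "\<And>p. (f has_derivative (\<lambda>h. f1 p * fst h + f2 p * snd h)) (at p)" and C: "C_k2 k f1" "C_k2 k f2"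
    using assms by auto
  have d1: "((\<lambda>x. f (x, y)) has_real_derivative f1 (x, y)) (at x)" for x y
  proof -
    have "((\<lambda>x. (x, y)) has_derivative (\<lambda>h. (h, 0))) (at x)" by (auto intro!: derivative_eq_intros)
    from has_derivative_compose[OF this f]
    show ?thesis by (simp add: has_field_derivative_def)
  qed
  have 1: "dx f = f1" using d1 by (auto simp: dx_def intro!: ext DERIV_imp_deriv)
  show "((\<lambda>x. f (x, y)) has_real_derivative dx f (x, y)) (at x)" "C_k2 k (dx f)"
    using 1 d1 C by auto
  show "continuous_on UNIV f"
    by (intro continuous_at_imp_continuous_on ballI has_derivative_continuous[OF f])
qed

declare C_k2.simps(2) [simp del]

lemma C_k2_cont: "C_k2 k f \<Longrightarrow> continuous_on UNIV f"
  by (cases k) (auto dest: C_k2_partial(3))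

lemma periodic2_partial:
  assumes "C_k2 (Suc k) f" "periodic2 f"
  shows "periodic2 (dx f)"
proof -
  note d = C_k2_partial(1)[OF assms(1)]
  have p: "f (x + 1, y) = f (x, y)" "f (x, y + 1) = f (x, y)" for x y
    using assms(2) by (auto simp: periodic2_def)
  show "periodic2 (dx f)" unfolding periodic2_def
  proof (intro allI conjI)
    fix x y
    have "((\<lambda>x. f (x + 1, y)) has_real_derivative dx f (x + 1, y)) (at x)"
      using d[of y "x + 1"] by (simp only: DERIV_shift)
    thus "dx f (x + 1, y) = dx f (x, y)" using d[of y x] p DERIV_unique by simp
    show "dx f (x, y + 1) = dx f (x, y)" by (simp add: dx_def p)
  qed
qed

lemma periodic2_bounded:
  assumes "periodic2 f" "continuous_on UNIV f"
  obtains B where "B > 0" "\<And>p. \<bar>f p\<bar> \<le> B"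
proof -
  have "compact (f ` ({0..1} \<times> {0..1}))"
    by (intro compact_continuous_image continuous_on_subset[OF assms(2)] compact_Times) auto
  then obtain B where B: "B > 0" "\<forall>z\<in>f ` ({0..1} \<times> {0..1}). norm z \<le> B"
    using compact_imp_bounded bounded_pos by metis
  have "\<bar>f (x, y)\<bar> \<le> B" for x y
  proof -
    have 1: "periodic1 (\<lambda>x. f (x, y))" for y using assms(1) by (simp add: periodic1_def periodic2_def)
    have 2: "periodic1 (\<lambda>y. f (x, y))" for x using assms(1) by (simp add: periodic1_def periodic2_def)
    have "f (x, y) = f (frac x, frac y)" using periodic1_frac[OF 1] periodic1_frac[OF 2] by metis
    moreover have "f (frac x, frac y) \<in> f ` ({0..1} \<times> {0..1})" using frac01 by blast
    ultimately show ?thesis using B by auto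
  qed
  thus ?thesis using that[OF B(1)] by (metis prod.collapse)
qed

locale coupled_map =
  fixes T :: "real \<Rightarrow> real" and g :: "real \<Rightarrow> real \<Rightarrow> real"
  assumes lift: "circle_map_lift T" and C5: "C_k 5 T" and coupling: "coupling g"
begin

definition g0 :: "real \<times> real \<Rightarrow> real" where "g0 = (\<lambda>(x, y). g x y)"

definition Gd :: "nat \<Rightarrow> (real \<Rightarrow> real) \<Rightarrow> real \<Rightarrow> real" where
  "Gd j h x = cint (\<lambda>y. (dx ^^ j) g0 (x, y) * h y)"

abbreviation T1 :: "real \<Rightarrow> real" where "T1 \<equiv> deriv T"
abbreviation T2 :: "real \<Rightarrow> real" where "T2 \<equiv> deriv T1"
abbreviation T3 :: "real \<Rightarrow> real" where "T3 \<equiv> deriv T2"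

abbreviation S :: "real \<Rightarrow> (real \<Rightarrow> real) \<Rightarrow> real \<Rightarrow> real" where "S \<epsilon> f \<equiv> T_map T g \<epsilon> f"

lemma T_deriv:
  "(T has_real_derivative T1 x) (at x)" "(T1 has_real_derivative T2 x) (at x)"
  "(T2 has_real_derivative T3 x) (at x)" "(T3 has_real_derivative deriv T3 x) (at x)"
proof -
  have C: "(deriv ^^ j) T field_differentiable (at x)" if "j < 5" for j x using C5 that by (simp add: C_k_def)
  show "(T has_real_derivative T1 x) (at x)" "(T1 has_real_derivative T2 x) (at x)"
    "(T2 has_real_derivative T3 x) (at x)" "(T3 has_real_derivative deriv T3 x) (at x)"
    using C[of 0 x] C[of "Suc 0" x] C[of "Suc (Suc 0)" x] C[of "Suc (Suc (Suc 0))" x]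
    by (simp_all add: DERIV_deriv_iff_field_differentiable)
qed

lemma T_cont: "continuous_on UNIV T" "continuous_on UNIV T1" "continuous_on UNIV T2" "continuous_on UNIV T3"
  using T_deriv by (meson DERIV_isCont continuous_at_imp_continuous_on)+

lemma T_lift: obtains d :: int where "\<And>x. T (x + 1) = T x + of_int d"
  using lift by (auto simp: circle_map_lift_def)

lemma T1_periodic: "periodic1 T1" "periodic1 T2" "periodic1 T3"
proof -
  obtain d :: int where d: "\<And>x. T (x + 1) = T x + of_int d" using T_lift by blast
  show 1: "periodic1 T1" unfolding periodic1_def
  proof
    fix x
    have "((\<lambda>x. T (x + 1)) has_real_derivative T1 (x + 1)) (at x)"
      using T_deriv(1)[of "x + 1"] by (simp only: DERIV_shift)
    moreover have "((\<lambda>x. T x + of_int d) has_real_derivative T1 x) (at x)"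
      using T_deriv(1)[of x] by (auto intro!: derivative_eq_intros)
    ultimately show "T1 (x + 1) = T1 x" using d DERIV_unique by simp
  qed
  show 2: "periodic1 T2" by (rule periodic1_deriv[OF 1 T_deriv(2)])
  show "periodic1 T3" by (rule periodic1_deriv[OF 2 T_deriv(3)])
qed

lemma periodic_T: "periodic1 p \<Longrightarrow> periodic1 (\<lambda>y. p (T y))"
proof -
  assume p: "periodic1 p"
  obtain d :: int where d: "\<And>x. T (x + 1) = T x + of_int d" using T_lift by blast
  show ?thesis using periodic1_int[OF p] by (simp add: periodic1_def d)
qed

lemma g0_C: "C_k2 (5 - j) ((dx ^^ j) g0)" "periodic2 ((dx ^^ j) g0)" if "j \<le> 4" for j
proof -
  have "C_k2 (5 - j) ((dx ^^ j) g0) \<and> periodic2 ((dx ^^ j) g0)" using that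
  proof (induction j)
    case 0
    thus ?case using coupling by (simp add: coupling_def g0_def periodic2_def)
  next
    case (Suc j)
    have e: "5 - j = Suc (5 - Suc j)" using Suc.prems by simp
    have "C_k2 (Suc (5 - Suc j)) ((dx ^^ j) g0)" "periodic2 ((dx ^^ j) g0)"
      using Suc unfolding e[symmetric] by simp_all
    thus ?case using C_k2_partial(2) periodic2_partial by auto
  qed
  thus "C_k2 (5 - j) ((dx ^^ j) g0)" "periodic2 ((dx ^^ j) g0)" by auto
qed

lemma g0_cont: "j \<le> 4 \<Longrightarrow> continuous_on UNIV ((dx ^^ j) g0)"
  using g0_C C_k2_cont by blast

lemma g0_slice: "j \<le> 4 \<Longrightarrow> continuous_on UNIV (\<lambda>y. (dx ^^ j) g0 (x, y))"
  by (intro continuous_on_compose2[OF g0_cont] continuous_intros) auto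

lemma g0_deriv: "j \<le> 3 \<Longrightarrow> ((\<lambda>x. (dx ^^ j) g0 (x, y)) has_real_derivative (dx ^^ Suc j) g0 (x, y)) (at x)"
proof -
  assume j: "j \<le> 3"
  have e: "5 - j = Suc (5 - Suc j)" using j by simp
  have "C_k2 (Suc (5 - Suc j)) ((dx ^^ j) g0)" using g0_C(1)[of j] j unfolding e by simp
  from C_k2_partial(1)[OF this] show ?thesis by simp
qed

lemma ex_bound: "\<exists>A\<ge>1. (\<forall>j\<le>3. \<forall>p. \<bar>(dx ^^ j) g0 p\<bar> \<le> A) \<and> (\<forall>x. \<bar>T1 x\<bar> \<le> A \<and> \<bar>T2 x\<bar> \<le> A \<and> \<bar>T3 x\<bar> \<le> A)"
proof -
  have "\<exists>B. \<forall>p. \<bar>(dx ^^ j) g0 p\<bar> \<le> B" if "j \<le> 3" for j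
  proof -
    have j: "j \<le> 4" using that by simp
    show ?thesis using periodic2_bounded[OF g0_C(2)[OF j] g0_cont[OF j]] by blast
  qed
  then obtain B where B: "\<And>j p. j \<le> 3 \<Longrightarrow> \<bar>(dx ^^ j) g0 p\<bar> \<le> B j" by metis
  obtain b1 where b1: "\<And>x. \<bar>T1 x\<bar> \<le> b1" using periodic_bounded[OF T1_periodic(1) T_cont(2)] by blast
  obtain b2 where b2: "\<And>x. \<bar>T2 x\<bar> \<le> b2" using periodic_bounded[OF T1_periodic(2) T_cont(3)] by blast
  obtain b3 where b3: "\<And>x. \<bar>T3 x\<bar> \<le> b3" using periodic_bounded[OF T1_periodic(3) T_cont(4)] by blast
  define A where "A = (\<Sum>j\<le>3. \<bar>B j\<bar>) + 1 + \<bar>b1\<bar> + \<bar>b2\<bar> + \<bar>b3\<bar>"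
  have s: "0 \<le> (\<Sum>j\<le>3. \<bar>B j\<bar>)" by (intro sum_nonneg) auto
  have "\<bar>(dx ^^ j) g0 p\<bar> \<le> A" if "j \<le> 3" for j p
  proof -
    have "\<bar>B j\<bar> \<le> (\<Sum>j\<le>3. \<bar>B j\<bar>)" using that by (intro member_le_sum) auto
    thus ?thesis using B[OF that, of p] by (simp add: A_def)
  qed
  moreover have "\<bar>T1 x\<bar> \<le> A" "\<bar>T2 x\<bar> \<le> A" "\<bar>T3 x\<bar> \<le> A" for x
    unfolding A_def using b1[of x] b2[of x] b3[of x] s by linarith+
  moreover have "A \<ge> 1" using s by (simp add: A_def)
  ultimately show ?thesis by blast
qed

text \<open>One bound for all derivatives of the coupling and of the map that occur below.\<close>

definition A :: real where
  "A = (SOME A. A \<ge> 1 \<and> (\<forall>j\<le>3. \<forall>p. \<bar>(dx ^^ j) g0 p\<bar> \<le> A) \<and> (\<forall>x. \<bar>T1 x\<bar> \<le> A \<and> \<bar>T2 x\<bar> \<le> A \<and> \<bar>T3 x\<bar> \<le> A))"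

lemma A: "A \<ge> 1" "j \<le> 3 \<Longrightarrow> \<bar>(dx ^^ j) g0 p\<bar> \<le> A" "\<bar>T1 x\<bar> \<le> A" "\<bar>T2 x\<bar> \<le> A" "\<bar>T3 x\<bar> \<le> A"
  using someI_ex[OF ex_bound] unfolding A_def[symmetric] by blast+

lemma Gd_deriv:
  assumes "j \<le> 3" "continuous_on UNIV h"
  shows "(Gd j h has_real_derivative Gd (Suc j) h x) (at x)"
proof -
  have c: "continuous_on UNIV (\<lambda>y. (dx ^^ i) g0 (x, y) * h y)" if "i \<le> 4" for x i
    by (intro continuous_on_mult assms g0_slice that)
  have eq: "Gd i h x = integral (cbox 0 1) (\<lambda>y. (dx ^^ i) g0 (x, y) * h y)" if "i \<le> 4" for i x
    unfolding Gd_def by (subst cint_HK[OF c[OF that]]) simp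
  have "((\<lambda>x. integral (cbox 0 1) (\<lambda>y. (dx ^^ j) g0 (x, y) * h y)) has_field_derivative
      integral (cbox 0 1) (\<lambda>y. (dx ^^ Suc j) g0 (x, y) * h y)) (at x within UNIV)"
  proof (rule leibniz_rule_field_derivative)
    show "((\<lambda>x. (dx ^^ j) g0 (x, t) * h t) has_real_derivative (dx ^^ Suc j) g0 (x, t) * h t) (at x within UNIV)" for x t
      using g0_deriv[OF assms(1), of t x] by (intro DERIV_cmult_right) simp
    show "(\<lambda>y. (dx ^^ j) g0 (x, y) * h y) integrable_on cbox 0 1" for x
      using c[of j x] assms(1) by (intro integrable_continuous) (auto intro: continuous_on_subset)
    have "continuous_on (UNIV \<times> cbox 0 1) (\<lambda>p. (dx ^^ Suc j) g0 p * h (snd p))"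
      using assms by (intro continuous_intros continuous_on_subset[OF g0_cont] continuous_on_compose2[OF assms(2)]) auto
    thus "continuous_on (UNIV \<times> cbox 0 1) (\<lambda>(x, t). (dx ^^ Suc j) g0 (x, t) * h t)"
      by (simp add: case_prod_beta')
  qed auto
  moreover have "(\<lambda>x. integral (cbox 0 1) (\<lambda>y. (dx ^^ j) g0 (x, y) * h y)) = Gd j h"
    using eq assms(1) by (intro ext) simp
  ultimately show ?thesis using eq[of "Suc j" x] assms(1) by simp
qed

lemma Gd_cont: "j \<le> 3 \<Longrightarrow> continuous_on UNIV h \<Longrightarrow> continuous_on UNIV (Gd j h)"
  by (rule deriv_imp_cont[OF Gd_deriv])

lemma Gd_periodic: "j \<le> 4 \<Longrightarrow> periodic1 (Gd j h)"
  using g0_C(2) by (simp add: periodic1_def Gd_def periodic2_def)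

lemma Gd_bound: "j \<le> 3 \<Longrightarrow> integrable circ h \<Longrightarrow> \<bar>Gd j h x\<bar> \<le> A * L1norm h"
  unfolding Gd_def using g0_slice[of j x] A(2)
  by (intro cint_mult_le borel_measurable_continuous_onI) auto

lemma Gd_lin:
  assumes "j \<le> 3" "integrable circ h" "integrable circ k"
  shows "Gd j (\<lambda>y. a * h y + b * k y) x = a * Gd j h x + b * Gd j k x"
proof -
  have i: "integrable circ (\<lambda>y. (dx ^^ j) g0 (x, y) * r y)" if "integrable circ r" for r
    using assms(1) by (intro integrable_circ_cmult[OF that g0_slice]) simp
  have "Gd j (\<lambda>y. a * h y + b * k y) x = cint (\<lambda>y. a * ((dx ^^ j) g0 (x, y) * h y) + b * ((dx ^^ j) g0 (x, y) * k y))"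
    unfolding Gd_def by (intro cint_cong) (simp add: algebra_simps)
  thus ?thesis using i assms by (subst (asm) cint_add) (auto simp: cint_cmult Gd_def)
qed

lemma S_eq: "S \<epsilon> f y = T y + \<epsilon> * Gd 0 f (T y)"
  by (simp add: T_map_def I_map_def Gd_def g0_def)

definition S1 :: "real \<Rightarrow> (real \<Rightarrow> real) \<Rightarrow> real \<Rightarrow> real" where
  "S1 \<epsilon> f y = T1 y * (1 + \<epsilon> * Gd 1 f (T y))"

definition S2 :: "real \<Rightarrow> (real \<Rightarrow> real) \<Rightarrow> real \<Rightarrow> real" where
  "S2 \<epsilon> f y = T2 y * (1 + \<epsilon> * Gd 1 f (T y)) + (T1 y)\<^sup>2 * (\<epsilon> * Gd 2 f (T y))"

definition S3 :: "real \<Rightarrow> (real \<Rightarrow> real) \<Rightarrow> real \<Rightarrow> real" where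
  "S3 \<epsilon> f y = T3 y * (1 + \<epsilon> * Gd 1 f (T y)) + 3 * (T1 y * T2 y) * (\<epsilon> * Gd 2 f (T y)) + (T1 y) ^ 3 * (\<epsilon> * Gd 3 f (T y))"

lemma Gd_T_deriv: "j \<le> 3 \<Longrightarrow> continuous_on UNIV h \<Longrightarrow> ((\<lambda>y. Gd j h (T y)) has_real_derivative Gd (Suc j) h (T y) * T1 y) (at y)"
  by (rule DERIV_chain2[OF Gd_deriv T_deriv(1)])

lemma S_deriv:
  assumes f: "continuous_on UNIV f"
  shows "(S \<epsilon> f has_real_derivative S1 \<epsilon> f y) (at y)" "(S1 \<epsilon> f has_real_derivative S2 \<epsilon> f y) (at y)"
    "(S2 \<epsilon> f has_real_derivative S3 \<epsilon> f y) (at y)"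
proof -
  note d = T_deriv Gd_T_deriv[OF _ f]
  have s: "S \<epsilon> f = (\<lambda>y. T y + \<epsilon> * Gd 0 f (T y))" by (rule ext) (rule S_eq)
  have d0: "((\<lambda>y. Gd 0 f (T y)) has_real_derivative Gd 1 f (T y) * T1 y) (at y)"
    and d1: "((\<lambda>y. Gd 1 f (T y)) has_real_derivative Gd 2 f (T y) * T1 y) (at y)"
    and d2: "((\<lambda>y. Gd 2 f (T y)) has_real_derivative Gd 3 f (T y) * T1 y) (at y)"
    using d(5)[of 0 y] d(5)[of 1 y] d(5)[of 2 y] by (simp_all add: numeral_2_eq_2 numeral_3_eq_3)
  have "((\<lambda>y. T y + \<epsilon> * Gd 0 f (T y)) has_real_derivative T1 y + \<epsilon> * (Gd 1 f (T y) * T1 y)) (at y)"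
    by (intro DERIV_add DERIV_cmult T_deriv(1) d0)
  thus "(S \<epsilon> f has_real_derivative S1 \<epsilon> f y) (at y)" unfolding s S1_def by (simp add: algebra_simps)
  have P: "((\<lambda>y. 1 + \<epsilon> * Gd 1 f (T y)) has_real_derivative 0 + \<epsilon> * (Gd 2 f (T y) * T1 y)) (at y)"
    by (intro DERIV_add DERIV_const DERIV_cmult d1)
  show "(S1 \<epsilon> f has_real_derivative S2 \<epsilon> f y) (at y)"
    using DERIV_mult[OF T_deriv(2)[of y] P] unfolding S1_def[abs_def] S2_def
    by (simp add: algebra_simps power2_eq_square)
  show "(S2 \<epsilon> f has_real_derivative S3 \<epsilon> f y) (at y)"
    using DERIV_add[OF DERIV_mult[OF T_deriv(3)[of y] P] DERIV_mult[OF DERIV_mult[OF T_deriv(2)[of y] T_deriv(2)[of y]] DERIV_cmult[OF d2]]]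
    unfolding S2_def[abs_def] S3_def power2_eq_square power3_eq_cube
    by (rule DERIV_cong) (simp add: algebra_simps)
qed

lemma S_cont:
  assumes f: "continuous_on UNIV f"
  shows "continuous_on UNIV (S \<epsilon> f)" "continuous_on UNIV (S1 \<epsilon> f)" "continuous_on UNIV (S2 \<epsilon> f)" "continuous_on UNIV (S3 \<epsilon> f)"
proof -
  show "continuous_on UNIV (S \<epsilon> f)" "continuous_on UNIV (S1 \<epsilon> f)" "continuous_on UNIV (S2 \<epsilon> f)"
    using S_deriv[OF f] by (meson DERIV_isCont continuous_at_imp_continuous_on)+
  show "continuous_on UNIV (S3 \<epsilon> f)" unfolding S3_def
    by (intro continuous_intros T_cont continuous_on_compose2[OF Gd_cont[OF _ f]]) auto
qed

lemma S_lift: "circle_map_lift (S \<epsilon> f)"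
proof -
  obtain d :: int where d: "\<And>x. T (x + 1) = T x + of_int d" using T_lift by blast
  have "Gd 0 f (T x + of_int d) = Gd 0 f (T x)" for x using periodic1_int[OF Gd_periodic[of 0]] by simp
  thus ?thesis unfolding circle_map_lift_def by (intro exI[of _ d]) (simp add: S_eq d)
qed

lemma S_diff:
  assumes "integrable circ f" "integrable circ k"
  shows "\<bar>S \<epsilon> f y - S \<epsilon> k y\<bar> \<le> \<bar>\<epsilon>\<bar> * A * cint (\<lambda>x. \<bar>f x - k x\<bar>)"
proof -
  have "Gd 0 (\<lambda>x. f x - k x) (T y) = Gd 0 f (T y) - Gd 0 k (T y)"
    using Gd_lin[of 0 f k 1 "-1" "T y"] assms by simp
  hence "S \<epsilon> f y - S \<epsilon> k y = \<epsilon> * Gd 0 (\<lambda>x. f x - k x) (T y)"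
    by (simp add: S_eq right_diff_distrib)
  thus ?thesis using Gd_bound[of 0 "\<lambda>x. f x - k x" "T y"] assms
    by (simp add: abs_mult mult.assoc mult_left_mono)
qed

lemma sc_transfer_N_eq:
  assumes N: "0 < N" and f: "f \<in> F_N M" and nz: "\<And>y. S1 \<epsilon> f y \<noteq> 0"
  shows "sc_transfer_N T g \<epsilon> N f = (\<lambda>x. cint (\<lambda>y. fejer N (x - S \<epsilon> f y) * f y))"
proof -
  have c: "continuous_on UNIV f" by (rule F_N_cont[OF f])
  obtain u where "is_transfer (S \<epsilon> f) f u"
    using transfer_exists[OF S_lift S_deriv(1)[OF c] S_cont(2)[OF c] nz F_N_L1[OF f]] by blast
  from is_transfer_Pi_N[OF N is_transfer_transfer[OF this]] show ?thesis
    by (simp add: sc_transfer_N_def sc_transfer_def)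
qed

end

section \<open>The Frechet derivative of the discretised operator\<close>

text \<open>For \<open>\<sigma>\<close> the identity this is convolution on the circle. With \<open>\<sigma> = S\<close> and \<open>\<kappa>\<close> the Fejer kernel it is \<open>\<Pi>\<^sub>N \<L>\<^sub>S r\<close>.\<close>

definition conv :: "(real \<Rightarrow> real) \<Rightarrow> (real \<Rightarrow> real) \<Rightarrow> (real \<Rightarrow> real) \<Rightarrow> real \<Rightarrow> real" where
  "conv \<kappa> \<sigma> r x = cint (\<lambda>y. \<kappa> (x - \<sigma> y) * r y)"

lemma conv_slice:
  fixes \<kappa> \<sigma> :: "real \<Rightarrow> real"
  assumes "continuous_on UNIV \<kappa>" "continuous_on UNIV \<sigma>"
  shows "continuous_on UNIV (\<lambda>y. \<kappa> (x - \<sigma> y))"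
  by (rule continuous_on_compose2[OF assms(1)]) (auto intro!: continuous_intros assms(2))

lemma conv_integrable:
  fixes \<kappa> \<sigma> :: "real \<Rightarrow> real"
  assumes "continuous_on UNIV \<kappa>" "continuous_on UNIV \<sigma>" "integrable circ r"
  shows "integrable circ (\<lambda>y. \<kappa> (x - \<sigma> y) * r y)"
  by (rule integrable_circ_cmult[OF assms(3) conv_slice[OF assms(1,2)]])

lemma conv_lin:
  assumes "continuous_on UNIV \<kappa>" "continuous_on UNIV \<sigma>" "integrable circ r" "integrable circ s"
  shows "conv \<kappa> \<sigma> (\<lambda>y. a * r y + b * s y) x = a * conv \<kappa> \<sigma> r x + b * conv \<kappa> \<sigma> s x"
proof -
  have "conv \<kappa> \<sigma> (\<lambda>y. a * r y + b * s y) x = cint (\<lambda>y. a * (\<kappa> (x - \<sigma> y) * r y) + b * (\<kappa> (x - \<sigma> y) * s y))"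
    unfolding conv_def by (intro cint_cong) (simp add: algebra_simps)
  thus ?thesis using conv_integrable[OF assms(1,2)] assms(3,4)
    by (subst (asm) cint_add) (auto simp: cint_cmult conv_def)
qed

lemma conv_bound:
  assumes "continuous_on UNIV \<kappa>" "continuous_on UNIV \<sigma>" "integrable circ r" "\<And>x. \<bar>\<kappa> x\<bar> \<le> B"
  shows "\<bar>conv \<kappa> \<sigma> r x\<bar> \<le> B * L1norm r"
  unfolding conv_def
  by (rule cint_mult_le[OF assms(3) borel_measurable_continuous_onI[OF conv_slice[OF assms(1,2)]]]) (rule assms(4))

lemma conv_diff:
  assumes \<kappa>: "\<And>x. (\<kappa> has_real_derivative \<kappa>' x) (at x)" "\<And>x. \<bar>\<kappa>' x\<bar> \<le> B"
    and "continuous_on UNIV \<sigma>" "continuous_on UNIV \<tau>" and r: "integrable circ r" and a: "\<And>y. \<bar>\<sigma> y - \<tau> y\<bar> \<le> a"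
  shows "\<bar>conv \<kappa> \<sigma> r x - conv \<kappa> \<tau> r x\<bar> \<le> B * a * L1norm r"
proof -
  have c: "continuous_on UNIV \<kappa>" by (rule deriv_imp_cont[OF \<kappa>(1)])
  have B: "0 \<le> B" using \<kappa>(2)[of 0] by linarith
  have "conv \<kappa> \<sigma> r x - conv \<kappa> \<tau> r x = cint (\<lambda>y. (\<kappa> (x - \<sigma> y) - \<kappa> (x - \<tau> y)) * r y)"
    unfolding conv_def left_diff_distrib
    by (rule cint_diff[symmetric]; rule conv_integrable[OF c _ r]; fact)
  also have "\<bar>\<dots>\<bar> \<le> (B * a) * L1norm r"
  proof (rule cint_mult_le[OF r])
    show "(\<lambda>y. \<kappa> (x - \<sigma> y) - \<kappa> (x - \<tau> y)) \<in> borel_measurable borel"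
      by (intro borel_measurable_continuous_onI continuous_on_diff conv_slice[OF c] assms)
    fix y
    have "\<bar>\<kappa> (x - \<sigma> y) - \<kappa> (x - \<tau> y)\<bar> \<le> B * \<bar>(x - \<sigma> y) - (x - \<tau> y)\<bar>"
      by (rule lipschitz_from_deriv[OF \<kappa>])
    also have "\<dots> \<le> B * a" using a[of y] B by (intro mult_left_mono) auto
    finally show "\<bar>\<kappa> (x - \<sigma> y) - \<kappa> (x - \<tau> y)\<bar> \<le> B * a" .
  qed
  finally show ?thesis .
qed

lemma taylor2:
  assumes "\<And>x. (\<kappa> has_real_derivative \<kappa>' x) (at x)" "\<And>x. (\<kappa>' has_real_derivative \<kappa>'' x) (at x)" "\<And>x. \<bar>\<kappa>'' x\<bar> \<le> B"
  shows "\<bar>\<kappa> (p - a) - \<kappa> p + a * \<kappa>' p\<bar> \<le> B * a\<^sup>2"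
proof -
  define F where "F t = \<kappa> (p - t) + t * \<kappa>' p" for t
  have dF: "(F has_real_derivative \<kappa>' (p - t) * (0 - 1) + \<kappa>' p) (at t)" for t
  proof -
    have "((\<lambda>t. \<kappa> (p - t)) has_real_derivative \<kappa>' (p - t) * (0 - 1)) (at t)"
      by (rule DERIV_chain2[OF assms(1)]) (intro derivative_intros)
    moreover have "((\<lambda>t. t * \<kappa>' p) has_real_derivative \<kappa>' p) (at t)"
      by (auto intro!: derivative_eq_intros)
    ultimately show ?thesis unfolding F_def by (rule DERIV_add)
  qed
  have "\<bar>F a - F 0\<bar> \<le> (B * \<bar>a\<bar>) * \<bar>a - 0\<bar>"
  proof (rule field_differentiable_bound[of "cball 0 \<bar>a\<bar>" F "\<lambda>t. \<kappa>' (p - t) * (0 - 1) + \<kappa>' p" "B * \<bar>a\<bar>" a 0, unfolded real_norm_def])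
    fix t :: real assume t: "t \<in> cball 0 \<bar>a\<bar>"
    show "(F has_real_derivative \<kappa>' (p - t) * (0 - 1) + \<kappa>' p) (at t within cball 0 \<bar>a\<bar>)"
      using dF has_field_derivative_at_within by blast
    have B: "0 \<le> B" using assms(3)[of 0] by linarith
    have "\<bar>\<kappa>' p - \<kappa>' (p - t)\<bar> \<le> B * \<bar>p - (p - t)\<bar>" by (rule lipschitz_from_deriv[OF assms(2,3)])
    also have "\<dots> \<le> B * \<bar>a\<bar>" using t B by (intro mult_left_mono) auto
    finally show "\<bar>\<kappa>' (p - t) * (0 - 1) + \<kappa>' p\<bar> \<le> B * \<bar>a\<bar>" by (simp add: algebra_simps)
  qed auto
  thus ?thesis by (simp add: F_def power2_eq_square algebra_simps)
qed

lemma conv_F_N: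
  assumes "\<kappa> \<in> F_N N" "continuous_on UNIV \<sigma>" "integrable circ r"
  shows "conv \<kappa> \<sigma> r \<in> F_N N" "deriv (conv \<kappa> \<sigma> r) = conv (deriv \<kappa>) \<sigma> r"
  using F_N_conv[OF assms(1,3) borel_measurable_continuous_onI[OF assms(2)]] unfolding conv_def[abs_def] by auto

lemma F_N_bounded:
  assumes "\<kappa> \<in> F_N N"
  obtains B where "B > 0" "\<And>j x. j \<le> 3 \<Longrightarrow> \<bar>(deriv ^^ j) \<kappa> x\<bar> \<le> B"
proof -
  have "\<exists>B. \<forall>x. \<bar>(deriv ^^ j) \<kappa> x\<bar> \<le> B" for j
    using periodic_bounded[OF F_N_periodic[OF F_N_iter[OF assms]] F_N_cont[OF F_N_iter[OF assms]]] by blast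
  then obtain b where b: "\<And>j x. \<bar>(deriv ^^ j) \<kappa> x\<bar> \<le> b j" by metis
  define B where "B = 1 + (\<Sum>j\<le>3. \<bar>b j\<bar>)"
  have "0 \<le> (\<Sum>j\<le>3. \<bar>b j\<bar>)" by (intro sum_nonneg) auto
  hence "B > 0" unfolding B_def by linarith
  moreover have "\<bar>(deriv ^^ j) \<kappa> x\<bar> \<le> B" if "j \<le> 3" for j x
  proof -
    have "\<bar>b j\<bar> \<le> (\<Sum>j\<le>3. \<bar>b j\<bar>)" using that by (intro member_le_sum) auto
    thus ?thesis using b[of j x] by (simp add: B_def)
  qed
  ultimately show ?thesis using that by blast
qed

lemma Wnorm1_sup:
  assumes "u \<in> F_N N" "\<And>x. \<bar>u x\<bar> \<le> M" "\<And>x. \<bar>deriv u x\<bar> \<le> M"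
  shows "Wnorm 1 u \<le> 2 * M"
  unfolding Wnorm1_F_N[OF assms(1)]
  using cint_le_bound[of "\<lambda>x. \<bar>u x\<bar>" M] cint_le_bound[of "\<lambda>x. \<bar>deriv u x\<bar>" M] assms(2,3)
    F_N_integrable[OF assms(1)] F_N_integrable[OF F_N_deriv(2)[OF assms(1)]] by fastforce

context coupled_map begin

text \<open>The operator is kept for an arbitrary kernel because differentiating it in \<open>x\<close> replaces the kernel by its
  derivative, so the \<open>W\<^sup>1\<^sup>,\<^sup>1\<close> estimates are two instances of one sup estimate.\<close>

definition kernel_deriv :: "real \<Rightarrow> (real \<Rightarrow> real) \<Rightarrow> (real \<Rightarrow> real) \<Rightarrow> (real \<Rightarrow> real) \<Rightarrow> real \<Rightarrow> real" where
  "kernel_deriv \<epsilon> \<kappa> f h x = conv \<kappa> (S \<epsilon> f) h x - \<epsilon> * conv (deriv \<kappa>) (S \<epsilon> f) (\<lambda>y. Gd 0 h (T y) * f y) x"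

definition kernel_op :: "real \<Rightarrow> (real \<Rightarrow> real) \<Rightarrow> (real \<Rightarrow> real) \<Rightarrow> real \<Rightarrow> real" where
  "kernel_op \<epsilon> \<kappa> f x = conv \<kappa> (S \<epsilon> f) f x"

lemma GT_cont: "continuous_on UNIV h \<Longrightarrow> continuous_on UNIV (\<lambda>y. Gd 0 h (T y))"
  by (intro continuous_on_compose2[OF Gd_cont T_cont(1)]) auto

lemma kernel_deriv_F_N:
  assumes "\<kappa> \<in> F_N N" "continuous_on UNIV f" "continuous_on UNIV h"
  shows "kernel_deriv \<epsilon> \<kappa> f h \<in> F_N N" "deriv (kernel_deriv \<epsilon> \<kappa> f h) = kernel_deriv \<epsilon> (deriv \<kappa>) f h"
proof -
  have i: "integrable circ h" "integrable circ (\<lambda>y. Gd 0 h (T y) * f y)"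
    by (intro integrable_circ_cont continuous_intros GT_cont assms)+
  note 1 = conv_F_N[OF assms(1) S_cont(1)[OF assms(2)] i(1)]
  note 2 = conv_F_N[OF F_N_deriv(2)[OF assms(1)] S_cont(1)[OF assms(2)] i(2)]
  have eq: "kernel_deriv \<epsilon> \<kappa> f h = (\<lambda>x. 1 * conv \<kappa> (S \<epsilon> f) h x + (- \<epsilon>) * conv (deriv \<kappa>) (S \<epsilon> f) (\<lambda>y. Gd 0 h (T y) * f y) x)" for \<kappa>
    by (auto simp: kernel_deriv_def)
  show "kernel_deriv \<epsilon> \<kappa> f h \<in> F_N N" unfolding eq by (rule F_N_lin[OF 1(1) 2(1)])
  show "deriv (kernel_deriv \<epsilon> \<kappa> f h) = kernel_deriv \<epsilon> (deriv \<kappa>) f h"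
    unfolding eq F_N_deriv_lin[OF 1(1) 2(1)] 1(2) 2(2) ..
qed

lemma kernel_op_F_N:
  assumes "\<kappa> \<in> F_N N" "continuous_on UNIV f"
  shows "kernel_op \<epsilon> \<kappa> f \<in> F_N N" "deriv (kernel_op \<epsilon> \<kappa> f) = kernel_op \<epsilon> (deriv \<kappa>) f"
  using conv_F_N[OF assms(1) S_cont(1)[OF assms(2)] integrable_circ_cont[OF assms(2)]]
  unfolding kernel_op_def[abs_def] by auto

lemma kernel_deriv_lin:
  assumes "\<kappa> \<in> F_N N" "continuous_on UNIV f" "continuous_on UNIV h" "continuous_on UNIV k"
  shows "kernel_deriv \<epsilon> \<kappa> f (\<lambda>x. a * h x + b * k x) = (\<lambda>x. a * kernel_deriv \<epsilon> \<kappa> f h x + b * kernel_deriv \<epsilon> \<kappa> f k x)"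
proof
  fix x
  note c = F_N_cont[OF assms(1)] F_N_cont[OF F_N_deriv(2)[OF assms(1)]] S_cont(1)[OF assms(2)]
  have i: "integrable circ h" "integrable circ k" "integrable circ (\<lambda>y. Gd 0 h (T y) * f y)" "integrable circ (\<lambda>y. Gd 0 k (T y) * f y)"
    by (intro integrable_circ_cont continuous_intros GT_cont assms)+
  have "(\<lambda>y. Gd 0 (\<lambda>x. a * h x + b * k x) (T y) * f y) = (\<lambda>y. a * (Gd 0 h (T y) * f y) + b * (Gd 0 k (T y) * f y))"
    using Gd_lin[of 0 h k a b] i by (simp add: algebra_simps)
  thus "kernel_deriv \<epsilon> \<kappa> f (\<lambda>x. a * h x + b * k x) x = a * kernel_deriv \<epsilon> \<kappa> f h x + b * kernel_deriv \<epsilon> \<kappa> f k x"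
    unfolding kernel_deriv_def using conv_lin[OF c(1,3) i(1,2)] conv_lin[OF c(2,3) i(3,4)]
    by (simp add: algebra_simps)
qed

lemma kernel_deriv_bound:
  assumes "\<kappa> \<in> F_N N" "continuous_on UNIV f" "continuous_on UNIV h" "\<And>x. \<bar>\<kappa> x\<bar> \<le> B" "\<And>x. \<bar>deriv \<kappa> x\<bar> \<le> B"
  shows "\<bar>kernel_deriv \<epsilon> \<kappa> f h x\<bar> \<le> B * (1 + \<bar>\<epsilon>\<bar> * A * L1norm f) * L1norm h"
proof -
  note c = F_N_cont[OF assms(1)] F_N_cont[OF F_N_deriv(2)[OF assms(1)]] S_cont(1)[OF assms(2)]
  have B: "0 \<le> B" using assms(4)[of 0] by linarith
  have ih: "integrable circ h" and i: "integrable circ (\<lambda>y. Gd 0 h (T y) * f y)" and if': "integrable circ f"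
    by (intro integrable_circ_cont continuous_intros GT_cont assms)+
  have 1: "\<bar>conv \<kappa> (S \<epsilon> f) h x\<bar> \<le> B * L1norm h" by (rule conv_bound[OF c(1,3) ih assms(4)])
  have "\<bar>conv (deriv \<kappa>) (S \<epsilon> f) (\<lambda>y. Gd 0 h (T y) * f y) x\<bar> \<le> B * cint (\<lambda>y. \<bar>Gd 0 h (T y) * f y\<bar>)"
    by (rule conv_bound[OF c(2,3) i assms(5)])
  also have "\<dots> \<le> B * (A * L1norm h * L1norm f)"
    by (intro mult_left_mono B cint_abs_mult_le[OF if' borel_measurable_continuous_onI[OF GT_cont[OF assms(3)]]] Gd_bound[OF _ ih]) auto
  finally have "\<bar>\<epsilon>\<bar> * \<bar>conv (deriv \<kappa>) (S \<epsilon> f) (\<lambda>y. Gd 0 h (T y) * f y) x\<bar> \<le> \<bar>\<epsilon>\<bar> * (B * (A * L1norm h * L1norm f))"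
    by (intro mult_left_mono) auto
  with 1 have "\<bar>kernel_deriv \<epsilon> \<kappa> f h x\<bar> \<le> B * L1norm h + \<bar>\<epsilon>\<bar> * (B * (A * L1norm h * L1norm f))"
    unfolding kernel_deriv_def abs_mult[symmetric] by linarith
  also have "\<dots> = B * (1 + \<bar>\<epsilon>\<bar> * A * L1norm f) * L1norm h" by (simp add: algebra_simps)
  finally show ?thesis .
qed

text \<open>The dependence on \<open>f\<close> is through the map \<open>S\<^sub>f\<close>, in both terms, and through the factor \<open>f\<close> in the second.\<close>

lemma kernel_deriv_lipschitz:
  assumes \<kappa>: "\<kappa> \<in> F_N N" "\<And>x. \<bar>deriv \<kappa> x\<bar> \<le> B" "\<And>x. \<bar>deriv (deriv \<kappa>) x\<bar> \<le> B"
    and c: "continuous_on UNIV f" "continuous_on UNIV k" "continuous_on UNIV h"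
    and f1: "L1norm f \<le> 1"
  shows "\<bar>kernel_deriv \<epsilon> \<kappa> f h x - kernel_deriv \<epsilon> \<kappa> k h x\<bar>
    \<le> B * (\<bar>\<epsilon>\<bar> * A) * (2 + \<bar>\<epsilon>\<bar> * A) * cint (\<lambda>y. \<bar>f y - k y\<bar>) * L1norm h"
proof -
  note ck = F_N_cont[OF \<kappa>(1)] F_N_cont[OF F_N_deriv(2)[OF \<kappa>(1)]]
  note cS = S_cont(1)[OF c(1), of \<epsilon>] S_cont(1)[OF c(2), of \<epsilon>]
  define d where "d = cint (\<lambda>y. \<bar>f y - k y\<bar>)"
  define H where "H = L1norm h"
  have nn: "0 \<le> d" "0 \<le> H" "0 \<le> L1norm f" unfolding d_def H_def by (intro cint_nonneg; simp)+
  have B: "0 \<le> B" using \<kappa>(2)[of 0] by linarith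
  have A0: "0 \<le> A" using A(1) by simp
  let ?b = "\<lambda>y. Gd 0 h (T y)"
  have cb: "continuous_on UNIV ?b" by (rule GT_cont[OF c(3)])
  have b: "\<bar>?b y\<bar> \<le> A * H" for y unfolding H_def by (rule Gd_bound[OF _ integrable_circ_cont[OF c(3)]]) simp
  have Sd: "\<bar>S \<epsilon> f y - S \<epsilon> k y\<bar> \<le> \<bar>\<epsilon>\<bar> * A * d" for y
    unfolding d_def by (rule S_diff; intro integrable_circ_cont c)
  have 1: "\<bar>conv \<kappa> (S \<epsilon> f) h x - conv \<kappa> (S \<epsilon> k) h x\<bar> \<le> B * (\<bar>\<epsilon>\<bar> * A * d) * H"
    unfolding H_def by (rule conv_diff[OF F_N_deriv(1)[OF \<kappa>(1)] \<kappa>(2) cS integrable_circ_cont[OF c(3)] Sd])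
  have bf: "cint (\<lambda>y. \<bar>?b y * f y\<bar>) \<le> A * H * 1"
  proof -
    have "cint (\<lambda>y. \<bar>?b y * f y\<bar>) \<le> A * H * L1norm f"
      by (rule cint_abs_mult_le[OF integrable_circ_cont[OF c(1)] borel_measurable_continuous_onI[OF cb] b])
    also have "\<dots> \<le> A * H * 1" using f1 A0 nn by (intro mult_left_mono) auto
    finally show ?thesis .
  qed
  have "\<bar>conv (deriv \<kappa>) (S \<epsilon> f) (\<lambda>y. ?b y * f y) x - conv (deriv \<kappa>) (S \<epsilon> k) (\<lambda>y. ?b y * f y) x\<bar>
      \<le> B * (\<bar>\<epsilon>\<bar> * A * d) * cint (\<lambda>y. \<bar>?b y * f y\<bar>)"
    by (rule conv_diff[OF F_N_deriv(1)[OF F_N_deriv(2)[OF \<kappa>(1)]] \<kappa>(3) cS _ Sd]) (intro integrable_circ_cont continuous_intros cb c)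
  also have "\<dots> \<le> B * (\<bar>\<epsilon>\<bar> * A * d) * (A * H * 1)" using bf B A0 nn by (intro mult_left_mono) auto
  finally have 2: "\<bar>conv (deriv \<kappa>) (S \<epsilon> f) (\<lambda>y. ?b y * f y) x - conv (deriv \<kappa>) (S \<epsilon> k) (\<lambda>y. ?b y * f y) x\<bar> \<le> B * (\<bar>\<epsilon>\<bar> * A * d) * (A * H)" by simp
  have e: "conv (deriv \<kappa>) (S \<epsilon> k) (\<lambda>y. ?b y * f y) x - conv (deriv \<kappa>) (S \<epsilon> k) (\<lambda>y. ?b y * k y) x
      = conv (deriv \<kappa>) (S \<epsilon> k) (\<lambda>y. ?b y * (f y - k y)) x"
    using conv_lin[OF ck(2) cS(2), of "\<lambda>y. ?b y * f y" "\<lambda>y. ?b y * k y" 1 "-1" x]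
    by (simp add: integrable_circ_cont cb c continuous_intros right_diff_distrib)
  have "\<bar>conv (deriv \<kappa>) (S \<epsilon> k) (\<lambda>y. ?b y * (f y - k y)) x\<bar> \<le> B * cint (\<lambda>y. \<bar>?b y * (f y - k y)\<bar>)"
    by (rule conv_bound[OF ck(2) cS(2) _ \<kappa>(2)]) (intro integrable_circ_cont continuous_intros cb c)
  also have "\<dots> \<le> B * (A * H * d)" unfolding d_def
    by (intro mult_left_mono B cint_abs_mult_le[OF _ borel_measurable_continuous_onI[OF cb] b] integrable_circ_cont continuous_intros c)
  finally have 3: "\<bar>conv (deriv \<kappa>) (S \<epsilon> k) (\<lambda>y. ?b y * f y) x - conv (deriv \<kappa>) (S \<epsilon> k) (\<lambda>y. ?b y * k y) x\<bar> \<le> B * (A * H * d)"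
    by (simp only: e)
  define P where "P = conv (deriv \<kappa>) (S \<epsilon> f) (\<lambda>y. ?b y * f y) x - conv (deriv \<kappa>) (S \<epsilon> k) (\<lambda>y. ?b y * k y) x"
  have "\<bar>P\<bar> \<le> B * (\<bar>\<epsilon>\<bar> * A * d) * (A * H) + B * (A * H * d)" using 2 3 unfolding P_def by linarith
  hence "\<bar>\<epsilon> * P\<bar> \<le> \<bar>\<epsilon>\<bar> * (B * (\<bar>\<epsilon>\<bar> * A * d) * (A * H) + B * (A * H * d))"
    unfolding abs_mult by (intro mult_left_mono) auto
  moreover have "kernel_deriv \<epsilon> \<kappa> f h x - kernel_deriv \<epsilon> \<kappa> k h x = (conv \<kappa> (S \<epsilon> f) h x - conv \<kappa> (S \<epsilon> k) h x) - \<epsilon> * P"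
    by (simp add: kernel_deriv_def P_def algebra_simps)
  ultimately have "\<bar>kernel_deriv \<epsilon> \<kappa> f h x - kernel_deriv \<epsilon> \<kappa> k h x\<bar>
     \<le> B * (\<bar>\<epsilon>\<bar> * A * d) * H + \<bar>\<epsilon>\<bar> * (B * (\<bar>\<epsilon>\<bar> * A * d) * (A * H) + B * (A * H * d))"
    using 1 by linarith
  also have "\<dots> = B * (\<bar>\<epsilon>\<bar> * A) * (2 + \<bar>\<epsilon>\<bar> * A) * d * H" by (simp add: algebra_simps)
  finally show ?thesis by (simp only: d_def H_def)
qed

lemma S_add:
  assumes "continuous_on UNIV f" "continuous_on UNIV h"
  shows "S \<epsilon> (\<lambda>y. f y + h y) y = S \<epsilon> f y + \<epsilon> * Gd 0 h (T y)"
  using Gd_lin[of 0 f h 1 1 "T y"] assms by (simp add: S_eq integrable_circ_cont algebra_simps)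

text \<open>With \<open>a = \<epsilon> (G h) \<circ> T\<close>, the increment of the map, the remainder splits into a second-order Taylor error of the kernel
  integrated against \<open>f\<close> and a first-order one integrated against \<open>h\<close>; both are quadratic in \<open>h\<close>.\<close>

lemma kernel_op_remainder:
  assumes \<kappa>: "\<kappa> \<in> F_N N" "\<And>x. \<bar>deriv \<kappa> x\<bar> \<le> B" "\<And>x. \<bar>deriv (deriv \<kappa>) x\<bar> \<le> B"
    and c: "continuous_on UNIV f" "continuous_on UNIV h"
  shows "\<bar>kernel_op \<epsilon> \<kappa> (\<lambda>y. f y + h y) x - kernel_op \<epsilon> \<kappa> f x - kernel_deriv \<epsilon> \<kappa> f h x\<bar>
    \<le> B * ((\<bar>\<epsilon>\<bar> * A)\<^sup>2 * L1norm f + \<bar>\<epsilon>\<bar> * A) * (L1norm h)\<^sup>2"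
proof -
  define a where "a y = \<epsilon> * Gd 0 h (T y)" for y
  define H where "H = L1norm h"
  have B: "0 \<le> B" using \<kappa>(2)[of 0] by linarith
  have ca: "continuous_on UNIV a" unfolding a_def by (intro continuous_intros GT_cont c)
  have ab: "\<bar>a y\<bar> \<le> \<bar>\<epsilon>\<bar> * A * H" for y
    using Gd_bound[of 0 h "T y"] integrable_circ_cont[OF c(2)] by (simp add: a_def abs_mult H_def mult.assoc mult_left_mono)
  note dk = F_N_deriv(1)[OF \<kappa>(1)] and dk2 = F_N_deriv(1)[OF F_N_deriv(2)[OF \<kappa>(1)]]
  note ck = F_N_cont[OF \<kappa>(1)] F_N_cont[OF F_N_deriv(2)[OF \<kappa>(1)]]
  have cS: "continuous_on UNIV (S \<epsilon> f)" by (rule S_cont(1)[OF c(1)])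
  have cp: "continuous_on UNIV (\<lambda>y. x - S \<epsilon> f y)" by (intro continuous_intros cS)
  have cc: "continuous_on UNIV (\<lambda>y. \<kappa> (x - S \<epsilon> f y))" "continuous_on UNIV (\<lambda>y. \<kappa> (x - S \<epsilon> f y - a y))"
    "continuous_on UNIV (\<lambda>y. deriv \<kappa> (x - S \<epsilon> f y))"
    by (intro continuous_on_compose2[OF ck(1)] continuous_on_compose2[OF ck(2)] continuous_intros cS ca; simp)+
  define q1 where "q1 y = \<kappa> (x - S \<epsilon> f y - a y) - \<kappa> (x - S \<epsilon> f y) + a y * deriv \<kappa> (x - S \<epsilon> f y)" for y
  define q2 where "q2 y = \<kappa> (x - S \<epsilon> f y - a y) - \<kappa> (x - S \<epsilon> f y)" for y
  have cq: "continuous_on UNIV q1" "continuous_on UNIV q2" unfolding q1_def q2_def by (intro continuous_intros cc ca)+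
  have if': "integrable circ f" and ih: "integrable circ h" by (intro integrable_circ_cont c)+
  have eq: "kernel_op \<epsilon> \<kappa> (\<lambda>y. f y + h y) x - kernel_op \<epsilon> \<kappa> f x - kernel_deriv \<epsilon> \<kappa> f h x = cint (\<lambda>y. q1 y * f y) + cint (\<lambda>y. q2 y * h y)"
  proof -
    have P: "kernel_op \<epsilon> \<kappa> (\<lambda>y. f y + h y) x = cint (\<lambda>y. \<kappa> (x - S \<epsilon> f y - a y) * (f y + h y))"
      unfolding kernel_op_def conv_def S_add[OF c] a_def by (simp add: algebra_simps)
    have D: "kernel_deriv \<epsilon> \<kappa> f h x = cint (\<lambda>y. \<kappa> (x - S \<epsilon> f y) * h y) - cint (\<lambda>y. a y * deriv \<kappa> (x - S \<epsilon> f y) * f y)"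
      unfolding kernel_deriv_def conv_def cint_cmult[symmetric] a_def by (simp add: mult_ac)
    define F1 F2 F3 F4 where "F1 y = \<kappa> (x - S \<epsilon> f y - a y) * (f y + h y)" and "F2 y = \<kappa> (x - S \<epsilon> f y) * f y"
      and "F3 y = \<kappa> (x - S \<epsilon> f y) * h y" and "F4 y = a y * deriv \<kappa> (x - S \<epsilon> f y) * f y" for y
    have iF: "integrable circ F1" "integrable circ F2" "integrable circ F3" "integrable circ F4"
      unfolding F1_def F2_def F3_def F4_def by (intro integrable_circ_cont continuous_intros cc ca c)+
    have "kernel_op \<epsilon> \<kappa> (\<lambda>y. f y + h y) x - kernel_op \<epsilon> \<kappa> f x - kernel_deriv \<epsilon> \<kappa> f h x = cint F1 - cint F2 - (cint F3 - cint F4)"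
      by (simp only: P D) (simp add: kernel_op_def conv_def F1_def[abs_def] F2_def[abs_def] F3_def[abs_def] F4_def[abs_def])
    also have "\<dots> = cint (\<lambda>y. F1 y - F2 y - (F3 y - F4 y))"
      using iF by (simp add: cint_diff)
    also have "\<dots> = cint (\<lambda>y. q1 y * f y + q2 y * h y)"
      by (intro cint_cong) (simp add: F1_def F2_def F3_def F4_def q1_def q2_def algebra_simps)
    also have "\<dots> = cint (\<lambda>y. q1 y * f y) + cint (\<lambda>y. q2 y * h y)"
      by (intro cint_add integrable_circ_cont continuous_intros cq c)
    finally show ?thesis .
  qed
  have H0: "0 \<le> H" unfolding H_def by (rule cint_nonneg) simp
  have A0: "0 \<le> A" using A(1) by simp
  have "\<bar>cint (\<lambda>y. q1 y * f y)\<bar> \<le> (B * (\<bar>\<epsilon>\<bar> * A * H)\<^sup>2) * L1norm f"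
  proof (rule cint_mult_le[OF if' borel_measurable_continuous_onI[OF cq(1)]])
    fix y
    have "\<bar>q1 y\<bar> \<le> B * (a y)\<^sup>2" unfolding q1_def by (rule taylor2[OF dk dk2 \<kappa>(3)])
    also have "\<dots> \<le> B * (\<bar>\<epsilon>\<bar> * A * H)\<^sup>2"
      using ab[of y] by (intro mult_left_mono B) (metis abs_le_square_iff abs_of_nonneg abs_ge_zero order_trans)
    finally show "\<bar>q1 y\<bar> \<le> B * (\<bar>\<epsilon>\<bar> * A * H)\<^sup>2" .
  qed
  moreover have "\<bar>cint (\<lambda>y. q2 y * h y)\<bar> \<le> (B * (\<bar>\<epsilon>\<bar> * A * H)) * L1norm h"
  proof (rule cint_mult_le[OF ih borel_measurable_continuous_onI[OF cq(2)]])
    fix y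
    have "\<bar>q2 y\<bar> \<le> B * \<bar>(x - S \<epsilon> f y - a y) - (x - S \<epsilon> f y)\<bar>" unfolding q2_def by (rule lipschitz_from_deriv[OF dk \<kappa>(2)])
    also have "\<dots> \<le> B * (\<bar>\<epsilon>\<bar> * A * H)" using ab[of y] by (intro mult_left_mono B) auto
    finally show "\<bar>q2 y\<bar> \<le> B * (\<bar>\<epsilon>\<bar> * A * H)" .
  qed
  ultimately have "\<bar>kernel_op \<epsilon> \<kappa> (\<lambda>y. f y + h y) x - kernel_op \<epsilon> \<kappa> f x - kernel_deriv \<epsilon> \<kappa> f h x\<bar> \<le>
     (B * (\<bar>\<epsilon>\<bar> * A * H)\<^sup>2) * L1norm f + (B * (\<bar>\<epsilon>\<bar> * A * H)) * H"
    unfolding eq by (simp only: H_def[symmetric])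
  also have "\<dots> = B * ((\<bar>\<epsilon>\<bar> * A)\<^sup>2 * L1norm f + \<bar>\<epsilon>\<bar> * A) * H\<^sup>2"
    by (simp add: power2_eq_square algebra_simps)
  finally show ?thesis by (simp only: H_def)
qed

end

lemma cint_conv:
  assumes N: "0 < N" and \<sigma>: "continuous_on UNIV \<sigma>" and r: "integrable circ r"
  shows "cint (conv (fejer N) \<sigma> r) = cint r"
proof -
  let ?H = "\<lambda>p. fejer N (fst p - \<sigma> (snd p))"
  have H: "continuous_on UNIV ?H"
    by (intro continuous_on_compose2[OF fejer_cont] continuous_on_compose2[OF \<sigma>] continuous_intros) auto
  have 1: "cint (\<lambda>x. fejer N (x - a)) = 1" for a
    using cint_shift(1)[OF fejer_periodic[OF N] integrable_circ_cont[OF fejer_cont], of "- a"] cint_fejer[OF N] by simp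
  have "cint (conv (fejer N) \<sigma> r) = cint (\<lambda>x. cint (\<lambda>y. ?H (x, y) * r y))" by (simp add: conv_def[abs_def])
  also have "\<dots> = cint (\<lambda>y. cint (\<lambda>x. ?H (x, y)) * r y)" by (rule cint_Fubini(1)[OF H r])
  finally show ?thesis by (simp add: 1)
qed

lemma cint_deriv_F_N:
  assumes "f \<in> F_N N" shows "cint (deriv f) = 0"
proof -
  have "cint (deriv f) = f 1 - f 0"
    using F_N_deriv[OF assms] F_N_cont by (intro cint_FTC) auto
  also have "\<dots> = 0" using F_N_periodic[OF assms] unfolding periodic1_def by (metis add_0 right_minus_eq)
  finally show ?thesis .
qed

declare One_nat_def [simp del]

subsection \<open>The norm on trigonometric polynomials\<close>

lemma Wnorm_nonneg: "0 \<le> Wnorm i h"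
  unfolding Wnorm_def by (intro sum_nonneg cint_nonneg) simp

lemma Wnorm_scale: "h \<in> F_N N \<Longrightarrow> Wnorm 1 (\<lambda>x. a * h x) = \<bar>a\<bar> * Wnorm 1 h"
proof -
  assume h: "h \<in> F_N N"
  have "deriv (\<lambda>x. a * h x) = (\<lambda>x. a * deriv h x)" using F_N_deriv_lin[OF h h, of a 0] by simp
  thus ?thesis unfolding Wnorm1_F_N[OF F_N_scale[OF h]] Wnorm1_F_N[OF h]
    by (simp add: cint_abs_cmult algebra_simps)
qed

lemma Wnorm_triangle:
  assumes "f \<in> F_N N" "g \<in> F_N N" shows "Wnorm 1 (\<lambda>x. f x + g x) \<le> Wnorm 1 f + Wnorm 1 g"
proof -
  have d: "deriv (\<lambda>x. f x + g x) = (\<lambda>x. deriv f x + deriv g x)" using F_N_deriv_lin[OF assms, of 1 1] by simp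
  show ?thesis unfolding Wnorm1_F_N[OF F_N_add[OF assms]] d Wnorm1_F_N[OF assms(1)] Wnorm1_F_N[OF assms(2)]
    using cint_abs_triangle[OF F_N_integrable[OF assms(1)] F_N_integrable[OF assms(2)]]
      cint_abs_triangle[OF F_N_integrable[OF F_N_deriv(2)[OF assms(1)]] F_N_integrable[OF F_N_deriv(2)[OF assms(2)]]]
    by linarith
qed

lemma Wnorm_diff_commute: "f \<in> F_N N \<Longrightarrow> g \<in> F_N N \<Longrightarrow> Wnorm 1 (\<lambda>x. f x - g x) = Wnorm 1 (\<lambda>x. g x - f x)"
  using Wnorm_scale[OF F_N_diff, of f N g "-1"] by simp

lemma Wnorm_diff:
  assumes "f \<in> F_N N" "g \<in> F_N N" shows "Wnorm 1 (\<lambda>x. f x - g x) \<le> Wnorm 1 f + Wnorm 1 g"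
  using Wnorm_triangle[OF assms(1) F_N_scale[OF assms(2), of "-1"]] Wnorm_scale[OF assms(2), of "-1"] by simp

lemma Wnorm_zero: "h \<in> F_N N \<Longrightarrow> Wnorm 1 h \<le> 0 \<Longrightarrow> h = (\<lambda>x. 0)"
proof -
  assume h: "h \<in> F_N N" "Wnorm 1 h \<le> 0"
  have "L1norm h \<le> 0" using cint_le_Wnorm[OF F_N_L1[OF h(1)], of 1] h(2) by linarith
  moreover have "0 \<le> L1norm h" by (rule cint_nonneg) simp
  ultimately have "L1norm h = 0" by simp
  from cint_zero_cont[OF F_N_cont[OF h(1)] F_N_periodic[OF h(1)] this] show ?thesis by (rule ext)
qed

lemma Wnorm_zero_fun: "Wnorm 1 (\<lambda>x. 0) = 0"
  using Wnorm_scale[OF F_N_const[of 1 0], of 0] by simp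

lemma V_N_iff: "h \<in> V_N N \<longleftrightarrow> h \<in> F_N N \<and> cint h = 0"
  by (auto simp: V_N_def V11_def F_N_W)

lemma V_N_lin: "f \<in> V_N N \<Longrightarrow> g \<in> V_N N \<Longrightarrow> (\<lambda>x. a * f x + b * g x) \<in> V_N N"
  using F_N_integrable[of f N] F_N_integrable[of g N]
  by (simp add: V_N_iff F_N_lin cint_add cint_cmult)

subsection \<open>Injective linear self-maps are bijective\<close>

text \<open>The scaling with which functions form a vector space in the sense of the locale of linear algebra.\<close>

definition fscale :: "real \<Rightarrow> (real \<Rightarrow> real) \<Rightarrow> real \<Rightarrow> real" where
  "fscale a f = (\<lambda>x. a * f x)"

interpretation funvs: vector_space fscale
  by unfold_locales (auto simp: fscale_def fun_eq_iff algebra_simps)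

lemma fun_sum_apply: "(\<Sum>k\<in>Z. F k) x = (\<Sum>k\<in>Z. F k x :: real)" for F :: "'a \<Rightarrow> real \<Rightarrow> real"
  by (induction Z rule: infinite_finite_induct) auto

lemma F_N_finite_span: "\<exists>B. finite B \<and> F_N N \<subseteq> funvs.span B"
proof -
  define Z where "Z = {- int N + 1..int N}"
  define C where "C k = (\<lambda>x. cos (2 * pi * of_int k * x))" for k :: int
  define D where "D k = (\<lambda>x. sin (2 * pi * of_int k * x))" for k :: int
  have "f \<in> funvs.span (C ` Z \<union> D ` Z)" if f: "f \<in> F_N N" for f
  proof -
    obtain c where c: "trig_coeffs N c f" using f F_N_coeffs by blast
    have "f x = (\<Sum>k\<in>Z. Re (c k) * C k x + (- Im (c k)) * D k x)" for x
    proof -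
      have "f x = Re (complex_of_real (f x))" by simp
      also have "\<dots> = (\<Sum>k\<in>Z. Re (c k * e_fun k x))" using c by (simp only: trig_coeffs_def Z_def Re_sum)
      finally show ?thesis by (simp add: C_def D_def)
    qed
    hence "f = (\<Sum>k\<in>Z. fscale (Re (c k)) (C k) + fscale (- Im (c k)) (D k))"
      by (auto simp: fun_eq_iff fun_sum_apply fscale_def)
    moreover have "\<dots> \<in> funvs.span (C ` Z \<union> D ` Z)"
      by (intro funvs.span_sum funvs.span_add funvs.span_scale funvs.span_base) auto
    ultimately show ?thesis by simp
  qed
  thus ?thesis by (intro exI[of _ "C ` Z \<union> D ` Z"]) (auto simp: Z_def)
qed

text \<open>A basis of \<open>V_N\<close> is finite, and its image under an injective linear map is independent of the same size.\<close>

lemma V_N_injective_surjective: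
  assumes L: "\<And>h. h \<in> V_N N \<Longrightarrow> L h \<in> V_N N"
    and lin: "\<And>a b h k. h \<in> V_N N \<Longrightarrow> k \<in> V_N N \<Longrightarrow> L (\<lambda>x. a * h x + b * k x) = (\<lambda>x. a * L h x + b * L k x)"
    and inj: "\<And>h. h \<in> V_N N \<Longrightarrow> L h = (\<lambda>x. 0) \<Longrightarrow> h = (\<lambda>x. 0)"
  shows "bij_betw L (V_N N) (V_N N)"
proof -
  let ?V = "V_N N"
  have z: "(\<lambda>x. 0) \<in> ?V" by (simp add: V_N_iff F_N_zero cint_const)
  have sub: "funvs.subspace ?V"
    unfolding funvs.subspace_def
  proof (intro conjI ballI allI)
    show "0 \<in> ?V" using z by (simp add: zero_fun_def)
    show "f + g \<in> ?V" if "f \<in> ?V" "g \<in> ?V" for f g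
      using V_N_lin[OF that, of 1 1] by (simp add: plus_fun_def)
    show "fscale a f \<in> ?V" if "f \<in> ?V" for a f
      using V_N_lin[OF that that, of a 0] by (simp add: fscale_def)
  qed
  obtain B where B: "B \<subseteq> ?V" "funvs.independent B" "?V \<subseteq> funvs.span B"
    using funvs.maximal_independent_subset[of ?V] by blast
  obtain F where F: "finite F" "F_N N \<subseteq> funvs.span F" using F_N_finite_span by blast
  have fB: "finite B"
  proof -
    have "?V \<subseteq> F_N N" by (auto simp: V_N_def)
    hence "B \<subseteq> funvs.span F" using B(1) F(2) by blast
    thus ?thesis using funvs.independent_span_bound[OF F(1) B(2)] by blast
  qed
  have lin_sum: "L (\<Sum>v\<in>t. fscale (u v) v) = (\<Sum>v\<in>t. fscale (u v) (L v)) \<and> (\<Sum>v\<in>t. fscale (u v) v) \<in> ?V"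
    if "finite t" "t \<subseteq> ?V" for t u
    using that
  proof (induction t rule: finite_induct)
    case empty
    have "L (\<lambda>x. 0) = (\<lambda>x. 0)" using lin[OF z z, of 0 0] by simp
    thus ?case using z by (simp add: zero_fun_def)
  next
    case (insert v t)
    have v: "v \<in> ?V" and IH: "L (\<Sum>v\<in>t. fscale (u v) v) = (\<Sum>v\<in>t. fscale (u v) (L v))" "(\<Sum>v\<in>t. fscale (u v) v) \<in> ?V"
      using insert by auto
    define s where "s = (\<Sum>v\<in>t. fscale (u v) v)"
    have "(\<Sum>v\<in>insert v t. fscale (u v) v) = (\<lambda>x. u v * v x + 1 * s x)"
      using insert.hyps by (auto simp: s_def plus_fun_def fscale_def)
    moreover have "(\<Sum>v\<in>insert v t. fscale (u v) (L v)) = (\<lambda>x. u v * L v x + 1 * L s x)"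
      using insert.hyps IH by (auto simp: s_def plus_fun_def fscale_def)
    ultimately show ?case using lin[OF v, of s "u v" 1] V_N_lin[OF v, of s "u v" 1] IH(2) by (simp add: s_def)
  qed
  have injon: "inj_on L ?V"
  proof (rule inj_onI)
    fix h k assume hk: "h \<in> ?V" "k \<in> ?V" "L h = L k"
    have "L (\<lambda>x. 1 * h x + (-1) * k x) = (\<lambda>x. 0)" using lin[OF hk(1,2), of 1 "-1"] hk(3) by simp
    from inj[OF V_N_lin[OF hk(1,2)] this] show "h = k" by (auto simp: fun_eq_iff)
  qed
  have injB: "inj_on L B" using injon B(1) inj_on_subset by blast
  have ind: "funvs.independent (L ` B)"
  proof
    assume "funvs.dependent (L ` B)"
    then obtain t u where t: "finite t" "t \<subseteq> L ` B" "(\<Sum>v\<in>t. fscale (u v) v) = 0" "\<exists>v\<in>t. u v \<noteq> 0"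
      unfolding funvs.dependent_explicit by blast
    obtain t' where t': "t' \<subseteq> B" "t = L ` t'" "inj_on L t'"
    proof -
      obtain t' where "t' \<subseteq> B" "t = L ` t'" using t(2) by (meson subset_imageE)
      thus ?thesis using that injB inj_on_subset by metis
    qed
    have ft': "finite t'" using t' fB finite_subset by blast
    have "(\<Sum>v\<in>t'. fscale (u (L v)) (L v)) = 0" using t(3) t' by (simp add: sum.reindex)
    hence "L (\<Sum>v\<in>t'. fscale (u (L v)) v) = (\<lambda>x. 0)"
      using lin_sum[OF ft', of "\<lambda>v. u (L v)"] t' B(1) by (auto simp: zero_fun_def)
    hence "(\<Sum>v\<in>t'. fscale (u (L v)) v) = 0"
      using inj lin_sum[OF ft', of "\<lambda>v. u (L v)"] t' B(1) by (auto simp: zero_fun_def)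
    moreover have "\<exists>v\<in>t'. u (L v) \<noteq> 0" using t(4) t' by auto
    ultimately have "funvs.dependent B" unfolding funvs.dependent_explicit using ft' t'(1)
      by (intro exI[of _ t'] exI[of _ "\<lambda>v. u (L v)"]) auto
    thus False using B(2) by simp
  qed
  have LB: "L ` B \<subseteq> ?V" using L B(1) by auto
  have "?V \<subseteq> funvs.span (L ` B)"
  proof
    fix w assume w: "w \<in> ?V"
    show "w \<in> funvs.span (L ` B)"
    proof (rule ccontr)
      assume n: "w \<notin> funvs.span (L ` B)"
      have i: "funvs.independent (insert w (L ` B))" using funvs.independent_insertI[OF n ind] .
      have "insert w (L ` B) \<subseteq> funvs.span B" using w LB B(3) by blast
      from funvs.independent_span_bound[OF fB i this]
      have "card (insert w (L ` B)) \<le> card B" by simp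
      moreover have "w \<notin> L ` B" using n funvs.span_base by blast
      ultimately show False using fB injB by (simp add: card_image)
    qed
  qed
  moreover have "funvs.span (L ` B) \<subseteq> L ` ?V"
  proof -
    have "funvs.subspace (L ` ?V)"
      unfolding funvs.subspace_def
    proof (intro conjI ballI allI)
      have "L (\<lambda>x. 0) = (\<lambda>x. 0)" using lin[OF z z, of 0 0] by simp
      hence "(\<lambda>x. 0) \<in> L ` ?V" using z by (metis imageI)
      thus "0 \<in> L ` ?V" by (simp add: zero_fun_def)
      show "f + g \<in> L ` ?V" if "f \<in> L ` ?V" "g \<in> L ` ?V" for f g
      proof -
        obtain h k where hk: "h \<in> ?V" "k \<in> ?V" "f = L h" "g = L k" using \<open>f \<in> L ` ?V\<close> \<open>g \<in> L ` ?V\<close> by auto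
        have "f + g = L (\<lambda>x. 1 * h x + 1 * k x)" using lin[OF hk(1,2), of 1 1] hk by (simp add: plus_fun_def)
        thus ?thesis using V_N_lin[OF hk(1,2)] by blast
      qed
      show "fscale a f \<in> L ` ?V" if "f \<in> L ` ?V" for a f
      proof -
        obtain h where h: "h \<in> ?V" "f = L h" using \<open>f \<in> L ` ?V\<close> by auto
        have "fscale a f = L (\<lambda>x. a * h x + 0 * h x)" using lin[OF h(1) h(1), of a 0] h by (simp add: fscale_def)
        thus ?thesis using V_N_lin[OF h(1) h(1)] by blast
      qed
    qed
    thus ?thesis using B(1) by (intro funvs.span_minimal) auto
  qed
  ultimately have "L ` ?V = ?V" using L by blast
  thus ?thesis using injon by (simp add: bij_betw_def)
qed

context coupled_map begin

text \<open>Depends on \<open>N\<close>; it enters only statements about a fixed \<open>N\<close>.\<close>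

definition kernel_bound :: "nat \<Rightarrow> real" where
  "kernel_bound N = (SOME B. B > 0 \<and> (\<forall>j\<le>3. \<forall>x. \<bar>(deriv ^^ j) (fejer N) x\<bar> \<le> B))"

lemma kernel_bound:
  assumes "0 < N"
  shows "kernel_bound N > 0" "\<bar>fejer N x\<bar> \<le> kernel_bound N" "\<bar>deriv (fejer N) x\<bar> \<le> kernel_bound N" "\<bar>deriv (deriv (fejer N)) x\<bar> \<le> kernel_bound N"
    "\<bar>deriv (deriv (deriv (fejer N))) x\<bar> \<le> kernel_bound N"
proof -
  have "\<exists>B. B > 0 \<and> (\<forall>j\<le>3. \<forall>x. \<bar>(deriv ^^ j) (fejer N) x\<bar> \<le> B)"
    using F_N_bounded[OF fejer_F_N[OF assms]] by metis
  from someI_ex[OF this] have k: "kernel_bound N > 0" "\<And>j x. j \<le> 3 \<Longrightarrow> \<bar>(deriv ^^ j) (fejer N) x\<bar> \<le> kernel_bound N"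
    unfolding kernel_bound_def[symmetric] by blast+
  show "kernel_bound N > 0" by (rule k(1))
  show "\<bar>fejer N x\<bar> \<le> kernel_bound N" "\<bar>deriv (fejer N) x\<bar> \<le> kernel_bound N" "\<bar>deriv (deriv (fejer N)) x\<bar> \<le> kernel_bound N"
    "\<bar>deriv (deriv (deriv (fejer N))) x\<bar> \<le> kernel_bound N"
    using k(2)[of 0 x] k(2)[of "Suc 0" x] k(2)[of "Suc (Suc 0)" x] k(2)[of "Suc (Suc (Suc 0))" x] by simp_all
qed

definition disc_deriv :: "nat \<Rightarrow> real \<Rightarrow> (real \<Rightarrow> real) \<Rightarrow> (real \<Rightarrow> real) \<Rightarrow> real \<Rightarrow> real" where
  "disc_deriv N \<epsilon> f h = kernel_deriv \<epsilon> (fejer N) f h"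

definition disc_op :: "nat \<Rightarrow> real \<Rightarrow> (real \<Rightarrow> real) \<Rightarrow> real \<Rightarrow> real" where
  "disc_op N \<epsilon> f = kernel_op \<epsilon> (fejer N) f"

lemma disc_deriv_F_N: "0 < N \<Longrightarrow> f \<in> F_N N \<Longrightarrow> h \<in> F_N N \<Longrightarrow> disc_deriv N \<epsilon> f h \<in> F_N N"
  unfolding disc_deriv_def by (rule kernel_deriv_F_N(1)[OF fejer_F_N F_N_cont F_N_cont])

lemma disc_op_F_N: "0 < N \<Longrightarrow> f \<in> F_N N \<Longrightarrow> disc_op N \<epsilon> f \<in> F_N N"
  unfolding disc_op_def by (rule kernel_op_F_N(1)[OF fejer_F_N F_N_cont])

lemma disc_deriv_lin:
  "0 < N \<Longrightarrow> f \<in> F_N N \<Longrightarrow> h \<in> F_N N \<Longrightarrow> k \<in> F_N N \<Longrightarrow>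
    disc_deriv N \<epsilon> f (\<lambda>x. a * h x + b * k x) = (\<lambda>x. a * disc_deriv N \<epsilon> f h x + b * disc_deriv N \<epsilon> f k x)"
  unfolding disc_deriv_def by (rule kernel_deriv_lin[OF fejer_F_N F_N_cont F_N_cont F_N_cont])

lemma cint_disc_op: "0 < N \<Longrightarrow> f \<in> F_N N \<Longrightarrow> cint (disc_op N \<epsilon> f) = cint f"
  unfolding disc_op_def kernel_op_def[abs_def] using cint_conv[OF _ S_cont(1)[OF F_N_cont] F_N_integrable, of N f N]
  by (simp add: conv_def[abs_def])

lemma cint_disc_deriv:
  assumes N: "0 < N" and f: "f \<in> F_N N" and h: "h \<in> F_N N"
  shows "cint (disc_deriv N \<epsilon> f h) = cint h"
proof -
  have i: "integrable circ h" "integrable circ (\<lambda>y. Gd 0 h (T y) * f y)"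
    by (intro integrable_circ_cont continuous_intros GT_cont F_N_cont[OF f] F_N_cont[OF h])+
  note cS = S_cont(1)[OF F_N_cont[OF f], of \<epsilon>]
  note K = conv_F_N[OF fejer_F_N[OF N] cS i(2)]
  have 0: "cint (conv (deriv (fejer N)) (S \<epsilon> f) (\<lambda>y. Gd 0 h (T y) * f y)) = 0"
    using cint_deriv_F_N[OF K(1)] K(2) by simp
  have "cint (disc_deriv N \<epsilon> f h) = cint (\<lambda>x. conv (fejer N) (S \<epsilon> f) h x - \<epsilon> * conv (deriv (fejer N)) (S \<epsilon> f) (\<lambda>y. Gd 0 h (T y) * f y) x)"
    by (simp add: disc_deriv_def kernel_deriv_def[abs_def])
  also have "\<dots> = cint (conv (fejer N) (S \<epsilon> f) h) - \<epsilon> * cint (conv (deriv (fejer N)) (S \<epsilon> f) (\<lambda>y. Gd 0 h (T y) * f y))"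
    using F_N_integrable[OF conv_F_N(1)[OF fejer_F_N[OF N] cS i(1)]]
      F_N_integrable[OF F_N_deriv(2)[OF K(1)]] K(2)
    by (subst cint_diff) (auto simp: cint_cmult)
  finally show ?thesis using 0 cint_conv[OF N cS i(1)] by simp
qed

definition lip_const :: "nat \<Rightarrow> real \<Rightarrow> real" where
  "lip_const N \<epsilon> = 2 * (kernel_bound N * (\<bar>\<epsilon>\<bar> * A) * (2 + \<bar>\<epsilon>\<bar> * A))"

definition quad_const :: "nat \<Rightarrow> real \<Rightarrow> real" where
  "quad_const N \<epsilon> = 2 * (kernel_bound N * ((\<bar>\<epsilon>\<bar> * A)\<^sup>2 + \<bar>\<epsilon>\<bar> * A))"

lemma lip_quad_nonneg: "0 < N \<Longrightarrow> 0 \<le> lip_const N \<epsilon>" "0 < N \<Longrightarrow> 0 \<le> quad_const N \<epsilon>"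
  using kernel_bound(1)[of N] A(1) by (auto simp: lip_const_def quad_const_def)

lemma disc_deriv_lipschitz:
  assumes N: "0 < N" and f: "f \<in> F_N N" "L1norm f \<le> 1" and k: "k \<in> F_N N" and h: "h \<in> F_N N"
  shows "Wnorm 1 (\<lambda>x. disc_deriv N \<epsilon> f h x - disc_deriv N \<epsilon> k h x) \<le> lip_const N \<epsilon> * Wnorm 1 (\<lambda>x. f x - k x) * Wnorm 1 h"
proof -
  note K = fejer_F_N[OF N] F_N_deriv(2)[OF fejer_F_N[OF N]]
  note c = F_N_cont[OF f(1)] F_N_cont[OF k] F_N_cont[OF h]
  let ?M = "kernel_bound N * (\<bar>\<epsilon>\<bar> * A) * (2 + \<bar>\<epsilon>\<bar> * A) * cint (\<lambda>y. \<bar>f y - k y\<bar>) * L1norm h"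
  have D: "disc_deriv N \<epsilon> f h \<in> F_N N" "disc_deriv N \<epsilon> k h \<in> F_N N" using disc_deriv_F_N N f k h by auto
  have "deriv (\<lambda>x. disc_deriv N \<epsilon> f h x - disc_deriv N \<epsilon> k h x) = (\<lambda>x. kernel_deriv \<epsilon> (deriv (fejer N)) f h x - kernel_deriv \<epsilon> (deriv (fejer N)) k h x)"
    using F_N_deriv_lin[OF D, of 1 "-1"] kernel_deriv_F_N(2)[OF K(1)] c by (simp add: disc_deriv_def)
  hence "Wnorm 1 (\<lambda>x. disc_deriv N \<epsilon> f h x - disc_deriv N \<epsilon> k h x) \<le> 2 * ?M"
    using kernel_deriv_lipschitz[OF K(1) kernel_bound(3,4)[OF N] c f(2)] kernel_deriv_lipschitz[OF K(2) kernel_bound(4,5)[OF N] c f(2)]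
    by (intro Wnorm1_sup[OF F_N_diff[OF D]]) (simp_all add: disc_deriv_def)
  also have "\<dots> = lip_const N \<epsilon> * (cint (\<lambda>y. \<bar>f y - k y\<bar>) * L1norm h)" by (simp add: lip_const_def)
  also have "\<dots> \<le> lip_const N \<epsilon> * (Wnorm 1 (\<lambda>x. f x - k x) * Wnorm 1 h)"
    by (intro mult_left_mono mult_mono cint_le_Wnorm F_N_L1[OF h] F_N_L1[OF F_N_diff[OF f(1) k]] Wnorm_nonneg lip_quad_nonneg N cint_nonneg) auto
  finally show ?thesis by (simp add: mult.assoc)
qed

lemma disc_op_remainder:
  assumes N: "0 < N" and f: "f \<in> F_N N" "L1norm f \<le> 1" and h: "h \<in> F_N N"
  shows "Wnorm 1 (\<lambda>x. disc_op N \<epsilon> (\<lambda>y. f y + h y) x - disc_op N \<epsilon> f x - disc_deriv N \<epsilon> f h x) \<le> quad_const N \<epsilon> * (Wnorm 1 h)\<^sup>2"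
proof -
  note K = fejer_F_N[OF N] F_N_deriv(2)[OF fejer_F_N[OF N]]
  note c = F_N_cont[OF f(1)] F_N_cont[OF h]
  have fh: "(\<lambda>y. f y + h y) \<in> F_N N" by (rule F_N_add[OF f(1) h])
  let ?H = "L1norm h"
  let ?M = "kernel_bound N * ((\<bar>\<epsilon>\<bar> * A)\<^sup>2 + \<bar>\<epsilon>\<bar> * A) * ?H\<^sup>2"
  have P: "disc_op N \<epsilon> (\<lambda>y. f y + h y) \<in> F_N N" "disc_op N \<epsilon> f \<in> F_N N" "disc_deriv N \<epsilon> f h \<in> F_N N" using disc_op_F_N disc_deriv_F_N N f h fh by auto
  have R: "(\<lambda>x. disc_op N \<epsilon> (\<lambda>y. f y + h y) x - disc_op N \<epsilon> f x - disc_deriv N \<epsilon> f h x) \<in> F_N N" by (intro F_N_diff P)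
  have d: "deriv (\<lambda>x. disc_op N \<epsilon> (\<lambda>y. f y + h y) x - disc_op N \<epsilon> f x - disc_deriv N \<epsilon> f h x)
     = (\<lambda>x. kernel_op \<epsilon> (deriv (fejer N)) (\<lambda>y. f y + h y) x - kernel_op \<epsilon> (deriv (fejer N)) f x - kernel_deriv \<epsilon> (deriv (fejer N)) f h x)"
    using F_N_deriv_lin[OF F_N_diff[OF P(1,2)] P(3), of 1 "-1"] F_N_deriv_lin[OF P(1,2), of 1 "-1"]
      kernel_deriv_F_N(2)[OF K(1) c] kernel_op_F_N(2)[OF K(1) c(1)] kernel_op_F_N(2)[OF K(1) F_N_cont[OF fh]] by (simp add: disc_deriv_def disc_op_def)
  have le: "B * ((\<bar>\<epsilon>\<bar> * A)\<^sup>2 * L1norm f + \<bar>\<epsilon>\<bar> * A) * ?H\<^sup>2 \<le> ?M" if "B = kernel_bound N" for B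
    using f(2) kernel_bound(1)[OF N] A(1) unfolding that
    by (intro mult_right_mono mult_left_mono add_right_mono) (auto simp: mult_left_le)
  have "Wnorm 1 (\<lambda>x. disc_op N \<epsilon> (\<lambda>y. f y + h y) x - disc_op N \<epsilon> f x - disc_deriv N \<epsilon> f h x) \<le> 2 * ?M"
  proof (rule Wnorm1_sup[OF R])
    fix x
    show "\<bar>disc_op N \<epsilon> (\<lambda>y. f y + h y) x - disc_op N \<epsilon> f x - disc_deriv N \<epsilon> f h x\<bar> \<le> ?M"
      using kernel_op_remainder[OF K(1) kernel_bound(3,4)[OF N] c, of \<epsilon> x] le[OF refl] unfolding disc_op_def disc_deriv_def by linarith
    show "\<bar>deriv (\<lambda>x. disc_op N \<epsilon> (\<lambda>y. f y + h y) x - disc_op N \<epsilon> f x - disc_deriv N \<epsilon> f h x) x\<bar> \<le> ?M"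
      using kernel_op_remainder[OF K(2) kernel_bound(4,5)[OF N] c, of \<epsilon> x] le[OF refl] unfolding d by linarith
  qed
  also have "\<dots> = quad_const N \<epsilon> * ?H\<^sup>2" by (simp add: quad_const_def)
  also have "\<dots> \<le> quad_const N \<epsilon> * (Wnorm 1 h)\<^sup>2"
    by (intro mult_left_mono power_mono cint_le_Wnorm F_N_L1[OF h] lip_quad_nonneg N cint_nonneg) auto
  finally show ?thesis .
qed

lemma disc_op_quad:
  assumes N: "0 < N" and f: "f \<in> F_N N" "L1norm f \<le> 1" and k: "k \<in> F_N N"
  shows "Wnorm 1 (\<lambda>x. disc_op N \<epsilon> k x - disc_op N \<epsilon> f x - disc_deriv N \<epsilon> f (\<lambda>y. k y - f y) x) \<le> quad_const N \<epsilon> * (Wnorm 1 (\<lambda>x. k x - f x))\<^sup>2"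
  using disc_op_remainder[OF N f F_N_diff[OF k f(1)]] by simp

end

lemma lift_periodic:
  assumes "circle_map_lift S" "periodic1 \<kappa>"
  shows "periodic1 (\<lambda>y. \<kappa> (x - S y))"
proof -
  obtain d :: int where d: "\<And>y. S (y + 1) = S y + of_int d" using assms(1) by (auto simp: circle_map_lift_def)
  have "\<kappa> (x - S (y + 1)) = \<kappa> (x - S y)" for y
    unfolding d using periodic1_int[OF assms(2), of "x - S y" "- d"] by (simp add: algebra_simps)
  thus ?thesis by (simp add: periodic1_def)
qed

text \<open>\<open>\<psi>' \<circ> S\<close> is the derivative of \<open>\<psi> \<circ> S\<close> divided by \<open>S'\<close>.\<close>

lemma parts_along:
  assumes S: "circle_map_lift S" "\<And>y. (S has_real_derivative S' y) (at y)" "continuous_on UNIV S'" "\<And>y. S' y \<noteq> 0"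
    and p: "\<And>y. ((\<lambda>y. p y / S' y) has_real_derivative r y) (at y)" "continuous_on UNIV r" "periodic1 (\<lambda>y. p y / S' y)"
    and \<psi>: "\<And>x. (\<psi> has_real_derivative \<psi>' x) (at x)" "continuous_on UNIV \<psi>'" "periodic1 \<psi>"
  shows "cint (\<lambda>y. \<psi>' (S y) * p y) = - cint (\<lambda>y. \<psi> (S y) * r y)"
proof -
  have cS: "continuous_on UNIV S" by (rule deriv_imp_cont[OF S(2)])
  have "cint (\<lambda>y. \<psi> (S y) * r y) = - cint (\<lambda>y. \<psi>' (S y) * S' y * (p y / S' y))"
  proof (rule cint_parts)
    show "((\<lambda>y. \<psi> (S y)) has_real_derivative \<psi>' (S y) * S' y) (at y)" for y by (rule DERIV_chain2[OF \<psi>(1) S(2)])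
    show "continuous_on UNIV (\<lambda>y. \<psi>' (S y) * S' y)"
      by (intro continuous_intros continuous_on_compose2[OF \<psi>(2) cS] S) auto
    obtain d :: int where d: "\<And>y. S (y + 1) = S y + of_int d" using S(1) by (auto simp: circle_map_lift_def)
    show "periodic1 (\<lambda>y. \<psi> (S y))" using periodic1_int[OF \<psi>(3)] by (simp add: periodic1_def d)
  qed (use p in auto)
  moreover have "(\<lambda>y. \<psi>' (S y) * S' y * (p y / S' y)) = (\<lambda>y. \<psi>' (S y) * p y)" using S(4) by auto
  ultimately show ?thesis by simp
qed

lemma conv_deriv_parts:
  assumes S: "circle_map_lift S" "\<And>y. (S has_real_derivative S' y) (at y)" "continuous_on UNIV S'" "\<And>y. S' y \<noteq> 0"
    and p: "\<And>y. ((\<lambda>y. p y / S' y) has_real_derivative r y) (at y)" "continuous_on UNIV r" "periodic1 (\<lambda>y. p y / S' y)"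
    and \<kappa>: "\<kappa> \<in> F_N N"
  shows "conv (deriv \<kappa>) S p x = conv \<kappa> S r x"
proof -
  have "cint (\<lambda>y. (deriv \<kappa> (x - S y) * (0 - 1)) * p y) = - cint (\<lambda>y. \<kappa> (x - S y) * r y)"
  proof (rule parts_along[OF S p])
    show "((\<lambda>u. \<kappa> (x - u)) has_real_derivative deriv \<kappa> (x - u) * (0 - 1)) (at u)" for u
      by (rule DERIV_chain2[OF F_N_deriv(1)[OF \<kappa>]]) (intro DERIV_diff DERIV_const DERIV_ident)
    show "continuous_on UNIV (\<lambda>u. deriv \<kappa> (x - u) * (0 - 1))"
      by (intro continuous_intros conv_slice F_N_cont[OF F_N_deriv(2)[OF \<kappa>]])
    show "periodic1 (\<lambda>u. \<kappa> (x - u))"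
      using lift_periodic[of "\<lambda>u. u", OF _ F_N_periodic[OF \<kappa>]] by (auto simp: circle_map_lift_def intro: exI[of _ 1])
  qed
  thus ?thesis by (simp add: conv_def cint_minus)
qed

context coupled_map begin

lemma sc_transfer_eq_disc_op:
  assumes "0 < N" "f \<in> F_N N" "\<And>y. S1 \<epsilon> f y \<noteq> 0"
  shows "sc_transfer_N T g \<epsilon> N f = disc_op N \<epsilon> f"
  using sc_transfer_N_eq[OF assms] by (auto simp: disc_op_def kernel_op_def conv_def)

text \<open>The Frechet derivative looks at \<open>f + h\<close>, which need not be a density. The explicit formula still holds there as long
  as the perturbed map has no critical point, which is an open condition.\<close>

lemma sc_transfer_eq_disc_op_near:
  assumes N: "0 < N" and f: "f \<in> F_N N" and e: "\<And>y. 1 \<le> \<bar>S1 \<epsilon> f y\<bar>"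
  obtains d where "d > 0" "\<And>h. h \<in> F_N N \<Longrightarrow> Wnorm 1 h < d \<Longrightarrow> sc_transfer_N T g \<epsilon> N (\<lambda>y. f y + h y) = disc_op N \<epsilon> (\<lambda>y. f y + h y)"
proof
  define d where "d = 1 / (A * (\<bar>\<epsilon>\<bar> * A) + 1)"
  have A0: "0 \<le> A" using A(1) by simp
  hence p: "0 < A * (\<bar>\<epsilon>\<bar> * A) + 1" by (simp add: add_nonneg_pos)
  thus "d > 0" by (simp add: d_def)
  fix h assume h: "h \<in> F_N N" "Wnorm 1 h < d"
  have ch: "L1norm h < d" using cint_le_Wnorm[OF F_N_L1[OF h(1)], of 1] h(2) by linarith
  have "S1 \<epsilon> (\<lambda>y. f y + h y) y \<noteq> 0" for y
  proof -
    have "S1 \<epsilon> (\<lambda>y. f y + h y) y = S1 \<epsilon> f y + T1 y * (\<epsilon> * Gd 1 h (T y))"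
      using Gd_lin[of 1 f h 1 1 "T y"] F_N_integrable[OF f] F_N_integrable[OF h(1)]
      by (simp add: S1_def algebra_simps)
    moreover have "\<bar>T1 y * (\<epsilon> * Gd 1 h (T y))\<bar> \<le> A * (\<bar>\<epsilon>\<bar> * (A * L1norm h))"
      unfolding abs_mult using A(3)[of y] Gd_bound[of 1 h "T y"] F_N_integrable[OF h(1)]
      by (intro mult_mono mult_left_mono) (auto simp: A0 intro!: mult_nonneg_nonneg cint_nonneg)
    moreover have "A * (\<bar>\<epsilon>\<bar> * (A * L1norm h)) < 1"
    proof -
      have "A * (\<bar>\<epsilon>\<bar> * (A * L1norm h)) = (A * (\<bar>\<epsilon>\<bar> * A)) * L1norm h" by simp
      also have "\<dots> \<le> (A * (\<bar>\<epsilon>\<bar> * A)) * d" using ch A0 by (intro mult_left_mono) auto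
      also have "\<dots> < 1" using p by (simp add: d_def)
      finally show ?thesis .
    qed
    ultimately show ?thesis using e[of y] by linarith
  qed
  thus "sc_transfer_N T g \<epsilon> N (\<lambda>y. f y + h y) = disc_op N \<epsilon> (\<lambda>y. f y + h y)"
    by (intro sc_transfer_eq_disc_op N F_N_add f h)
qed

lemma disc_deriv_bounded:
  assumes N: "0 < N" and f: "f \<in> F_N N" and h: "h \<in> F_N N"
  shows "Wnorm 1 (disc_deriv N \<epsilon> f h) \<le> 2 * (kernel_bound N * (1 + \<bar>\<epsilon>\<bar> * A * L1norm f)) * Wnorm 1 h"
proof -
  note K = fejer_F_N[OF N] F_N_deriv(2)[OF fejer_F_N[OF N]]
  note c = F_N_cont[OF f(1)] F_N_cont[OF h]
  have D: "disc_deriv N \<epsilon> f h \<in> F_N N" by (rule disc_deriv_F_N[OF N f h])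
  let ?H = "L1norm h"
  have "Wnorm 1 (disc_deriv N \<epsilon> f h) \<le> 2 * (kernel_bound N * (1 + \<bar>\<epsilon>\<bar> * A * L1norm f) * ?H)"
    using kernel_deriv_bound[OF K(1) c kernel_bound(2,3)[OF N]] kernel_deriv_bound[OF K(2) c kernel_bound(3,4)[OF N]] kernel_deriv_F_N(2)[OF K(1) c]
    by (intro Wnorm1_sup[OF D]) (simp_all add: disc_deriv_def)
  also have "\<dots> = 2 * (kernel_bound N * (1 + \<bar>\<epsilon>\<bar> * A * L1norm f)) * ?H" by simp
  also have "\<dots> \<le> 2 * (kernel_bound N * (1 + \<bar>\<epsilon>\<bar> * A * L1norm f)) * Wnorm 1 h"
    using kernel_bound(1)[OF N] A(1)
    by (intro mult_left_mono cint_le_Wnorm F_N_L1[OF h] mult_nonneg_nonneg add_nonneg_nonneg cint_nonneg) auto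
  finally show ?thesis .
qed

lemma frechet_disc_deriv:
  assumes N: "0 < N" and f: "f \<in> F_N N" "L1norm f \<le> 1" and e: "\<And>y. 1 \<le> \<bar>S1 \<epsilon> f y\<bar>"
  shows "has_frechet_on_F N (sc_transfer_N T g \<epsilon> N) f (disc_deriv N \<epsilon> f)"
  unfolding has_frechet_on_F_def
proof (intro conjI ballI allI impI)
  show "disc_deriv N \<epsilon> f h \<in> F_N N" if "h \<in> F_N N" for h by (rule disc_deriv_F_N[OF N f(1) that])
  show "disc_deriv N \<epsilon> f (\<lambda>x. a * h x + b * k x) = (\<lambda>x. a * disc_deriv N \<epsilon> f h x + b * disc_deriv N \<epsilon> f k x)"
    if "h \<in> F_N N" "k \<in> F_N N" for h k a b by (rule disc_deriv_lin[OF N f(1) that])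
  show "\<exists>B. \<forall>h\<in>F_N N. Wnorm 1 (disc_deriv N \<epsilon> f h) \<le> B * Wnorm 1 h" using disc_deriv_bounded[OF N f(1)] by blast
  fix \<eta> :: real assume \<eta>: "\<eta> > 0"
  have nz: "S1 \<epsilon> f y \<noteq> 0" for y using e[of y] by auto
  obtain d where d: "d > 0" "\<And>h. h \<in> F_N N \<Longrightarrow> Wnorm 1 h < d \<Longrightarrow> sc_transfer_N T g \<epsilon> N (\<lambda>y. f y + h y) = disc_op N \<epsilon> (\<lambda>y. f y + h y)"
    using sc_transfer_eq_disc_op_near[OF N f(1) e] by metis
  have q: "0 < quad_const N \<epsilon> + 1" using lip_quad_nonneg(2)[OF N, of \<epsilon>] by linarith
  show "\<exists>d>0. \<forall>h\<in>F_N N. Wnorm 1 h < d \<longrightarrow>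
      Wnorm 1 (\<lambda>x. sc_transfer_N T g \<epsilon> N (\<lambda>y. f y + h y) x - sc_transfer_N T g \<epsilon> N f x - disc_deriv N \<epsilon> f h x) \<le> \<eta> * Wnorm 1 h"
  proof (intro exI[of _ "min d (\<eta> / (quad_const N \<epsilon> + 1))"] conjI ballI impI)
    show "0 < min d (\<eta> / (quad_const N \<epsilon> + 1))" using d \<eta> q by simp
    fix h assume h: "h \<in> F_N N" "Wnorm 1 h < min d (\<eta> / (quad_const N \<epsilon> + 1))"
    have "Wnorm 1 (\<lambda>x. sc_transfer_N T g \<epsilon> N (\<lambda>y. f y + h y) x - sc_transfer_N T g \<epsilon> N f x - disc_deriv N \<epsilon> f h x) \<le> quad_const N \<epsilon> * (Wnorm 1 h)\<^sup>2"
      using disc_op_remainder[OF N f h(1)] d(2)[OF h(1)] h(2) sc_transfer_eq_disc_op[OF N f(1) nz] by simp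
    also have "\<dots> = (quad_const N \<epsilon> * Wnorm 1 h) * Wnorm 1 h" by (simp add: power2_eq_square)
    also have "\<dots> \<le> \<eta> * Wnorm 1 h"
    proof (intro mult_right_mono Wnorm_nonneg)
      have "quad_const N \<epsilon> * Wnorm 1 h \<le> (quad_const N \<epsilon> + 1) * (\<eta> / (quad_const N \<epsilon> + 1))"
        using h(2) q Wnorm_nonneg[of 1 h] by (intro mult_mono) auto
      thus "quad_const N \<epsilon> * Wnorm 1 h \<le> \<eta>" using q by simp
    qed
    finally show "Wnorm 1 (\<lambda>x. sc_transfer_N T g \<epsilon> N (\<lambda>y. f y + h y) x - sc_transfer_N T g \<epsilon> N f x - disc_deriv N \<epsilon> f h x) \<le> \<eta> * Wnorm 1 h" .
  qed
qed

lemma D_sc_transfer_eq: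
  assumes N: "0 < N" and f: "f \<in> F_N N" "L1norm f \<le> 1" and e: "\<And>y. 1 \<le> \<bar>S1 \<epsilon> f y\<bar>" and h: "h \<in> F_N N"
  shows "D_sc T g \<epsilon> N f h = disc_deriv N \<epsilon> f h"
proof -
  let ?\<Phi> = "sc_transfer_N T g \<epsilon> N" and ?D = "D_sc T g \<epsilon> N f" and ?E = "disc_deriv N \<epsilon> f" and ?n = "Wnorm 1 h"
  note FE = frechet_disc_deriv[OF N f e]
  have FD: "has_frechet_on_F N ?\<Phi> f ?D" unfolding D_sc_def by (rule someI[of "has_frechet_on_F N ?\<Phi> f", OF FE])
  have nz: "S1 \<epsilon> f y \<noteq> 0" for y using e[of y] by auto
  have DF: "?D h \<in> F_N N" "?E h \<in> F_N N" using FD FE h unfolding has_frechet_on_F_def by blast+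
  have sc: "?D (\<lambda>x. a * h x) = (\<lambda>x. a * ?D h x)" "?E (\<lambda>x. a * h x) = (\<lambda>x. a * ?E h x)" for a
  proof -
    have "?D (\<lambda>x. a * h x + 0 * h x) = (\<lambda>x. a * ?D h x + 0 * ?D h x)" using FD h unfolding has_frechet_on_F_def by blast
    thus "?D (\<lambda>x. a * h x) = (\<lambda>x. a * ?D h x)" by simp
    have "?E (\<lambda>x. a * h x + 0 * h x) = (\<lambda>x. a * ?E h x + 0 * ?E h x)" using FE h unfolding has_frechet_on_F_def by blast
    thus "?E (\<lambda>x. a * h x) = (\<lambda>x. a * ?E h x)" by simp
  qed
  obtain d where d: "d > 0" "\<And>h. h \<in> F_N N \<Longrightarrow> Wnorm 1 h < d \<Longrightarrow> ?\<Phi> (\<lambda>y. f y + h y) = disc_op N \<epsilon> (\<lambda>y. f y + h y)"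
    using sc_transfer_eq_disc_op_near[OF N f(1) e] by metis
  have le: "Wnorm 1 (\<lambda>x. ?D h x - ?E h x) \<le> 2 * \<eta> * ?n" if \<eta>: "\<eta> > 0" for \<eta>
  proof -
    obtain d1 where d1: "d1 > 0" "\<And>h. h \<in> F_N N \<Longrightarrow> Wnorm 1 h < d1 \<Longrightarrow>
        Wnorm 1 (\<lambda>x. ?\<Phi> (\<lambda>y. f y + h y) x - ?\<Phi> f x - ?D h x) \<le> \<eta> * Wnorm 1 h"
      using FD \<eta> unfolding has_frechet_on_F_def by meson
    obtain d2 where d2: "d2 > 0" "\<And>h. h \<in> F_N N \<Longrightarrow> Wnorm 1 h < d2 \<Longrightarrow>
        Wnorm 1 (\<lambda>x. ?\<Phi> (\<lambda>y. f y + h y) x - ?\<Phi> f x - ?E h x) \<le> \<eta> * Wnorm 1 h"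
      using FE \<eta> unfolding has_frechet_on_F_def by meson
    define m where "m = min d (min d1 d2)"
    define t where "t = m / (2 * (?n + 1))"
    have n0: "?n \<ge> 0" by (rule Wnorm_nonneg)
    have m: "m > 0" using d d1 d2 by (simp add: m_def)
    have t: "t > 0" using m n0 by (simp add: t_def)
    let ?k = "\<lambda>x. t * h x"
    have k: "?k \<in> F_N N" by (rule F_N_scale[OF h])
    have nk: "Wnorm 1 ?k = t * ?n" using Wnorm_scale[OF h, of t] t by simp
    have "t * ?n < m"
    proof -
      have "t * ?n \<le> t * (?n + 1)" using t by simp
      also have "\<dots> = m / 2" using n0 by (simp add: t_def field_simps add_nonneg_eq_0_iff)
      also have "\<dots> < m" using m by simp
      finally show ?thesis .
    qed
    hence sm: "Wnorm 1 ?k < d" "Wnorm 1 ?k < d1" "Wnorm 1 ?k < d2" by (auto simp: nk m_def)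
    have P: "?\<Phi> (\<lambda>y. f y + ?k y) \<in> F_N N" "?\<Phi> f \<in> F_N N"
      using d(2)[OF k sm(1)] disc_op_F_N[OF N F_N_add[OF f(1) k]] sc_transfer_eq_disc_op[OF N f(1) nz] disc_op_F_N[OF N f(1)] by simp_all
    have kD: "?D ?k \<in> F_N N" "?E ?k \<in> F_N N" unfolding sc using DF by (auto intro: F_N_scale)
    let ?r1 = "\<lambda>x. ?\<Phi> (\<lambda>y. f y + ?k y) x - ?\<Phi> f x - ?D ?k x" and ?r2 = "\<lambda>x. ?\<Phi> (\<lambda>y. f y + ?k y) x - ?\<Phi> f x - ?E ?k x"
    have r: "?r1 \<in> F_N N" "?r2 \<in> F_N N" by (intro F_N_diff P kD)+
    have "t * Wnorm 1 (\<lambda>x. ?D h x - ?E h x) = Wnorm 1 (\<lambda>x. t * (?D h x - ?E h x))"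
      using Wnorm_scale[OF F_N_diff[OF DF], of t] t by simp
    also have "(\<lambda>x. t * (?D h x - ?E h x)) = (\<lambda>x. ?r2 x - ?r1 x)"
      unfolding sc by (auto simp: algebra_simps)
    also have "Wnorm 1 \<dots> \<le> Wnorm 1 ?r2 + Wnorm 1 ?r1" by (rule Wnorm_diff[OF r(2,1)])
    also have "\<dots> \<le> \<eta> * Wnorm 1 ?k + \<eta> * Wnorm 1 ?k" by (intro add_mono d1(2) d2(2) k sm)
    also have "\<dots> = t * (2 * \<eta> * ?n)" by (simp add: nk)
    finally show ?thesis using t by simp
  qed
  have "Wnorm 1 (\<lambda>x. ?D h x - ?E h x) \<le> 0"
  proof (rule field_le_epsilon)
    fix c :: real assume c: "c > 0"
    have n0: "?n \<ge> 0" by (rule Wnorm_nonneg)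
    have "Wnorm 1 (\<lambda>x. ?D h x - ?E h x) \<le> 2 * (c / (2 * (?n + 1))) * ?n" using c n0 by (intro le) simp
    also have "\<dots> \<le> c" using c n0 by (simp add: field_simps)
    finally show "Wnorm 1 (\<lambda>x. ?D h x - ?E h x) \<le> 0 + c" by simp
  qed
  from Wnorm_zero[OF F_N_diff[OF DF] this] show ?thesis by (auto simp: fun_eq_iff)
qed

text \<open>On the finite-dimensional space \<open>V_N\<close> injectivity of \<open>I - D\<^sub>f\<close> suffices.\<close>

lemma newton_defined:
  assumes N: "0 < N" and f: "f \<in> F_N N" "L1norm f \<le> 1" and e: "\<And>y. 1 \<le> \<bar>S1 \<epsilon> f y\<bar>"
    and inj: "\<And>h. h \<in> V_N N \<Longrightarrow> (\<lambda>x. h x - disc_deriv N \<epsilon> f h x) = (\<lambda>x. 0) \<Longrightarrow> h = (\<lambda>x. 0)"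
  shows "newton_defined_at T g \<epsilon> N f"
    and "v \<in> V_N N \<Longrightarrow> inv_I_minus_D T g \<epsilon> N f v \<in> V_N N"
    and "v \<in> V_N N \<Longrightarrow> v = (\<lambda>x. inv_I_minus_D T g \<epsilon> N f v x - disc_deriv N \<epsilon> f (inv_I_minus_D T g \<epsilon> N f v) x)"
    and "h \<in> V_N N \<Longrightarrow> inv_I_minus_D T g \<epsilon> N f (\<lambda>x. h x - disc_deriv N \<epsilon> f h x) = h"
proof -
  have V_N_F_N: "h \<in> F_N N" if "h \<in> V_N N" for h using that by (simp add: V_N_iff)
  have IM: "I_minus_D T g \<epsilon> N f h = (\<lambda>x. h x - disc_deriv N \<epsilon> f h x)" if "h \<in> V_N N" for h
    using D_sc_transfer_eq[OF N f e V_N_F_N[OF that]] by (simp add: I_minus_D_def)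
  have bij: "bij_betw (I_minus_D T g \<epsilon> N f) (V_N N) (V_N N)"
  proof (rule V_N_injective_surjective)
    show "I_minus_D T g \<epsilon> N f h \<in> V_N N" if h: "h \<in> V_N N" for h
      unfolding IM[OF h] V_N_iff
      using F_N_diff[OF V_N_F_N[OF h] disc_deriv_F_N[OF N f(1) V_N_F_N[OF h]]] h cint_disc_deriv[OF N f(1) V_N_F_N[OF h]]
        F_N_integrable[OF V_N_F_N[OF h]] F_N_integrable[OF disc_deriv_F_N[OF N f(1) V_N_F_N[OF h]]]
      by (auto simp: cint_diff V_N_iff)
    show "I_minus_D T g \<epsilon> N f (\<lambda>x. a * h x + b * k x) = (\<lambda>x. a * I_minus_D T g \<epsilon> N f h x + b * I_minus_D T g \<epsilon> N f k x)"
      if "h \<in> V_N N" "k \<in> V_N N" for a b h k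
      unfolding IM[OF that(1)] IM[OF that(2)] IM[OF V_N_lin[OF that]] disc_deriv_lin[OF N f(1) V_N_F_N[OF that(1)] V_N_F_N[OF that(2)]]
      by (auto simp: algebra_simps)
    show "h = (\<lambda>x. 0)" if "h \<in> V_N N" "I_minus_D T g \<epsilon> N f h = (\<lambda>x. 0)" for h
      using inj[OF that(1)] that IM by simp
  qed
  show "newton_defined_at T g \<epsilon> N f"
    unfolding newton_defined_at_def using frechet_disc_deriv[OF N f e] bij by blast
  show iv: "inv_I_minus_D T g \<epsilon> N f v \<in> V_N N" if "v \<in> V_N N" for v
    unfolding inv_I_minus_D_def using bij that by (intro inv_into_into) (simp add: bij_betw_def)
  show "v = (\<lambda>x. inv_I_minus_D T g \<epsilon> N f v x - disc_deriv N \<epsilon> f (inv_I_minus_D T g \<epsilon> N f v) x)" if v: "v \<in> V_N N"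
  proof -
    have "I_minus_D T g \<epsilon> N f (inv_I_minus_D T g \<epsilon> N f v) = v"
      unfolding inv_I_minus_D_def
      by (rule f_inv_into_f[of v "I_minus_D T g \<epsilon> N f" "V_N N"]) (use bij v in \<open>simp add: bij_betw_def\<close>)
    thus ?thesis using IM[OF iv[OF v]] by simp
  qed
  show "inv_I_minus_D T g \<epsilon> N f (\<lambda>x. h x - disc_deriv N \<epsilon> f h x) = h" if h: "h \<in> V_N N"
    unfolding IM[OF h, symmetric] inv_I_minus_D_def using bij h by (intro inv_into_f_f) (auto simp: bij_betw_def)
qed

definition map_bound :: "real \<Rightarrow> real" where
  "map_bound E = A * (1 + E * A) + 3 * A\<^sup>2 * (E * A) + A ^ 3 * (E * A)"

lemma map_derivs_bound:
  assumes f: "continuous_on UNIV f" "L1norm f \<le> 1" and E: "\<bar>\<epsilon>\<bar> \<le> E"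
  shows "\<bar>S1 \<epsilon> f y\<bar> \<le> map_bound E" "\<bar>S2 \<epsilon> f y\<bar> \<le> map_bound E" "\<bar>S3 \<epsilon> f y\<bar> \<le> map_bound E" "1 \<le> map_bound E"
proof -
  have A0: "0 \<le> A" "1 \<le> A" using A(1) by auto
  have E0: "0 \<le> E" using E by linarith
  have G: "\<bar>\<epsilon> * Gd j f (T y)\<bar> \<le> E * A" if "j \<le> 3" for j
  proof -
    have "\<bar>Gd j f (T y)\<bar> \<le> A * L1norm f" by (rule Gd_bound[OF that integrable_circ_cont[OF f(1)]])
    also have "\<dots> \<le> A" using f(2) A0 by (simp add: mult_left_le)
    finally show ?thesis unfolding abs_mult using E E0 by (intro mult_mono) auto
  qed
  have 1: "\<bar>1 + \<epsilon> * Gd 1 f (T y)\<bar> \<le> 1 + E * A" using G[of 1] by (simp add: abs_le_iff)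
  have p: "0 \<le> E * A" using E0 A0 by simp
  have t: "\<bar>(T1 y)\<^sup>2\<bar> \<le> A\<^sup>2" "\<bar>T1 y * T2 y\<bar> \<le> A\<^sup>2" "\<bar>(T1 y) ^ 3\<bar> \<le> A ^ 3"
  proof -
    show "\<bar>(T1 y)\<^sup>2\<bar> \<le> A\<^sup>2" "\<bar>(T1 y) ^ 3\<bar> \<le> A ^ 3"
      unfolding power_abs using A(3)[of y] by (intro power_mono; simp)+
    show "\<bar>T1 y * T2 y\<bar> \<le> A\<^sup>2"
      unfolding abs_mult power2_eq_square using A(3,4)[of y] A0 by (intro mult_mono) auto
  qed
  have a1: "\<bar>R * (1 + \<epsilon> * Gd 1 f (T y))\<bar> \<le> A * (1 + E * A)" if "\<bar>R\<bar> \<le> A" for R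
    unfolding abs_mult using that 1 A0 by (intro mult_mono) auto
  have a2: "\<bar>(T1 y)\<^sup>2 * (\<epsilon> * Gd 2 f (T y))\<bar> \<le> A\<^sup>2 * (E * A)"
    unfolding abs_mult[of "(T1 y)\<^sup>2"] using t(1) G[of 2] by (intro mult_mono) auto
  have a3: "\<bar>3 * (T1 y * T2 y) * (\<epsilon> * Gd 2 f (T y))\<bar> \<le> 3 * A\<^sup>2 * (E * A)"
    unfolding abs_mult[of "3 * (T1 y * T2 y)"] using t(2) G[of 2] by (intro mult_mono) auto
  have a4: "\<bar>(T1 y) ^ 3 * (\<epsilon> * Gd 3 f (T y))\<bar> \<le> A ^ 3 * (E * A)"
    unfolding abs_mult[of "(T1 y) ^ 3"] using t(3) G[of 3] A0 by (intro mult_mono) auto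
  have q: "0 \<le> A\<^sup>2 * (E * A)" "0 \<le> A ^ 3 * (E * A)" using p A0 by simp_all
  show "\<bar>S1 \<epsilon> f y\<bar> \<le> map_bound E" unfolding S1_def map_bound_def using a1[OF A(3)[of y]] q by linarith
  show "\<bar>S2 \<epsilon> f y\<bar> \<le> map_bound E" unfolding S2_def map_bound_def using a1[OF A(4)[of y]] a2 q by linarith
  show "\<bar>S3 \<epsilon> f y\<bar> \<le> map_bound E" unfolding S3_def map_bound_def using a1[OF A(5)[of y]] a3 a4 q by linarith
  have "1 * 1 \<le> A * (1 + E * A)" using A0 p by (intro mult_mono) auto
  thus "1 \<le> map_bound E" unfolding map_bound_def using q by linarith
qed

end

text \<open>Two integrations by parts along an expanding map replace \<open>p\<close> by \<open>r1\<close> and then by \<open>r2\<close>, where \<open>r1 = (p / S')'\<close> and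
  \<open>r2 = (r1 / S')'\<close>. The derivatives of \<open>p\<close> up to order two and bounds on the first two derivatives of \<open>S'\<close> control them.\<close>

lemma quotient_derivs:
  fixes p p1 p2 s s1 s2 :: "real \<Rightarrow> real"
  assumes p: "\<And>y. (p has_real_derivative p1 y) (at y)" "\<And>y. (p1 has_real_derivative p2 y) (at y)"
    and s: "\<And>y. (s has_real_derivative s1 y) (at y)" "\<And>y. (s1 has_real_derivative s2 y) (at y)"
    and s_ge: "\<And>y. 1 \<le> \<bar>s y\<bar>" and M: "\<And>y. \<bar>s1 y\<bar> \<le> M" "\<And>y. \<bar>s2 y\<bar> \<le> M" "1 \<le> M"
    and cont: "continuous_on UNIV p2" "continuous_on UNIV s2"
  obtains r1 r2 where "\<And>y. ((\<lambda>y. p y / s y) has_real_derivative r1 y) (at y)" "\<And>y. ((\<lambda>y. r1 y / s y) has_real_derivative r2 y) (at y)"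
    "continuous_on UNIV r1" "continuous_on UNIV r2" "\<And>y. \<bar>r1 y\<bar> + \<bar>r2 y\<bar> \<le> 5 * M\<^sup>2 * (\<bar>p y\<bar> + \<bar>p1 y\<bar> + \<bar>p2 y\<bar>)"
proof -
  have nz: "s y \<noteq> 0" for y using s_ge[of y] by auto
  define n where "n y = p1 y * s y - p y * s1 y" for y
  define r1 where "r1 y = n y / (s y * s y)" for y
  define r1' where "r1' y = ((p2 y * s y - p y * s2 y) * (s y * s y) - n y * (s1 y * s y + s1 y * s y)) / ((s y * s y) * (s y * s y))" for y
  define r2 where "r2 y = (r1' y * s y - r1 y * s1 y) / (s y * s y)" for y
  have d1: "((\<lambda>y. p y / s y) has_real_derivative r1 y) (at y)" for y
    unfolding r1_def n_def by (rule DERIV_divide[OF p(1) s(1) nz])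
  have dn: "(n has_real_derivative (p2 y * s y - p y * s2 y)) (at y)" for y
    using DERIV_diff[OF DERIV_mult[OF p(2)[of y] s(1)[of y]] DERIV_mult[OF p(1)[of y] s(2)[of y]]]
    unfolding n_def[abs_def] by (simp add: algebra_simps)
  have dss: "((\<lambda>y. s y * s y) has_real_derivative s1 y * s y + s1 y * s y) (at y)" for y
    by (rule DERIV_mult[OF s(1) s(1)])
  have dr1: "(r1 has_real_derivative r1' y) (at y)" for y
  proof -
    have "s y * s y \<noteq> 0" using nz by simp
    from DERIV_divide[OF dn dss this] show ?thesis unfolding r1_def[abs_def] r1'_def .
  qed
  have d2: "((\<lambda>y. r1 y / s y) has_real_derivative r2 y) (at y)" for y
    unfolding r2_def by (rule DERIV_divide[OF dr1 s(1) nz])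
  have c: "continuous_on UNIV p" "continuous_on UNIV p1" "continuous_on UNIV s" "continuous_on UNIV s1" "continuous_on UNIV n"
    using p s dn by (meson DERIV_isCont continuous_at_imp_continuous_on)+
  have cr1: "continuous_on UNIV r1" by (rule deriv_imp_cont[OF dr1])
  have cr1': "continuous_on UNIV r1'" unfolding r1'_def by (intro continuous_intros c cont) (auto simp: nz)
  have cr2: "continuous_on UNIV r2" unfolding r2_def by (intro continuous_intros c cr1 cr1') (auto simp: nz)
  have dv: "\<bar>x / s y\<bar> \<le> \<bar>x\<bar>" for x y
    using s_ge[of y] nz[of y] by (simp add: abs_divide divide_le_eq mult_le_cancel_left1)
  have le: "\<bar>r1 y\<bar> + \<bar>r2 y\<bar> \<le> 5 * M\<^sup>2 * (\<bar>p y\<bar> + \<bar>p1 y\<bar> + \<bar>p2 y\<bar>)" for y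
  proof -
    have M0: "0 \<le> M" using M(3) by simp
    have e1: "r1 y = p1 y / s y - (p y * s1 y) / s y / s y" using nz[of y] by (simp add: r1_def n_def field_simps)
    have ps: "\<bar>p y * s1 y\<bar> \<le> M * \<bar>p y\<bar>" "\<bar>p y * s2 y\<bar> \<le> M * \<bar>p y\<bar>"
      unfolding abs_mult mult.commute[of "\<bar>p y\<bar>"] using M(1,2)[of y] by (intro mult_right_mono; simp)+
    have b1: "\<bar>r1 y\<bar> \<le> \<bar>p1 y\<bar> + M * \<bar>p y\<bar>"
      unfolding e1 by (rule order_trans[OF abs_triangle_ineq4])
        (rule add_mono[OF dv order_trans[OF dv order_trans[OF dv ps(1)]]])
    have e2: "r1' y = p2 y / s y - (p y * s2 y) / s y / s y - 2 * (r1 y * s1 y / s y)"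
      using nz[of y] by (simp add: r1'_def r1_def field_simps)
    have rs: "\<bar>r1 y * s1 y\<bar> \<le> M * \<bar>r1 y\<bar>"
      unfolding abs_mult mult.commute[of "\<bar>r1 y\<bar>"] using M(1)[of y] by (intro mult_right_mono; simp)
    have b2: "\<bar>r1' y\<bar> \<le> \<bar>p2 y\<bar> + M * \<bar>p y\<bar> + 2 * (M * \<bar>r1 y\<bar>)"
    proof -
      have "\<bar>2 * (r1 y * s1 y / s y)\<bar> \<le> 2 * (M * \<bar>r1 y\<bar>)"
        unfolding abs_mult[of 2] using order_trans[OF dv rs, of y] by simp
      from add_mono[OF order_trans[OF abs_triangle_ineq4 add_mono[OF dv order_trans[OF dv order_trans[OF dv ps(2)]]]] this]
      show ?thesis unfolding e2 by (rule order_trans[OF abs_triangle_ineq4])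
    qed
    have e3: "r2 y = r1' y / s y - (r1 y * s1 y) / s y / s y" using nz[of y] by (simp add: r2_def field_simps)
    have b3: "\<bar>r2 y\<bar> \<le> \<bar>r1' y\<bar> + M * \<bar>r1 y\<bar>"
      unfolding e3 by (rule order_trans[OF abs_triangle_ineq4])
        (rule add_mono[OF dv order_trans[OF dv order_trans[OF dv rs]]])
    have "\<bar>r1 y\<bar> + \<bar>r2 y\<bar> \<le> (1 + 3 * M) * \<bar>r1 y\<bar> + \<bar>p2 y\<bar> + M * \<bar>p y\<bar>" using b2 b3 by (simp add: algebra_simps)
    also have "\<dots> \<le> (1 + 3 * M) * (\<bar>p1 y\<bar> + M * \<bar>p y\<bar>) + \<bar>p2 y\<bar> + M * \<bar>p y\<bar>"
      using b1 M0 by (intro add_right_mono mult_left_mono) auto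
    also have "\<dots> = (2 * M + 3 * M\<^sup>2) * \<bar>p y\<bar> + (1 + 3 * M) * \<bar>p1 y\<bar> + \<bar>p2 y\<bar>" by (simp add: algebra_simps power2_eq_square)
    also have "\<dots> \<le> (5 * M\<^sup>2) * \<bar>p y\<bar> + (5 * M\<^sup>2) * \<bar>p1 y\<bar> + (5 * M\<^sup>2) * \<bar>p2 y\<bar>"
    proof -
      have mm: "M \<le> M\<^sup>2" "1 \<le> M\<^sup>2" using M(3) by (auto simp: power2_eq_square mult_le_cancel_left1 intro: order_trans)
      have "1 * \<bar>p2 y\<bar> \<le> (5 * M\<^sup>2) * \<bar>p2 y\<bar>" using mm by (intro mult_right_mono) auto
      thus ?thesis using mm by (intro add_mono mult_right_mono) auto
    qed
    finally show ?thesis by (simp add: algebra_simps)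
  qed
  show ?thesis by (rule that[OF d1 d2 cr1 cr2 le])
qed

context coupled_map begin

lemma observable_derivs:
  assumes h: "h \<in> F_N N"
  obtains b1 b2 where "\<And>y. ((\<lambda>y. Gd 0 h (T y)) has_real_derivative b1 y) (at y)" "\<And>y. (b1 has_real_derivative b2 y) (at y)"
    "continuous_on UNIV b2" "\<And>y. \<bar>Gd 0 h (T y)\<bar> \<le> A ^ 3 * L1norm h"
    "\<And>y. \<bar>b1 y\<bar> \<le> A ^ 3 * L1norm h" "\<And>y. \<bar>b2 y\<bar> \<le> 2 * (A ^ 3 * L1norm h)"
proof -
  note ch = F_N_cont[OF h]
  define H where "H = L1norm h"
  have H0: "0 \<le> H" unfolding H_def by (rule cint_nonneg) simp
  have A1: "1 \<le> A" "0 \<le> A" using A(1) by auto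
  define b where "b y = Gd 0 h (T y)" for y
  define b1 where "b1 y = Gd 1 h (T y) * T1 y" for y
  define b2 where "b2 y = Gd 2 h (T y) * T1 y * T1 y + Gd 1 h (T y) * T2 y" for y
  have db: "(b has_real_derivative b1 y) (at y)" for y
    using Gd_T_deriv[of 0 h y] ch by (simp add: b_def[abs_def] b1_def One_nat_def)
  have db1: "(b1 has_real_derivative b2 y) (at y)" for y
  proof -
    have "((\<lambda>y. Gd 1 h (T y)) has_real_derivative Gd 2 h (T y) * T1 y) (at y)"
      using Gd_T_deriv[of 1 h y] ch by (simp add: numeral_2_eq_2 One_nat_def)
    from DERIV_mult[OF this T_deriv(2)[of y]] show ?thesis unfolding b1_def[abs_def] b2_def by (simp add: algebra_simps)
  qed
  have G: "\<bar>Gd j h z\<bar> \<le> A * H" if "j \<le> 3" for j z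
    unfolding H_def by (rule Gd_bound[OF that integrable_circ_cont[OF ch]])
  have AH: "0 \<le> A * H" using A1 H0 by simp
  have bb: "\<bar>b y\<bar> \<le> A ^ 3 * H" "\<bar>b1 y\<bar> \<le> A ^ 3 * H" "\<bar>b2 y\<bar> \<le> 2 * (A ^ 3 * H)" for y
  proof -
    have A3: "A \<le> A ^ 3" "A\<^sup>2 \<le> A ^ 3" using A1 by (auto simp: power_increasing intro: self_le_power)
    have "\<bar>b y\<bar> \<le> A * H" unfolding b_def by (rule G) simp
    also have "\<dots> \<le> A ^ 3 * H" using A3 H0 by (intro mult_right_mono)
    finally show "\<bar>b y\<bar> \<le> A ^ 3 * H" .
    have "\<bar>b1 y\<bar> \<le> (A * H) * A" unfolding b1_def abs_mult using G[of 1 "T y"] A(3)[of y] AH by (intro mult_mono) auto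
    also have "\<dots> = A\<^sup>2 * H" by (simp add: power2_eq_square)
    also have "\<dots> \<le> A ^ 3 * H" using A3 H0 by (intro mult_right_mono)
    finally show "\<bar>b1 y\<bar> \<le> A ^ 3 * H" .
    have "\<bar>Gd 2 h (T y) * T1 y * T1 y\<bar> \<le> (A * H) * A * A"
      unfolding abs_mult using G[of 2 "T y"] A(3)[of y] AH A1 by (intro mult_mono) auto
    moreover have "\<bar>Gd 1 h (T y) * T2 y\<bar> \<le> (A * H) * A" unfolding abs_mult using G[of 1 "T y"] A(4)[of y] AH by (intro mult_mono) auto
    moreover have "(A * H) * A * A = A ^ 3 * H" "(A * H) * A = A\<^sup>2 * H" by (simp_all add: power2_eq_square power3_eq_cube)
    moreover have "A\<^sup>2 * H \<le> A ^ 3 * H" using A3 H0 by (intro mult_right_mono)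
    ultimately show "\<bar>b2 y\<bar> \<le> 2 * (A ^ 3 * H)" unfolding b2_def by linarith
  qed
  have cb2: "continuous_on UNIV b2" unfolding b2_def
    by (intro continuous_intros T_cont continuous_on_compose2[OF Gd_cont[OF _ ch] T_cont(1)]) auto
  show ?thesis by (rule that[OF db[unfolded b_def[abs_def]] db1 cb2 bb(1)[unfolded b_def H_def] bb(2,3)[unfolded H_def]])
qed

text \<open>The coupling term of \<open>D\<^sub>f\<close> carries \<open>K'\<close>, whose norm grows with \<open>N\<close>. Integrating by parts once for the function and
  twice for its derivative leaves \<open>K\<close>, at the price of two derivatives of \<open>(G h)(T y) f(y)\<close>. Those of \<open>G h\<close> cost only the
  \<open>L\<^sup>1\<close> norm of \<open>h\<close> because \<open>g\<close> is smooth, and those of \<open>f\<close> give its \<open>W\<^sup>2\<^sup>,\<^sup>1\<close> norm. The bound is uniform in \<open>N\<close>.\<close>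

lemma disc_deriv_transport_bound:
  assumes N: "0 < N" and f: "f \<in> F_N N" "L1norm f \<le> 1" and e: "\<And>y. 1 \<le> \<bar>S1 \<epsilon> f y\<bar>"
    and h: "h \<in> F_N N" and E: "\<bar>\<epsilon>\<bar> \<le> E"
  shows "Wnorm 1 (\<lambda>x. disc_deriv N \<epsilon> f h x - conv (fejer N) (S \<epsilon> f) h x)
    \<le> \<bar>\<epsilon>\<bar> * (20 * (map_bound E)\<^sup>2 * A ^ 3 * Wnorm 2 f) * L1norm h"
proof -
  define H where "H = L1norm h"
  have H0: "0 \<le> H" unfolding H_def by (rule cint_nonneg) simp
  have A1: "1 \<le> A" "0 \<le> A" using A(1) by auto
  note cf = F_N_cont[OF f(1)] and ch = F_N_cont[OF h]
  note f' = F_N_deriv(1)[OF f(1)] and f'' = F_N_deriv(1)[OF F_N_deriv(2)[OF f(1)]]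
  note cf' = F_N_cont[OF F_N_deriv(2)[OF f(1)]] and cf'' = F_N_cont[OF F_N_deriv(2)[OF F_N_deriv(2)[OF f(1)]]]
  define b where "b y = Gd 0 h (T y)" for y
  obtain b1 b2 where db: "\<And>y. (b has_real_derivative b1 y) (at y)" and db1: "\<And>y. (b1 has_real_derivative b2 y) (at y)"
    and cb2: "continuous_on UNIV b2" and bb: "\<And>y. \<bar>b y\<bar> \<le> A ^ 3 * H" "\<And>y. \<bar>b1 y\<bar> \<le> A ^ 3 * H" "\<And>y. \<bar>b2 y\<bar> \<le> 2 * (A ^ 3 * H)"
    by (rule observable_derivs[OF h, folded b_def H_def], rule that; assumption)
  define p where "p y = b y * f y" for y
  define p1 where "p1 y = b1 y * f y + deriv f y * b y" for y
  define p2 where "p2 y = (b2 y * f y + deriv f y * b1 y) + (deriv (deriv f) y * b y + b1 y * deriv f y)" for y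
  have dp: "(p has_real_derivative p1 y) (at y)" for y unfolding p_def p1_def by (rule DERIV_mult[OF db f'])
  have dp1: "(p1 has_real_derivative p2 y) (at y)" for y unfolding p1_def p2_def
    by (rule DERIV_add[OF DERIV_mult[OF db1 f'] DERIV_mult[OF f'' db]])
  have cb: "continuous_on UNIV b" "continuous_on UNIV b1" using db db1 by (meson DERIV_isCont continuous_at_imp_continuous_on)+
  have cp: "continuous_on UNIV p" by (rule deriv_imp_cont[OF dp])
  have cp2: "continuous_on UNIV p2" unfolding p2_def by (intro continuous_intros cb cb2 cf cf' cf'')
  have c1: "continuous_on UNIV p1" by (rule deriv_imp_cont[OF dp1])
  have sum: "\<bar>p y\<bar> + \<bar>p1 y\<bar> + \<bar>p2 y\<bar> \<le> 4 * (A ^ 3 * H) * (\<bar>f y\<bar> + \<bar>deriv f y\<bar> + \<bar>deriv (deriv f) y\<bar>)" for y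
  proof -
    define C where "C = A ^ 3 * H"
    note b = bb[of y, folded C_def]
    have C0: "0 \<le> C" using b(1) by linarith
    have m: "\<bar>b y * z\<bar> \<le> C * \<bar>z\<bar>" "\<bar>b1 y * z\<bar> \<le> C * \<bar>z\<bar>" "\<bar>b2 y * z\<bar> \<le> 2 * C * \<bar>z\<bar>" for z
      unfolding abs_mult using b by (intro mult_right_mono; simp)+
    have q: "0 \<le> C * \<bar>z\<bar>" for z using C0 by simp
    have "\<bar>p y\<bar> \<le> C * \<bar>f y\<bar>" "\<bar>p1 y\<bar> \<le> C * \<bar>f y\<bar> + C * \<bar>deriv f y\<bar>"
      "\<bar>p2 y\<bar> \<le> 2 * C * \<bar>f y\<bar> + 2 * (C * \<bar>deriv f y\<bar>) + C * \<bar>deriv (deriv f) y\<bar>"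
    proof -
      have comm: "deriv f y * b y = b y * deriv f y" "deriv f y * b1 y = b1 y * deriv f y"
        "deriv (deriv f) y * b y = b y * deriv (deriv f) y" by simp_all
      show "\<bar>p y\<bar> \<le> C * \<bar>f y\<bar>" unfolding p_def by (rule m(1))
      have "\<bar>p1 y\<bar> \<le> \<bar>b1 y * f y\<bar> + \<bar>b y * deriv f y\<bar>" unfolding p1_def comm by (rule abs_triangle_ineq)
      also have "\<dots> \<le> C * \<bar>f y\<bar> + C * \<bar>deriv f y\<bar>" by (intro add_mono m)
      finally show "\<bar>p1 y\<bar> \<le> C * \<bar>f y\<bar> + C * \<bar>deriv f y\<bar>" .
      have "\<bar>p2 y\<bar> \<le> (\<bar>b2 y * f y\<bar> + \<bar>b1 y * deriv f y\<bar>) + (\<bar>b y * deriv (deriv f) y\<bar> + \<bar>b1 y * deriv f y\<bar>)"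
        unfolding p2_def comm by (intro order_trans[OF abs_triangle_ineq] add_mono abs_triangle_ineq)
      also have "\<dots> \<le> (2 * C * \<bar>f y\<bar> + C * \<bar>deriv f y\<bar>) + (C * \<bar>deriv (deriv f) y\<bar> + C * \<bar>deriv f y\<bar>)"
        by (intro add_mono m)
      finally show "\<bar>p2 y\<bar> \<le> 2 * C * \<bar>f y\<bar> + 2 * (C * \<bar>deriv f y\<bar>) + C * \<bar>deriv (deriv f) y\<bar>" by simp
    qed
    moreover have "4 * (A ^ 3 * H) * (\<bar>f y\<bar> + \<bar>deriv f y\<bar> + \<bar>deriv (deriv f) y\<bar>)
      = 4 * (C * \<bar>f y\<bar>) + 4 * (C * \<bar>deriv f y\<bar>) + 4 * (C * \<bar>deriv (deriv f) y\<bar>)"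
      by (simp add: C_def algebra_simps)
    ultimately show ?thesis using q[of "f y"] q[of "deriv f y"] q[of "deriv (deriv f) y"] by linarith
  qed
  note M = map_derivs_bound[OF cf f(2) E]
  note sd = S_deriv[OF cf]
  have nz: "S1 \<epsilon> f y \<noteq> 0" for y using e[of y] by auto
  obtain r1 r2 where r: "\<And>y. ((\<lambda>y. p y / S1 \<epsilon> f y) has_real_derivative r1 y) (at y)"
    "\<And>y. ((\<lambda>y. r1 y / S1 \<epsilon> f y) has_real_derivative r2 y) (at y)" "continuous_on UNIV r1" "continuous_on UNIV r2"
    "\<And>y. \<bar>r1 y\<bar> + \<bar>r2 y\<bar> \<le> 5 * (map_bound E)\<^sup>2 * (\<bar>p y\<bar> + \<bar>p1 y\<bar> + \<bar>p2 y\<bar>)"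
    using quotient_derivs[OF dp dp1 sd(2) sd(3) e M(2,3,4) cp2 S_cont(4)[OF cf]] by blast
  have pS: "periodic1 (S1 \<epsilon> f)" using T1_periodic(1) periodic_T[OF Gd_periodic[of 1 f]] by (simp add: periodic1_def S1_def)
  have pb: "periodic1 b" unfolding b_def using periodic_T[OF Gd_periodic[of 0 h]] by simp
  have pp: "periodic1 (\<lambda>y. p y / S1 \<epsilon> f y)" using pb pS F_N_periodic[OF f(1)] by (simp add: periodic1_def p_def)
  have pr1: "periodic1 (\<lambda>y. r1 y / S1 \<epsilon> f y)" using periodic1_deriv[OF pp r(1)] pS by (simp add: periodic1_def)
  note K = fejer_F_N[OF N] and K1 = F_N_deriv(2)[OF fejer_F_N[OF N]]
  have i1: "conv (deriv (fejer N)) (S \<epsilon> f) p x = conv (fejer N) (S \<epsilon> f) r1 x" for x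
    by (rule conv_deriv_parts[OF S_lift sd(1) S_cont(2)[OF cf] nz r(1,3) pp K])
  have i2: "conv (deriv (deriv (fejer N))) (S \<epsilon> f) p x = conv (fejer N) (S \<epsilon> f) r2 x" for x
    unfolding conv_deriv_parts[OF S_lift sd(1) S_cont(2)[OF cf] nz r(1,3) pp K1]
    by (rule conv_deriv_parts[OF S_lift sd(1) S_cont(2)[OF cf] nz r(2,4) pr1 K])
  note Q = conv_F_N[OF K1 S_cont(1)[OF cf, of \<epsilon>] integrable_circ_cont[OF cp]]
  have ir: "integrable circ r1" "integrable circ r2" by (intro integrable_circ_cont r)+
  have "Wnorm 1 (conv (deriv (fejer N)) (S \<epsilon> f) p) = cint (\<lambda>x. \<bar>conv (fejer N) (S \<epsilon> f) r1 x\<bar>) + cint (\<lambda>x. \<bar>conv (fejer N) (S \<epsilon> f) r2 x\<bar>)"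
    unfolding Wnorm1_F_N[OF Q(1)] Q(2) i1 i2 ..
  also have "\<dots> \<le> L1norm r1 + L1norm r2"
    unfolding conv_def by (intro add_mono cint_conv_abs_le N S_cont(1)[OF cf] ir)
  also have "\<dots> = cint (\<lambda>y. \<bar>r1 y\<bar> + \<bar>r2 y\<bar>)" using ir by (intro cint_add[symmetric]) auto
  also have "\<dots> \<le> cint (\<lambda>y. 20 * (map_bound E)\<^sup>2 * A ^ 3 * H * (\<bar>f y\<bar> + \<bar>deriv f y\<bar> + \<bar>deriv (deriv f) y\<bar>))"
  proof (rule cint_mono)
    fix y
    have "\<bar>r1 y\<bar> + \<bar>r2 y\<bar> \<le> 5 * (map_bound E)\<^sup>2 * (4 * (A ^ 3 * H) * (\<bar>f y\<bar> + \<bar>deriv f y\<bar> + \<bar>deriv (deriv f) y\<bar>))"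
      by (rule order_trans[OF r(5)]) (intro mult_left_mono sum, simp)
    thus "\<bar>r1 y\<bar> + \<bar>r2 y\<bar> \<le> 20 * (map_bound E)\<^sup>2 * A ^ 3 * H * (\<bar>f y\<bar> + \<bar>deriv f y\<bar> + \<bar>deriv (deriv f) y\<bar>)" by simp
  qed (intro integrable_circ_cont continuous_intros r cf cf' cf'')+
  also have "\<dots> = 20 * (map_bound E)\<^sup>2 * A ^ 3 * H * Wnorm 2 f"
    unfolding cint_cmult Wnorm2_F_N[OF f(1)]
    by (subst cint_add, (intro integrable_circ_cont continuous_intros cf cf' cf'')+,
        subst cint_add, (intro integrable_circ_cont continuous_intros cf cf' cf'')+) simp
  finally have le: "Wnorm 1 (conv (deriv (fejer N)) (S \<epsilon> f) p) \<le> 20 * (map_bound E)\<^sup>2 * A ^ 3 * H * Wnorm 2 f" .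
  have "(\<lambda>x. disc_deriv N \<epsilon> f h x - conv (fejer N) (S \<epsilon> f) h x) = (\<lambda>x. (- \<epsilon>) * conv (deriv (fejer N)) (S \<epsilon> f) p x)"
    by (auto simp: disc_deriv_def kernel_deriv_def p_def[abs_def] b_def)
  hence "Wnorm 1 (\<lambda>x. disc_deriv N \<epsilon> f h x - conv (fejer N) (S \<epsilon> f) h x) = \<bar>\<epsilon>\<bar> * Wnorm 1 (conv (deriv (fejer N)) (S \<epsilon> f) p)"
    using Wnorm_scale[OF Q(1), of "- \<epsilon>"] by simp
  also have "\<dots> \<le> \<bar>\<epsilon>\<bar> * (20 * (map_bound E)\<^sup>2 * A ^ 3 * H * Wnorm 2 f)" using le by (intro mult_left_mono) auto
  finally show ?thesis by (simp add: H_def mult_ac)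
qed

end

section \<open>Uniform invertibility on a ball of \<open>W\<^sup>2\<^sup>,\<^sup>1\<close>\<close>

locale expanding_coupled_map = coupled_map +
  fixes \<epsilon>0 lam C0 CLY :: real
  assumes \<epsilon>0: "0 < \<epsilon>0" and lam: "0 < lam" "lam < 1" and uc: "uniform_constants T g \<epsilon>0 lam C0"
    and CLY: "0 < CLY" and LY: "lasota_yorke T g \<epsilon>0 lam CLY"
begin

lemma density_F_N:
  assumes "f \<in> densities" "f \<in> F_N N"
  shows "cint f = 1" "L1norm f = 1" "integrable circ f"
proof -
  show i: "integrable circ f" by (rule F_N_integrable[OF assms(2)])
  show "cint f = 1" using assms by (simp add: densities_def)
  have "AE x in circ. 0 \<le> f x" using assms by (intro AE_circ) (simp add: densities_def)
  hence "L1norm f = cint f" unfolding cint_circ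
    by (intro integral_cong_AE) (use i in \<open>auto\<close>)
  thus "L1norm f = 1" using \<open>cint f = 1\<close> by simp
qed

lemma density_expanding:
  assumes "f \<in> densities" "continuous_on UNIV f" "\<epsilon> \<in> {0..\<epsilon>0}"
  shows "1 / lam \<le> \<bar>S1 \<epsilon> f y\<bar>" "1 \<le> \<bar>S1 \<epsilon> f y\<bar>"
proof -
  have "deriv (S \<epsilon> f) y = S1 \<epsilon> f y" by (rule DERIV_imp_deriv[OF S_deriv(1)[OF assms(2)]])
  hence "S1 \<epsilon> f y \<noteq> 0" "1 / \<bar>S1 \<epsilon> f y\<bar> \<le> lam" using uc assms(1,3) unfolding uniform_constants_def by metis+
  thus 1: "1 / lam \<le> \<bar>S1 \<epsilon> f y\<bar>" using lam by (simp add: field_simps)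
  have "1 \<le> 1 / lam" using lam by simp
  thus "1 \<le> \<bar>S1 \<epsilon> f y\<bar>" using 1 by linarith
qed

definition transport_const :: "real \<Rightarrow> real" where "transport_const K = 20 * (map_bound \<epsilon>0)\<^sup>2 * A ^ 3 * K"

text \<open>Compares \<open>h\<close>, \<open>D\<^sub>f h\<close> and the exact transfer \<open>v\<close>. The last estimate, that \<open>h\<close> is nearly fixed by the transfer operator,
  is only in \<open>L\<^sup>1\<close>, since \<open>\<Pi>\<^sub>N v\<close> is close to \<open>v\<close> only there; the Lasota-Yorke inequality of the second line lifts it
  back to \<open>W\<^sup>1\<^sup>,\<^sup>1\<close>.\<close>

lemma transfer_step:
  assumes N: "0 < N" and f: "f \<in> densities" "f \<in> F_N N" "Wnorm 2 f \<le> K" and e: "\<epsilon> \<in> {0..\<epsilon>0}" and h: "h \<in> F_N N"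
  defines "v \<equiv> transfer (S \<epsilon> f) h" and "H \<equiv> L1norm h" and "Y \<equiv> Wnorm 1 (\<lambda>x. h x - disc_deriv N \<epsilon> f h x)"
  shows "is_transfer (S \<epsilon> f) h v"
    and "Wnorm 1 v \<le> lam * Wnorm 1 h + CLY * H"
    and "Wnorm 1 (\<lambda>x. disc_deriv N \<epsilon> f h x) \<le> Wnorm 1 v + \<epsilon> * transport_const K * H"
    and "Wnorm 1 h \<le> Wnorm 1 v + \<epsilon> * transport_const K * H + Y"
    and "cint (\<lambda>x. \<bar>h x - v x\<bar>) \<le> \<epsilon> * transport_const K * H + Y + 2 / sqrt (real N) * Wnorm 1 v"
proof -
  note cf = F_N_cont[OF f(2)] and ch = F_N_cont[OF h]
  note fd = density_F_N[OF f(1,2)]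
  note ex = density_expanding[OF f(1) cf e]
  have nz: "S1 \<epsilon> f y \<noteq> 0" for y using ex(2)[of y] by auto
  obtain w where w: "is_transfer (S \<epsilon> f) h w" "continuous_on UNIV h \<Longrightarrow> continuous_on UNIV w"
    using transfer_exists[OF S_lift S_deriv(1)[OF cf] S_cont(2)[OF cf] nz F_N_L1[OF h]] by blast
  show tv: "is_transfer (S \<epsilon> f) h v" unfolding v_def by (rule is_transfer_transfer[OF w(1)])
  have "transfer (fold (\<lambda>f S. T_map T g \<epsilon> f \<circ> S) [f] id) h \<in> W 1 \<and>
      Wnorm 1 (transfer (fold (\<lambda>f S. T_map T g \<epsilon> f \<circ> S) [f] id) h) \<le> lam ^ (1 * length [f]) * Wnorm 1 h + CLY * Wnorm (1 - 1) h"
    using LY e f(1) F_N_W[OF h, of 1] unfolding lasota_yorke_def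
    by (elim ballE[where x = \<epsilon>] allE[where x = "[f]"] impE ballE[where x = 1] ballE[where x = h]) auto
  hence W1: "v \<in> W 1" and Wv: "Wnorm 1 v \<le> lam * Wnorm 1 h + CLY * H"
    using Wnorm0_F_N[OF h] by (auto simp: v_def H_def)
  show "Wnorm 1 v \<le> lam * Wnorm 1 h + CLY * H" by (rule Wv)
  have Pv: "Pi_N N v = conv (fejer N) (S \<epsilon> f) h"
    using is_transfer_Pi_N[OF N tv] by (simp add: conv_def[abs_def])
  have vL: "v \<in> L1" "integrable circ v" using tv by (auto simp: is_transfer_def L1_iff)
  have PF: "Pi_N N v \<in> F_N N" by (rule Pi_N_F_N[OF N vL(2)])
  have DF: "disc_deriv N \<epsilon> f h \<in> F_N N" by (rule disc_deriv_F_N[OF N f(2) h])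
  define q where "q x = disc_deriv N \<epsilon> f h x - Pi_N N v x" for x
  have qF: "q \<in> F_N N" unfolding q_def by (rule F_N_diff[OF DF PF])
  have H0: "0 \<le> H" unfolding H_def by (rule cint_nonneg) simp
  have qb: "Wnorm 1 q \<le> \<epsilon> * transport_const K * H"
  proof -
    have "Wnorm 1 q \<le> \<bar>\<epsilon>\<bar> * (20 * (map_bound \<epsilon>0)\<^sup>2 * A ^ 3 * Wnorm 2 f) * H"
      unfolding q_def Pv H_def using e fd by (intro disc_deriv_transport_bound N f ex h) auto
    also have "\<dots> \<le> \<bar>\<epsilon>\<bar> * (20 * (map_bound \<epsilon>0)\<^sup>2 * A ^ 3 * K) * H"
      using f(3) H0 A(1) by (intro mult_right_mono mult_left_mono mult_nonneg_nonneg) auto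
    finally show ?thesis using e by (simp add: transport_const_def)
  qed
  have yF: "(\<lambda>x. h x - disc_deriv N \<epsilon> f h x) \<in> F_N N" by (rule F_N_diff[OF h DF])
  have Pn: "Wnorm 1 (Pi_N N v) \<le> Wnorm 1 v" by (rule Wnorm1_Pi_N[OF N W1])
  have "Wnorm 1 (\<lambda>x. Pi_N N v x + q x) \<le> Wnorm 1 (Pi_N N v) + Wnorm 1 q" by (rule Wnorm_triangle[OF PF qF])
  hence D: "Wnorm 1 (disc_deriv N \<epsilon> f h) \<le> Wnorm 1 v + \<epsilon> * transport_const K * H" using qb Pn by (simp add: q_def)
  thus "Wnorm 1 (\<lambda>x. disc_deriv N \<epsilon> f h x) \<le> Wnorm 1 v + \<epsilon> * transport_const K * H" by simp
  have "Wnorm 1 (\<lambda>x. disc_deriv N \<epsilon> f h x + (h x - disc_deriv N \<epsilon> f h x)) \<le> Wnorm 1 (disc_deriv N \<epsilon> f h) + Y"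
    unfolding Y_def by (rule Wnorm_triangle[OF DF yF])
  thus "Wnorm 1 h \<le> Wnorm 1 v + \<epsilon> * transport_const K * H + Y" using D by simp
  have hP: "cint (\<lambda>x. \<bar>h x - Pi_N N v x\<bar>) \<le> \<epsilon> * transport_const K * H + Y"
  proof -
    have "cint (\<lambda>x. \<bar>h x - Pi_N N v x\<bar>) = cint (\<lambda>x. \<bar>q x + (h x - disc_deriv N \<epsilon> f h x)\<bar>)" by (simp add: q_def)
    also have "\<dots> \<le> L1norm q + cint (\<lambda>x. \<bar>h x - disc_deriv N \<epsilon> f h x\<bar>)"
      by (rule cint_abs_triangle[OF F_N_integrable[OF qF] F_N_integrable[OF yF]])
    also have "\<dots> \<le> Wnorm 1 q + Y" unfolding Y_def by (intro add_mono cint_le_Wnorm F_N_L1[OF qF] F_N_L1[OF yF])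
    finally show ?thesis using qb by simp
  qed
  have "cint (\<lambda>x. \<bar>v x - w x\<bar>) \<le> cint (\<lambda>x. \<bar>h x - h x\<bar>)"
    by (rule is_transfer_nonexpansive[OF tv w(1) borel_measurable_continuous_onI[OF S_cont(1)[OF cf]]]) (intro F_N_integrable[OF h])+
  hence vw0: "cint (\<lambda>x. \<bar>v x - w x\<bar>) \<le> 0" by (simp add: cint_const)
  have wL: "periodic1 w" "integrable circ w" using w(1) by (auto simp: is_transfer_def L1_iff)
  have "cint (\<lambda>x. \<bar>v x - w x\<bar>) = 0" using vw0 cint_nonneg[of "\<lambda>x. \<bar>v x - w x\<bar>"] by simp
  hence "AE x in circ. \<bar>v x - w x\<bar> = 0"
    using integral_nonneg_eq_0_iff_AE[of circ "\<lambda>x. \<bar>v x - w x\<bar>"] vL wL by (simp add: cint_circ)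
  hence vw: "AE x in circ. v x = w x" by eventually_elim simp
  have "cint (\<lambda>x. \<bar>Pi_N N v x - v x\<bar>) \<le> 2 / sqrt (real N) * cint (\<lambda>x. \<bar>weak_deriv 1 v x\<bar>)"
    by (rule Pi_N_defect[OF N vL(1) W_weak_deriv[OF W1] w(2)[OF ch] wL(1) vw]) simp
  also have "\<dots> \<le> 2 / sqrt (real N) * Wnorm 1 v" by (intro mult_left_mono cint_weak_deriv_le) auto
  finally have Pd: "cint (\<lambda>x. \<bar>Pi_N N v x - v x\<bar>) \<le> 2 / sqrt (real N) * Wnorm 1 v" .
  have "cint (\<lambda>x. \<bar>h x - v x\<bar>) = cint (\<lambda>x. \<bar>(h x - Pi_N N v x) + (Pi_N N v x - v x)\<bar>)" by simp
  also have "\<dots> \<le> cint (\<lambda>x. \<bar>h x - Pi_N N v x\<bar>) + cint (\<lambda>x. \<bar>Pi_N N v x - v x\<bar>)"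
    using F_N_integrable[OF h] F_N_integrable[OF PF] vL(2) by (intro cint_abs_triangle) auto
  finally show "cint (\<lambda>x. \<bar>h x - v x\<bar>) \<le> \<epsilon> * transport_const K * H + Y + 2 / sqrt (real N) * Wnorm 1 v" using hP Pd by linarith
qed

text \<open>The transfer operator does not increase \<open>L\<^sup>1\<close> distances, so the defect accumulates linearly.\<close>

lemma transfer_iterates:
  assumes f: "f \<in> densities" "f \<in> F_N N" and e: "\<epsilon> \<in> {0..\<epsilon>0}" and h: "h \<in> F_N N"
  shows "cint (\<lambda>x. \<bar>h x - (transfer (S \<epsilon> f) ^^ n) h x\<bar>) \<le> real n * cint (\<lambda>x. \<bar>h x - transfer (S \<epsilon> f) h x\<bar>)"
    and "(transfer (S \<epsilon> f) ^^ n) h \<in> L1"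
proof -
  let ?L = "transfer (S \<epsilon> f)"
  note cf = F_N_cont[OF f(2)]
  note ex = density_expanding[OF f(1) cf e]
  have nz: "S1 \<epsilon> f y \<noteq> 0" for y using ex(2)[of y] by auto
  have tr: "is_transfer (S \<epsilon> f) \<psi> (?L \<psi>)" if "\<psi> \<in> L1" for \<psi>
    using transfer_exists[OF S_lift S_deriv(1)[OF cf] S_cont(2)[OF cf] nz that] is_transfer_transfer by metis
  have L: "(?L ^^ n) h \<in> L1" for n
  proof (induction n)
    case 0 show ?case using F_N_L1[OF h] by simp
  next
    case (Suc n) show ?case using tr[OF Suc] by (simp add: is_transfer_def)
  qed
  thus "(?L ^^ n) h \<in> L1" .
  have iL: "integrable circ ((?L ^^ n) h)" for n using L[of n] by (simp add: L1_iff)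
  have st: "cint (\<lambda>x. \<bar>(?L ^^ n) h x - (?L ^^ Suc n) h x\<bar>) \<le> cint (\<lambda>x. \<bar>h x - ?L h x\<bar>)" for n
  proof (induction n)
    case (Suc n)
    have "cint (\<lambda>x. \<bar>(?L ^^ Suc n) h x - (?L ^^ Suc (Suc n)) h x\<bar>) \<le> cint (\<lambda>x. \<bar>(?L ^^ n) h x - (?L ^^ Suc n) h x\<bar>)"
      using is_transfer_nonexpansive[OF tr[OF L[of n]] tr[OF L[of "Suc n"]] borel_measurable_continuous_onI[OF S_cont(1)[OF cf]] iL iL]
      by simp
    thus ?case using Suc by linarith
  qed simp
  show "cint (\<lambda>x. \<bar>h x - (?L ^^ n) h x\<bar>) \<le> real n * cint (\<lambda>x. \<bar>h x - ?L h x\<bar>)"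
  proof (induction n)
    case 0 show ?case by (simp add: cint_const)
  next
    case (Suc n)
    have "cint (\<lambda>x. \<bar>h x - (?L ^^ Suc n) h x\<bar>) = cint (\<lambda>x. \<bar>(h x - (?L ^^ n) h x) + ((?L ^^ n) h x - (?L ^^ Suc n) h x)\<bar>)" by simp
    also have "\<dots> \<le> cint (\<lambda>x. \<bar>h x - (?L ^^ n) h x\<bar>) + cint (\<lambda>x. \<bar>(?L ^^ n) h x - (?L ^^ Suc n) h x\<bar>)"
      using F_N_integrable[OF h] iL[of n] iL[of "Suc n"] by (intro cint_abs_triangle) auto
    also have "\<dots> \<le> real n * cint (\<lambda>x. \<bar>h x - ?L h x\<bar>) + cint (\<lambda>x. \<bar>h x - ?L h x\<bar>)" by (intro add_mono Suc st)
    finally show ?case by (simp add: algebra_simps)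
  qed
qed

text \<open>By Lasota-Yorke \<open>\<parallel>h\<parallel>\<close> is bounded by a multiple \<open>a\<close> of its \<open>L\<^sup>1\<close> norm plus the residual \<open>Y\<close>. Compare \<open>h\<close> in
  \<open>L\<^sup>1\<close> with its \<open>n\<close>-th image under the transfer operator, for a fixed \<open>n\<close> with \<open>a Cs \<theta>\<^sup>n \<le> 1/4\<close>: the image is small by
  the contraction, and the difference is at most \<open>n\<close> one-step defects of size \<open>O(\<epsilon>) + O(N\<^sup>-\<^sup>1\<^sup>/\<^sup>2)\<close>. Choosing \<open>\<epsilon>7\<close> and
  \<open>N0\<close> so that these two errors also contribute at most a quarter each, \<open>\<parallel>h\<parallel>\<close> is absorbed.\<close>

lemma uniform_inverse_bound:
  assumes sc: "sequential_contraction T g K \<epsilon>1" and \<epsilon>1: "\<epsilon>1 \<le> \<epsilon>0" and K: "0 \<le> K"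
  shows "\<exists>\<epsilon>7>0. \<exists>N0 M. 0 < N0 \<and> 0 < M \<and> (\<forall>\<epsilon>. 0 \<le> \<epsilon> \<and> \<epsilon> \<le> \<epsilon>1 \<and> \<epsilon> \<le> \<epsilon>7 \<longrightarrow> (\<forall>N\<ge>N0. \<forall>f\<in>BK K \<inter> F_N N. \<forall>h\<in>V_N N.
     Wnorm 1 h \<le> M * Wnorm 1 (\<lambda>x. h x - disc_deriv N \<epsilon> f h x)))"
proof -
  obtain Cs \<theta> where Cs: "0 < Cs" "0 < \<theta>" "\<theta> < 1" and con: "\<And>\<epsilon> fs i h. \<epsilon> \<in> {0..\<epsilon>1} \<Longrightarrow> set fs \<subseteq> BK K \<Longrightarrow> i \<in> {1..2} \<Longrightarrow> h \<in> W i \<Longrightarrow> cint h = 0 \<Longrightarrow>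
      fold (\<lambda>f. transfer (T_map T g \<epsilon> f)) fs h \<in> W i \<and> Wnorm i (fold (\<lambda>f. transfer (T_map T g \<epsilon> f)) fs h) \<le> Cs * \<theta> ^ length fs * Wnorm i h"
    using sc unfolding sequential_contraction_def by metis
  have Cq0: "0 \<le> transport_const K" using K A(1) by (simp add: transport_const_def)
  define a where "a = (CLY + \<epsilon>0 * transport_const K) / (1 - lam)"
  define b where "b = 1 / (1 - lam)"
  have a: "0 < a" using CLY \<epsilon>0 Cq0 lam by (simp add: a_def add_pos_nonneg)
  have b: "0 < b" using lam by (simp add: b_def)
  obtain n where n: "\<theta> ^ n < 1 / (4 * a * Cs)" using real_arch_pow_inv[of "1 / (4 * a * Cs)" \<theta>] a Cs by auto
  define \<epsilon>7 where "\<epsilon>7 = 1 / (4 * a * real n * transport_const K + 1)"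
  have den: "0 \<le> 4 * a * real n * transport_const K" using a Cq0 by simp
  define N0 where "N0 = nat \<lceil>(8 * a * real n * (lam + CLY))\<^sup>2\<rceil> + 1"
  define M where "M = 4 * (a * real n + b)"
  show ?thesis
  proof (rule exI[of _ \<epsilon>7], rule conjI[rotated], rule exI[of _ N0], rule exI[of _ M], intro conjI allI impI ballI)
    show "0 < \<epsilon>7" using den by (simp add: \<epsilon>7_def)
    show "0 < N0" by (simp add: N0_def)
    show "0 < M" using a b by (simp add: M_def add_nonneg_pos)
    fix \<epsilon> N f h
    assume e: "0 \<le> \<epsilon> \<and> \<epsilon> \<le> \<epsilon>1 \<and> \<epsilon> \<le> \<epsilon>7" and N: "N0 \<le> N" and fK: "f \<in> BK K \<inter> F_N N" and hV: "h \<in> V_N N"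
    have N0: "0 < N" using N by (simp add: N0_def)
    have f: "f \<in> densities" "f \<in> F_N N" "Wnorm 2 f \<le> K" using fK by (auto simp: BK_def)
    have h: "h \<in> F_N N" "cint h = 0" using hV by (auto simp: V_N_iff)
    have e0: "\<epsilon> \<in> {0..\<epsilon>0}" using e \<epsilon>1 by auto
    define v where "v = transfer (S \<epsilon> f) h"
    define H where "H = L1norm h"
    define Y where "Y = Wnorm 1 (\<lambda>x. h x - disc_deriv N \<epsilon> f h x)"
    define w where "w = Wnorm 1 h"
    note st = transfer_step[OF N0 f e0 h(1), folded v_def H_def Y_def w_def]
    have H: "0 \<le> H" unfolding H_def by (rule cint_nonneg) simp
    have Hw: "H \<le> w" unfolding H_def w_def by (rule cint_le_Wnorm[OF F_N_L1[OF h(1)]])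
    have Y0: "0 \<le> Y" unfolding Y_def by (rule Wnorm_nonneg)
    have s: "(2::real) / sqrt (real N) * (a * real n * (lam + CLY)) \<le> 1/4"
    proof -
      have "(8 * a * real n * (lam + CLY))\<^sup>2 \<le> real N" using N by (simp add: N0_def) linarith
      hence "8 * a * real n * (lam + CLY) \<le> sqrt (real N)" by (rule real_le_rsqrt)
      thus ?thesis using N0 by (simp add: field_simps)
    qed
    have wa: "w \<le> a * H + b * Y"
    proof -
      have "\<epsilon> * transport_const K * H \<le> \<epsilon>0 * transport_const K * H" using e0 Cq0 H by (intro mult_right_mono) auto
      hence "w \<le> lam * w + (CLY + \<epsilon>0 * transport_const K) * H + Y" using st(2,4) by (simp add: algebra_simps)
      hence "(1 - lam) * w \<le> (CLY + \<epsilon>0 * transport_const K) * H + Y" by (simp add: algebra_simps)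
      hence "w \<le> ((CLY + \<epsilon>0 * transport_const K) * H + Y) / (1 - lam)" using lam by (simp add: pos_le_divide_eq mult.commute)
      also have "\<dots> = a * H + b * Y"
        unfolding a_def b_def times_divide_eq_left mult_1_left by (rule add_divide_distrib)
      finally show ?thesis .
    qed
    have vw: "Wnorm 1 v \<le> (lam + CLY) * w"
    proof -
      have "CLY * H \<le> CLY * w" using Hw CLY by simp
      thus ?thesis using st(2) by (simp add: algebra_simps)
    qed
    define hn where "hn = (transfer (S \<epsilon> f) ^^ n) h"
    note it = transfer_iterates[OF f(1,2) e0 h(1), of n, folded hn_def v_def]
    have fr: "fold F (replicate n f) x = (F f ^^ n) x" for F :: "(real \<Rightarrow> real) \<Rightarrow> (real \<Rightarrow> real) \<Rightarrow> real \<Rightarrow> real" and x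
      by (induction n arbitrary: x) (simp_all add: funpow_swap1)
    have "set (replicate n f) \<subseteq> BK K" using fK by auto
    from con[OF _ this _ F_N_W[OF h(1)] h(2), of \<epsilon> 1] e
    have "Wnorm 1 hn \<le> Cs * \<theta> ^ n * w" by (simp add: fr hn_def w_def)
    hence hn: "L1norm hn \<le> Cs * \<theta> ^ n * w" using cint_le_Wnorm[OF it(2), of 1] by linarith
    have "H = cint (\<lambda>x. \<bar>(h x - hn x) + hn x\<bar>)" by (simp add: H_def)
    also have "\<dots> \<le> cint (\<lambda>x. \<bar>h x - hn x\<bar>) + L1norm hn"
      using it(2) F_N_integrable[OF h(1)] by (intro cint_abs_triangle) (auto simp: L1_iff)
    also have "\<dots> \<le> real n * (\<epsilon> * transport_const K * H + Y + 2 / sqrt (real N) * Wnorm 1 v) + Cs * \<theta> ^ n * w"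
      using order_trans[OF it(1) mult_left_mono[OF st(5)]] hn by linarith
    also have "\<dots> \<le> real n * (\<epsilon> * transport_const K * w + Y + 2 / sqrt (real N) * ((lam + CLY) * w)) + Cs * \<theta> ^ n * w"
      using Hw vw e Cq0 by (intro add_right_mono mult_left_mono add_mono order_refl) auto
    finally have "a * H \<le> a * (real n * (\<epsilon> * transport_const K * w + Y + 2 / sqrt (real N) * ((lam + CLY) * w)) + Cs * \<theta> ^ n * w)"
      using a by (intro mult_left_mono) auto
    also have "\<dots> = (a * real n * transport_const K * \<epsilon>) * w + (2 / sqrt (real N) * (a * real n * (lam + CLY))) * w + (a * Cs * \<theta> ^ n) * w + a * real n * Y"
      by (simp add: algebra_simps add_divide_distrib)
    also have "\<dots> \<le> (1/4) * w + (1/4) * w + (1/4) * w + a * real n * Y"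
    proof (intro add_mono mult_right_mono order_refl s)
      have "a * real n * transport_const K * \<epsilon> \<le> a * real n * transport_const K * \<epsilon>7" using e a Cq0 by (intro mult_left_mono) auto
      also have "\<dots> \<le> 1/4" using den by (simp add: \<epsilon>7_def field_simps)
      finally show "a * real n * transport_const K * \<epsilon> \<le> 1/4" .
      show "a * Cs * \<theta> ^ n \<le> 1/4" using n a Cs by (simp add: field_simps)
      show "0 \<le> w" "0 \<le> w" "0 \<le> w" using H Hw by auto
    qed (use Y0 a in auto)
    finally have "w \<le> 3/4 * w + (a * real n + b) * Y" using wa by (simp add: algebra_simps)
    hence "w \<le> 4 * ((a * real n + b) * Y)" by simp
    thus "Wnorm 1 h \<le> M * Wnorm 1 (\<lambda>x. h x - disc_deriv N \<epsilon> f h x)" by (simp only: M_def w_def Y_def mult.assoc)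
  qed
qed

end

section \<open>Newton's method under an admissible choice of constants\<close>

lemma Wnorm_sum: "(\<And>j. j < (n::nat) \<Longrightarrow> F j \<in> F_N N) \<Longrightarrow>
    (\<lambda>x. \<Sum>j<n. F j x) \<in> F_N N \<and> Wnorm 1 (\<lambda>x. \<Sum>j<n. F j x) \<le> (\<Sum>j<n. Wnorm 1 (F j))"
proof (induction n)
  case 0 show ?case by (simp add: F_N_zero Wnorm_zero_fun)
next
  case (Suc n)
  hence IH: "(\<lambda>x. \<Sum>j<n. F j x) \<in> F_N N" "Wnorm 1 (\<lambda>x. \<Sum>j<n. F j x) \<le> (\<Sum>j<n. Wnorm 1 (F j))" and F: "F n \<in> F_N N" by auto
  show ?case using F_N_add[OF IH(1) F] Wnorm_triangle[OF IH(1) F] IH(2) by simp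
qed

lemma F_N_sup_bound:
  assumes "f \<in> F_N N" shows "\<bar>f x - cint f\<bar> \<le> L1norm (deriv f)"
proof -
  note d = F_N_deriv[OF assms]
  have c': "continuous_on UNIV (deriv f)" by (rule F_N_cont[OF d(2)])
  have ca: "continuous_on UNIV (\<lambda>y. \<bar>deriv f y\<bar>)" by (intro continuous_intros c')
  have le: "\<bar>f b - f a\<bar> \<le> L1norm (deriv f)" if "0 \<le> a" "a \<le> b" "b \<le> 1" for a b
  proof -
    have "(deriv f has_integral (f b - f a)) {a..b}"
      by (rule fundamental_theorem_of_calculus[OF that(2)])
         (use d(1) in \<open>auto simp: has_real_derivative_iff_has_vector_derivative intro: has_vector_derivative_at_within\<close>)
    hence "f b - f a = integral {a..b} (deriv f)" by (simp add: integral_unique)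
    also have "\<bar>\<dots>\<bar> \<le> integral {a..b} (\<lambda>y. \<bar>deriv f y\<bar>)"
      using integral_norm_bound_integral[of "deriv f" "{a..b}" "\<lambda>y. \<bar>deriv f y\<bar>"]
      by (simp add: integrable_continuous_interval continuous_on_subset[OF c'] continuous_on_subset[OF ca])
    also have "\<dots> \<le> integral {0..1} (\<lambda>y. \<bar>deriv f y\<bar>)"
      by (rule integral_subset_le) (use that in \<open>auto intro!: integrable_continuous_interval continuous_on_subset[OF ca]\<close>)
    finally show ?thesis by (simp add: cint_HK[OF ca])
  qed
  have le2: "\<bar>f b - f a\<bar> \<le> L1norm (deriv f)" if "a \<in> {0..1}" "b \<in> {0..1}" for a b
    using le[of a b] le[of b a] that by (cases "a \<le> b") (auto simp: abs_minus_commute)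
  have i: "integrable circ f" by (rule F_N_integrable[OF assms])
  have "\<bar>f x - cint f\<bar> \<le> L1norm (deriv f)" if x: "x \<in> {0..1}" for x
  proof -
    have "f x - cint f = cint (\<lambda>y. f x - f y)" using i by (subst cint_diff) (auto simp: cint_const)
    also have "\<bar>\<dots>\<bar> \<le> cint (\<lambda>y. \<bar>f x - f y\<bar>)" by (rule cint_abs_le)
    also have "\<dots> \<le> L1norm (deriv f)" using i le2[OF _ x] by (intro cint_le_bound) auto
    finally show ?thesis .
  qed
  thus ?thesis using periodic1_all[OF F_N_periodic[OF assms], of "\<lambda>z. \<bar>z - cint f\<bar> \<le> L1norm (deriv f)"] by blast
qed

lemma W2_triangle:
  assumes "f \<in> F_N N" "g \<in> F_N N"
  shows "Wnorm 2 (\<lambda>x. a * f x + b * g x) \<le> \<bar>a\<bar> * Wnorm 2 f + \<bar>b\<bar> * Wnorm 2 g"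
proof -
  have t: "cint (\<lambda>x. \<bar>a * p x + b * q x\<bar>) \<le> \<bar>a\<bar> * L1norm p + \<bar>b\<bar> * L1norm q"
    if "p \<in> F_N N" "q \<in> F_N N" for p q
    using cint_abs_triangle[OF F_N_integrable[OF F_N_scale[OF that(1), of a]] F_N_integrable[OF F_N_scale[OF that(2), of b]]]
    by (simp add: cint_abs_cmult)
  note d = F_N_deriv(2)[OF assms(1)] F_N_deriv(2)[OF assms(2)]
  note dd = F_N_deriv(2)[OF d(1)] F_N_deriv(2)[OF d(2)]
  show ?thesis
    unfolding Wnorm2_F_N[OF F_N_lin[OF assms]] Wnorm2_F_N[OF assms(1)] Wnorm2_F_N[OF assms(2)] F_N_deriv_lin[OF assms] F_N_deriv_lin[OF d]
    using t[OF assms] t[OF d] t[OF dd] by (simp add: distrib_left)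
qed

text \<open>The linear rate brings \<open>M e\<^sub>n\<close> below \<open>1/2\<close> after a number \<open>m\<close> of steps that depends on \<open>M\<close> alone; from then on it squares
  in each step. Hence \<open>C\<close> and \<open>\<gamma>\<close> do not depend on the sequence, and one pair serves all initial densities.\<close>

lemma quadratic_convergence:
  fixes M :: real
  obtains C \<gamma> where "0 < C" "0 < \<gamma>" "\<gamma> < 1"
    "\<And>e :: nat \<Rightarrow> real. (\<And>n. 0 \<le> e n) \<Longrightarrow> e 0 \<le> 1 \<Longrightarrow> (\<And>n. e (Suc n) \<le> e n / 4) \<Longrightarrow> (\<And>n. e (Suc n) \<le> M * (e n)\<^sup>2) \<Longrightarrow>
      \<forall>n. e n \<le> C * \<gamma> ^ (2 ^ n)"
proof -
  define M' where "M' = max M 1"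
  have M': "1 \<le> M'" "M \<le> M'" by (auto simp: M'_def)
  obtain m :: nat where m: "(1/4::real) ^ m < 1 / (2 * M')" using real_arch_pow_inv[of "1 / (2 * M')" "1/4"] M' by auto
  define \<gamma> where "\<gamma> = root (2 ^ m) (1/2)"
  have g0: "0 < \<gamma>" by (simp add: \<gamma>_def)
  have g1: "\<gamma> < 1" by (simp add: \<gamma>_def)
  have gm: "\<gamma> ^ (2 ^ m) = 1/2" by (simp add: \<gamma>_def real_root_pow_pos)
  show ?thesis
  proof (rule that[of 2 \<gamma>])
    fix e :: "nat \<Rightarrow> real"
    assume e0: "\<And>n. 0 \<le> e n" and e1: "e 0 \<le> 1" and lin: "\<And>n. e (Suc n) \<le> e n / 4" and qu: "\<And>n. e (Suc n) \<le> M * (e n)\<^sup>2"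
    have geo: "e n \<le> (1/4) ^ n" for n
    proof (induction n)
      case (Suc n) thus ?case using lin[of n] by simp
    qed (simp add: e1)
    have q: "M' * e (m + j) \<le> (1/2) ^ (2 ^ j)" for j
    proof (induction j)
      case 0
      have "M' * e m \<le> M' * (1 / (2 * M'))" using geo[of m] m M' by (intro mult_left_mono) auto
      thus ?case using M' by simp
    next
      case (Suc j)
      have "M' * e (m + Suc j) \<le> M' * (M' * (e (m + j))\<^sup>2)"
      proof (intro mult_left_mono)
        have "e (m + Suc j) \<le> M * (e (m + j))\<^sup>2" using qu[of "m + j"] by simp
        also have "\<dots> \<le> M' * (e (m + j))\<^sup>2" using M' by (intro mult_right_mono) auto
        finally show "e (m + Suc j) \<le> M' * (e (m + j))\<^sup>2" .
      qed (use M' in auto)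
      also have "\<dots> = (M' * e (m + j))\<^sup>2" by (simp add: power2_eq_square)
      also have "\<dots> \<le> ((1/2) ^ (2 ^ j))\<^sup>2" using Suc e0 M' by (intro power_mono mult_nonneg_nonneg) auto
      also have "\<dots> = (1/2) ^ (2 ^ Suc j)" by (simp only: power_Suc power_mult[symmetric] mult.commute)
      finally show ?case .
    qed
    show "\<forall>n. e n \<le> 2 * \<gamma> ^ (2 ^ n)"
    proof
      fix n
      show "e n \<le> 2 * \<gamma> ^ (2 ^ n)"
      proof (cases "m \<le> n")
        case True
        then obtain j where n: "n = m + j" using le_Suc_ex by blast
        have "e n \<le> M' * e n" using M' e0[of n] by (simp add: mult_le_cancel_right1)
        also have "\<dots> \<le> (1/2) ^ (2 ^ j)" using q n by simp
        also have "\<dots> = \<gamma> ^ (2 ^ n)" by (simp add: n power_add power_mult gm)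
        also have "\<dots> \<le> 2 * \<gamma> ^ (2 ^ n)" using g0 by simp
        finally show ?thesis .
      next
        case False
        have "e n \<le> (1/4) ^ n" by (rule geo)
        also have "\<dots> \<le> 1" by (simp add: power_le_one)
        also have "1 = 2 * \<gamma> ^ (2 ^ m)" by (simp add: gm)
        also have "\<dots> \<le> 2 * \<gamma> ^ (2 ^ n)" using False g0 g1 by (intro mult_left_mono power_decreasing power_increasing) auto
        finally show ?thesis .
      qed
    qed
  qed (use g0 g1 in auto)
qed

lemma BK_convex:
  assumes f: "f \<in> BK K \<inter> F_N N" and k: "k \<in> BK L \<inter> F_N N" and t: "0 \<le> t" "t \<le> 1"
  shows "(\<lambda>x. (1 - t) * f x + t * k x) \<in> BK ((1 - t) * K + t * L) \<inter> F_N N"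
proof -
  let ?u = "\<lambda>x. (1 - t) * f x + t * k x"
  have F: "?u \<in> F_N N" using f k by (intro F_N_lin) auto
  have "AE x in lborel. 0 \<le> f x" "AE x in lborel. 0 \<le> k x" using f k by (auto simp: BK_def densities_def)
  hence "AE x in lborel. 0 \<le> ?u x" by eventually_elim (use t in auto)
  moreover have "cint ?u = 1"
    using f k F_N_integrable[of f N] F_N_integrable[of k N] by (subst cint_add) (auto simp: cint_cmult BK_def densities_def)
  moreover have "Wnorm 2 ?u \<le> (1 - t) * K + t * L"
  proof -
    have "Wnorm 2 ?u \<le> \<bar>1 - t\<bar> * Wnorm 2 f + \<bar>t\<bar> * Wnorm 2 k" using f k by (intro W2_triangle) auto
    also have "\<dots> \<le> (1 - t) * K + t * L" using f k t by (auto simp: BK_def intro!: add_mono mult_left_mono)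
    finally show ?thesis .
  qed
  ultimately show ?thesis using F F_N_L1[OF F] F_N_W[OF F] by (auto simp: BK_def densities_def)
qed

lemma BK_mono: "K \<le> L \<Longrightarrow> BK K \<subseteq> BK L"
  by (auto simp: BK_def)

lemma one_BK: "0 < N \<Longrightarrow> (\<lambda>x. 1) \<in> BK 1 \<inter> F_N N"
  using F_N_const[of N 1] F_N_L1[OF F_N_const[of N 1]] F_N_W[OF F_N_const[of N 1]]
  by (auto simp: BK_def densities_def cint_const Wnorm2_F_N)

text \<open>Moving towards the constant density lowers the \<open>W\<^sup>2\<^sup>,\<^sup>1\<close> norm at a rate comparable to the \<open>W\<^sup>1\<^sup>,\<^sup>1\<close>
  displacement, because the distance to the constant is at most \<open>2 \<integral> \<bar>f'\<bar>\<close>, and \<open>\<integral> \<bar>f'\<bar> \<le> \<parallel>f\<parallel> - 1\<close>.\<close>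

lemma BK_shrink:
  assumes N: "0 < N" and f: "f \<in> BK (\<kappa> + \<eta>) \<inter> F_N N" and \<kappa>: "1 \<le> \<kappa>" and \<eta>: "0 < \<eta>"
  obtains f' where "f' \<in> BK \<kappa> \<inter> F_N N" "Wnorm 1 (\<lambda>x. f x - f' x) \<le> 2 * \<eta>"
proof -
  define t where "t = \<eta> / (\<kappa> + \<eta> - 1)"
  have den: "0 < \<kappa> + \<eta> - 1" using \<kappa> \<eta> by simp
  have t: "0 \<le> t" "t \<le> 1" using \<kappa> \<eta> den by (auto simp: t_def)
  have tm: "t * (\<kappa> + \<eta> - 1) = \<eta>" using den by (simp add: t_def)
  define f' where "f' = (\<lambda>x. (1 - t) * f x + t * 1)"
  have "f' \<in> BK ((1 - t) * (\<kappa> + \<eta>) + t * 1) \<inter> F_N N" unfolding f'_def using BK_convex[OF f one_BK[OF N] t] by simp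
  moreover have "(1 - t) * (\<kappa> + \<eta>) + t * 1 = \<kappa>" using tm by (simp add: algebra_simps)
  ultimately have f': "f' \<in> BK \<kappa> \<inter> F_N N" by simp
  have fF: "f \<in> F_N N" and f1: "cint f = 1" and fK: "Wnorm 2 f \<le> \<kappa> + \<eta>" using f by (auto simp: BK_def densities_def)
  have gF: "(\<lambda>x. f x - 1) \<in> F_N N" by (intro F_N_diff fF F_N_const N)
  have dg: "deriv (\<lambda>x. f x - 1) = deriv f"
    using F_N_deriv(1)[OF fF] by (intro ext DERIV_imp_deriv) (auto intro!: derivative_eq_intros)
  define D where "D = L1norm (deriv f)"
  have sup: "\<bar>f x - 1\<bar> \<le> D" for x using F_N_sup_bound[OF fF, of x] f1 by (simp add: D_def)
  have "Wnorm 1 (\<lambda>x. f x - 1) \<le> D + D"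
    unfolding Wnorm1_F_N[OF gF] dg D_def[symmetric]
    using cint_le_bound[of "\<lambda>x. \<bar>f x - 1\<bar>" D] F_N_integrable[OF gF] sup by simp
  moreover have "1 + D \<le> Wnorm 2 f"
  proof -
    have "\<bar>cint f\<bar> \<le> L1norm f" by (rule cint_abs_le)
    moreover have "0 \<le> L1norm (deriv (deriv f))" by (rule cint_nonneg) simp
    ultimately show ?thesis using f1 by (simp add: Wnorm2_F_N[OF fF] D_def)
  qed
  ultimately have "Wnorm 1 (\<lambda>x. f x - 1) \<le> D + D" "D \<le> \<kappa> + \<eta> - 1" using fK by simp_all
  hence n: "Wnorm 1 (\<lambda>x. f x - 1) \<le> 2 * (\<kappa> + \<eta> - 1)" by (auto elim: order_trans)
  have "(\<lambda>x. f x - f' x) = (\<lambda>x. t * (f x - 1))" by (auto simp: f'_def algebra_simps)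
  hence "Wnorm 1 (\<lambda>x. f x - f' x) = t * Wnorm 1 (\<lambda>x. f x - 1)" using Wnorm_scale[OF gF, of t] t by simp
  also have "\<dots> \<le> t * (2 * (\<kappa> + \<eta> - 1))" using n t by (intro mult_left_mono) auto
  also have "\<dots> = 2 * (t * (\<kappa> + \<eta> - 1))" by (simp only: mult.left_commute)
  also have "\<dots> = 2 * \<eta>" by (simp only: tm)
  finally show ?thesis using that[OF f'] by blast
qed

locale discretised = expanding_coupled_map +
  fixes \<epsilon> :: real and N :: nat
  assumes eps: "\<epsilon> \<in> {0..\<epsilon>0}" and N2: "2 \<le> N"
begin

lemma N0: "0 < N" using N2 by simp

abbreviation D where "D \<equiv> disc_deriv N \<epsilon>"
abbreviation \<Phi> where "\<Phi> \<equiv> sc_transfer_N T g \<epsilon> N"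

text \<open>A quantitative form of invertibility of \<open>I - D\<^sub>f\<close> on \<open>V_N\<close> that needs no inverse.\<close>

definition bounded_below :: "(real \<Rightarrow> real) \<Rightarrow> real \<Rightarrow> bool" where
  "bounded_below f M \<longleftrightarrow> (\<forall>h\<in>V_N N. Wnorm 1 h \<le> M * Wnorm 1 (\<lambda>x. h x - D f h x))"

definition all_bounded :: "real \<Rightarrow> real \<Rightarrow> bool" where
  "all_bounded \<kappa> M \<longleftrightarrow> (\<forall>f\<in>BK \<kappa> \<inter> F_N N. bounded_below f M)"

lemma density_facts:
  assumes "f \<in> densities" "f \<in> F_N N"
  shows "L1norm f \<le> 1" "\<And>y. 1 \<le> \<bar>S1 \<epsilon> f y\<bar>" "\<Phi> f = disc_op N \<epsilon> f" "\<And>h. h \<in> F_N N \<Longrightarrow> D_sc T g \<epsilon> N f h = D f h"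
proof -
  show 1: "L1norm f \<le> 1" using density_F_N[OF assms] by simp
  show 2: "\<And>y. 1 \<le> \<bar>S1 \<epsilon> f y\<bar>" using density_expanding(2)[OF assms(1) F_N_cont[OF assms(2)] eps] .
  hence "S1 \<epsilon> f y \<noteq> 0" for y by (metis abs_zero not_one_le_zero)
  thus "\<Phi> f = disc_op N \<epsilon> f" by (rule sc_transfer_eq_disc_op[OF N0 assms(2)])
  show "\<And>h. h \<in> F_N N \<Longrightarrow> D_sc T g \<epsilon> N f h = D f h" by (rule D_sc_transfer_eq[OF N0 assms(2) 1 2])
qed

lemma BK_density: "f \<in> BK \<kappa> \<inter> F_N N \<Longrightarrow> f \<in> densities \<and> f \<in> F_N N" by (auto simp: BK_def)

lemma V_N_F_N: "h \<in> V_N N \<Longrightarrow> h \<in> F_N N" by (simp add: V_N_iff)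

lemma bounded_below_newton:
  assumes f: "f \<in> densities" "f \<in> F_N N" and bb: "bounded_below f M"
  shows "newton_defined_at T g \<epsilon> N f"
    and "v \<in> V_N N \<Longrightarrow> inv_I_minus_D T g \<epsilon> N f v \<in> V_N N"
    and "v \<in> V_N N \<Longrightarrow> v = (\<lambda>x. inv_I_minus_D T g \<epsilon> N f v x - D f (inv_I_minus_D T g \<epsilon> N f v) x)"
    and "h \<in> V_N N \<Longrightarrow> inv_I_minus_D T g \<epsilon> N f (\<lambda>x. h x - D f h x) = h"
    and "v \<in> V_N N \<Longrightarrow> Wnorm 1 (inv_I_minus_D T g \<epsilon> N f v) \<le> M * Wnorm 1 v"
proof -
  have inj: "h = (\<lambda>x. 0)" if "h \<in> V_N N" "(\<lambda>x. h x - D f h x) = (\<lambda>x. 0)" for h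
  proof (rule Wnorm_zero[OF V_N_F_N[OF that(1)]])
    have "Wnorm 1 h \<le> M * Wnorm 1 (\<lambda>x. h x - D f h x)" using bb that(1) by (simp add: bounded_below_def)
    thus "Wnorm 1 h \<le> 0" by (simp only: that(2) Wnorm_zero_fun mult_zero_right)
  qed
  note nd = newton_defined[OF N0 f(2) density_facts(1,2)[OF f] inj]
  show "newton_defined_at T g \<epsilon> N f" by (rule nd(1))
  show i: "v \<in> V_N N \<Longrightarrow> inv_I_minus_D T g \<epsilon> N f v \<in> V_N N" by (rule nd(2))
  show e: "v \<in> V_N N \<Longrightarrow> v = (\<lambda>x. inv_I_minus_D T g \<epsilon> N f v x - D f (inv_I_minus_D T g \<epsilon> N f v) x)" by (rule nd(3))
  show "h \<in> V_N N \<Longrightarrow> inv_I_minus_D T g \<epsilon> N f (\<lambda>x. h x - D f h x) = h" by (rule nd(4))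
  show "Wnorm 1 (inv_I_minus_D T g \<epsilon> N f v) \<le> M * Wnorm 1 v" if v: "v \<in> V_N N"
    using bb i[OF v] e[OF v] unfolding bounded_below_def by metis
qed

lemma newton_defined_inj:
  assumes f: "f \<in> densities" "f \<in> F_N N" and nd: "newton_defined_at T g \<epsilon> N f"
    and h: "h \<in> V_N N" "(\<lambda>x. h x - D f h x) = (\<lambda>x. 0)"
  shows "h = (\<lambda>x. 0)"
proof -
  have z: "(\<lambda>x. 0) \<in> V_N N" by (simp add: V_N_iff F_N_zero cint_const)
  have Dz: "D f (\<lambda>x. 0) = (\<lambda>x. 0)" using disc_deriv_lin[OF N0 f(2) V_N_F_N[OF z] V_N_F_N[OF z], of \<epsilon> 0 0] by simp
  have "I_minus_D T g \<epsilon> N f h = I_minus_D T g \<epsilon> N f (\<lambda>x. 0)"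
    using h(2) Dz density_facts(4)[OF f V_N_F_N[OF h(1)]] density_facts(4)[OF f V_N_F_N[OF z]] by (simp add: I_minus_D_def)
  thus ?thesis using nd h(1) z unfolding newton_defined_at_def bij_betw_def inj_on_def by blast
qed

text \<open>Rescales \<open>h\<close> to make its image a unit vector, as the operator norm is a supremum over the unit ball. If the image vanishes, the assumed bijectivity applies
  instead.\<close>

lemma admissible_bounded_below:
  assumes ad: "admissible T g \<epsilon> N \<kappa> \<Lambda> \<beta>" and f: "f \<in> BK \<kappa> \<inter> F_N N"
  shows "bounded_below f \<Lambda>" "0 < \<Lambda>"
proof -
  note fE = BK_density[OF f, THEN conjunct1] BK_density[OF f, THEN conjunct2]
  have nd: "newton_defined_at T g \<epsilon> N f" using ad f by (auto simp: admissible_def)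
  let ?I = "inv_I_minus_D T g \<epsilon> N f"
  have op: "opnorm_on (V_N N) ?I < ereal \<Lambda>"
  proof -
    have "opnorm_on (V_N N) ?I \<le> inverse_bound T g \<epsilon> N \<kappa>" unfolding inverse_bound_def by (rule SUP_upper[OF f])
    also have "\<dots> < ereal \<Lambda>" using ad by (simp add: admissible_def)
    finally show ?thesis .
  qed
  have ub: "Wnorm 1 (?I v) < \<Lambda>" if "v \<in> V_N N" "Wnorm 1 v \<le> 1" for v
  proof -
    have "ereal (Wnorm 1 (?I v)) \<le> opnorm_on (V_N N) ?I" unfolding opnorm_on_def by (rule SUP_upper) (use that in auto)
    hence "ereal (Wnorm 1 (?I v)) < ereal \<Lambda>" using op by (rule le_less_trans)
    thus ?thesis by simp
  qed
  have z: "(\<lambda>x. 0) \<in> V_N N" by (simp add: V_N_iff F_N_zero cint_const)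
  show L: "0 < \<Lambda>" using ub[OF z] Wnorm_nonneg[of 1 "?I (\<lambda>x. 0)"] Wnorm_zero_fun by simp
  show "bounded_below f \<Lambda>"
    unfolding bounded_below_def
  proof
    fix h assume h: "h \<in> V_N N"
    let ?y = "\<lambda>x. h x - D f h x"
    have yF: "?y \<in> F_N N" by (intro F_N_diff V_N_F_N[OF h] disc_deriv_F_N N0 fE)
    show "Wnorm 1 h \<le> \<Lambda> * Wnorm 1 ?y"
    proof (cases "Wnorm 1 ?y = 0")
      case True
      have "?y = (\<lambda>x. 0)" by (rule Wnorm_zero[OF yF]) (use True in simp)
      from newton_defined_inj[OF fE nd h this] show ?thesis using True Wnorm_zero_fun by simp
    next
      case False
      hence p: "0 < Wnorm 1 ?y" using Wnorm_nonneg[of 1 ?y] by simp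
      define c where "c = 1 / Wnorm 1 ?y"
      have c: "0 < c" using p by (simp add: c_def)
      let ?h = "\<lambda>x. c * h x"
      have hV: "?h \<in> V_N N" using V_N_lin[OF h h, of c 0] by simp
      have e: "(\<lambda>x. ?h x - D f ?h x) = (\<lambda>x. c * ?y x)"
        using disc_deriv_lin[OF N0 fE(2) V_N_F_N[OF h] V_N_F_N[OF h], of \<epsilon> c 0] by (auto simp: algebra_simps)
      have "D f ?h \<in> F_N N" by (rule disc_deriv_F_N[OF N0 fE(2) V_N_F_N[OF hV]])
      have "(\<lambda>x. ?h x - D f ?h x) \<in> V_N N"
        unfolding V_N_iff
        using F_N_diff[OF V_N_F_N[OF hV] \<open>D f ?h \<in> F_N N\<close>] hV cint_disc_deriv[OF N0 fE(2) V_N_F_N[OF hV], of \<epsilon>]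
          F_N_integrable[OF V_N_F_N[OF hV]] F_N_integrable[OF \<open>D f ?h \<in> F_N N\<close>]
        by (auto simp: cint_diff V_N_iff)
      moreover have "Wnorm 1 (\<lambda>x. ?h x - D f ?h x) = 1" unfolding e using Wnorm_scale[OF yF, of c] p c by (simp add: c_def)
      ultimately have "Wnorm 1 (?I (\<lambda>x. ?h x - D f ?h x)) < \<Lambda>" by (intro ub) auto
      moreover have "?I (\<lambda>x. ?h x - D f ?h x) = ?h"
        by (rule newton_defined(4)[OF N0 fE(2) density_facts(1,2)[OF fE]]) (use newton_defined_inj[OF fE nd] hV in blast)+
      ultimately have "Wnorm 1 ?h < \<Lambda>" by (simp only:)
      hence "c * Wnorm 1 h < \<Lambda>" using Wnorm_scale[OF V_N_F_N[OF h], of c] c by simp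
      thus ?thesis using p by (simp add: c_def field_simps)
    qed
  qed
qed

text \<open>\<open>M + 1\<close> exceeds the supremum of the inverses strictly, and by Lipschitz continuity of the derivative the supremum
  that defines \<open>\<delta>\<close> is positive.\<close>

lemma admissible_exists:
  assumes "all_bounded \<kappa> M" "0 \<le> M"
  shows "\<exists>\<Lambda> \<beta>. admissible T g \<epsilon> N \<kappa> \<Lambda> \<beta>"
proof -
  define \<Lambda> where "\<Lambda> = M + 1"
  have L: "0 < \<Lambda>" using assms(2) by (simp add: \<Lambda>_def)
  have l: "0 \<le> lip_const N \<epsilon>" by (rule lip_quad_nonneg(1)[OF N0])
  define \<delta> where "\<delta> = 1 / (4 * \<Lambda> * (lip_const N \<epsilon> + 1))"
  have d: "0 < \<delta>" using L l by (simp add: \<delta>_def)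
  have "inverse_bound T g \<epsilon> N \<kappa> \<le> ereal M"
    unfolding inverse_bound_def opnorm_on_def
  proof (intro SUP_least)
    fix f v assume f: "f \<in> BK \<kappa> \<inter> F_N N" and v: "v \<in> {h \<in> V_N N. Wnorm 1 h \<le> 1}"
    have "Wnorm 1 (inv_I_minus_D T g \<epsilon> N f v) \<le> M * Wnorm 1 v"
      using assms(1) f v BK_density[OF f] by (intro bounded_below_newton(5)) (auto simp: all_bounded_def)
    also have "\<dots> \<le> M" using v assms(2) by (simp add: mult_left_le)
    finally show "ereal (Wnorm 1 (inv_I_minus_D T g \<epsilon> N f v)) \<le> ereal M" by simp
  qed
  hence i: "inverse_bound T g \<epsilon> N \<kappa> < ereal \<Lambda>" by (rule le_less_trans) (simp add: \<Lambda>_def)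
  have "ereal \<delta> \<le> delta_KN T g \<epsilon> N \<kappa> \<Lambda>"
    unfolding delta_KN_def
  proof (intro Sup_upper imageI CollectI ballI impI)
    fix f k assume f: "f \<in> F_N N \<inter> densities \<inter> BK \<kappa>" and k: "k \<in> F_N N \<inter> densities \<inter> BK \<kappa>" and fk: "Wnorm 1 (\<lambda>x. f x - k x) \<le> \<delta>"
    have fE: "f \<in> densities" "f \<in> F_N N" "k \<in> densities" "k \<in> F_N N" using f k by auto
    show "opnorm_on (F_N N) (\<lambda>h x. D_sc T g \<epsilon> N f h x - D_sc T g \<epsilon> N k h x) \<le> ereal (1 / (4 * \<Lambda>))"
      unfolding opnorm_on_def
    proof (rule SUP_least)
      fix h assume h: "h \<in> {h \<in> F_N N. Wnorm 1 h \<le> 1}"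
      have "Wnorm 1 (\<lambda>x. D f h x - D k h x) \<le> lip_const N \<epsilon> * Wnorm 1 (\<lambda>x. f x - k x) * Wnorm 1 h"
        using h by (intro disc_deriv_lipschitz N0 fE density_facts) auto
      also have "\<dots> \<le> lip_const N \<epsilon> * \<delta> * 1" using h fk l d by (intro mult_mono mult_left_mono mult_nonneg_nonneg Wnorm_nonneg) auto
      also have "\<dots> \<le> (lip_const N \<epsilon> + 1) * \<delta>" using d by simp
      also have "\<dots> = 1 / (4 * \<Lambda>)" using l L by (simp add: \<delta>_def)
      finally show "ereal (Wnorm 1 (\<lambda>x. D_sc T g \<epsilon> N f h x - D_sc T g \<epsilon> N k h x)) \<le> ereal (1 / (4 * \<Lambda>))"
        using h fE by (simp add: density_facts(4))
    qed
  qed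
  hence "ereal (min 1 \<delta>) \<le> min 1 (delta_KN T g \<epsilon> N \<kappa> \<Lambda>)"
    by (metis ereal_min min.mono one_ereal_def order_refl)
  moreover have "\<forall>f\<in>BK \<kappa> \<inter> F_N N. newton_defined_at T g \<epsilon> N f"
    using assms(1) bounded_below_newton(1) BK_density unfolding all_bounded_def by blast
  ultimately have "admissible T g \<epsilon> N \<kappa> \<Lambda> (min 1 \<delta>)" using i d by (simp add: admissible_def)
  thus ?thesis by blast
qed

text \<open>\<open>\<beta>\<close> is at most a supremum that need not be attained, so the closeness of the derivatives is available at every radius
  below \<open>\<beta>\<close> only.\<close>

lemma admissible_close:
  assumes ad: "admissible T g \<epsilon> N \<kappa> \<Lambda> \<beta>" and c: "c < \<beta>"
  obtains \<delta> where "c < \<delta>" "\<And>f k h. f \<in> BK \<kappa> \<inter> F_N N \<Longrightarrow> k \<in> BK \<kappa> \<inter> F_N N \<Longrightarrow> h \<in> F_N N \<Longrightarrow>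
    Wnorm 1 (\<lambda>x. f x - k x) \<le> \<delta> \<Longrightarrow> Wnorm 1 (\<lambda>x. D f h x - D k h x) \<le> 1 / (4 * \<Lambda>) * Wnorm 1 h"
proof -
  have "ereal c < delta_KN T g \<epsilon> N \<kappa> \<Lambda>" using ad c unfolding admissible_def by (meson ereal_less_ereal_Ex less_ereal.simps(1) less_le_trans min.boundedE)
  then obtain \<delta> where \<delta>: "c < \<delta>" and close: "\<And>f k. f \<in> F_N N \<inter> densities \<inter> BK \<kappa> \<Longrightarrow> k \<in> F_N N \<inter> densities \<inter> BK \<kappa> \<Longrightarrow>
       Wnorm 1 (\<lambda>x. f x - k x) \<le> \<delta> \<Longrightarrow>
       opnorm_on (F_N N) (\<lambda>h x. D_sc T g \<epsilon> N f h x - D_sc T g \<epsilon> N k h x) \<le> ereal (1 / (4 * \<Lambda>))"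
    unfolding delta_KN_def less_Sup_iff by auto
  show ?thesis
  proof (rule that[OF \<delta>])
    fix f k h assume f: "f \<in> BK \<kappa> \<inter> F_N N" and k: "k \<in> BK \<kappa> \<inter> F_N N" and h: "h \<in> F_N N" and fk: "Wnorm 1 (\<lambda>x. f x - k x) \<le> \<delta>"
    note fE = BK_density[OF f, THEN conjunct1] BK_density[OF f, THEN conjunct2] and kE = BK_density[OF k, THEN conjunct1] BK_density[OF k, THEN conjunct2]
    have op: "opnorm_on (F_N N) (\<lambda>h x. D_sc T g \<epsilon> N f h x - D_sc T g \<epsilon> N k h x) \<le> ereal (1 / (4 * \<Lambda>))"
      using f k fE kE fk by (intro close) auto
    have u: "Wnorm 1 (\<lambda>x. D f v x - D k v x) \<le> 1 / (4 * \<Lambda>)" if "v \<in> F_N N" "Wnorm 1 v \<le> 1" for v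
    proof -
      have "ereal (Wnorm 1 (\<lambda>x. D_sc T g \<epsilon> N f v x - D_sc T g \<epsilon> N k v x)) \<le> opnorm_on (F_N N) (\<lambda>h x. D_sc T g \<epsilon> N f h x - D_sc T g \<epsilon> N k h x)"
        unfolding opnorm_on_def by (rule SUP_upper) (use that in auto)
      hence "ereal (Wnorm 1 (\<lambda>x. D_sc T g \<epsilon> N f v x - D_sc T g \<epsilon> N k v x)) \<le> ereal (1 / (4 * \<Lambda>))" using op by (rule order_trans)
      thus ?thesis using that by (simp add: density_facts(4)[OF fE] density_facts(4)[OF kE])
    qed
    have DF: "D f h \<in> F_N N" "D k h \<in> F_N N" by (intro disc_deriv_F_N N0 fE kE h)+
    show "Wnorm 1 (\<lambda>x. D f h x - D k h x) \<le> 1 / (4 * \<Lambda>) * Wnorm 1 h"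
    proof (cases "Wnorm 1 h = 0")
      case True
      have hz: "h = (\<lambda>x. 0)" by (rule Wnorm_zero[OF h]) (use True in simp)
      have "D p (\<lambda>x. 0) = (\<lambda>x. 0)" if "p \<in> F_N N" for p using disc_deriv_lin[OF N0 that F_N_zero F_N_zero, of \<epsilon> 0 0] by simp
      thus ?thesis unfolding hz using fE kE by (simp add: Wnorm_zero_fun)
    next
      case False
      hence p: "0 < Wnorm 1 h" using Wnorm_nonneg[of 1 h] by simp
      define c where "c = 1 / Wnorm 1 h"
      have c: "0 < c" using p by (simp add: c_def)
      have s: "D q (\<lambda>x. c * h x) = (\<lambda>x. c * D q h x)" if "q \<in> F_N N" for q using disc_deriv_lin[OF N0 that h h, of \<epsilon> c 0] by simp
      have "Wnorm 1 (\<lambda>x. D f (\<lambda>x. c * h x) x - D k (\<lambda>x. c * h x) x) \<le> 1 / (4 * \<Lambda>)"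
        using Wnorm_scale[OF h, of c] p by (intro u F_N_scale h) (simp add: c_def)
      also have "(\<lambda>x. D f (\<lambda>x. c * h x) x - D k (\<lambda>x. c * h x) x) = (\<lambda>x. c * (D f h x - D k h x))"
        unfolding s[OF fE(2)] s[OF kE(2)] by (auto simp: algebra_simps)
      also have "Wnorm 1 \<dots> = c * Wnorm 1 (\<lambda>x. D f h x - D k h x)" using Wnorm_scale[OF F_N_diff[OF DF], of c] c by simp
      finally have "Wnorm 1 (\<lambda>x. D f h x - D k h x) / Wnorm 1 h \<le> 1 / (4 * \<Lambda>)" by (simp add: c_def)
      thus ?thesis by (subst (asm) pos_divide_le_eq[OF p])
    qed
  qed
qed

end

context discretised begin

lemma segment_BK:
  assumes f: "f \<in> BK \<kappa> \<inter> F_N N" and k: "k \<in> BK \<kappa> \<inter> F_N N" and j: "j \<le> n" and n: "0 < (n::nat)"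
  shows "(\<lambda>x. f x + (real j / real n) * (k x - f x)) \<in> BK \<kappa> \<inter> F_N N"
proof -
  define t where "t = real j / real n"
  have t: "0 \<le> t" "t \<le> 1" using j n by (auto simp: t_def)
  have "(\<lambda>x. (1 - t) * f x + t * k x) \<in> BK ((1 - t) * \<kappa> + t * \<kappa>) \<inter> F_N N" by (rule BK_convex[OF f k t])
  moreover have "(\<lambda>x. (1 - t) * f x + t * k x) = (\<lambda>x. f x + t * (k x - f x))" by (auto simp: algebra_simps)
  moreover have "(1 - t) * \<kappa> + t * \<kappa> = \<kappa>" by (simp add: algebra_simps)
  ultimately show ?thesis by (simp add: t_def)
qed

text \<open>Cut the segment from \<open>f\<close> to \<open>k\<close> into pieces shorter than an admissible radius; on each the derivative changes by at most
  \<open>1 / (4 \<Lambda>)\<close>. Read backwards, two densities with very different derivatives force \<open>\<beta>\<close> to be small.\<close>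

lemma derivative_chain:
  assumes ad: "admissible T g \<epsilon> N \<kappa> \<Lambda> \<beta>" and f: "f \<in> BK \<kappa> \<inter> F_N N" and k: "k \<in> BK \<kappa> \<inter> F_N N" and h: "h \<in> F_N N"
  shows "Wnorm 1 (\<lambda>x. D k h x - D f h x) \<le> (2 * Wnorm 1 (\<lambda>x. k x - f x) / \<beta> + 1) / (4 * \<Lambda>) * Wnorm 1 h"
proof -
  define w where "w = Wnorm 1 (\<lambda>x. k x - f x)"
  have w0: "0 \<le> w" unfolding w_def by (rule Wnorm_nonneg)
  have b: "0 < \<beta>" using ad by (simp add: admissible_def)
  have L: "0 < \<Lambda>" by (rule admissible_bounded_below(2)[OF ad f])
  obtain \<delta> where \<delta>: "\<beta> / 2 < \<delta>" and close: "\<And>f k h. f \<in> BK \<kappa> \<inter> F_N N \<Longrightarrow> k \<in> BK \<kappa> \<inter> F_N N \<Longrightarrow> h \<in> F_N N \<Longrightarrow>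
    Wnorm 1 (\<lambda>x. f x - k x) \<le> \<delta> \<Longrightarrow> Wnorm 1 (\<lambda>x. D f h x - D k h x) \<le> 1 / (4 * \<Lambda>) * Wnorm 1 h"
    using admissible_close[OF ad, of "\<beta> / 2"] b by auto
  have d0: "0 < \<delta>" using \<delta> b by linarith
  define n where "n = nat \<lfloor>w / \<delta>\<rfloor> + 1"
  have n0: "0 < n" by (simp add: n_def)
  have wd0: "0 \<le> w / \<delta>" using w0 d0 by simp
  have n1: "w / \<delta> \<le> real n" "real n \<le> w / \<delta> + 1" unfolding n_def using wd0 by linarith+
  have nb: "real n \<le> 2 * w / \<beta> + 1"
  proof -
    have "w / \<delta> \<le> w / (\<beta> / 2)" using \<delta> b w0 by (intro divide_left_mono) auto
    also have "\<dots> = 2 * w / \<beta>" by simp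
    finally show ?thesis using n1(2) by linarith
  qed
  have kf: "(\<lambda>x. k x - f x) \<in> F_N N" using f k by (intro F_N_diff) auto
  define p where "p j = (\<lambda>x. f x + (real j / real n) * (k x - f x))" for j
  have pB: "p j \<in> BK \<kappa> \<inter> F_N N" if "j \<le> n" for j unfolding p_def by (rule segment_BK[OF f k that n0])
  have p0: "p 0 = f" by (simp add: p_def)
  have pn: "p n = k" using n0 by (simp add: p_def)
  have st: "Wnorm 1 (\<lambda>x. p (Suc j) x - p j x) \<le> \<delta>" for j
  proof -
    have "(\<lambda>x. p (Suc j) x - p j x) = (\<lambda>x. (1 / real n) * (k x - f x))"
      by (auto simp: p_def add_divide_distrib algebra_simps)
    hence "Wnorm 1 (\<lambda>x. p (Suc j) x - p j x) = w / real n" using Wnorm_scale[OF kf, of "1 / real n"] by (simp add: w_def)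
    also have "\<dots> \<le> \<delta>" using n1(1) n0 d0 by (simp add: field_simps)
    finally show ?thesis .
  qed
  have DF: "D (p j) h \<in> F_N N" if "j \<le> n" for j using pB[OF that] by (intro disc_deriv_F_N N0 h) auto
  have dd: "Wnorm 1 (\<lambda>x. D (p (Suc j)) h x - D (p j) h x) \<le> 1 / (4 * \<Lambda>) * Wnorm 1 h" if "j < n" for j
    by (rule close[OF pB pB h st]) (use that in auto)
  have tel: "(\<lambda>x. D k h x - D f h x) = (\<lambda>x. \<Sum>j<n. D (p (Suc j)) h x - D (p j) h x)"
    using sum_lessThan_telescope[of "\<lambda>j. D (p j) h _" n] by (simp add: p0 pn)
  have "Wnorm 1 (\<lambda>x. D k h x - D f h x) \<le> (\<Sum>j<n. Wnorm 1 (\<lambda>x. D (p (Suc j)) h x - D (p j) h x))"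
    unfolding tel by (rule Wnorm_sum[where N = N, THEN conjunct2]) (intro F_N_diff DF, auto)
  also have "\<dots> \<le> (\<Sum>j<n. 1 / (4 * \<Lambda>) * Wnorm 1 h)" by (intro sum_mono dd) auto
  also have "\<dots> = real n * (1 / (4 * \<Lambda>) * Wnorm 1 h)" by simp
  also have "\<dots> \<le> (2 * w / \<beta> + 1) * (1 / (4 * \<Lambda>) * Wnorm 1 h)"
    using nb L by (intro mult_right_mono mult_nonneg_nonneg Wnorm_nonneg) auto
  finally show ?thesis by (simp add: w_def)
qed

lemma bounded_below_perturb:
  assumes f: "f \<in> densities" "f \<in> F_N N" and f': "f' \<in> F_N N" and bb: "bounded_below f' M" and M: "0 \<le> M"
    and d: "Wnorm 1 (\<lambda>x. f x - f' x) \<le> d" "lip_const N \<epsilon> * d * M \<le> 1/2"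
  shows "bounded_below f (2 * M)"
  unfolding bounded_below_def
proof
  fix h assume h: "h \<in> V_N N"
  note hF = V_N_F_N[OF h]
  have DF: "D f h \<in> F_N N" "D f' h \<in> F_N N" by (intro disc_deriv_F_N N0 f f' hF)+
  have l: "0 \<le> lip_const N \<epsilon>" by (rule lip_quad_nonneg(1)[OF N0])
  have "Wnorm 1 (\<lambda>x. D f h x - D f' h x) \<le> lip_const N \<epsilon> * Wnorm 1 (\<lambda>x. f x - f' x) * Wnorm 1 h"
    by (intro disc_deriv_lipschitz N0 f f' hF density_facts[OF f])
  also have "\<dots> \<le> lip_const N \<epsilon> * d * Wnorm 1 h" using d l by (intro mult_right_mono mult_left_mono Wnorm_nonneg) auto
  finally have dd: "Wnorm 1 (\<lambda>x. D f h x - D f' h x) \<le> lip_const N \<epsilon> * d * Wnorm 1 h" .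
  have "(\<lambda>x. h x - D f' h x) = (\<lambda>x. (h x - D f h x) + (D f h x - D f' h x))" by auto
  hence "Wnorm 1 (\<lambda>x. h x - D f' h x) \<le> Wnorm 1 (\<lambda>x. h x - D f h x) + Wnorm 1 (\<lambda>x. D f h x - D f' h x)"
    using Wnorm_triangle[OF F_N_diff[OF hF DF(1)] F_N_diff[OF DF]] by simp
  hence "Wnorm 1 (\<lambda>x. h x - D f' h x) \<le> Wnorm 1 (\<lambda>x. h x - D f h x) + lip_const N \<epsilon> * d * Wnorm 1 h" using dd by linarith
  hence "M * Wnorm 1 (\<lambda>x. h x - D f' h x) \<le> M * (Wnorm 1 (\<lambda>x. h x - D f h x) + lip_const N \<epsilon> * d * Wnorm 1 h)"
    using M by (rule mult_left_mono)
  moreover have "Wnorm 1 h \<le> M * Wnorm 1 (\<lambda>x. h x - D f' h x)" using bb h by (simp add: bounded_below_def)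
  moreover have "(lip_const N \<epsilon> * d * M) * Wnorm 1 h \<le> 1/2 * Wnorm 1 h" using d(2) by (intro mult_right_mono Wnorm_nonneg)
  ultimately show "Wnorm 1 h \<le> 2 * M * Wnorm 1 (\<lambda>x. h x - D f h x)" by (simp add: algebra_simps)
qed

text \<open>A density slightly outside \<open>BK \<kappa>\<close> is close to one inside. The gain \<open>\<eta>\<close> is inversely proportional to \<open>M\<close>, so near a
  radius at which invertibility fails the constant \<open>M\<close> must be large.\<close>

lemma all_bounded_extend:
  assumes ab: "all_bounded \<kappa> M" and M: "0 < M" and \<kappa>: "1 \<le> \<kappa>"
  obtains \<eta> where "0 < \<eta>" "\<eta> = 1 / (4 * (lip_const N \<epsilon> + 1) * M)" "all_bounded (\<kappa> + \<eta>) (2 * M)"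
proof -
  have l: "0 \<le> lip_const N \<epsilon>" by (rule lip_quad_nonneg(1)[OF N0])
  define \<eta> where "\<eta> = 1 / (4 * (lip_const N \<epsilon> + 1) * M)"
  have e: "0 < \<eta>" using l M by (simp add: \<eta>_def)
  have "all_bounded (\<kappa> + \<eta>) (2 * M)"
    unfolding all_bounded_def
  proof
    fix f assume f: "f \<in> BK (\<kappa> + \<eta>) \<inter> F_N N"
    obtain f' where f': "f' \<in> BK \<kappa> \<inter> F_N N" "Wnorm 1 (\<lambda>x. f x - f' x) \<le> 2 * \<eta>" using BK_shrink[OF N0 f \<kappa> e] .
    show "bounded_below f (2 * M)"
    proof (rule bounded_below_perturb)
      show "bounded_below f' M" using ab f'(1) by (simp add: all_bounded_def)
      have "lip_const N \<epsilon> * (2 * \<eta>) * M \<le> (lip_const N \<epsilon> + 1) * (2 * \<eta>) * M" using e M by (intro mult_right_mono) auto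
      also have "\<dots> = 1/2" using l M by (simp add: \<eta>_def)
      finally show "lip_const N \<epsilon> * (2 * \<eta>) * M \<le> 1/2" .
    qed (use f f' M BK_density[OF f] in auto)
  qed
  thus ?thesis using that e \<eta>_def by blast
qed

lemma all_bounded_mono: "all_bounded \<kappa> M \<Longrightarrow> \<kappa>' \<le> \<kappa> \<Longrightarrow> all_bounded \<kappa>' M"
  using BK_mono unfolding all_bounded_def by blast

lemma Wnorm1_BK: "f \<in> BK \<kappa> \<inter> F_N N \<Longrightarrow> Wnorm 1 f \<le> \<kappa>"
proof -
  assume f: "f \<in> BK \<kappa> \<inter> F_N N"
  hence F: "f \<in> F_N N" by simp
  have "Wnorm 1 f \<le> Wnorm 2 f" unfolding Wnorm1_F_N[OF F] Wnorm2_F_N[OF F] using cint_nonneg[of "\<lambda>x. \<bar>deriv (deriv f) x\<bar>"] by simp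
  thus ?thesis using f by (simp add: BK_def)
qed

text \<open>Let \<open>Ks\<close> be the supremum of the radii at which \<open>I - D\<^sub>f\<close> is uniformly invertible. At \<open>\<kappa>\<close> just below \<open>Ks\<close> some density
  \<open>f\<close> has a nearly singular \<open>I - D\<^sub>f\<close>, so \<open>\<Lambda>\<close> exceeds a given \<open>Mb\<close>. At \<open>hs\<close> the inverse is bounded by \<open>M0\<close>, hence the derivatives at
  \<open>f\<close> and \<open>hs\<close> differ by at least \<open>1 / (2 M0)\<close> in some direction, whereas along the segment they differ by at most
  \<open>(4 KM / \<beta> + 1) / (4 \<Lambda>)\<close>. So \<open>\<beta> = O(1 / \<Lambda>)\<close>. The second conclusion lets the ball around \<open>hs\<close> fit into \<open>BK \<kappa>\<close>.\<close>

lemma small_radius_before_failure: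
  assumes hs: "hs \<in> BK K \<inter> F_N N" and K: "1 \<le> K" and Q: "all_bounded K M0" "0 < M0"
    and fail: "\<And>M. \<not> all_bounded KM M" and KM: "K \<le> KM" and c: "0 < c" and r: "0 < r"
  obtains \<kappa> where "K < \<kappa>" "\<kappa> \<le> KM" "\<exists>M\<ge>0. all_bounded \<kappa> M"
    "\<And>\<Lambda> \<beta>. admissible T g \<epsilon> N \<kappa> \<Lambda> \<beta> \<Longrightarrow> \<beta> \<le> c \<and> K + r * \<beta> \<le> \<kappa>"
proof -
  define Z where "Z = {\<kappa>. K \<le> \<kappa> \<and> \<kappa> \<le> KM \<and> (\<exists>M. all_bounded \<kappa> M)}"
  have KZ: "K \<in> Z" using Q KM by (auto simp: Z_def)
  have bdd: "bdd_above Z" by (rule bdd_aboveI[of _ KM]) (simp add: Z_def)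
  define Ks where "Ks = Sup Z"
  have pos: "all_bounded \<kappa> (max M 1)" if "all_bounded \<kappa> M" for \<kappa> M
  proof -
    have "M * a \<le> max M 1 * a" if "0 \<le> a" for a :: real using that by (intro mult_right_mono) auto
    hence "bounded_below f (max M 1)" if "bounded_below f M" for f
      using that Wnorm_nonneg unfolding bounded_below_def by (meson order_trans)
    thus ?thesis using that by (auto simp: all_bounded_def)
  qed
  have upper: "\<not> all_bounded \<kappa> M" if "Ks < \<kappa>" for \<kappa> M
  proof
    assume ab: "all_bounded \<kappa> M"
    show False
    proof (cases "\<kappa> \<le> KM")
      case True
      have "K \<le> Ks" unfolding Ks_def by (rule cSup_upper[OF KZ bdd])
      hence "\<kappa> \<in> Z" using True ab that by (auto simp: Z_def)
      hence "\<kappa> \<le> Ks" unfolding Ks_def by (rule cSup_upper[OF _ bdd])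
      thus False using that by simp
    next
      case False
      thus False using all_bounded_mono[OF ab, of KM] fail by simp
    qed
  qed
  have lower: "\<exists>M\<ge>0. all_bounded \<kappa> M" if lt: "\<kappa> < Ks" for \<kappa>
  proof -
    obtain z where z: "z \<in> Z" "\<kappa> < z" using lt KZ unfolding Ks_def by (metis empty_iff less_cSup_iff[OF _ bdd])
    then obtain M where "all_bounded z M" by (auto simp: Z_def)
    from pos[OF all_bounded_mono[OF this less_imp_le[OF z(2)]]] show ?thesis by (intro exI[of _ "max M 1"]) auto
  qed
  have KKs: "K < Ks"
  proof -
    obtain \<eta> where "0 < \<eta>" "all_bounded (K + \<eta>) (2 * M0)" using all_bounded_extend[OF Q K] by blast
    thus ?thesis using upper[of "K + \<eta>"] by (meson less_add_same_cancel1 linorder_not_le order_less_le_trans)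
  qed
  have KsM: "Ks \<le> KM" unfolding Ks_def by (rule cSup_least) (use KZ in \<open>auto simp: Z_def\<close>)
  define c' where "c' = min c ((Ks - K) / (2 * r))"
  have c': "0 < c'" using c r KKs by (simp add: c'_def)
  \<comment> \<open>If \<open>\<Lambda>\<close> exceeds this value, then \<open>\<beta> \<le> c'\<close>.\<close>
  define Mb where "Mb = 2 * M0 + 4 * KM * M0 / c'"
  have KM0: "1 \<le> KM" using K KM by simp
  have Mb: "0 < Mb" "2 * M0 \<le> Mb" using Q KM0 c' by (auto simp: Mb_def intro!: add_pos_nonneg)
  \<comment> \<open>A bound \<open>Mb\<close> at \<open>\<kappa>\<close> would extend to the radius \<open>\<kappa> + \<eta>b\<close>, beyond the supremum.\<close>
  define \<eta>b where "\<eta>b = 1 / (4 * (lip_const N \<epsilon> + 1) * Mb)"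
  have eb: "0 < \<eta>b" using lip_quad_nonneg(1)[OF N0, of \<epsilon>] Mb by (simp add: \<eta>b_def)
  define \<kappa> where "\<kappa> = max ((K + Ks) / 2) (Ks - \<eta>b / 2)"
  have k1: "(K + Ks) / 2 \<le> \<kappa>" "Ks - \<eta>b / 2 \<le> \<kappa>" by (auto simp: \<kappa>_def)
  have k2: "\<kappa> < Ks" using KKs eb by (simp add: \<kappa>_def)
  have k3: "K < \<kappa>" using less_le_trans[OF _ k1(1), of K] KKs by simp
  have notMb: "\<not> all_bounded \<kappa> Mb"
  proof
    assume "all_bounded \<kappa> Mb"
    then obtain \<eta> where "\<eta> = 1 / (4 * (lip_const N \<epsilon> + 1) * Mb)" "all_bounded (\<kappa> + \<eta>) (2 * Mb)"
      using all_bounded_extend Mb(1) K k3 by (metis less_imp_le order_trans)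
    hence "all_bounded (\<kappa> + \<eta>b) (2 * Mb)" by (simp add: \<eta>b_def)
    thus False using upper[of "\<kappa> + \<eta>b"] k1 eb by simp
  qed
  show ?thesis
  proof (rule that[OF k3])
    show "\<kappa> \<le> KM" using k2 KsM by simp
    show "\<exists>M\<ge>0. all_bounded \<kappa> M" by (rule lower[OF k2])
    fix \<Lambda> \<beta> assume ad: "admissible T g \<epsilon> N \<kappa> \<Lambda> \<beta>"
    have b: "0 < \<beta>" using ad by (simp add: admissible_def)
    obtain f where f: "f \<in> BK \<kappa> \<inter> F_N N" "\<not> bounded_below f Mb" using notMb by (auto simp: all_bounded_def)
    then obtain h where h: "h \<in> V_N N" "Mb * Wnorm 1 (\<lambda>x. h x - D f h x) < Wnorm 1 h" by (auto simp: bounded_below_def not_le)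
    have bbf: "bounded_below f \<Lambda>" "0 < \<Lambda>" using admissible_bounded_below[OF ad f(1)] by auto
    have LM: "Mb < \<Lambda>"
    proof (rule ccontr)
      assume "\<not> Mb < \<Lambda>"
      hence "\<Lambda> * Wnorm 1 (\<lambda>x. h x - D f h x) \<le> Mb * Wnorm 1 (\<lambda>x. h x - D f h x)" by (intro mult_right_mono Wnorm_nonneg) auto
      thus False using bbf(1) h unfolding bounded_below_def by force
    qed
    define w where "w = Wnorm 1 h"
    define y where "y = Wnorm 1 (\<lambda>x. h x - D f h x)"
    define z where "z = Wnorm 1 (\<lambda>x. D f h x - D hs h x)"
    note hF = V_N_F_N[OF h(1)]
    have hsk: "hs \<in> BK \<kappa> \<inter> F_N N" using hs BK_mono[of K \<kappa>] k3 by auto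
    have DF: "D f h \<in> F_N N" "D hs h \<in> F_N N" using f hs by (auto intro!: disc_deriv_F_N N0 hF)
    have y0: "0 \<le> y" "0 \<le> z" unfolding y_def z_def by (rule Wnorm_nonneg)+
    have wp: "0 < w" using h(2) y0 Mb unfolding w_def y_def by (meson le_less_trans mult_nonneg_nonneg less_imp_le)
    have "bounded_below hs M0" using Q(1) hs by (simp add: all_bounded_def)
    hence "w \<le> M0 * Wnorm 1 (\<lambda>x. h x - D hs h x)" using h(1) by (simp add: bounded_below_def w_def)
    also have "\<dots> \<le> M0 * (y + z)"
    proof (intro mult_left_mono)
      have "(\<lambda>x. h x - D hs h x) = (\<lambda>x. (h x - D f h x) + (D f h x - D hs h x))" by auto
      thus "Wnorm 1 (\<lambda>x. h x - D hs h x) \<le> y + z"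
        unfolding y_def z_def using Wnorm_triangle[OF F_N_diff[OF hF DF(1)] F_N_diff[OF DF]] by simp
    qed (use Q in simp)
    finally have wz: "w \<le> M0 * y + M0 * z" by (simp add: distrib_left)
    have "M0 * y \<le> w / 2"
    proof -
      have "2 * M0 * y \<le> Mb * y" using Mb y0 by (intro mult_right_mono) auto
      thus ?thesis using h(2) by (simp add: w_def y_def)
    qed
    hence wz2: "w / 2 \<le> M0 * z" using wz by simp
    have fhs: "Wnorm 1 (\<lambda>x. f x - hs x) \<le> 2 * KM"
      using Wnorm_diff[of f N hs] Wnorm1_BK[OF f(1)] Wnorm1_BK[OF hs] f hs k2 KsM KM by simp
    have "z \<le> (2 * Wnorm 1 (\<lambda>x. f x - hs x) / \<beta> + 1) / (4 * \<Lambda>) * w"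
      unfolding z_def w_def by (rule derivative_chain[OF ad hsk f(1) hF])
    also have "\<dots> \<le> (4 * KM / \<beta> + 1) / (4 * \<Lambda>) * w"
      using fhs b bbf(2) wp by (intro mult_right_mono divide_right_mono add_right_mono) (auto simp: divide_right_mono)
    finally have "M0 * z \<le> M0 * ((4 * KM / \<beta> + 1) / (4 * \<Lambda>) * w)" using Q(2) by (intro mult_left_mono) auto
    with wz2 have "w / 2 \<le> M0 * ((4 * KM / \<beta> + 1) / (4 * \<Lambda>) * w)" by (rule order_trans)
    moreover have "M0 * ((4 * KM / \<beta> + 1) / (4 * \<Lambda>) * w) = w * (M0 * ((4 * KM / \<beta> + 1) / (4 * \<Lambda>)))" by (simp only: mult_ac)
    moreover have "w / 2 = w * (1/2)" by simp
    ultimately have "w * (1/2) \<le> w * (M0 * ((4 * KM / \<beta> + 1) / (4 * \<Lambda>)))" by (simp only:)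
    hence "1/2 \<le> M0 * ((4 * KM / \<beta> + 1) / (4 * \<Lambda>))" using wp by (simp only: mult_le_cancel_left_pos)
    hence "2 * \<Lambda> \<le> M0 * (4 * KM / \<beta> + 1)"
    proof -
      define X where "X = 4 * KM / \<beta> + 1"
      assume "1/2 \<le> M0 * ((4 * KM / \<beta> + 1) / (4 * \<Lambda>))"
      hence "1/2 \<le> (M0 * X) / (4 * \<Lambda>)" by (simp add: X_def[symmetric])
      hence "1/2 * (4 * \<Lambda>) \<le> M0 * X" using bbf(2) by (subst (asm) pos_le_divide_eq) auto
      thus ?thesis by (simp add: X_def[symmetric])
    qed
    hence "2 * Mb \<le> M0 * (4 * KM / \<beta>) + M0" using LM by (simp add: algebra_simps)
    hence "Mb \<le> M0 * (4 * KM / \<beta>)" using Mb Q by linarith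
    hence "4 * KM * M0 / c' \<le> 4 * KM * M0 / \<beta>" using Q by (simp add: Mb_def mult_ac)
    hence "\<beta> \<le> c'"
    proof -
      have p: "0 < 4 * KM * M0" using KM0 Q by simp
      assume "4 * KM * M0 / c' \<le> 4 * KM * M0 / \<beta>"
      moreover have "4 * KM * M0 / \<beta> < 4 * KM * M0 / c'" if "c' < \<beta>"
        using that p b c' by (intro divide_strict_left_mono) auto
      ultimately show ?thesis by (meson linorder_not_le)
    qed
    hence bc: "\<beta> \<le> c" and br: "\<beta> \<le> (Ks - K) / (2 * r)" by (auto simp: c'_def)
    moreover have "r * \<beta> \<le> r * ((Ks - K) / (2 * r))" using br r by (intro mult_left_mono) auto
    moreover have "r * ((Ks - K) / (2 * r)) = (Ks - K) / 2" using r by simp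
    ultimately have "r * \<beta> \<le> (Ks - K) / 2" by (simp only:)
    moreover have "K + (Ks - K) / 2 = (K + Ks) / 2" by (simp add: field_simps)
    ultimately have "K + r * \<beta> \<le> \<kappa>" using k1(1) by simp
    thus "\<beta> \<le> c \<and> K + r * \<beta> \<le> \<kappa>" using bc by simp
  qed
qed

text \<open>The mean value inequality on the segment, by a subdivision whose quadratic remainders vanish in the limit. It replaces an
  integral of the derivative along the segment.\<close>

lemma mean_value_newton:
  assumes f: "f \<in> BK \<kappa> \<inter> F_N N" and k: "k \<in> BK \<kappa> \<inter> F_N N" and c: "0 \<le> c"
    and close: "\<And>p h. p \<in> BK \<kappa> \<inter> F_N N \<Longrightarrow> Wnorm 1 (\<lambda>x. p x - f x) \<le> Wnorm 1 (\<lambda>x. f x - k x) \<Longrightarrow> h \<in> F_N N \<Longrightarrow>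
       Wnorm 1 (\<lambda>x. D p h x - D f h x) \<le> c * Wnorm 1 h"
  shows "Wnorm 1 (\<lambda>x. disc_op N \<epsilon> f x - disc_op N \<epsilon> k x - D f (\<lambda>y. f y - k y) x) \<le> c * Wnorm 1 (\<lambda>x. f x - k x)"
proof -
  define u where "u = (\<lambda>x. f x - k x)"
  define w where "w = Wnorm 1 u"
  have fE: "f \<in> densities" "f \<in> F_N N" and kE: "k \<in> densities" "k \<in> F_N N" using BK_density[OF f] BK_density[OF k] by auto
  have uF: "u \<in> F_N N" unfolding u_def by (rule F_N_diff[OF fE(2) kE(2)])
  have w0: "0 \<le> w" unfolding w_def by (rule Wnorm_nonneg)
  have q0: "0 \<le> quad_const N \<epsilon>" by (rule lip_quad_nonneg(2)[OF N0])
  let ?R = "\<lambda>x. disc_op N \<epsilon> f x - disc_op N \<epsilon> k x - D f u x"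
  have main: "Wnorm 1 ?R \<le> c * w + quad_const N \<epsilon> * w\<^sup>2 / real n" if n: "0 < n" for n :: nat
  proof -
    define p where "p j = (\<lambda>x. k x + (real j / real n) * (f x - k x))" for j
    have pB: "p j \<in> BK \<kappa> \<inter> F_N N" if "j \<le> n" for j unfolding p_def by (rule segment_BK[OF k f that n])
    define v where "v = (\<lambda>x. (1 / real n) * u x)"
    have vF: "v \<in> F_N N" unfolding v_def by (rule F_N_scale[OF uF])
    have vw: "Wnorm 1 v = w / real n" using Wnorm_scale[OF uF, of "1 / real n"] by (simp add: v_def w_def)
    have pd: "(\<lambda>y. p (Suc j) y - p j y) = v" for j
      by (auto simp: p_def v_def u_def add_divide_distrib algebra_simps)
    define F where "F j = (\<lambda>x. (disc_op N \<epsilon> (p (Suc j)) x - disc_op N \<epsilon> (p j) x - D (p j) v x) + (D (p j) v x - D f v x))" for j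
    have PF: "disc_op N \<epsilon> (p j) \<in> F_N N" "D (p j) v \<in> F_N N" if "j \<le> n" for j
      using pB[OF that] by (auto intro!: disc_op_F_N disc_deriv_F_N N0 vF)
    have DfF: "D f v \<in> F_N N" by (intro disc_deriv_F_N N0 fE vF)
    have FF: "F j \<in> F_N N" if "j < n" for j
      unfolding F_def using that by (intro F_N_add F_N_diff PF DfF) auto
    have Fb: "Wnorm 1 (F j) \<le> quad_const N \<epsilon> * (w / real n)\<^sup>2 + c * (w / real n)" if j: "j < n" for j
    proof -
      note pj = pB[of j] pB[of "Suc j"]
      have pE: "p j \<in> densities" "p j \<in> F_N N" "p (Suc j) \<in> F_N N" using BK_density[OF pj(1)] BK_density[OF pj(2)] j by auto
      have "Wnorm 1 (F j) \<le> Wnorm 1 (\<lambda>x. disc_op N \<epsilon> (p (Suc j)) x - disc_op N \<epsilon> (p j) x - D (p j) v x) + Wnorm 1 (\<lambda>x. D (p j) v x - D f v x)"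
        unfolding F_def using j by (intro Wnorm_triangle[where N = N] F_N_diff PF DfF) auto
      moreover have "Wnorm 1 (\<lambda>x. disc_op N \<epsilon> (p (Suc j)) x - disc_op N \<epsilon> (p j) x - D (p j) v x) \<le> quad_const N \<epsilon> * (w / real n)\<^sup>2"
        using disc_op_quad[OF N0 pE(2) density_facts(1)[OF pE(1,2)] pE(3)] unfolding pd vw .
      moreover have "Wnorm 1 (\<lambda>x. D (p j) v x - D f v x) \<le> c * (w / real n)"
      proof -
        define t where "t = 1 - real j / real n"
        have t: "0 \<le> t" "t \<le> 1" using j n by (auto simp: t_def)
        have "(\<lambda>x. p j x - f x) = (\<lambda>x. (- t) * u x)" by (auto simp: p_def u_def t_def algebra_simps)
        hence "Wnorm 1 (\<lambda>x. p j x - f x) = t * w" using Wnorm_scale[OF uF, of "- t"] t by (simp add: w_def)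
        also have "\<dots> \<le> w" using t w0 by (simp add: mult_left_le_one_le)
        finally have "Wnorm 1 (\<lambda>x. p j x - f x) \<le> Wnorm 1 (\<lambda>x. f x - k x)" by (simp only: w_def u_def)
        from close[OF pj(1) this vF] j show ?thesis by (simp add: vw)
      qed
      ultimately show ?thesis by linarith
    qed
    have eq: "?R = (\<lambda>x. \<Sum>j<n. F j x)"
    proof
      fix x
      have "(\<Sum>j<n. F j x) = (\<Sum>j<n. (disc_op N \<epsilon> (p (Suc j)) x - disc_op N \<epsilon> (p j) x) - D f v x)"
        by (intro sum.cong) (auto simp: F_def)
      also have "\<dots> = (\<Sum>j<n. disc_op N \<epsilon> (p (Suc j)) x - disc_op N \<epsilon> (p j) x) - (\<Sum>j<n. D f v x)"
        by (rule sum_subtractf)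
      also have "(\<Sum>j<n. D f v x) = real n * D f v x" by simp
      also have "(\<Sum>j<n. disc_op N \<epsilon> (p (Suc j)) x - disc_op N \<epsilon> (p j) x) = disc_op N \<epsilon> (p n) x - disc_op N \<epsilon> (p 0) x"
        by (rule sum_lessThan_telescope)
      also have "D f v x = (1 / real n) * D f u x"
        using disc_deriv_lin[OF N0 fE(2) uF uF, of \<epsilon> "1 / real n" 0] by (simp add: v_def)
      finally show "?R x = (\<Sum>j<n. F j x)" using n by (simp add: p_def)
    qed
    have "Wnorm 1 ?R \<le> (\<Sum>j<n. Wnorm 1 (F j))" unfolding eq by (rule Wnorm_sum[where N = N, THEN conjunct2]) (rule FF)
    also have "\<dots> \<le> (\<Sum>j<n. quad_const N \<epsilon> * (w / real n)\<^sup>2 + c * (w / real n))" by (intro sum_mono Fb) auto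
    also have "\<dots> = c * w + quad_const N \<epsilon> * w\<^sup>2 / real n" using n by (simp add: power2_eq_square field_simps)
    finally show ?thesis .
  qed
  have "Wnorm 1 ?R \<le> c * w"
  proof (rule field_le_epsilon)
    fix e :: real assume e: "0 < e"
    define n where "n = nat \<lceil>quad_const N \<epsilon> * w\<^sup>2 / e\<rceil> + 1"
    have n: "0 < n" by (simp add: n_def)
    have "quad_const N \<epsilon> * w\<^sup>2 / e \<le> real n" unfolding n_def by linarith
    hence "quad_const N \<epsilon> * w\<^sup>2 / real n \<le> e" using e n by (simp add: field_simps)
    thus "Wnorm 1 ?R \<le> c * w + e" using main[OF n] by linarith
  qed
  thus ?thesis by (simp only: w_def u_def)
qed

text \<open>The new error is \<open>(I - D\<^sub>h)\<^sup>-\<^sup>1\<close> applied to the Taylor remainder \<open>E\<close> of the operator between \<open>hs\<close> and \<open>h\<close>. The inverse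
  costs \<open>\<Lambda>\<close>; the remainder is bounded by \<open>1 / (4 \<Lambda>)\<close> times the error by the choice of \<open>\<beta>\<close>, and quadratically by smoothness.\<close>

lemma newton_step_contracts:
  assumes ad: "admissible T g \<epsilon> N \<kappa> \<Lambda> \<beta>" and hs: "hs \<in> BK \<kappa> \<inter> F_N N" "disc_op N \<epsilon> hs = hs"
    and h: "h \<in> BK \<kappa> \<inter> F_N N" "Wnorm 1 (\<lambda>x. h x - hs x) < \<beta>"
  defines "h1 \<equiv> newton_step T g \<epsilon> N h"
  shows "h1 \<in> F_N N" "cint h1 = 1"
    "Wnorm 1 (\<lambda>x. h1 x - hs x) \<le> Wnorm 1 (\<lambda>x. h x - hs x) / 4"
    "Wnorm 1 (\<lambda>x. h1 x - hs x) \<le> \<Lambda> * quad_const N \<epsilon> * (Wnorm 1 (\<lambda>x. h x - hs x))\<^sup>2"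
proof -
  have hE: "h \<in> densities" "h \<in> F_N N" and sE: "hs \<in> densities" "hs \<in> F_N N" using BK_density[OF h(1)] BK_density[OF hs(1)] by auto
  have bb: "bounded_below h \<Lambda>" "0 < \<Lambda>" using admissible_bounded_below[OF ad h(1)] by auto
  note nb = bounded_below_newton[OF hE bb(1)]
  define w where "w = (\<lambda>x. h x - hs x)"
  define E where "E = (\<lambda>x. disc_op N \<epsilon> h x - disc_op N \<epsilon> hs x - D h w x)"
  have wV: "w \<in> V_N N" unfolding w_def V_N_iff
    using F_N_diff[OF hE(2) sE(2)] density_F_N[OF hE] density_F_N[OF sE] by (simp add: cint_diff)
  note wF = V_N_F_N[OF wV]
  have DF: "D h w \<in> F_N N" by (intro disc_deriv_F_N N0 hE wF)
  have PF: "disc_op N \<epsilon> h \<in> F_N N" "disc_op N \<epsilon> hs \<in> F_N N" by (intro disc_op_F_N N0 hE sE)+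
  have EF: "E \<in> F_N N" unfolding E_def by (intro F_N_diff PF DF)
  have iF: "integrable circ (disc_op N \<epsilon> h)" "integrable circ (disc_op N \<epsilon> hs)" "integrable circ (D h w)"
    using PF DF F_N_integrable by auto
  have "cint E = cint (disc_op N \<epsilon> h) - cint (disc_op N \<epsilon> hs) - cint (D h w)"
    unfolding E_def using iF by (simp add: cint_diff)
  also have "\<dots> = 0" using cint_disc_op[OF N0 hE(2)] cint_disc_op[OF N0 sE(2)] cint_disc_deriv[OF N0 hE(2) wF] density_F_N[OF hE] density_F_N[OF sE] wV
    by (simp add: V_N_iff)
  finally have EV: "E \<in> V_N N" using EF by (simp add: V_N_iff)
  define z where "z = inv_I_minus_D T g \<epsilon> N h E"
  have zV: "z \<in> V_N N" unfolding z_def by (rule nb(2)[OF EV])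
  have Ez: "E x = z x - D h z x" for x using nb(3)[OF EV] unfolding z_def by metis
  have zW: "Wnorm 1 z \<le> \<Lambda> * Wnorm 1 E" unfolding z_def by (rule nb(5)[OF EV])
  have wzV: "(\<lambda>x. w x - z x) \<in> V_N N" using V_N_lin[OF wV zV, of 1 "-1"] by simp
  have Dwz: "D h (\<lambda>x. w x - z x) = (\<lambda>x. D h w x - D h z x)"
    using disc_deriv_lin[OF N0 hE(2) wF V_N_F_N[OF zV], of \<epsilon> 1 "-1"] by simp
  have "(\<lambda>y. h y - \<Phi> h y) = (\<lambda>x. (w x - z x) - D h (\<lambda>x. w x - z x) x)"
  proof
    fix y
    have "h y - \<Phi> h y = w y - D h w y - E y" using hs(2) by (simp add: density_facts(3)[OF hE] E_def w_def)
    thus "h y - \<Phi> h y = (w y - z y) - D h (\<lambda>x. w x - z x) y" unfolding Dwz Ez by simp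
  qed
  hence "inv_I_minus_D T g \<epsilon> N h (\<lambda>y. h y - \<Phi> h y) = (\<lambda>x. w x - z x)" using nb(4)[OF wzV] by simp
  hence h1: "h1 = (\<lambda>x. hs x + z x)" by (auto simp: h1_def newton_step_def w_def)
  show "h1 \<in> F_N N" unfolding h1 by (intro F_N_add sE V_N_F_N[OF zV])
  show "cint h1 = 1" unfolding h1 using density_F_N[OF sE] zV F_N_integrable[OF V_N_F_N[OF zV]] by (simp add: cint_add V_N_iff)
  have d: "(\<lambda>x. h1 x - hs x) = z" by (auto simp: h1)
  have "Wnorm 1 E \<le> 1 / (4 * \<Lambda>) * Wnorm 1 w"
    unfolding E_def w_def
  proof (rule mean_value_newton[OF h(1) hs(1)])
    obtain \<delta> where \<delta>: "Wnorm 1 (\<lambda>x. h x - hs x) < \<delta>" and close: "\<And>f k h. f \<in> BK \<kappa> \<inter> F_N N \<Longrightarrow> k \<in> BK \<kappa> \<inter> F_N N \<Longrightarrow> h \<in> F_N N \<Longrightarrow>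
      Wnorm 1 (\<lambda>x. f x - k x) \<le> \<delta> \<Longrightarrow> Wnorm 1 (\<lambda>x. D f h x - D k h x) \<le> 1 / (4 * \<Lambda>) * Wnorm 1 h"
      using admissible_close[OF ad h(2)] by auto
    show "Wnorm 1 (\<lambda>x. D p v x - D h v x) \<le> 1 / (4 * \<Lambda>) * Wnorm 1 v"
      if "p \<in> BK \<kappa> \<inter> F_N N" "Wnorm 1 (\<lambda>x. p x - h x) \<le> Wnorm 1 (\<lambda>x. h x - hs x)" "v \<in> F_N N" for p v
      using close[OF that(1) h(1) that(3)] that(2) \<delta> by linarith
  qed (use bb in simp)
  hence "\<Lambda> * Wnorm 1 E \<le> \<Lambda> * (1 / (4 * \<Lambda>) * Wnorm 1 w)" using bb by (intro mult_left_mono) auto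
  hence "\<Lambda> * Wnorm 1 E \<le> Wnorm 1 w / 4" using bb by simp
  thus "Wnorm 1 (\<lambda>x. h1 x - hs x) \<le> Wnorm 1 (\<lambda>x. h x - hs x) / 4" using zW unfolding d w_def[symmetric] by linarith
  have "Wnorm 1 E \<le> quad_const N \<epsilon> * (Wnorm 1 w)\<^sup>2"
  proof -
    define q where "q = (\<lambda>x. disc_op N \<epsilon> hs x - disc_op N \<epsilon> h x - D h (\<lambda>y. hs y - h y) x)"
    have "D h (\<lambda>y. hs y - h y) = (\<lambda>x. - D h w x)"
      using disc_deriv_lin[OF N0 hE(2) wF wF, of \<epsilon> "-1" 0] by (simp add: w_def)
    hence "E = (\<lambda>x. (-1) * q x)" by (auto simp: E_def q_def)
    moreover have qF: "q \<in> F_N N" unfolding q_def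
      by (intro F_N_diff PF disc_deriv_F_N N0 hE sE)
    ultimately have "Wnorm 1 E = Wnorm 1 q" using Wnorm_scale[OF qF, of "-1"] by simp
    also have "\<dots> \<le> quad_const N \<epsilon> * (Wnorm 1 (\<lambda>x. hs x - h x))\<^sup>2"
      unfolding q_def by (rule disc_op_quad[OF N0 hE(2) density_facts(1)[OF hE] sE(2)])
    also have "Wnorm 1 (\<lambda>x. hs x - h x) = Wnorm 1 w" unfolding w_def by (rule Wnorm_diff_commute[OF sE(2) hE(2)])
    finally show ?thesis .
  qed
  hence "\<Lambda> * Wnorm 1 E \<le> \<Lambda> * (quad_const N \<epsilon> * (Wnorm 1 w)\<^sup>2)" using bb by (intro mult_left_mono) auto
  thus "Wnorm 1 (\<lambda>x. h1 x - hs x) \<le> \<Lambda> * quad_const N \<epsilon> * (Wnorm 1 (\<lambda>x. h x - hs x))\<^sup>2"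
    using zW unfolding d w_def[symmetric] by (simp add: mult.assoc)
qed

text \<open>The conclusion of the theorem for one choice of the constants.\<close>

definition newton_succeeds :: "real \<Rightarrow> real \<Rightarrow> real \<Rightarrow> (real \<Rightarrow> real) \<Rightarrow> bool" where
  "newton_succeeds \<kappa> \<Lambda> \<beta> hs \<longleftrightarrow>
     hs \<in> B_prime T g \<epsilon> N \<kappa> \<Lambda> \<beta> \<and>
     (\<exists>C \<gamma>. 0 < C \<and> 0 < \<gamma> \<and> \<gamma> < 1 \<and>
       (\<forall>h0 \<in> B_prime T g \<epsilon> N \<kappa> \<Lambda> \<beta> \<inter> W11_ball hs \<beta>.
          (\<forall>n. newton_defined_at T g \<epsilon> N ((newton_step T g \<epsilon> N ^^ n) h0)) \<and>
          (\<lambda>n. Wnorm 1 (\<lambda>x. (newton_step T g \<epsilon> N ^^ n) h0 x - hs x)) \<longlonglongrightarrow> 0 \<and>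
          (\<forall>n. Wnorm 1 (\<lambda>x. (newton_step T g \<epsilon> N ^^ n) h0 x - hs x) \<le> C * \<gamma> ^ (2 ^ n))))"

lemma newton_converges:
  assumes ad: "admissible T g \<epsilon> N \<kappa> \<Lambda> \<beta>" and hs: "hs \<in> BK \<kappa> \<inter> F_N N" "disc_op N \<epsilon> hs = hs"
    and ball: "densities \<inter> F_N N \<inter> W11_ball hs \<beta> \<subseteq> BK \<kappa>"
    and stay: "\<And>h. h \<in> densities \<inter> F_N N \<inter> W11_ball hs \<beta> \<Longrightarrow> newton_step T g \<epsilon> N h \<in> densities"
  shows "newton_succeeds \<kappa> \<Lambda> \<beta> hs"
proof -
  have sE: "hs \<in> densities" "hs \<in> F_N N" using BK_density[OF hs(1)] by auto
  have b: "0 < \<beta>" using ad by (simp add: admissible_def)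
  have b1: "\<beta> \<le> 1"
  proof -
    have "ereal \<beta> \<le> 1" using ad unfolding admissible_def by (meson min.boundedE)
    thus ?thesis by (simp add: one_ereal_def)
  qed
  have L: "0 < \<Lambda>" by (rule admissible_bounded_below(2)[OF ad hs(1)])
  have B: "hs \<in> B_prime T g \<epsilon> N \<kappa> \<Lambda> \<beta>"
    unfolding B_prime_def using sE ball density_facts(3)[OF sE] hs(2) b L by (simp add: Wnorm_zero_fun)
  obtain C \<gamma> where C: "0 < C" "0 < \<gamma>" "\<gamma> < 1" and conv:
    "\<And>e :: nat \<Rightarrow> real. (\<And>n. 0 \<le> e n) \<Longrightarrow> e 0 \<le> 1 \<Longrightarrow> (\<And>n. e (Suc n) \<le> e n / 4) \<Longrightarrow> (\<And>n. e (Suc n) \<le> (\<Lambda> * quad_const N \<epsilon>) * (e n)\<^sup>2) \<Longrightarrow>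
      \<forall>n. e n \<le> C * \<gamma> ^ (2 ^ n)"
    using quadratic_convergence[of "\<Lambda> * quad_const N \<epsilon>"] by blast
  show ?thesis unfolding newton_succeeds_def
  proof (rule conjI[OF B], rule exI[of _ C], rule exI[of _ \<gamma>], intro conjI C ballI allI)
    fix h0 assume h0: "h0 \<in> B_prime T g \<epsilon> N \<kappa> \<Lambda> \<beta> \<inter> W11_ball hs \<beta>"
    define h where "h n = (newton_step T g \<epsilon> N ^^ n) h0" for n
    define e where "e n = Wnorm 1 (\<lambda>x. h n x - hs x)" for n
    have e0: "0 \<le> e n" for n unfolding e_def by (rule Wnorm_nonneg)
    have in_ball: "u \<in> W11_ball hs \<beta> \<longleftrightarrow> Wnorm 1 (\<lambda>x. u x - hs x) < \<beta>" if "u \<in> F_N N" for u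
      using F_N_W[OF that] by (simp add: W11_ball_def)
    have inv: "h n \<in> densities \<inter> F_N N \<and> e n < \<beta>" for n
    proof (induction n)
      case 0
      have "h0 \<in> densities \<inter> F_N N" using h0 by (auto simp: B_prime_def)
      thus ?case using h0 in_ball[of h0] by (auto simp: h_def e_def)
    next
      case (Suc n)
      hence hn: "h n \<in> densities \<inter> F_N N \<inter> W11_ball hs \<beta>" using in_ball[of "h n"] by (auto simp: e_def)
      hence "h n \<in> BK \<kappa> \<inter> F_N N" using ball by auto
      note st = newton_step_contracts[OF ad hs this]
      have en: "Wnorm 1 (\<lambda>x. h n x - hs x) < \<beta>" using Suc by (simp add: e_def)
      have hS: "h (Suc n) = newton_step T g \<epsilon> N (h n)" by (simp add: h_def)
      have "e (Suc n) \<le> e n / 4" using st(3)[OF en] by (simp add: e_def hS)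
      thus ?case using stay[OF hn] st(1)[OF en] Suc e0[of n] unfolding hS by simp
    qed
    have hB: "h n \<in> BK \<kappa> \<inter> F_N N" for n using inv[of n] in_ball[of "h n"] ball by (auto simp: e_def)
    have hS: "h (Suc n) = newton_step T g \<epsilon> N (h n)" for n by (simp add: h_def)
    have st: "e (Suc n) \<le> e n / 4" "e (Suc n) \<le> (\<Lambda> * quad_const N \<epsilon>) * (e n)\<^sup>2" for n
      using newton_step_contracts(3,4)[OF ad hs hB[of n]] inv[of n] by (simp_all add: e_def hS)
    show "newton_defined_at T g \<epsilon> N ((newton_step T g \<epsilon> N ^^ n) h0)" for n
      using ad hB[of n] by (simp add: admissible_def h_def)
    have all: "\<forall>n. e n \<le> C * \<gamma> ^ (2 ^ n)" by (rule conv[of e, OF e0 _ st]) (use inv[of 0] b1 in linarith)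
    thus "Wnorm 1 (\<lambda>x. (newton_step T g \<epsilon> N ^^ n) h0 x - hs x) \<le> C * \<gamma> ^ (2 ^ n)" for n by (simp add: e_def h_def)
    have "e n \<le> (1/4) ^ n" for n
    proof (induction n)
      case 0 thus ?case using inv[of 0] b1 by simp
    next
      case (Suc n) thus ?case using st(1)[of n] by simp
    qed
    moreover have "(\<lambda>n. (1/4::real) ^ n) \<longlonglongrightarrow> 0" by (intro LIMSEQ_realpow_zero) auto
    ultimately have "e \<longlonglongrightarrow> 0" using e0 by (intro tendsto_sandwich[of "\<lambda>n. 0" e sequentially "\<lambda>n. (1/4) ^ n"]) auto
    thus "(\<lambda>n. Wnorm 1 (\<lambda>x. (newton_step T g \<epsilon> N ^^ n) h0 x - hs x)) \<longlonglongrightarrow> 0" by (simp add: e_def[abs_def] h_def)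
  qed
qed

text \<open>A mean-zero function is bounded by its \<open>W\<^sup>1\<^sup>,\<^sup>1\<close> norm, so a radius below the minimum of \<open>hs\<close> keeps the
  iterates nonnegative.\<close>

lemma newton_stays_positive:
  assumes ad: "admissible T g \<epsilon> N \<kappa> \<Lambda> \<beta>" and hs: "hs \<in> BK \<kappa> \<inter> F_N N" "disc_op N \<epsilon> hs = hs"
    and ball: "densities \<inter> F_N N \<inter> W11_ball hs \<beta> \<subseteq> BK \<kappa>"
    and pos: "\<And>x. \<beta> \<le> hs x" and h: "h \<in> densities \<inter> F_N N \<inter> W11_ball hs \<beta>"
  shows "newton_step T g \<epsilon> N h \<in> densities"
proof -
  let ?h1 = "newton_step T g \<epsilon> N h"
  have hB: "h \<in> BK \<kappa> \<inter> F_N N" and hw: "Wnorm 1 (\<lambda>x. h x - hs x) < \<beta>" using h ball by (auto simp: W11_ball_def)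
  note st = newton_step_contracts[OF ad hs hB hw]
  have sE: "hs \<in> densities" "hs \<in> F_N N" using BK_density[OF hs(1)] by auto
  let ?z = "\<lambda>x. ?h1 x - hs x"
  have zF: "?z \<in> F_N N" by (rule F_N_diff[OF st(1) sE(2)])
  have cz: "cint ?z = 0" using st(2) density_F_N[OF sE] F_N_integrable[OF st(1)] by (simp add: cint_diff)
  have "0 \<le> ?h1 x" for x
  proof -
    have "\<bar>?z x - cint ?z\<bar> \<le> cint (\<lambda>y. \<bar>deriv ?z y\<bar>)" by (rule F_N_sup_bound[OF zF])
    also have "\<dots> \<le> Wnorm 1 ?z" unfolding Wnorm1_F_N[OF zF] using cint_nonneg[of "\<lambda>x. \<bar>?z x\<bar>"] by simp
    also have "\<dots> \<le> \<beta>" using st(3) hw Wnorm_nonneg[of 1 "\<lambda>x. h x - hs x"] by linarith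
    finally show ?thesis using pos[of x] cz by (simp add: abs_le_iff)
  qed
  thus ?thesis using st(2) F_N_L1[OF st(1)] by (simp add: densities_def)
qed

end

section \<open>Fixed points are uniformly positive\<close>

lemma cint_window:
  assumes "continuous_on UNIV G" "periodic1 G"
  shows "cint G = integral {a..a+1} G"
proof -
  have s: "set_integrable lborel {a..a+1} G"
    by (rule borel_integrable_atLeastAtMost') (rule continuous_on_subset[OF assms(1)], simp)
  have "cint G = cint (\<lambda>x. G (x + a))" using cint_shift(1)[OF assms(2) integrable_circ_cont[OF assms(1)], of a] by simp
  also have "\<dots> = (LINT y:{a..a+1}|lborel. G y)" using LINT_unit(2)[OF s] by simp
  also have "\<dots> = integral {a..a+1} G" by (rule set_borel_integral_eq_integral(2)[OF s])
  finally show ?thesis .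
qed

lemma cint_window_ge:
  assumes "continuous_on UNIV G" "periodic1 G" "\<And>x. 0 \<le> G x" "a \<le> b" "b \<le> a + 1"
  shows "integral {a..b} G \<le> cint G"
  unfolding cint_window[OF assms(1,2), of a]
  by (rule integral_subset_le) (use assms in \<open>auto intro!: integrable_continuous_interval continuous_on_subset[OF assms(1)]\<close>)

lemma integral_FTC_real:
  assumes "\<And>x. (F has_real_derivative f x) (at x)" "a \<le> b"
  shows "integral {a..b} f = F b - F a"
  by (rule integral_unique, rule fundamental_theorem_of_calculus[OF assms(2)])
     (use assms(1) in \<open>auto simp: has_real_derivative_iff_has_vector_derivative intro: has_vector_derivative_at_within\<close>)

lemma fejer_primitive:
  assumes N: "0 < N"
  obtains H where "\<And>x. (H has_real_derivative fejer N x) (at x)" "\<And>x. H (x + 1) = H x + 1" "mono H"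
proof -
  obtain F where F: "\<And>x. (F has_real_derivative fejer N x - cint (fejer N)) (at x)" "periodic1 F"
    using F_N_antideriv[OF fejer_F_N[OF N]] by blast
  define H where "H x = F x + x" for x
  have d: "(H has_real_derivative fejer N x) (at x)" for x
    unfolding H_def using DERIV_add[OF F(1)[of x] DERIV_ident] cint_fejer[OF N] by simp
  have "mono H"
  proof (rule monoI)
    fix x y :: real assume "x \<le> y"
    thus "H x \<le> H y" by (rule DERIV_nonneg_imp_nondecreasing) (use d fejer_nonneg[OF N] in blast)
  qed
  thus ?thesis using that[of H] d F(2) by (simp add: H_def periodic1_def)
qed

text \<open>Away from the integers \<open>sin\<^sup>2\<close> is at least \<open>4 \<rho>\<^sup>2\<close>, so the second moment of the kernel bounds its mass there. The
  primitive \<open>H\<close> measures this mass.\<close>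

lemma fejer_mass_near_zero:
  assumes N: "0 < N" and H: "\<And>x. (H has_real_derivative fejer N x) (at x)" "\<And>x. H (x + 1) = H x + 1"
    and \<rho>: "0 < \<rho>" "\<rho> \<le> 1/2" and NN: "1 / (4 * \<rho>\<^sup>2) \<le> real N"
  shows "1/2 \<le> H \<rho> - H (- \<rho>)"
proof -
  let ?G = "\<lambda>t. (sin (pi * t))\<^sup>2 * fejer N t"
  have cG: "continuous_on UNIV ?G" by (intro continuous_intros fejer_cont)
  have pG: "periodic1 ?G" using fejer_periodic[OF N] by (simp add: periodic1_def distrib_left)
  have sub: "integral {\<rho>..1 - \<rho>} ?G \<le> 1 / (2 * real N)"
    using cint_window_ge[OF cG pG, of \<rho> "1 - \<rho>"] cint_fejer_sin2[OF N] fejer_nonneg[OF N] \<rho> by simp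
  have "(4 * \<rho>\<^sup>2) * (H (1 - \<rho>) - H \<rho>) = integral {\<rho>..1 - \<rho>} (\<lambda>t. (4 * \<rho>\<^sup>2) * fejer N t)"
    using integral_FTC_real[OF H(1), of \<rho> "1 - \<rho>"] \<rho> by simp
  also have "\<dots> \<le> integral {\<rho>..1 - \<rho>} ?G"
  proof (rule integral_le)
    show "(\<lambda>t. (4 * \<rho>\<^sup>2) * fejer N t) integrable_on {\<rho>..1 - \<rho>}" "?G integrable_on {\<rho>..1 - \<rho>}"
      by (intro integrable_continuous_interval continuous_intros continuous_on_subset[OF fejer_cont] subset_UNIV)+
    fix t assume t: "t \<in> {\<rho>..1 - \<rho>}"
    have "2 * \<rho> \<le> \<bar>sin (pi * t)\<bar>"
    proof (cases "t \<le> 1/2")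
      case True
      thus ?thesis using sin_pi_ge[of t] t \<rho> by simp
    next
      case False
      have "\<bar>sin (pi * (t - of_int 1))\<bar> = \<bar>sin (pi * t)\<bar>" by (rule sin_pi_shift)
      moreover have "2 * \<bar>t - 1\<bar> \<le> \<bar>sin (pi * (t - 1))\<bar>" using sin_pi_ge[of "t - 1"] t False \<rho> by simp
      moreover have "2 * \<rho> \<le> 2 * \<bar>t - 1\<bar>" using t by (simp add: abs_if)
      ultimately show ?thesis by simp
    qed
    hence "(2 * \<rho>)\<^sup>2 \<le> \<bar>sin (pi * t)\<bar>\<^sup>2" using \<rho> by (intro power_mono) auto
    hence "4 * \<rho>\<^sup>2 \<le> (sin (pi * t))\<^sup>2" by (simp add: power2_eq_square)
    thus "(4 * \<rho>\<^sup>2) * fejer N t \<le> ?G t" using fejer_nonneg[OF N] by (intro mult_right_mono)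
  qed
  also have "\<dots> \<le> 1 / (2 * real N)" by (rule sub)
  also have "\<dots> \<le> (4 * \<rho>\<^sup>2) * (1/2)"
  proof -
    have "1 \<le> real N * (4 * \<rho>\<^sup>2)" using NN \<rho> by (simp add: divide_le_eq)
    thus ?thesis using N by (simp add: field_simps)
  qed
  finally have "H (1 - \<rho>) - H \<rho> \<le> 1/2" using \<rho> by (subst (asm) mult_le_cancel_left_pos) auto
  moreover have "H (1 - \<rho>) = H (- \<rho>) + 1" using H(2)[of "- \<rho>"] by simp
  ultimately show ?thesis by simp
qed

context expanding_coupled_map begin

text \<open>The arc of radius \<open>r\<close> around \<open>x0\<close> is mapped over at least the arc of radius \<open>r / lam\<close> around the image of \<open>x0\<close>. If \<open>x\<close> lies deeper
  than \<open>\<rho>\<close> inside, substituting \<open>S y\<close> in the integral for \<open>hs x\<close> covers the interval \<open>[-\<rho>, \<rho>]\<close>, which holds half of the mass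
  of the kernel; the Jacobian costs the factor \<open>map_bound\<close>.\<close>

lemma spread_lower_bound:
  assumes N: "0 < N" and hs: "hs \<in> F_N N" "hs \<in> densities" "disc_op N \<epsilon> hs = hs" "\<And>x. 0 \<le> hs x" and e: "\<epsilon> \<in> {0..\<epsilon>0}"
    and a: "0 \<le> a" "\<And>y. \<bar>y - x0\<bar> \<le> r \<Longrightarrow> a \<le> hs y" and r: "0 < r" "r \<le> 1/2"
    and \<rho>: "0 < \<rho>" "\<rho> \<le> 1/2" "1 / (4 * \<rho>\<^sup>2) \<le> real N" and x: "\<bar>x - S \<epsilon> hs x0\<bar> \<le> r / lam - \<rho>"
  shows "a / (2 * map_bound \<epsilon>0) \<le> hs x"
proof -
  let ?S = "S \<epsilon> hs" and ?S1 = "S1 \<epsilon> hs" and ?M = "map_bound \<epsilon>0"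
  note ch = F_N_cont[OF hs(1)]
  note dS = S_deriv(1)[OF ch, of \<epsilon>]
  have fd: "L1norm hs \<le> 1" using density_F_N[OF hs(2,1)] by simp
  have ex: "1 / lam \<le> \<bar>?S1 y\<bar>" for y by (rule density_expanding(1)[OF hs(2) ch e])
  have M: "\<bar>?S1 y\<bar> \<le> ?M" "1 \<le> ?M" for y using map_derivs_bound(1,4)[OF ch fd, of \<epsilon> \<epsilon>0] e by auto
  have nz: "?S1 y \<noteq> 0" for y using ex[of y] lam by auto
  obtain H where H: "\<And>x. (H has_real_derivative fejer N x) (at x)" "\<And>x. H (x + 1) = H x + 1" "mono H"
    using fejer_primitive[OF N] by blast
  have mass: "1/2 \<le> H \<rho> - H (- \<rho>)" by (rule fejer_mass_near_zero[OF N H(1,2) \<rho>])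
  define \<sigma> where "\<sigma> = sgn (?S1 0)"
  have sg: "\<bar>?S1 y\<bar> = \<sigma> * ?S1 y" for y
  proof -
    have conn: "connected (range ?S1)" by (intro connected_continuous_image S_cont ch) auto
    have "\<not> (?S1 0 < 0 \<and> 0 < ?S1 y)" "\<not> (?S1 y < 0 \<and> 0 < ?S1 0)"
      using connectedD_interval[OF conn rangeI rangeI, of 0 0 y] connectedD_interval[OF conn rangeI rangeI, of y 0 0] nz
      by (metis imageE less_imp_le)+
    thus ?thesis using nz[of 0] nz[of y] unfolding \<sigma>_def sgn_if by (auto simp: abs_if not_less)
  qed
  have s1: "\<bar>\<sigma>\<bar> = 1" using nz[of 0] by (simp add: \<sigma>_def sgn_if)
  define u v where "u = x - ?S (x0 - r)" and "v = x - ?S (x0 + r)"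
  have der: "((\<lambda>y. - \<sigma> * H (x - ?S y)) has_real_derivative fejer N (x - ?S y) * \<bar>?S1 y\<bar>) (at y)" for y
  proof -
    have "((\<lambda>y. H (x - ?S y)) has_real_derivative fejer N (x - ?S y) * (0 - ?S1 y)) (at y)"
      by (rule DERIV_chain2[OF H(1)]) (intro DERIV_diff DERIV_const dS)
    from DERIV_cmult[OF this, of "- \<sigma>"] show ?thesis unfolding sg by (simp add: mult_ac)
  qed
  have grow: "(z - y) / lam \<le> \<sigma> * (?S z - ?S y)" if "y \<le> z" for y z
  proof -
    have "(\<lambda>y. \<sigma> * ?S y - y / lam) y \<le> (\<lambda>y. \<sigma> * ?S y - y / lam) z"
    proof (rule DERIV_nonneg_imp_nondecreasing[OF that])
      fix w
      have "((\<lambda>y. \<sigma> * ?S y - y / lam) has_real_derivative \<sigma> * ?S1 w - 1 / lam) (at w)"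
        by (intro DERIV_diff DERIV_cmult dS DERIV_cdivide DERIV_ident)
      moreover have "0 \<le> \<sigma> * ?S1 w - 1 / lam" using ex[of w] by (simp add: sg)
      ultimately show "\<exists>d. ((\<lambda>y. \<sigma> * ?S y - y / lam) has_real_derivative d) (at w) \<and> 0 \<le> d" by blast
    qed
    thus ?thesis by (simp add: diff_divide_distrib right_diff_distrib)
  qed
  have uv: "\<sigma> * v \<le> - \<rho>" "\<rho> \<le> \<sigma> * u"
  proof -
    have sx: "\<bar>\<sigma> * (x - ?S x0)\<bar> \<le> r / lam - \<rho>" using x s1 by (simp add: abs_mult)
    have "\<sigma> * v = \<sigma> * (x - ?S x0) - \<sigma> * (?S (x0 + r) - ?S x0)" by (simp add: v_def algebra_simps)
    moreover have "r / lam \<le> \<sigma> * (?S (x0 + r) - ?S x0)" using grow[of x0 "x0 + r"] r by simp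
    ultimately show "\<sigma> * v \<le> - \<rho>" using sx by (simp add: abs_le_iff)
    have "\<sigma> * u = \<sigma> * (x - ?S x0) + \<sigma> * (?S x0 - ?S (x0 - r))" by (simp add: u_def algebra_simps)
    moreover have "r / lam \<le> \<sigma> * (?S x0 - ?S (x0 - r))" using grow[of "x0 - r" x0] r by simp
    ultimately show "\<rho> \<le> \<sigma> * u" using sx by (simp add: abs_le_iff)
  qed
  have HH: "1/2 \<le> \<sigma> * (H u - H v)"
  proof (cases "\<sigma> = 1")
    case True
    have "H \<rho> \<le> H u" "H v \<le> H (- \<rho>)" using uv True by (auto intro: monoD[OF H(3)])
    thus ?thesis using mass True by simp
  next
    case False
    hence s: "\<sigma> = -1" using s1 by (simp add: abs_if split: if_splits)
    have "H \<rho> \<le> H v" "H u \<le> H (- \<rho>)" using uv s by (auto intro: monoD[OF H(3)])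
    thus ?thesis using mass s by simp
  qed
  have "integral {x0 - r..x0 + r} (\<lambda>y. fejer N (x - ?S y) * \<bar>?S1 y\<bar>) = \<sigma> * (H u - H v)"
    using integral_FTC_real[OF der, of "x0 - r" "x0 + r"] r by (simp add: u_def v_def algebra_simps)
  hence I: "1/2 \<le> integral {x0 - r..x0 + r} (\<lambda>y. fejer N (x - ?S y) * \<bar>?S1 y\<bar>)" using HH by simp
  let ?F = "\<lambda>y. fejer N (x - ?S y) * hs y"
  have cK: "continuous_on UNIV (\<lambda>y. fejer N (x - ?S y))" by (rule conv_slice[OF fejer_cont S_cont(1)[OF ch]])
  have cF: "continuous_on UNIV ?F" by (intro continuous_intros cK ch)
  have pF: "periodic1 ?F" using lift_periodic[OF S_lift[of \<epsilon> hs] fejer_periodic[OF N], of x] F_N_periodic[OF hs(1)] by (simp add: periodic1_def)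
  have "a / (2 * ?M) = (a / ?M) * (1/2)" by simp
  also have "\<dots> \<le> (a / ?M) * integral {x0 - r..x0 + r} (\<lambda>y. fejer N (x - ?S y) * \<bar>?S1 y\<bar>)"
    using I a(1) M(2) by (intro mult_left_mono divide_nonneg_nonneg) auto
  also have "\<dots> = integral {x0 - r..x0 + r} (\<lambda>y. (a / ?M) * (fejer N (x - ?S y) * \<bar>?S1 y\<bar>))" by simp
  also have "\<dots> \<le> integral {x0 - r..x0 + r} ?F"
  proof (rule integral_le)
    show "(\<lambda>y. (a / ?M) * (fejer N (x - ?S y) * \<bar>?S1 y\<bar>)) integrable_on {x0 - r..x0 + r}"
      by (intro integrable_continuous_interval continuous_on_mult continuous_on_const continuous_on_rabs
          continuous_on_subset[OF cK] continuous_on_subset[OF S_cont(2)[OF ch]] subset_UNIV)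
    show "?F integrable_on {x0 - r..x0 + r}" by (intro integrable_continuous_interval continuous_on_subset[OF cF] subset_UNIV)
    fix y assume "y \<in> {x0 - r..x0 + r}"
    hence ay: "a \<le> hs y" by (intro a(2)) (auto simp: abs_le_iff)
    have "(a / ?M) * \<bar>?S1 y\<bar> \<le> (a / ?M) * ?M" using M a(1) by (intro mult_left_mono divide_nonneg_nonneg) auto
    also have "\<dots> \<le> hs y" using ay M(2) by simp
    finally have "fejer N (x - ?S y) * ((a / ?M) * \<bar>?S1 y\<bar>) \<le> fejer N (x - ?S y) * hs y"
      using fejer_nonneg[OF N] by (intro mult_left_mono)
    thus "(a / ?M) * (fejer N (x - ?S y) * \<bar>?S1 y\<bar>) \<le> ?F y" by (simp add: mult_ac)
  qed
  also have "\<dots> \<le> cint ?F"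
    using r hs(4) fejer_nonneg[OF N] by (intro cint_window_ge[OF cF pF] mult_nonneg_nonneg) auto
  also have "\<dots> = hs x" using fun_cong[OF hs(3), of x] by (simp add: disc_op_def kernel_op_def conv_def)
  finally show ?thesis .
qed

text \<open>A fixed point has mass one and a bounded slope, so it is at least \<open>1/2\<close> on an arc of definite length; the
  expansion spreads this lower bound over the circle in a bounded number of steps, and the Fejer kernel loses
  only a bounded factor in each.\<close>

lemma uniform_positivity:
  assumes K: "1 \<le> K"
  obtains c N1 where "0 < c" "\<And>\<epsilon> N hs x. \<epsilon> \<in> {0..\<epsilon>0} \<Longrightarrow> N1 \<le> N \<Longrightarrow> hs \<in> BK K \<inter> F_N N \<Longrightarrow> disc_op N \<epsilon> hs = hs \<Longrightarrow> c \<le> hs x"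
proof -
  define r0 where "r0 = 1 / (2 * K)"
  have r0: "0 < r0" "r0 \<le> 1/2" using K by (auto simp: r0_def field_simps)
  \<comment> \<open>Any rate strictly between \<open>1\<close> and the expansion; the rest pays for the width \<open>\<rho>\<close> of the kernel.\<close>
  define \<kappa> where "\<kappa> = (1 + 1 / lam) / 2"
  have il: "1 < 1 / lam" using lam by simp
  have \<kappa>: "1 < \<kappa>" "\<kappa> < 1 / lam" using il unfolding \<kappa>_def by (simp_all add: field_simps)
  define \<rho> where "\<rho> = min (1/2) (r0 * (1 / lam - \<kappa>))"
  have \<rho>: "0 < \<rho>" using r0 \<kappa> by (simp add: \<rho>_def)
  have \<rho>': "\<rho> \<le> 1/2" unfolding \<rho>_def by (rule min.cobounded1)
  define N1 where "N1 = nat \<lceil>1 / (4 * \<rho>\<^sup>2)\<rceil> + 1"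
  obtain n0 :: nat where n0: "1 / (2 * r0) < \<kappa> ^ n0" using real_arch_pow[OF \<kappa>(1)] by blast
  have M: "1 \<le> map_bound \<epsilon>0" using map_derivs_bound(4)[of "\<lambda>x. 0" \<epsilon>0 \<epsilon>0] \<epsilon>0 by (simp add: cint_const)
  define c where "c = (1/2) * (1 / (2 * map_bound \<epsilon>0)) ^ n0"
  have c0: "0 < c" using M by (simp add: c_def)
  show ?thesis
  proof (rule that[of c N1])
    show "0 < c" by (rule c0)
    fix \<epsilon> N hs x assume e: "\<epsilon> \<in> {0..\<epsilon>0}" and N: "N1 \<le> N" and hs: "hs \<in> BK K \<inter> F_N N" and fix': "disc_op N \<epsilon> hs = hs"
    have N0: "0 < N" using N by (simp add: N1_def)
    have NN: "1 / (4 * \<rho>\<^sup>2) \<le> real N"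
    proof -
      have "1 / (4 * \<rho>\<^sup>2) \<le> real (nat \<lceil>1 / (4 * \<rho>\<^sup>2)\<rceil>)" by (rule real_nat_ceiling_ge)
      also have "\<dots> \<le> real N" using N by (simp add: N1_def)
      finally show ?thesis .
    qed
    have h: "hs \<in> F_N N" "hs \<in> densities" and hK: "Wnorm 2 hs \<le> K" using hs by (auto simp: BK_def)
    note ch = F_N_cont[OF h(1)]
    have nn: "0 \<le> hs x" for x
    proof -
      have "AE y in circ. 0 \<le> hs y" using h(2) by (intro AE_circ) (simp add: densities_def)
      hence "AE y in circ. 0 \<le> fejer N (x - S \<epsilon> hs y) * hs y" by eventually_elim (simp add: fejer_nonneg[OF N0])
      hence "0 \<le> cint (\<lambda>y. fejer N (x - S \<epsilon> hs y) * hs y)" unfolding cint_circ by (rule integral_nonneg_AE)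
      thus ?thesis using fun_cong[OF fix', of x] by (simp add: disc_op_def kernel_op_def conv_def)
    qed
    have slope: "\<bar>deriv hs y\<bar> \<le> K" for y
    proof -
      have "\<bar>deriv hs y - cint (deriv hs)\<bar> \<le> L1norm (deriv (deriv hs))" by (rule F_N_sup_bound[OF F_N_deriv(2)[OF h(1)]])
      also have "\<dots> \<le> Wnorm 2 hs" unfolding Wnorm2_F_N[OF h(1)]
        using cint_nonneg[of "\<lambda>x. \<bar>hs x\<bar>"] cint_nonneg[of "\<lambda>x. \<bar>deriv hs x\<bar>"] by simp
      finally show ?thesis using hK cint_deriv_F_N[OF h(1)] by simp
    qed
    obtain x0 where x0: "1 \<le> hs x0"
    proof (rule ccontr)
      assume "\<not> thesis"
      hence lt: "hs y < 1" for y using that by (meson not_le)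
      have i: "integrable circ hs" by (rule F_N_integrable[OF h(1)])
      have "cint (\<lambda>y. \<bar>1 - hs y\<bar>) = cint (\<lambda>y. 1 - hs y)" using lt by (intro cint_cong) (simp add: less_imp_le)
      also have "\<dots> = 0" using i density_F_N(1)[OF h(2,1)] by (simp add: cint_diff cint_const)
      finally have "1 - hs 0 = 0"
        using F_N_periodic[OF h(1)] by (intro cint_zero_cont[where f = "\<lambda>y. 1 - hs y"] continuous_intros ch) (auto simp: periodic1_def)
      thus False using lt[of 0] by simp
    qed
    define R where "R n = min (\<kappa> ^ n * r0) (1/2)" for n
    have Rr: "r0 \<le> R n" "R n \<le> 1/2" for n
    proof -
      have "1 \<le> \<kappa> ^ n" using \<kappa> by simp
      hence "1 * r0 \<le> \<kappa> ^ n * r0" using r0 by (intro mult_right_mono) auto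
      thus "r0 \<le> R n" "R n \<le> 1/2" using r0 by (auto simp: R_def)
    qed
    have arc: "\<exists>z. \<forall>y. \<bar>y - z\<bar> \<le> R n \<longrightarrow> (1/2) * (1 / (2 * map_bound \<epsilon>0)) ^ n \<le> hs y" for n
    proof (induction n)
      case 0
      have "1/2 \<le> hs y" if y: "\<bar>y - x0\<bar> \<le> R 0" for y
      proof -
        have "\<bar>hs y - hs x0\<bar> \<le> K * \<bar>y - x0\<bar>" by (rule lipschitz_from_deriv[OF F_N_deriv(1)[OF h(1)] slope])
        also have "\<dots> \<le> K * r0" using y r0 K by (intro mult_left_mono) (auto simp: R_def)
        also have "\<dots> = 1/2" using K by (simp add: r0_def)
        finally have "hs x0 - 1/2 \<le> hs y" by (simp only: abs_diff_le_iff)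
        thus ?thesis using x0 by simp
      qed
      thus ?case by auto
    next
      case (Suc n)
      then obtain z where z: "\<And>y. \<bar>y - z\<bar> \<le> R n \<Longrightarrow> (1/2) * (1 / (2 * map_bound \<epsilon>0)) ^ n \<le> hs y" by blast
      have "(1/2) * (1 / (2 * map_bound \<epsilon>0)) ^ Suc n \<le> hs y" if y: "\<bar>y - S \<epsilon> hs z\<bar> \<le> R (Suc n)" for y
      proof -
        have "R (Suc n) \<le> R n / lam - \<rho>"
        proof -
          have "R (Suc n) \<le> \<kappa> * R n"
          proof -
            have "\<kappa> * R n = min (\<kappa> * (\<kappa> ^ n * r0)) (\<kappa> * (1/2))"
              unfolding R_def using \<kappa> by (auto simp: min_def)
            moreover have "1/2 \<le> \<kappa> * (1/2)" using \<kappa> by simp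
            ultimately show ?thesis by (simp add: R_def mult.assoc min.coboundedI1 min_le_iff_disj)
          qed
          moreover have "\<rho> \<le> R n * (1 / lam - \<kappa>)"
          proof -
            have "\<rho> \<le> r0 * (1 / lam - \<kappa>)" by (simp add: \<rho>_def)
            also have "\<dots> \<le> R n * (1 / lam - \<kappa>)" using Rr \<kappa> by (intro mult_right_mono) auto
            finally show ?thesis .
          qed
          ultimately show ?thesis by (simp add: right_diff_distrib mult.commute)
        qed
        hence "\<bar>y - S \<epsilon> hs z\<bar> \<le> R n / lam - \<rho>" using y by simp
        from spread_lower_bound[OF N0 h fix' nn e _ z _ _ \<rho> \<rho>' NN this]
        have "((1/2) * (1 / (2 * map_bound \<epsilon>0)) ^ n) / (2 * map_bound \<epsilon>0) \<le> hs y" using Rr[of n] r0 M by simp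
        thus ?thesis by simp
      qed
      thus ?case by blast
    qed
    have R12: "R n0 = 1/2"
    proof -
      have "1 < \<kappa> ^ n0 * (2 * r0)" using n0 r0 by (simp add: divide_less_eq)
      thus ?thesis by (simp add: R_def min_def)
    qed
    obtain z where z: "\<And>y. \<bar>y - z\<bar> \<le> 1/2 \<Longrightarrow> c \<le> hs y" using arc[of n0] unfolding R12 c_def by blast
    obtain m :: int where m: "\<bar>(x - z) - of_int m\<bar> \<le> 1/2" using near_integer .
    have "\<bar>(x + of_int (- m)) - z\<bar> \<le> 1/2" using m by (simp add: algebra_simps)
    hence "c \<le> hs (x + of_int (- m))" by (rule z)
    thus "c \<le> hs x" using periodic1_int[OF F_N_periodic[OF h(1)], of x "- m"] by (simp only:)
  qed
qed

end

section \<open>The derivative varies strongly with the density\<close>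

lemma cint_square_pos:
  assumes "continuous_on UNIV b" "periodic1 b" "b y0 \<noteq> 0"
  shows "0 < cint (\<lambda>y. (b y)\<^sup>2)"
proof (rule ccontr)
  assume "\<not> 0 < cint (\<lambda>y. (b y)\<^sup>2)"
  moreover have "0 \<le> cint (\<lambda>y. (b y)\<^sup>2)" by (rule cint_nonneg) simp
  ultimately have "cint (\<lambda>y. \<bar>(b y)\<^sup>2\<bar>) = 0" by simp
  hence "(b y0)\<^sup>2 = 0" by (rule cint_zero_cont[rotated 2]) (use assms in \<open>auto intro!: continuous_intros simp: periodic1_def\<close>)
  thus False using assms(3) by simp
qed

lemma cint_conv_dual:
  assumes N: "0 < N" and \<phi>: "continuous_on UNIV \<phi>" and \<sigma>: "continuous_on UNIV \<sigma>" and r: "integrable circ r"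
  shows "cint (\<lambda>x. \<phi> x * conv (fejer N) \<sigma> r x) = cint (\<lambda>y. Pi_N N \<phi> (\<sigma> y) * r y)"
proof -
  let ?H = "\<lambda>p. \<phi> (fst p) * fejer N (fst p - \<sigma> (snd p))"
  have H: "continuous_on UNIV ?H"
    by (intro continuous_on_compose2[OF fejer_cont] continuous_on_compose2[OF \<phi>] continuous_on_compose2[OF \<sigma>] continuous_intros) auto
  have "cint (\<lambda>x. \<phi> x * conv (fejer N) \<sigma> r x) = cint (\<lambda>x. cint (\<lambda>y. ?H (x, y) * r y))"
    unfolding conv_def cint_cmult[symmetric] by (simp add: mult_ac)
  also have "\<dots> = cint (\<lambda>y. cint (\<lambda>x. ?H (x, y)) * r y)" by (rule cint_Fubini(1)[OF H r])
  also have "\<dots> = cint (\<lambda>y. Pi_N N \<phi> (\<sigma> y) * r y)"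
    unfolding Pi_N_def fst_conv snd_conv using fejer_even[of N "_ - _"] by (simp add: mult_ac)
  finally show ?thesis .
qed

lemma Pi_N_deriv_F_N:
  assumes N: "0 < N" and f: "f \<in> F_N M"
  shows "deriv (Pi_N N f) = Pi_N N (deriv f)"
  using Pi_N_deriv[OF N] is_weak_deriv_classical[OF F_N_deriv(1)[OF f] F_N_cont[OF F_N_deriv(2)[OF f]] F_N_periodic[OF f]] by blast

context coupled_map begin

lemma S1_periodic: "periodic1 (S1 \<epsilon> f)"
  using T1_periodic(1) periodic_T[OF Gd_periodic[of 1 f]] by (simp add: periodic1_def S1_def)

text \<open>A test function of size one may oscillate fast, but against a fixed smooth function its derivatives
  along an expanding map integrate to a bounded quantity, by parts. Only a rough density can make them large.\<close>

lemma transported_oscillation_bounded: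
  assumes f: "continuous_on UNIV f" "L1norm f \<le> 1" and e: "\<And>y. 1 \<le> \<bar>S1 \<epsilon> f y\<bar>" and E: "\<bar>\<epsilon>\<bar> \<le> E"
    and p: "\<And>y. (p has_real_derivative p1 y) (at y)" "\<And>y. (p1 has_real_derivative p2 y) (at y)" "continuous_on UNIV p2"
    and per: "periodic1 p" and P: "\<And>y. \<bar>p y\<bar> + \<bar>p1 y\<bar> + \<bar>p2 y\<bar> \<le> P"
    and \<psi>: "\<psi> \<in> F_N N" "\<And>x. \<bar>\<psi> x\<bar> \<le> 2"
  shows "\<bar>cint (\<lambda>y. deriv \<psi> (S \<epsilon> f y) * p y)\<bar> \<le> 10 * (map_bound E)\<^sup>2 * P"
    and "\<bar>cint (\<lambda>y. deriv (deriv \<psi>) (S \<epsilon> f y) * p y)\<bar> \<le> 10 * (map_bound E)\<^sup>2 * P"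
proof -
  note M = map_derivs_bound[OF f E]
  note sd = S_deriv[OF f(1)]
  have nz: "S1 \<epsilon> f y \<noteq> 0" for y using e[of y] by auto
  obtain r1 r2 where r: "\<And>y. ((\<lambda>y. p y / S1 \<epsilon> f y) has_real_derivative r1 y) (at y)"
    "\<And>y. ((\<lambda>y. r1 y / S1 \<epsilon> f y) has_real_derivative r2 y) (at y)" "continuous_on UNIV r1" "continuous_on UNIV r2"
    "\<And>y. \<bar>r1 y\<bar> + \<bar>r2 y\<bar> \<le> 5 * (map_bound E)\<^sup>2 * (\<bar>p y\<bar> + \<bar>p1 y\<bar> + \<bar>p2 y\<bar>)"
    using quotient_derivs[OF p(1,2) sd(2) sd(3) e M(2,3,4) p(3) S_cont(4)[OF f(1)]] by blast
  have rP: "\<bar>r1 y\<bar> \<le> 5 * (map_bound E)\<^sup>2 * P" "\<bar>r2 y\<bar> \<le> 5 * (map_bound E)\<^sup>2 * P" for y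
  proof -
    have "5 * (map_bound E)\<^sup>2 * (\<bar>p y\<bar> + \<bar>p1 y\<bar> + \<bar>p2 y\<bar>) \<le> 5 * (map_bound E)\<^sup>2 * P" by (intro mult_left_mono P) simp
    thus "\<bar>r1 y\<bar> \<le> 5 * (map_bound E)\<^sup>2 * P" "\<bar>r2 y\<bar> \<le> 5 * (map_bound E)\<^sup>2 * P" using r(5)[of y] by linarith+
  qed
  have pp: "periodic1 (\<lambda>y. p y / S1 \<epsilon> f y)" using per S1_periodic[of \<epsilon> f] by (simp add: periodic1_def)
  have pr1: "periodic1 (\<lambda>y. r1 y / S1 \<epsilon> f y)" using periodic1_deriv[OF pp r(1)] S1_periodic[of \<epsilon> f] by (simp add: periodic1_def)
  note \<psi>1 = F_N_deriv(2)[OF \<psi>(1)]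
  have parts: "cint (\<lambda>y. deriv \<eta> (S \<epsilon> f y) * p y) = - cint (\<lambda>y. \<eta> (S \<epsilon> f y) * r y)"
    if "\<And>y. ((\<lambda>y. p y / S1 \<epsilon> f y) has_real_derivative r y) (at y)" "continuous_on UNIV r" "periodic1 (\<lambda>y. p y / S1 \<epsilon> f y)" "\<eta> \<in> F_N N" for p r \<eta>
    by (rule parts_along[OF S_lift sd(1) S_cont(2)[OF f(1)] nz that(1-3) F_N_deriv(1) F_N_cont[OF F_N_deriv(2)] F_N_periodic]) (rule that(4))+
  have c\<psi>: "continuous_on UNIV (\<lambda>y. \<psi> (S \<epsilon> f y))"
    by (intro continuous_on_compose2[OF F_N_cont[OF \<psi>(1)] S_cont(1)[OF f(1)]]) auto
  have fin: "\<bar>cint (\<lambda>y. \<psi> (S \<epsilon> f y) * r y)\<bar> \<le> 10 * (map_bound E)\<^sup>2 * P" if "continuous_on UNIV r" "\<And>y. \<bar>r y\<bar> \<le> 5 * (map_bound E)\<^sup>2 * P" for r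
  proof -
    have "\<bar>cint (\<lambda>y. \<psi> (S \<epsilon> f y) * r y)\<bar> \<le> 2 * L1norm r"
      by (rule cint_mult_le[OF integrable_circ_cont[OF that(1)] borel_measurable_continuous_onI[OF c\<psi>]]) (rule \<psi>(2))
    also have "\<dots> \<le> 2 * (5 * (map_bound E)\<^sup>2 * P)" using that
      by (intro mult_left_mono cint_le_bound integrable_circ_cont continuous_intros) auto
    finally show ?thesis by simp
  qed
  show "\<bar>cint (\<lambda>y. deriv \<psi> (S \<epsilon> f y) * p y)\<bar> \<le> 10 * (map_bound E)\<^sup>2 * P"
    unfolding parts[OF r(1,3) pp \<psi>(1)] abs_minus_cancel by (rule fin[OF r(3) rP(1)])
  show "\<bar>cint (\<lambda>y. deriv (deriv \<psi>) (S \<epsilon> f y) * p y)\<bar> \<le> 10 * (map_bound E)\<^sup>2 * P"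
    unfolding parts[OF r(1,3) pp \<psi>1]
      parts[OF r(2,4) pr1 \<psi>(1)] abs_minus_cancel by (rule fin[OF r(4) rP(2)])
qed

text \<open>Pairs \<open>D\<^sub>f h\<close> with \<open>\<phi>'\<close>: since \<open>\<bar>\<phi>\<bar> \<le> 1\<close>, this is a lower bound for the norm, and by duality the Fejer kernel acts on \<open>\<phi>\<close>.\<close>

lemma disc_deriv_dual:
  assumes N: "0 < N" and f: "f \<in> F_N N" and h: "h \<in> F_N N" and \<phi>: "\<phi> \<in> F_N N" "\<And>x. \<bar>\<phi> x\<bar> \<le> 1"
  shows "\<bar>cint (\<lambda>y. deriv (Pi_N N \<phi>) (S \<epsilon> f y) * h y)
     + \<epsilon> * cint (\<lambda>y. deriv (deriv (Pi_N N \<phi>)) (S \<epsilon> f y) * (Gd 0 h (T y) * f y))\<bar> \<le> Wnorm 1 (disc_deriv N \<epsilon> f h)"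
proof -
  note cf = F_N_cont[OF f] and ch = F_N_cont[OF h]
  note cS = S_cont(1)[OF cf, of \<epsilon>]
  note \<phi>1 = F_N_deriv(2)[OF \<phi>(1)] and \<phi>2 = F_N_deriv(2)[OF F_N_deriv(2)[OF \<phi>(1)]]
  let ?r = "\<lambda>y. Gd 0 h (T y) * f y"
  have ir: "integrable circ ?r" "integrable circ h" by (intro integrable_circ_cont continuous_intros GT_cont cf ch)+
  let ?c = "conv (fejer N) (S \<epsilon> f)"
  note cr = conv_F_N[OF fejer_F_N[OF N] cS ir(1)] and chh = conv_F_N[OF fejer_F_N[OF N] cS ir(2)]
  have p1: "deriv (Pi_N N \<phi>) = Pi_N N (deriv \<phi>)" by (rule Pi_N_deriv_F_N[OF N \<phi>(1)])
  have p2: "deriv (Pi_N N (deriv \<phi>)) = Pi_N N (deriv (deriv \<phi>))" by (rule Pi_N_deriv_F_N[OF N \<phi>1])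
  note u = disc_deriv_F_N[OF N f h, of \<epsilon>]
  have "cint (\<lambda>x. deriv \<phi> x * disc_deriv N \<epsilon> f h x)
      = cint (\<lambda>x. deriv \<phi> x * ?c h x - \<epsilon> * (deriv \<phi> x * deriv (?c ?r) x))"
    unfolding disc_deriv_def kernel_deriv_def cr(2) by (intro cint_cong) (simp add: algebra_simps)
  also have "\<dots> = cint (\<lambda>x. deriv \<phi> x * ?c h x) - \<epsilon> * cint (\<lambda>x. deriv \<phi> x * deriv (?c ?r) x)"
    unfolding cint_cmult[symmetric]
    by (intro cint_diff integrable_circ_cont continuous_intros F_N_cont[OF \<phi>1] F_N_cont[OF chh(1)] F_N_cont[OF F_N_deriv(2)[OF cr(1)]])
  also have "cint (\<lambda>x. deriv \<phi> x * deriv (?c ?r) x) = - cint (\<lambda>x. deriv (deriv \<phi>) x * ?c ?r x)"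
    by (rule cint_parts[OF F_N_deriv(1)[OF \<phi>1] F_N_deriv(1)[OF cr(1)] F_N_cont[OF \<phi>2] F_N_cont[OF F_N_deriv(2)[OF cr(1)]] F_N_periodic[OF \<phi>1] F_N_periodic[OF cr(1)]])
  finally have eq: "cint (\<lambda>x. deriv \<phi> x * disc_deriv N \<epsilon> f h x) = cint (\<lambda>y. deriv (Pi_N N \<phi>) (S \<epsilon> f y) * h y)
     + \<epsilon> * cint (\<lambda>y. deriv (deriv (Pi_N N \<phi>)) (S \<epsilon> f y) * ?r y)"
    unfolding p1 p2 cint_conv_dual[OF N F_N_cont[OF \<phi>1] cS ir(2)] cint_conv_dual[OF N F_N_cont[OF \<phi>2] cS ir(1)] by simp
  have "cint (\<lambda>x. deriv \<phi> x * disc_deriv N \<epsilon> f h x) = - cint (\<lambda>x. \<phi> x * deriv (disc_deriv N \<epsilon> f h) x)"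
    using cint_parts[OF F_N_deriv(1)[OF \<phi>(1)] F_N_deriv(1)[OF u] F_N_cont[OF \<phi>1] F_N_cont[OF F_N_deriv(2)[OF u]] F_N_periodic[OF \<phi>(1)] F_N_periodic[OF u]] by simp
  hence "\<bar>cint (\<lambda>x. deriv \<phi> x * disc_deriv N \<epsilon> f h x)\<bar> = \<bar>cint (\<lambda>x. \<phi> x * deriv (disc_deriv N \<epsilon> f h) x)\<bar>" by simp
  also have "\<dots> \<le> 1 * cint (\<lambda>x. \<bar>deriv (disc_deriv N \<epsilon> f h) x\<bar>)"
    by (rule cint_mult_le[OF F_N_integrable[OF F_N_deriv(2)[OF u]] borel_measurable_continuous_onI[OF F_N_cont[OF \<phi>(1)]]]) (rule \<phi>(2))
  also have "\<dots> \<le> Wnorm 1 (disc_deriv N \<epsilon> f h)" unfolding Wnorm1_F_N[OF u] using cint_nonneg[of "\<lambda>x. \<bar>disc_deriv N \<epsilon> f h x\<bar>"] by simp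
  finally show ?thesis unfolding eq .
qed

end

text \<open>Since \<open>cos\<^sup>2 + sin\<^sup>2 = 1\<close>, one of the two functions captures half of the integral of \<open>b\<^sup>2\<close>.\<close>

lemma oscillation_choice:
  assumes b: "continuous_on UNIV b" and s: "continuous_on UNIV s"
  obtains \<tau> \<tau>1 :: "real \<Rightarrow> real" where "\<And>x. (\<tau> has_real_derivative \<tau>1 x) (at x)" "\<And>x. (\<tau>1 has_real_derivative - \<tau> x) (at x)"
    "\<And>x. \<bar>\<tau> x\<bar> \<le> 1" "\<And>x. \<bar>\<tau>1 x\<bar> \<le> 1" "(\<lambda>x. \<tau> (2 * pi * real m * x)) \<in> F_N (Suc m)"
    "cint (\<lambda>y. (b y)\<^sup>2) / 2 \<le> cint (\<lambda>y. (\<tau> (2 * pi * real m * s y) * b y)\<^sup>2)"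
proof -
  let ?C = "\<lambda>y. (cos (2 * pi * real m * s y) * b y)\<^sup>2" and ?S = "\<lambda>y. (sin (2 * pi * real m * s y) * b y)\<^sup>2"
  have "cint (\<lambda>y. (b y)\<^sup>2) = cint (\<lambda>y. ?C y + ?S y)"
    by (intro cint_cong) (simp add: power_mult_distrib flip: distrib_right)
  also have "\<dots> = cint ?C + cint ?S" by (intro cint_add integrable_circ_cont continuous_intros b s)
  finally consider "cint (\<lambda>y. (b y)\<^sup>2) / 2 \<le> cint ?C" | "cint (\<lambda>y. (b y)\<^sup>2) / 2 \<le> cint ?S" by linarith
  thus ?thesis
  proof cases
    case 1
    show ?thesis by (rule that[of cos "\<lambda>x. - sin x"]) (use 1 F_N_cos[of m "Suc m"] in \<open>auto intro!: derivative_eq_intros\<close>)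
  next
    case 2
    show ?thesis by (rule that[of sin cos]) (use 2 F_N_sin[of m "Suc m"] in \<open>auto intro!: derivative_eq_intros\<close>)
  qed
qed


context expanding_coupled_map begin

text \<open>Let \<open>b = (G h) \<circ> T\<close> and perturb the constant density by \<open>w = (d0 / m) \<tau>(2 \<pi> m S\<^sub>1) b\<close>, with \<open>\<tau>\<close> one of \<open>cos\<close> and \<open>sin\<close>. This is bounded in
  \<open>W\<^sup>1\<^sup>,\<^sup>1\<close> uniformly in \<open>m\<close>. Testing \<open>D\<^sub>f h\<close> with \<open>\<phi>(x) = \<tau>(2 \<pi> m x)\<close>, the term \<open>\<epsilon> \<integral> \<phi>''(S\<^sub>f) b w\<close> is of order
  \<open>\<epsilon> m d0 \<integral> b\<^sup>2\<close>, because \<open>\<phi>''(S\<^sub>1)\<close> and \<open>w\<close> oscillate in phase. Replacing \<open>S\<^sub>1\<close> by \<open>S\<^sub>f\<close>, which is at distance \<open>O(d0 / m)\<close>, costs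
  \<open>m\<^sup>3 (d0 / m)\<^sup>2 = m d0\<^sup>2\<close>, harmless for small \<open>d0\<close>; the terms without \<open>w\<close> stay bounded. So the norm of \<open>D\<^sub>f h\<close> grows
  like \<open>m\<close>, and \<open>N\<close> has only to be large enough to resolve \<open>w\<close> and \<open>\<phi>\<close>.\<close>

lemma oscillating_density:
  assumes e: "\<epsilon> \<in> {0..\<epsilon>0}" "0 < \<epsilon>" and h: "h \<in> F_N M0" and y0: "Gd 0 h (T y0) \<noteq> 0"
  obtains L where "0 \<le> L" "\<And>R. \<exists>N2. \<forall>N\<ge>N2. \<exists>f\<in>densities \<inter> F_N N. Wnorm 1 (\<lambda>x. f x - 1) \<le> L \<and> R \<le> Wnorm 1 (disc_deriv N \<epsilon> f h)"
proof -
  define b where "b y = Gd 0 h (T y)" for y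
  define H where "H = A ^ 3 * L1norm h"
  obtain b1 b2 where db: "\<And>y. (b has_real_derivative b1 y) (at y)" and db1: "\<And>y. (b1 has_real_derivative b2 y) (at y)"
    and cb2: "continuous_on UNIV b2" and bb: "\<And>y. \<bar>b y\<bar> \<le> H" "\<And>y. \<bar>b1 y\<bar> \<le> H" "\<And>y. \<bar>b2 y\<bar> \<le> 2 * H"
    by (rule observable_derivs[OF h, folded b_def H_def], rule that; assumption)
  have H0: "0 \<le> H" using bb(1)[of 0] by linarith
  have cb: "continuous_on UNIV b" "continuous_on UNIV b1" using db db1 by (meson DERIV_isCont continuous_at_imp_continuous_on)+
  have pb: "periodic1 b" unfolding b_def using periodic_T[OF Gd_periodic[of 0 h]] by simp
  obtain k3 where k3: "0 < k3" "\<And>j x. j \<le> 3 \<Longrightarrow> \<bar>(deriv ^^ j) h x\<bar> \<le> k3" using F_N_bounded[OF h] by blast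
  define P where "P = 4 * H + 3 * k3 + 1"
  have P1: "1 \<le> P" "0 < P" using H0 k3(1) unfolding P_def by linarith+
  have Pb: "\<bar>b y\<bar> + \<bar>b1 y\<bar> + \<bar>b2 y\<bar> \<le> P" for y using bb[of y] k3(1) unfolding P_def by linarith
  have Pb0: "\<bar>b y\<bar> \<le> P" "\<bar>b1 y\<bar> \<le> P" for y using Pb[of y] by linarith+
  have Phh: "\<bar>h y\<bar> + \<bar>deriv h y\<bar> + \<bar>deriv (deriv h) y\<bar> \<le> P" for y
  proof -
    have "\<bar>h y\<bar> \<le> k3" "\<bar>deriv h y\<bar> \<le> k3" "\<bar>deriv (deriv h) y\<bar> \<le> k3"
      using k3(2)[of 0 y] k3(2)[of 1 y] k3(2)[of 2 y] by (simp_all add: numeral_2_eq_2 One_nat_def)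
    thus ?thesis using H0 unfolding P_def by linarith
  qed
  define I where "I = cint (\<lambda>y. (b y)\<^sup>2)"
  have I: "0 < I" unfolding I_def using cint_square_pos[OF cb(1) pb, of y0] y0 by (simp add: b_def)
  define M where "M = map_bound \<epsilon>0"
  define C1 where "C1 = 10 * M\<^sup>2 * P"
  have C10: "0 \<le> C1" using P1 by (simp add: C1_def)
  define q :: real where "q = 2 * pi"
  have q: "0 < q" by (simp add: q_def)
  have A0: "0 < A" using A(1) by simp
  define s0 where "s0 = S \<epsilon> (\<lambda>x. 1)"
  have c1: "continuous_on UNIV (\<lambda>x::real. 1::real)" "cint (\<lambda>x. \<bar>1\<bar>) \<le> 1" by (auto simp: cint_const)
  have eE: "\<bar>\<epsilon>\<bar> \<le> \<epsilon>0" using e by simp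
  have M: "\<bar>S1 \<epsilon> (\<lambda>x. 1) y\<bar> \<le> M" "1 \<le> M" for y using map_derivs_bound(1,4)[OF c1 eE] by (simp_all add: M_def)
  have ds0: "(s0 has_real_derivative S1 \<epsilon> (\<lambda>x. 1) y) (at y)" for y unfolding s0_def by (rule S_deriv(1)[OF c1(1)])
  have cs0: "continuous_on UNIV s0" unfolding s0_def by (rule S_cont(1)[OF c1(1)])
  \<comment> \<open>The first bound keeps the density nonnegative, the second lets the main term dominate the change of the map.\<close>
  define d0 where "d0 = min (1 / (4 * P)) (I / (8 * q * \<epsilon> * A * P ^ 3))"
  have d0: "0 < d0" using P1 I q e A0 by (simp add: d0_def)
  have d0P: "d0 * P \<le> 1/4"
  proof -
    have "d0 * P \<le> 1 / (4 * P) * P" unfolding d0_def using P1 by (intro mult_right_mono min.cobounded1) auto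
    thus ?thesis using P1 by simp
  qed
  have d0I: "8 * q * \<epsilon> * A * P ^ 3 * d0 \<le> I"
  proof -
    have pos: "0 < 8 * q * \<epsilon> * A * P ^ 3" using q e A0 P1 by simp
    have "d0 \<le> I / (8 * q * \<epsilon> * A * P ^ 3)" unfolding d0_def by (rule min.cobounded2)
    thus ?thesis using pos by (simp only: pos_le_divide_eq mult.commute)
  qed
  define L where "L = 1 + (d0 * q * M * P + d0 * P)"
  show ?thesis
  proof (rule that[of L])
    show "0 \<le> L" using d0 q M(2) P1 by (simp add: L_def add_nonneg_nonneg)
    fix R :: real
    define X where "X = R + C1 + 2 * \<epsilon> * C1 + \<epsilon> * (P + q\<^sup>2 * P)"
    define G where "G = \<epsilon> * (q\<^sup>2 * d0 * I / 4)"
    have G: "0 < G" using e q d0 I by (simp add: G_def)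
    \<comment> \<open>The main term grows like \<open>G m\<close>, and \<open>X\<close> collects the target \<open>R\<close> and all bounded errors.\<close>
    define m where "m = nat \<lceil>X / G\<rceil> + 1"
    have m0: "0 < m" "1 \<le> real m" by (simp_all add: m_def)
    have mX: "X \<le> G * real m"
    proof -
      have "X / G \<le> real (nat \<lceil>X / G\<rceil>)" by (rule real_nat_ceiling_ge)
      also have "\<dots> \<le> real m" by (simp add: m_def)
      finally show ?thesis using G by (simp add: pos_divide_le_eq mult.commute)
    qed
    define Q where "Q = q * real m"
    have Q: "0 < Q" using q m0 by (simp add: Q_def)
    define a where "a = d0 * P / real m"
    have a: "0 \<le> a" "a \<le> 1/4"
    proof -
      show "0 \<le> a" using d0 P1 by (simp add: a_def)
      have "a \<le> d0 * P" using d0 P1 m0 by (simp add: a_def divide_le_eq)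
      thus "a \<le> 1/4" using d0P by linarith
    qed
    obtain \<tau> \<tau>1 :: "real \<Rightarrow> real" where \<tau>: "\<And>x. (\<tau> has_real_derivative \<tau>1 x) (at x)" "\<And>x. (\<tau>1 has_real_derivative - \<tau> x) (at x)"
      "\<And>x. \<bar>\<tau> x\<bar> \<le> 1" "\<And>x. \<bar>\<tau>1 x\<bar> \<le> 1" "(\<lambda>x. \<tau> (Q * x)) \<in> F_N (Suc m)"
      "I / 2 \<le> cint (\<lambda>y. (\<tau> (Q * s0 y) * b y)\<^sup>2)"
      by (rule oscillation_choice[OF cb(1) cs0, of m, folded q_def, folded Q_def I_def], rule that; assumption)
    have lin: "((\<lambda>x. Q * x) has_real_derivative Q) (at x)" for x by (auto intro!: derivative_eq_intros)
    define \<phi> where "\<phi> x = \<tau> (Q * x)" for x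
    have \<phi>F: "\<phi> \<in> F_N (Suc m)" unfolding \<phi>_def[abs_def] by (rule \<tau>(5))
    have d\<phi>: "deriv \<phi> = (\<lambda>x. \<tau>1 (Q * x) * Q)"
      unfolding \<phi>_def[abs_def] by (intro ext DERIV_imp_deriv DERIV_chain2[OF \<tau>(1) lin])
    have dd\<phi>: "deriv (deriv \<phi>) = (\<lambda>x. - \<tau> (Q * x) * Q * Q)"
      unfolding d\<phi> by (intro ext DERIV_imp_deriv DERIV_cmult_right DERIV_chain2[OF \<tau>(2) lin])
    define \<phi>2 where "\<phi>2 = deriv (deriv \<phi>)"
    note \<phi>2F = F_N_deriv(2)[OF F_N_deriv(2)[OF \<phi>F], folded \<phi>2_def]
    have \<phi>2: "\<phi>2 x = - (Q\<^sup>2 * \<tau> (Q * x))" for x by (simp add: \<phi>2_def dd\<phi> power2_eq_square)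
    have \<phi>2b: "\<bar>\<phi>2 x\<bar> \<le> Q\<^sup>2" for x
    proof -
      have "Q\<^sup>2 * \<bar>\<tau> (Q * x)\<bar> \<le> Q\<^sup>2 * 1" by (intro mult_left_mono \<tau>) simp
      thus ?thesis by (simp add: \<phi>2 abs_mult)
    qed
    have \<phi>2L: "\<bar>\<phi>2 x - \<phi>2 y\<bar> \<le> Q ^ 3 * \<bar>x - y\<bar>" for x y
    proof (rule lipschitz_from_deriv)
      show "(\<phi>2 has_real_derivative - (Q\<^sup>2 * (\<tau>1 (Q * z) * Q))) (at z)" for z
        unfolding \<phi>2[abs_def] by (intro DERIV_minus DERIV_cmult DERIV_chain2[OF \<tau>(1) lin])
      show "\<bar>- (Q\<^sup>2 * (\<tau>1 (Q * z) * Q))\<bar> \<le> Q ^ 3" for z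
      proof -
        have "Q ^ 3 * \<bar>\<tau>1 (Q * z)\<bar> \<le> Q ^ 3 * 1" using Q by (intro mult_left_mono \<tau>) simp
        thus ?thesis using Q by (simp add: abs_mult power2_eq_square power3_eq_cube mult_ac)
      qed
    qed
    define w where "w y = d0 / real m * (\<tau> (Q * s0 y) * b y)" for y
    define w1 where "w1 y = d0 / real m * (\<tau>1 (Q * s0 y) * (Q * S1 \<epsilon> (\<lambda>x. 1) y) * b y + b1 y * \<tau> (Q * s0 y))" for y
    have dw: "(w has_real_derivative w1 y) (at y)" for y unfolding w_def[abs_def] w1_def
      by (intro DERIV_cmult DERIV_mult db DERIV_chain2[OF \<tau>(1)] ds0)
    have c\<tau>: "continuous_on UNIV \<tau>" "continuous_on UNIV \<tau>1" using \<tau>(1,2) by (meson DERIV_isCont continuous_at_imp_continuous_on)+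
    have c\<tau>s: "continuous_on UNIV (\<lambda>y. \<tau> (Q * s0 y))" "continuous_on UNIV (\<lambda>y. \<tau>1 (Q * s0 y))"
      by (intro continuous_on_compose2[OF c\<tau>(1)] continuous_on_compose2[OF c\<tau>(2)] continuous_intros cs0; simp)+
    have cw: "continuous_on UNIV w" by (rule deriv_imp_cont[OF dw])
    have cw1: "continuous_on UNIV w1" unfolding w1_def[abs_def] by (intro continuous_intros c\<tau>s cb S_cont(2)[OF c1(1)])
    have pw: "periodic1 w"
    proof -
      obtain d :: int where d: "\<And>y. s0 (y + 1) = s0 y + of_int d" using S_lift[of \<epsilon> "\<lambda>x. 1"] by (auto simp: circle_map_lift_def s0_def)
      have "\<tau> (Q * s0 (y + 1)) = \<tau> (Q * s0 y)" for y
        using periodic1_int[OF F_N_periodic[OF \<phi>F], of "s0 y" d] by (simp add: \<phi>_def d)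
      thus ?thesis using pb by (simp add: periodic1_def w_def)
    qed
    have wa: "\<bar>w y\<bar> \<le> a" for y
    proof -
      have "\<bar>\<tau> (Q * s0 y) * b y\<bar> \<le> 1 * P" unfolding abs_mult by (intro mult_mono \<tau> Pb0) auto
      hence "d0 / real m * \<bar>\<tau> (Q * s0 y) * b y\<bar> \<le> d0 / real m * P" using d0 by (intro mult_left_mono) auto
      thus ?thesis using d0 by (simp add: w_def a_def abs_mult)
    qed
    have w1b: "\<bar>w1 y\<bar> \<le> d0 * q * M * P + d0 * P" for y
    proof -
      have 1: "\<bar>\<tau>1 (Q * s0 y) * (Q * S1 \<epsilon> (\<lambda>x. 1) y) * b y\<bar> \<le> 1 * (Q * M) * P"
        unfolding abs_mult using Q M by (intro mult_mono \<tau> Pb0) auto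
      have 2: "\<bar>b1 y * \<tau> (Q * s0 y)\<bar> \<le> P * 1" unfolding abs_mult using P1 by (intro mult_mono \<tau> Pb0) auto
      have "\<bar>w1 y\<bar> = d0 / real m * \<bar>\<tau>1 (Q * s0 y) * (Q * S1 \<epsilon> (\<lambda>x. 1) y) * b y + b1 y * \<tau> (Q * s0 y)\<bar>"
        using d0 by (simp add: w1_def abs_mult)
      also have "\<dots> \<le> d0 / real m * (Q * M * P + P)" using 1 2 d0 by (intro mult_left_mono) auto
      also have "\<dots> = d0 * q * M * P + d0 * P / real m" using m0 by (simp add: Q_def field_simps)
      also have "d0 * P / real m \<le> d0 * P" using d0 P1 m0 by (simp add: divide_le_eq)
      finally show ?thesis by simp
    qed
    define e2 where "e2 = 1 / (real m)\<^sup>2"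
    have e2: "0 < e2" using m0 by (simp add: e2_def)
    obtain n1 where n1: "0 < n1" "\<And>N x. N \<ge> n1 \<Longrightarrow> \<bar>Pi_N N \<phi>2 x - \<phi>2 x\<bar> \<le> 1"
      using Pi_N_uniform[OF F_N_periodic[OF \<phi>2F] F_N_cont[OF \<phi>2F], of 1] by auto
    obtain n2 where n2: "0 < n2" "\<And>N x. N \<ge> n2 \<Longrightarrow> \<bar>Pi_N N w x - w x\<bar> \<le> e2"
      using Pi_N_uniform[OF pw cw e2] by blast
    show "\<exists>N2. \<forall>N\<ge>N2. \<exists>f\<in>densities \<inter> F_N N. Wnorm 1 (\<lambda>x. f x - 1) \<le> L \<and> R \<le> Wnorm 1 (disc_deriv N \<epsilon> f h)"
    proof (rule exI[of _ "Suc m + n1 + n2 + M0"], intro allI impI)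
      fix N assume N: "Suc m + n1 + n2 + M0 \<le> N"
      hence N0: "0 < N" and Ns: "Suc m \<le> N" "n1 \<le> N" "n2 \<le> N" "M0 \<le> N" by auto
      note hN = F_N_mono[OF Ns(4) h] and \<phi>N = F_N_mono[OF Ns(1) \<phi>F]
      note iw = integrable_circ_cont[OF cw]
      define z where "z = Pi_N N w"
      define c0 where "c0 = cint w"
      \<comment> \<open>Subtracting the mean of the perturbation keeps the total mass equal to one.\<close>
      define f where "f x = (1 - c0) + z x" for x
      have zF: "z \<in> F_N N" unfolding z_def by (rule Pi_N_F_N[OF N0 iw])
      note cz = F_N_cont[OF zF]
      have za: "\<bar>z y\<bar> \<le> a" for y unfolding z_def by (rule Pi_N_sup[OF N0 cw wa])
      have c0a: "\<bar>c0\<bar> \<le> a"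
      proof -
        have "\<bar>c0\<bar> \<le> L1norm w" unfolding c0_def by (rule cint_abs_le)
        also have "\<dots> \<le> a" using wa iw by (intro cint_le_bound) auto
        finally show ?thesis .
      qed
      have fF: "f \<in> F_N N" unfolding f_def[abs_def] by (intro F_N_add F_N_const N0 zF)
      note cf = F_N_cont[OF fF]
      have f_pos: "0 \<le> f x" for x using za[of x] c0a a unfolding f_def by linarith
      have "cint f = (1 - c0) + cint z" unfolding f_def[abs_def] using F_N_integrable[OF zF] by (subst cint_add) (auto simp: cint_const)
      also have "cint z = c0" unfolding z_def c0_def by (rule cint_Pi_N[OF N0 iw])
      finally have cf1: "cint f = 1" by simp
      have fd: "f \<in> densities" using F_N_L1[OF fF] cf1 f_pos by (simp add: densities_def)
      have fd1: "L1norm f \<le> 1" using density_F_N(2)[OF fd fF] by simp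
      have f1: "\<bar>f x - 1\<bar> \<le> 2 * a" for x using za[of x] c0a unfolding f_def by linarith
      have fm1F: "(\<lambda>x. f x - 1) \<in> F_N N" by (intro F_N_diff fF F_N_const N0)
      have "Wnorm 1 (\<lambda>x. f x - 1) \<le> L"
      proof -
        have "deriv (\<lambda>x. f x - 1) = deriv z"
        proof (intro ext DERIV_imp_deriv)
          fix x
          show "((\<lambda>x. f x - 1) has_real_derivative deriv z x) (at x)"
            unfolding f_def by (rule derivative_eq_intros F_N_deriv(1)[OF zF] refl | simp)+
        qed
        also have "deriv z = Pi_N N w1" unfolding z_def
          using Pi_N_deriv[OF N0] is_weak_deriv_classical[OF dw cw1 pw] by blast
        finally have d: "deriv (\<lambda>x. f x - 1) = Pi_N N w1" .
        have "\<bar>Pi_N N w1 x\<bar> \<le> d0 * q * M * P + d0 * P" for x by (rule Pi_N_sup[OF N0 cw1 w1b])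
        hence "cint (\<lambda>x. \<bar>Pi_N N w1 x\<bar>) \<le> d0 * q * M * P + d0 * P"
          using F_N_integrable[OF Pi_N_F_N[OF N0 integrable_circ_cont[OF cw1]]] by (intro cint_le_bound) auto
        moreover have "cint (\<lambda>x. \<bar>f x - 1\<bar>) \<le> 1"
        proof (rule cint_le_bound)
          show "\<bar>f x - 1\<bar> \<le> 1" for x using f1[of x] a by linarith
        qed (use F_N_integrable[OF fm1F] in auto)
        ultimately show ?thesis unfolding Wnorm1_F_N[OF fm1F] d L_def by linarith
      qed
      moreover have "R \<le> Wnorm 1 (disc_deriv N \<epsilon> f h)"
      proof -
        define \<psi> where "\<psi> = Pi_N N \<phi>"
        define \<psi>2 where "\<psi>2 = deriv (deriv \<psi>)"
        note c\<phi> = F_N_cont[OF \<phi>F]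
        have \<psi>F: "\<psi> \<in> F_N N" unfolding \<psi>_def by (rule Pi_N_F_N[OF N0 integrable_circ_cont[OF c\<phi>]])
        have \<psi>b: "\<bar>\<psi> x\<bar> \<le> 2" for x using Pi_N_sup[OF N0 c\<phi>, of 1 x] \<tau>(3) by (simp add: \<psi>_def \<phi>_def)
        have \<psi>2P: "\<psi>2 = Pi_N N \<phi>2" unfolding \<psi>2_def \<psi>_def \<phi>2_def
          by (simp only: Pi_N_deriv_F_N[OF N0 \<phi>F] Pi_N_deriv_F_N[OF N0 F_N_deriv(2)[OF \<phi>F]])
        have \<psi>2F: "\<psi>2 \<in> F_N N" unfolding \<psi>2_def by (intro F_N_deriv \<psi>F)
        let ?S = "S \<epsilon> f"
        have cS: "continuous_on UNIV ?S" by (rule S_cont(1)[OF cf])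
        have c\<psi>S: "continuous_on UNIV (\<lambda>y. \<psi>2 (?S y))" by (intro continuous_on_compose2[OF F_N_cont[OF \<psi>2F] cS]) auto
        have c\<phi>s: "continuous_on UNIV (\<lambda>y. \<phi>2 (s0 y))" by (intro continuous_on_compose2[OF F_N_cont[OF \<phi>2F] cs0]) auto
        note ex = density_expanding(2)[OF fd cf e(1)]
        define U where "U = cint (\<lambda>y. deriv \<psi> (?S y) * h y)"
        define Y where "Y = cint (\<lambda>y. \<psi>2 (?S y) * b y)"
        define Z where "Z = cint (\<lambda>y. \<psi>2 (?S y) * (b y * z y))"
        define J where "J = cint (\<lambda>y. \<phi>2 (s0 y) * (b y * w y))"
        have U: "\<bar>U\<bar> \<le> C1" unfolding U_def C1_def M_def
          by (rule transported_oscillation_bounded(1)[OF cf fd1 ex eE F_N_deriv(1)[OF h] F_N_deriv(1)[OF F_N_deriv(2)[OF h]]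
                F_N_cont[OF F_N_deriv(2)[OF F_N_deriv(2)[OF h]]] F_N_periodic[OF h] Phh \<psi>F \<psi>b])
        have Y: "\<bar>Y\<bar> \<le> C1" unfolding Y_def C1_def M_def \<psi>2_def
          by (rule transported_oscillation_bounded(2)[OF cf fd1 ex eE db db1 cb2 pb Pb \<psi>F \<psi>b])
        have split: "cint (\<lambda>y. \<psi>2 (?S y) * (b y * f y)) = (1 - c0) * Y + Z"
        proof -
          have "cint (\<lambda>y. \<psi>2 (?S y) * (b y * f y)) = cint (\<lambda>y. (1 - c0) * (\<psi>2 (?S y) * b y) + \<psi>2 (?S y) * (b y * z y))"
            by (intro cint_cong) (simp add: f_def algebra_simps)
          also have "\<dots> = cint (\<lambda>y. (1 - c0) * (\<psi>2 (?S y) * b y)) + Z"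
            unfolding Z_def by (intro cint_add integrable_circ_cont continuous_intros c\<psi>S cb cz)
          finally show ?thesis by (simp only: cint_cmult Y_def)
        qed
        have J: "q\<^sup>2 * d0 * I / 2 * real m \<le> \<bar>J\<bar>"
        proof -
          have "J = cint (\<lambda>y. - (Q\<^sup>2 * d0 / real m) * (\<tau> (Q * s0 y) * b y)\<^sup>2)"
            unfolding J_def by (intro cint_cong) (simp add: \<phi>2 w_def power2_eq_square)
          also have "\<dots> = - (Q\<^sup>2 * d0 / real m) * cint (\<lambda>y. (\<tau> (Q * s0 y) * b y)\<^sup>2)" by (rule cint_cmult)
          also have "\<bar>\<dots>\<bar> = Q\<^sup>2 * d0 / real m * cint (\<lambda>y. (\<tau> (Q * s0 y) * b y)\<^sup>2)"
            unfolding abs_mult using d0 cint_nonneg[of "\<lambda>y. (\<tau> (Q * s0 y) * b y)\<^sup>2"] by simp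
          finally have Jeq: "\<bar>J\<bar> = Q\<^sup>2 * d0 / real m * cint (\<lambda>y. (\<tau> (Q * s0 y) * b y)\<^sup>2)" .
          have "q\<^sup>2 * d0 * I / 2 * real m = Q\<^sup>2 * d0 / real m * (I / 2)"
            using m0 by (simp add: Q_def power2_eq_square field_simps)
          also have "\<dots> \<le> \<bar>J\<bar>" unfolding Jeq using d0 by (intro mult_left_mono \<tau>) auto
          finally show ?thesis .
        qed
        have ZJ: "\<bar>Z - J\<bar> \<le> P + q\<^sup>2 * d0 * I / 4 * real m + q\<^sup>2 * P"
        proof -
          have Sd: "\<bar>?S y - s0 y\<bar> \<le> \<epsilon> * A * (2 * a)" for y
          proof -
            have "\<bar>?S y - s0 y\<bar> \<le> \<bar>\<epsilon>\<bar> * A * cint (\<lambda>x. \<bar>f x - 1\<bar>)" unfolding s0_def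
              by (rule S_diff[OF F_N_integrable[OF fF] integrable_circ_cont[OF c1(1)]])
            also have "\<dots> \<le> \<bar>\<epsilon>\<bar> * A * (2 * a)" using A0 f1 F_N_integrable[OF fm1F]
              by (intro mult_left_mono cint_le_bound) auto
            finally show ?thesis using e by simp
          qed
          have pt: "\<bar>\<psi>2 (?S y) * (b y * z y) - \<phi>2 (s0 y) * (b y * w y)\<bar> \<le> P + q\<^sup>2 * d0 * I / 4 * real m + q\<^sup>2 * P" for y
          proof -
            have bz: "\<bar>b y * z y\<bar> \<le> P * a" unfolding abs_mult using P1 by (intro mult_mono za Pb0) auto
            have t1: "\<bar>(\<psi>2 (?S y) - \<phi>2 (?S y)) * (b y * z y)\<bar> \<le> 1 * (P * a)"
              unfolding abs_mult[of "\<psi>2 (?S y) - \<phi>2 (?S y)"] using n1(2)[OF Ns(2)] by (intro mult_mono bz) (auto simp: \<psi>2P)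
            have "\<bar>\<phi>2 (?S y) - \<phi>2 (s0 y)\<bar> \<le> Q ^ 3 * (\<epsilon> * A * (2 * a))"
              by (rule order_trans[OF \<phi>2L]) (use Q Sd in \<open>intro mult_left_mono, auto\<close>)
            hence t2: "\<bar>(\<phi>2 (?S y) - \<phi>2 (s0 y)) * (b y * z y)\<bar> \<le> Q ^ 3 * (\<epsilon> * A * (2 * a)) * (P * a)"
              unfolding abs_mult[of "\<phi>2 (?S y) - \<phi>2 (s0 y)"] using Q e A0 a by (intro mult_mono bz) auto
            have "\<bar>z y - w y\<bar> \<le> e2" unfolding z_def by (rule n2(2)[OF Ns(3)])
            hence t3: "\<bar>\<phi>2 (s0 y) * (b y * (z y - w y))\<bar> \<le> Q\<^sup>2 * (P * e2)"
              unfolding abs_mult using P1 by (intro mult_mono \<phi>2b Pb0) auto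
            have v1: "1 * (P * a) \<le> P" using a P1 by simp
            have v2: "Q ^ 3 * (\<epsilon> * A * (2 * a)) * (P * a) \<le> q\<^sup>2 * d0 * I / 4 * real m"
            proof -
              have "Q ^ 3 * (\<epsilon> * A * (2 * a)) * (P * a) = (q\<^sup>2 * d0 * real m / 4) * (8 * q * \<epsilon> * A * P ^ 3 * d0)"
                unfolding Q_def a_def using m0 by (simp add: power2_eq_square power3_eq_cube field_simps)
              also have "\<dots> \<le> (q\<^sup>2 * d0 * real m / 4) * I" using d0 by (intro mult_left_mono d0I) auto
              finally show ?thesis by (simp add: mult_ac)
            qed
            have v3: "Q\<^sup>2 * (P * e2) = q\<^sup>2 * P" using m0 by (simp add: Q_def e2_def power_mult_distrib)
            have "\<psi>2 (?S y) * (b y * z y) - \<phi>2 (s0 y) * (b y * w y)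
              = (\<psi>2 (?S y) - \<phi>2 (?S y)) * (b y * z y) + (\<phi>2 (?S y) - \<phi>2 (s0 y)) * (b y * z y) + \<phi>2 (s0 y) * (b y * (z y - w y))"
              by (simp add: algebra_simps)
            thus ?thesis using t1 t2 t3 v1 v2 v3 by linarith
          qed
          have ZJ: "Z - J = cint (\<lambda>y. \<psi>2 (?S y) * (b y * z y) - \<phi>2 (s0 y) * (b y * w y))"
            unfolding Z_def J_def by (intro cint_diff[symmetric] integrable_circ_cont continuous_intros c\<psi>S c\<phi>s cb cz cw)
          have "\<bar>Z - J\<bar> \<le> cint (\<lambda>y. \<bar>\<psi>2 (?S y) * (b y * z y) - \<phi>2 (s0 y) * (b y * w y)\<bar>)" unfolding ZJ by (rule cint_abs_le)
          also have "\<dots> \<le> P + q\<^sup>2 * d0 * I / 4 * real m + q\<^sup>2 * P"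
            by (rule cint_le_bound[OF _ pt]) (intro integrable_circ_cont continuous_intros c\<psi>S c\<phi>s cb cz cw)
          finally show ?thesis .
        qed
        have "q\<^sup>2 * d0 * I / 4 * real m - (P + q\<^sup>2 * P) \<le> \<bar>Z\<bar>"
        proof -
          have "q\<^sup>2 * d0 * I / 2 * real m = q\<^sup>2 * d0 * I / 4 * real m + q\<^sup>2 * d0 * I / 4 * real m" by simp
          thus ?thesis using J ZJ by linarith
        qed
        hence "\<epsilon> * (q\<^sup>2 * d0 * I / 4 * real m - (P + q\<^sup>2 * P)) \<le> \<epsilon> * \<bar>Z\<bar>" using e by (intro mult_left_mono) auto
        hence Zb: "G * real m - \<epsilon> * (P + q\<^sup>2 * P) \<le> \<epsilon> * \<bar>Z\<bar>" by (simp add: G_def algebra_simps)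
        have Yb: "\<bar>\<epsilon> * ((1 - c0) * Y)\<bar> \<le> \<epsilon> * (2 * C1)"
        proof -
          have "\<bar>1 - c0\<bar> \<le> 2" using c0a a by linarith
          hence "\<bar>(1 - c0) * Y\<bar> \<le> 2 * C1" unfolding abs_mult using Y by (intro mult_mono) auto
          thus ?thesis using e by (simp add: abs_mult)
        qed
        have "\<bar>U + \<epsilon> * ((1 - c0) * Y + Z)\<bar> \<le> Wnorm 1 (disc_deriv N \<epsilon> f h)"
          using disc_deriv_dual[OF N0 fF hN \<phi>N, of \<epsilon>] \<tau>(3) split unfolding U_def \<psi>2_def \<psi>_def by (simp add: \<phi>_def b_def)
        moreover have "\<epsilon> * ((1 - c0) * Y + Z) = \<epsilon> * ((1 - c0) * Y) + \<epsilon> * Z" by (rule distrib_left)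
        moreover have "\<bar>\<epsilon> * Z\<bar> = \<epsilon> * \<bar>Z\<bar>" using e by (simp add: abs_mult)
        ultimately have "\<epsilon> * \<bar>Z\<bar> - C1 - \<epsilon> * (2 * C1) \<le> Wnorm 1 (disc_deriv N \<epsilon> f h)" using U Yb by linarith
        moreover have "X = R + C1 + \<epsilon> * (2 * C1) + \<epsilon> * (P + q\<^sup>2 * P)" by (simp add: X_def)
        ultimately show ?thesis using Zb mX by linarith
      qed
      ultimately show "\<exists>f\<in>densities \<inter> F_N N. Wnorm 1 (\<lambda>x. f x - 1) \<le> L \<and> R \<le> Wnorm 1 (disc_deriv N \<epsilon> f h)"
        using fd fF by blast
    qed
  qed
qed

end

context coupled_map begin

text \<open>The Fejer means of \<open>g(x0, \<cdot>)\<close> converge to it, so they pair nontrivially with it.\<close>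

lemma detecting_polynomial:
  assumes "g x0 y0 \<noteq> 0"
  obtains M0 h where "h \<in> F_N M0" "Gd 0 h x0 \<noteq> 0"
proof -
  define r where "r y = g0 (x0, y)" for y
  have cr: "continuous_on UNIV r" using g0_slice[of 0 x0] by (simp add: r_def[abs_def])
  have pr: "periodic1 r" using g0_C(2)[of 0] by (simp add: r_def periodic1_def periodic2_def)
  define I where "I = cint (\<lambda>y. (r y)\<^sup>2)"
  have I: "0 < I" unfolding I_def using cint_square_pos[OF cr pr, of y0] assms by (simp add: r_def g0_def)
  define R where "R = L1norm r"
  have R: "0 \<le> R" unfolding R_def by (rule cint_nonneg) simp
  define e where "e = I / (2 * (R + 1))"
  have e: "0 < e" using I R by (simp add: e_def)
  have eR: "e * R < I"
  proof -
    have "e * (R + 1) = I / 2" using R by (simp add: e_def field_simps)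
    hence "e * R + e = I / 2" by (simp add: distrib_left)
    thus ?thesis using e I by linarith
  qed
  obtain M0 where M0: "0 < M0" "\<And>N x. N \<ge> M0 \<Longrightarrow> \<bar>Pi_N N r x - r x\<bar> \<le> e"
    using Pi_N_uniform[OF pr cr e] by blast
  define h where "h = Pi_N M0 r"
  have hF: "h \<in> F_N M0" unfolding h_def by (rule Pi_N_F_N[OF M0(1) integrable_circ_cont[OF cr]])
  note ch = F_N_cont[OF hF]
  have "cint (\<lambda>y. r y * h y) - I = cint (\<lambda>y. r y * h y - (r y)\<^sup>2)"
    unfolding I_def by (intro cint_diff[symmetric] integrable_circ_cont continuous_intros cr ch)
  also have "\<dots> = cint (\<lambda>y. (h y - r y) * r y)" by (intro cint_cong) (simp add: power2_eq_square algebra_simps)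
  also have "\<bar>\<dots>\<bar> \<le> e * R" unfolding R_def
    by (rule cint_mult_le[OF integrable_circ_cont[OF cr] borel_measurable_continuous_onI])
       (use M0(2)[of M0, folded h_def] in \<open>auto intro!: continuous_intros cr ch\<close>)
  finally have "cint (\<lambda>y. r y * h y) \<noteq> 0" using eR by auto
  hence "Gd 0 h x0 \<noteq> 0" by (simp add: Gd_def r_def)
  thus ?thesis by (rule that[OF hF])
qed

end

context expanding_coupled_map begin

text \<open>The lift has nonzero degree, because its derivative does not vanish.\<close>

lemma T_onto: obtains y and n :: int where "T y = x0 + of_int n"
proof -
  have c1: "(\<lambda>x::real. 1::real) \<in> densities" "continuous_on UNIV (\<lambda>x::real. 1::real)"
    using one_BK[of 1] by (auto simp: BK_def)
  have "S1 0 (\<lambda>x. 1) y = T1 y" for y by (simp add: S1_def)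
  hence nz: "T1 y \<noteq> 0" for y using density_expanding(2)[OF c1, of 0 y] \<epsilon>0 by auto
  obtain d :: int where d: "\<And>x. T (x + 1) = T x + of_int d" using T_lift by blast
  have d0: "d \<noteq> 0"
  proof
    assume "d = 0"
    hence "T 1 = T 0" using d[of 0] by simp
    moreover obtain z where "T 1 - T 0 = (1 - 0) * T1 z" using MVT2[of 0 1 T T1] T_deriv(1) by auto
    ultimately show False using nz[of z] by simp
  qed
  have conn: "connected (range T)" by (intro connected_continuous_image T_cont) auto
  have T1: "T 1 = T 0 + of_int d" using d[of 0] by simp
  have fr: "0 \<le> frac (x0 - T 0)" "frac (x0 - T 0) < 1" using frac_ge_0 frac_lt_1 by auto
  have fl: "T 0 + frac (x0 - T 0) = x0 + of_int (- \<lfloor>x0 - T 0\<rfloor>)" by (simp add: frac_def)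
  show ?thesis
  proof (cases "0 < d")
    case True
    hence "1 \<le> (of_int d :: real)" by simp
    hence "T 0 \<le> T 0 + frac (x0 - T 0)" "T 0 + frac (x0 - T 0) \<le> T 1" using fr T1 by linarith+
    hence "T 0 + frac (x0 - T 0) \<in> range T" by (rule connectedD_interval[OF conn rangeI rangeI])
    then obtain y where "T y = T 0 + frac (x0 - T 0)" by auto
    thus ?thesis using that[of y "- \<lfloor>x0 - T 0\<rfloor>"] fl by simp
  next
    case False
    hence "d \<le> -1" using d0 by simp
    hence "of_int d \<le> (-1 :: real)" by (metis of_int_le_iff of_int_minus of_int_1)
    hence "T 1 \<le> T 0 + frac (x0 - T 0) - 1" "T 0 + frac (x0 - T 0) - 1 \<le> T 0" using fr T1 by linarith+
    hence "T 0 + frac (x0 - T 0) - 1 \<in> range T" by (rule connectedD_interval[OF conn rangeI rangeI])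
    then obtain y where "T y = T 0 + frac (x0 - T 0) - 1" by auto
    thus ?thesis using that[of y "- \<lfloor>x0 - T 0\<rfloor> - 1"] fl by simp
  qed
qed

lemma disc_deriv_one_bound:
  obtains C where "0 \<le> C" "\<And>\<epsilon> N h. \<epsilon> \<in> {0..\<epsilon>0} \<Longrightarrow> 0 < N \<Longrightarrow> h \<in> F_N N \<Longrightarrow> Wnorm 1 (disc_deriv N \<epsilon> (\<lambda>x. 1) h) \<le> C * Wnorm 1 h"
proof (rule that[of "lam + CLY + \<epsilon>0 * transport_const 1"])
  have transport_const: "0 \<le> transport_const 1" using A(1) by (simp add: transport_const_def)
  show "0 \<le> lam + CLY + \<epsilon>0 * transport_const 1" using lam CLY \<epsilon>0 transport_const by simp
  fix \<epsilon> N h assume e: "\<epsilon> \<in> {0..\<epsilon>0}" and N: "0 < N" and h: "h \<in> F_N N"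
  have one: "(\<lambda>x::real. 1::real) \<in> densities" "(\<lambda>x::real. 1::real) \<in> F_N N" "Wnorm 2 (\<lambda>x::real. 1::real) \<le> 1"
    using one_BK[OF N] by (auto simp: BK_def)
  note st = transfer_step(2,3)[OF N one e h]
  define H where "H = L1norm h"
  have H: "H \<le> Wnorm 1 h" "0 \<le> H" unfolding H_def Wnorm1_F_N[OF h] using cint_nonneg[of "\<lambda>x. \<bar>deriv h x\<bar>"] cint_nonneg[of "\<lambda>x. \<bar>h x\<bar>"] by auto
  have "\<epsilon> * transport_const 1 * H \<le> \<epsilon>0 * transport_const 1 * Wnorm 1 h" using e transport_const H \<epsilon>0 by (intro mult_mono) auto
  moreover have "CLY * H \<le> CLY * Wnorm 1 h" using H CLY by (intro mult_left_mono) auto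
  ultimately have "Wnorm 1 (disc_deriv N \<epsilon> (\<lambda>x. 1) h) \<le> lam * Wnorm 1 h + CLY * Wnorm 1 h + \<epsilon>0 * transport_const 1 * Wnorm 1 h"
    using st unfolding H_def by linarith
  thus "Wnorm 1 (disc_deriv N \<epsilon> (\<lambda>x. 1) h) \<le> (lam + CLY + \<epsilon>0 * transport_const 1) * Wnorm 1 h" by (simp only: distrib_right)
qed

text \<open>If \<open>\<beta> > c\<close>, the derivatives at any two densities of \<open>F_N\<close> at distance at most \<open>L\<close> would differ by a bounded amount, as
  \<open>\<Lambda>\<close> cannot be small: \<open>I - D\<^sub>f\<close> is bounded at the constant density. The oscillating densities contradict this.\<close>

lemma admissible_radius_small:
  assumes e: "\<epsilon> \<in> {0..\<epsilon>0}" "0 < \<epsilon>" and g: "g x0 y0 \<noteq> 0" and c: "0 < c"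
  obtains N2 where "\<And>N \<kappa> \<Lambda> \<beta>. N2 \<le> N \<Longrightarrow> densities \<inter> F_N N \<subseteq> BK \<kappa> \<Longrightarrow> admissible T g \<epsilon> N \<kappa> \<Lambda> \<beta> \<Longrightarrow> \<beta> \<le> c"
proof -
  obtain M0 h where h: "h \<in> F_N M0" and Gx: "Gd 0 h x0 \<noteq> 0" using detecting_polynomial[OF g] by blast
  obtain y1 and n :: int where Ty: "T y1 = x0 + of_int n" using T_onto by blast
  have y1: "Gd 0 h (T y1) \<noteq> 0" unfolding Ty using Gx periodic1_int[OF Gd_periodic[of 0 h], of x0 n] by simp
  obtain L where L: "0 \<le> L" and osc: "\<And>R. \<exists>N2. \<forall>N\<ge>N2. \<exists>f\<in>densities \<inter> F_N N. Wnorm 1 (\<lambda>x. f x - 1) \<le> L \<and> R \<le> Wnorm 1 (disc_deriv N \<epsilon> f h)"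
    using oscillating_density[OF e h y1] by blast
  obtain C where C: "0 \<le> C" "\<And>N h. 0 < N \<Longrightarrow> h \<in> F_N N \<Longrightarrow> Wnorm 1 (disc_deriv N \<epsilon> (\<lambda>x. 1) h) \<le> C * Wnorm 1 h"
    using disc_deriv_one_bound e(1) by metis
  define hc where "hc = deriv (\<lambda>x. sin (2 * pi * real 1 * x))"
  have sF: "(\<lambda>x. sin (2 * pi * real 1 * x)) \<in> F_N 2" by (rule F_N_sin) simp
  have hcF: "hc \<in> F_N 2" unfolding hc_def by (rule F_N_deriv(2)[OF sF])
  have hc0: "cint hc = 0" unfolding hc_def by (rule cint_deriv_F_N[OF sF])
  have "hc 0 = 2 * pi" unfolding hc_def by (rule DERIV_imp_deriv) (auto intro!: derivative_eq_intros)
  hence Wc: "0 < Wnorm 1 hc" using Wnorm_zero[OF hcF] by (metis not_le pi_gt_zero mult_eq_0_iff less_irrefl zero_neq_numeral)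
  define w where "w = Wnorm 1 h"
  have w: "0 \<le> w" unfolding w_def by (rule Wnorm_nonneg)
  define R where "R = C * w + (2 * L / c + 1) * ((1 + C) / 4) * w + 1"
  obtain N2 where large: "\<And>N. N2 \<le> N \<Longrightarrow> \<exists>f\<in>densities \<inter> F_N N. Wnorm 1 (\<lambda>x. f x - 1) \<le> L \<and> R \<le> Wnorm 1 (disc_deriv N \<epsilon> f h)"
    using osc[of R] by blast
  show ?thesis
  proof (rule that[of "N2 + M0 + 2"])
    fix N \<kappa> \<Lambda> \<beta> assume N: "N2 + M0 + 2 \<le> N" and sub: "densities \<inter> F_N N \<subseteq> BK \<kappa>" and ad: "admissible T g \<epsilon> N \<kappa> \<Lambda> \<beta>"
    have Nb: "2 \<le> N" "N2 \<le> N" "M0 \<le> N" "0 < N" using N by auto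
    interpret discretised T g \<epsilon>0 lam C0 CLY \<epsilon> N by unfold_locales (rule e(1), rule Nb(1))
    have one: "(\<lambda>x. 1) \<in> BK \<kappa> \<inter> F_N N" using one_BK[OF Nb(4)] sub by (auto simp: BK_def)
    note oneF = IntD2[OF one]
    note hN = F_N_mono[OF Nb(3) h] and hcN = F_N_mono[OF Nb(1) hcF]
    note bb = admissible_bounded_below[OF ad one]
    have "Wnorm 1 hc \<le> \<Lambda> * Wnorm 1 (\<lambda>x. hc x - D (\<lambda>x. 1) hc x)"
      using bb(1) hcN hc0 unfolding bounded_below_def by (simp add: V_N_iff)
    also have "\<dots> \<le> \<Lambda> * (Wnorm 1 hc + C * Wnorm 1 hc)"
      using bb(2) by (intro mult_left_mono order_trans[OF Wnorm_diff[OF hcN disc_deriv_F_N[OF Nb(4) oneF hcN]]] add_left_mono C(2)[OF Nb(4) hcN]) auto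
    also have "\<dots> = (\<Lambda> * (1 + C)) * Wnorm 1 hc" by (simp add: algebra_simps)
    finally have "1 \<le> \<Lambda> * (1 + C)" using Wc by simp
    hence \<Lambda>: "1 / (4 * \<Lambda>) \<le> (1 + C) / 4" using bb(2) by (simp add: field_simps)
    obtain f where f: "f \<in> densities \<inter> F_N N" "Wnorm 1 (\<lambda>x. f x - 1) \<le> L" "R \<le> Wnorm 1 (D f h)" using large[OF Nb(2)] by blast
    have fB: "f \<in> BK \<kappa> \<inter> F_N N" using f(1) sub by auto
    have DF: "D f h \<in> F_N N" "D (\<lambda>x. 1) h \<in> F_N N" using f(1) by (auto intro!: disc_deriv_F_N Nb oneF hN)
    show "\<beta> \<le> c"
    proof (rule ccontr)
      assume "\<not> \<beta> \<le> c"
      hence b: "c < \<beta>" by simp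
      have "Wnorm 1 (\<lambda>x. D f h x - D (\<lambda>x. 1) h x) \<le> (2 * Wnorm 1 (\<lambda>x. f x - 1) / \<beta> + 1) / (4 * \<Lambda>) * w"
        unfolding w_def by (rule derivative_chain[OF ad one fB hN])
      also have "\<dots> = (2 * Wnorm 1 (\<lambda>x. f x - 1) / \<beta> + 1) * (1 / (4 * \<Lambda>)) * w" by simp
      also have "\<dots> \<le> (2 * L / c + 1) * ((1 + C) / 4) * w"
      proof (rule mult_right_mono[OF mult_mono w])
        have "2 * Wnorm 1 (\<lambda>x. f x - 1) / \<beta> \<le> 2 * L / c"
          using f(2) b c L Wnorm_nonneg[of 1 "\<lambda>x. f x - 1"] by (intro frac_le) auto
        thus "2 * Wnorm 1 (\<lambda>x. f x - 1) / \<beta> + 1 \<le> 2 * L / c + 1" by simp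
      qed (use \<Lambda> L c bb(2) in \<open>auto intro!: add_nonneg_nonneg divide_nonneg_nonneg\<close>)
      finally have V: "Wnorm 1 (\<lambda>x. D f h x - D (\<lambda>x. 1) h x) \<le> R - 1 - C * w" by (simp add: R_def)
      have "D f h = (\<lambda>x. (D f h x - D (\<lambda>x. 1) h x) + D (\<lambda>x. 1) h x)" by simp
      hence "Wnorm 1 (D f h) \<le> Wnorm 1 (\<lambda>x. D f h x - D (\<lambda>x. 1) h x) + Wnorm 1 (D (\<lambda>x. 1) h)"
        using Wnorm_triangle[OF F_N_diff[OF DF] DF(2)] by simp
      thus False using V f(3) C(2)[OF Nb(4) hN] unfolding w_def by linarith
    qed
  qed
qed

end

section \<open>Convergence of the Newton scheme\<close>

context discretised begin

lemma bounded_below_mono: "bounded_below f M \<Longrightarrow> M \<le> M' \<Longrightarrow> bounded_below f M'"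
  unfolding bounded_below_def by (meson Wnorm_nonneg mult_right_mono order_trans)

lemma linear_case:
  assumes "\<epsilon> = 0 \<or> (\<forall>x y. g x y = 0)"
  shows "D f h = disc_op N \<epsilon> h"
proof -
  have G: "\<epsilon> * Gd 0 k x = 0" for k x using assms
    by (auto simp: Gd_def g0_def cint_const)
  have S: "S \<epsilon> k = T" for k by (rule ext) (simp add: S_eq G)
  have "\<epsilon> * conv (deriv (fejer N)) T (\<lambda>y. Gd 0 h (T y) * f y) x = 0" for x
    using assms by (auto simp: Gd_def g0_def cint_const conv_def)
  thus ?thesis by (auto simp: disc_deriv_def kernel_deriv_def disc_op_def kernel_op_def S)
qed

lemma linear_newton_step:
  assumes lin: "\<epsilon> = 0 \<or> (\<forall>x y. g x y = 0)" and ad: "admissible T g \<epsilon> N \<kappa> \<Lambda> \<beta>"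
    and hs: "hs \<in> densities" "hs \<in> F_N N" "disc_op N \<epsilon> hs = hs" and h: "h \<in> BK \<kappa> \<inter> F_N N"
  shows "newton_step T g \<epsilon> N h = hs"
proof -
  have hE: "h \<in> densities" "h \<in> F_N N" using BK_density[OF h] by auto
  note nb = bounded_below_newton[OF hE admissible_bounded_below(1)[OF ad h]]
  define w where "w = (\<lambda>x. h x - hs x)"
  have wV: "w \<in> V_N N" unfolding w_def V_N_iff
    using F_N_diff[OF hE(2) hs(2)] density_F_N[OF hE] density_F_N[OF hs(1,2)] by (simp add: cint_diff)
  have "D h w = (\<lambda>x. D h h x - D h hs x)"
    using disc_deriv_lin[OF N0 hE(2) hE(2) hs(2), of \<epsilon> 1 "-1"] by (simp add: w_def)
  hence "(\<lambda>y. h y - \<Phi> h y) = (\<lambda>x. w x - D h w x)"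
    using hs(3) by (auto simp: linear_case[OF lin] density_facts(3)[OF hE] w_def)
  hence "inv_I_minus_D T g \<epsilon> N h (\<lambda>y. h y - \<Phi> h y) = w" using nb(4)[OF wV] by simp
  thus ?thesis by (auto simp: newton_step_def w_def)
qed

text \<open>Chooses \<open>Kt\<close> as explained at the beginning. In the second case \<open>r = 1 + B\<close> converts the \<open>W\<^sup>1\<^sup>,\<^sup>1\<close> radius into a \<open>W\<^sup>2\<^sup>,\<^sup>1\<close>
  radius on \<open>F_N\<close>.\<close>

lemma newton_scheme_converges:
  assumes hs: "hs \<in> BK K \<inter> F_N N" "disc_op N \<epsilon> hs = hs" and K: "1 \<le> K" and ab: "all_bounded K M0" and M0: "0 < M0"
    and c: "0 < c" "\<And>x. c \<le> hs x"
    and radius: "\<And>x y \<kappa> \<Lambda> \<beta>. \<epsilon> \<noteq> 0 \<Longrightarrow> g x y \<noteq> 0 \<Longrightarrow> densities \<inter> F_N N \<subseteq> BK \<kappa> \<Longrightarrow> admissible T g \<epsilon> N \<kappa> \<Lambda> \<beta> \<Longrightarrow> \<beta> \<le> c"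
  shows "\<exists>Kt>0. (\<exists>\<Lambda>t \<beta>t. admissible T g \<epsilon> N Kt \<Lambda>t \<beta>t) \<and>
     (\<forall>\<Lambda>t \<beta>t. admissible T g \<epsilon> N Kt \<Lambda>t \<beta>t \<longrightarrow> newton_succeeds Kt \<Lambda>t \<beta>t hs)"
proof -
  obtain B where B: "B > 0" "\<And>f x. f \<in> F_N N \<Longrightarrow> \<bar>deriv f x\<bar> \<le> B * L1norm f"
    by (rule F_N_bernstein[of N], rule that; assumption)
  have B1: "L1norm (deriv f) \<le> B * L1norm f" if "f \<in> F_N N" for f
    using B(2)[OF that] F_N_integrable[OF F_N_deriv(2)[OF that]] by (intro cint_le_bound) auto
  have sE: "hs \<in> densities" "hs \<in> F_N N" and sK: "Wnorm 2 hs \<le> K" using hs(1) by (auto simp: BK_def)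
  define KM where "KM = max K (1 + B + B * B)"
  have all: "densities \<inter> F_N N \<subseteq> BK KM"
  proof
    fix f assume f: "f \<in> densities \<inter> F_N N"
    have 1: "L1norm (deriv f) \<le> B" using B1[of f] f density_F_N(2)[of f N] by simp
    have "L1norm (deriv (deriv f)) \<le> B * L1norm (deriv f)" using f by (intro B1 F_N_deriv(2)) auto
    also have "\<dots> \<le> B * B" using 1 B(1) by (intro mult_left_mono) auto
    finally have "Wnorm 2 f \<le> 1 + B + B * B" using 1 f Wnorm2_F_N[of f N] density_F_N(2)[of f N] by simp
    thus "f \<in> BK KM" using f F_N_W[of f N] by (auto simp: BK_def KM_def)
  qed
  show ?thesis
  proof (cases "\<exists>M. all_bounded KM M")
    case True
    then obtain M where M: "all_bounded KM M" by blast
    have "all_bounded KM (max M 0)" using M unfolding all_bounded_def by (meson bounded_below_mono max.cobounded1)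
    hence ex: "\<exists>\<Lambda> \<beta>. admissible T g \<epsilon> N KM \<Lambda> \<beta>" by (rule admissible_exists) simp
    have hsM: "hs \<in> BK KM \<inter> F_N N" using all sE by auto
    have "0 < KM" using K by (simp add: KM_def)
    moreover have "newton_succeeds KM \<Lambda> \<beta> hs"
      if ad: "admissible T g \<epsilon> N KM \<Lambda> \<beta>" for \<Lambda> \<beta>
    proof (rule newton_converges[OF ad hsM hs(2)])
      show ball: "densities \<inter> F_N N \<inter> W11_ball hs \<beta> \<subseteq> BK KM" using all by auto
      fix h assume h: "h \<in> densities \<inter> F_N N \<inter> W11_ball hs \<beta>"
      show "newton_step T g \<epsilon> N h \<in> densities"
      proof (cases "\<epsilon> = 0 \<or> (\<forall>x y. g x y = 0)")
        case True
        thus ?thesis using linear_newton_step[OF True ad sE hs(2), of h] h all sE by auto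
      next
        case False
        hence "\<beta> \<le> c" using radius[OF _ _ all ad] by blast
        hence "\<beta> \<le> hs x" for x using c(2)[of x] by simp
        thus ?thesis by (rule newton_stays_positive[OF ad hsM hs(2) ball _ h])
      qed
    qed
    ultimately show ?thesis using ex by blast
  next
    case False
    hence fail: "\<not> all_bounded KM M" for M by blast
    have KMK: "K \<le> KM" and r0: "0 < 1 + B" using B(1) by (auto simp: KM_def)
    obtain \<kappa> where \<kappa>: "K < \<kappa>" "\<exists>M\<ge>0. all_bounded \<kappa> M"
      "\<And>\<Lambda> \<beta>. admissible T g \<epsilon> N \<kappa> \<Lambda> \<beta> \<Longrightarrow> \<beta> \<le> c \<and> K + (1 + B) * \<beta> \<le> \<kappa>"
      by (rule small_radius_before_failure[OF hs(1) K ab M0 fail KMK c(1) r0], rule that; assumption)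
    have ex: "\<exists>\<Lambda> \<beta>. admissible T g \<epsilon> N \<kappa> \<Lambda> \<beta>" using \<kappa>(2) admissible_exists by blast
    have hsk: "hs \<in> BK \<kappa> \<inter> F_N N" using hs(1) BK_mono[of K \<kappa>] \<kappa>(1) by auto
    have "0 < \<kappa>" using K \<kappa>(1) by simp
    moreover have "newton_succeeds \<kappa> \<Lambda> \<beta> hs"
      if ad: "admissible T g \<epsilon> N \<kappa> \<Lambda> \<beta>" for \<Lambda> \<beta>
    proof (rule newton_converges[OF ad hsk hs(2)])
      have \<beta>: "\<beta> \<le> c" "K + (1 + B) * \<beta> \<le> \<kappa>" using \<kappa>(3)[OF ad] by auto
      show ball: "densities \<inter> F_N N \<inter> W11_ball hs \<beta> \<subseteq> BK \<kappa>"
      proof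
        fix f assume f: "f \<in> densities \<inter> F_N N \<inter> W11_ball hs \<beta>"
        define u where "u = (\<lambda>x. f x - hs x)"
        have uF: "u \<in> F_N N" unfolding u_def using f sE by (intro F_N_diff) auto
        have u\<beta>: "Wnorm 1 u \<le> \<beta>" using f by (simp add: W11_ball_def u_def)
        have f_eq: "f = (\<lambda>x. 1 * hs x + 1 * u x)" by (simp add: u_def)
        have "Wnorm 2 f \<le> Wnorm 2 hs + Wnorm 2 u" using W2_triangle[OF sE(2) uF, of 1 1] unfolding f_eq[symmetric] by simp
        also have "Wnorm 2 u \<le> (1 + B) * Wnorm 1 u"
        proof -
          have "L1norm (deriv (deriv u)) \<le> B * L1norm (deriv u)" by (rule B1[OF F_N_deriv(2)[OF uF]])
          also have "\<dots> \<le> B * Wnorm 1 u" unfolding Wnorm1_F_N[OF uF]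
            using B(1) cint_nonneg[of "\<lambda>x. \<bar>u x\<bar>"] by (intro mult_left_mono) auto
          finally show ?thesis unfolding distrib_right Wnorm2_F_N[OF uF] using Wnorm1_F_N[OF uF] by simp
        qed
        also have "(1 + B) * Wnorm 1 u \<le> (1 + B) * \<beta>" using u\<beta> B(1) by (intro mult_left_mono) auto
        finally have "Wnorm 2 f \<le> \<kappa>" using sK \<beta>(2) by simp
        thus "f \<in> BK \<kappa>" using f F_N_W[of f N] by (auto simp: BK_def)
      qed
      fix h assume h: "h \<in> densities \<inter> F_N N \<inter> W11_ball hs \<beta>"
      have "\<beta> \<le> hs x" for x using c(2)[of x] \<beta>(1) by simp
      thus "newton_step T g \<epsilon> N h \<in> densities" by (rule newton_stays_positive[OF ad hsk hs(2) ball _ h])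
    qed
    ultimately show ?thesis using ex by blast
  qed
qed

end

theorem theorem4p1:
  fixes T :: "real \<Rightarrow> real" and g :: "real \<Rightarrow> real \<Rightarrow> real"
    and \<epsilon>0 \<epsilon>1 \<epsilon>2 lam C0 CLY K :: real
  assumes "circle_map_lift T" and "C_k 5 T" and "uniformly_expanding T"
    and "coupling g"
    and "0 < \<epsilon>0" and "0 < lam" and "lam < 1" and "0 < C0"
    and "uniform_constants T g \<epsilon>0 lam C0"
    and "0 < CLY" and "lasota_yorke T g \<epsilon>0 lam CLY"
    and "CLY / (1 - lam\<^sup>2) < K"
    and "0 < \<epsilon>1" and "\<epsilon>1 \<le> \<epsilon>0" and "sequential_contraction T g K \<epsilon>1"
    and "0 < \<epsilon>2" and "\<epsilon>2 \<le> \<epsilon>1" and "exponential_convergence T g K \<epsilon>2"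
  shows "\<exists>\<epsilon>7>0. \<forall>\<epsilon>. 0 \<le> \<epsilon> \<and> \<epsilon> < min \<epsilon>2 \<epsilon>7 \<longrightarrow>
    (\<exists>N0. \<forall>N\<ge>N0.
      (\<exists>\<Lambda> \<beta>. admissible T g \<epsilon> N K \<Lambda> \<beta>) \<and>
      (\<forall>\<Lambda> \<beta> hs.
         admissible T g \<epsilon> N K \<Lambda> \<beta> \<and> hs \<in> BK K \<and> sc_transfer_N T g \<epsilon> N hs = hs \<longrightarrow>
         (\<exists>Kt>0.
           (\<exists>\<Lambda>t \<beta>t. admissible T g \<epsilon> N Kt \<Lambda>t \<beta>t) \<and>
           (\<forall>\<Lambda>t \<beta>t. admissible T g \<epsilon> N Kt \<Lambda>t \<beta>t \<longrightarrow>
              hs \<in> B_prime T g \<epsilon> N Kt \<Lambda>t \<beta>t \<and>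
              (\<exists>C \<gamma>. 0 < C \<and> 0 < \<gamma> \<and> \<gamma> < 1 \<and>
                (\<forall>h0 \<in> B_prime T g \<epsilon> N Kt \<Lambda>t \<beta>t \<inter> W11_ball hs \<beta>t.
                   (\<forall>n. newton_defined_at T g \<epsilon> N ((newton_step T g \<epsilon> N ^^ n) h0)) \<and>
                   (\<lambda>n. Wnorm 1 (\<lambda>x. (newton_step T g \<epsilon> N ^^ n) h0 x - hs x))
                     \<longlonglongrightarrow> 0 \<and>
                   (\<forall>n. Wnorm 1 (\<lambda>x. (newton_step T g \<epsilon> N ^^ n) h0 x - hs x)
                          \<le> C * \<gamma> ^ (2 ^ n))))))))"
proof -
  let "\<exists>\<epsilon>7>0. \<forall>\<epsilon>. 0 \<le> \<epsilon> \<and> \<epsilon> < min \<epsilon>2 \<epsilon>7 \<longrightarrow> ?P \<epsilon>" = ?thesis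
  let "\<exists>\<epsilon>7>0. \<forall>\<epsilon>. 0 \<le> \<epsilon> \<and> \<epsilon> < min \<epsilon>2 \<epsilon>7 \<longrightarrow> (\<exists>N0. \<forall>N\<ge>N0. _ \<and> (\<forall>\<Lambda> \<beta> hs. _ \<longrightarrow> ?Q \<epsilon> N hs))" = ?thesis
  interpret expanding_coupled_map T g \<epsilon>0 lam C0 CLY using assms by unfold_locales auto
  have K: "0 \<le> K"
  proof -
    have "lam\<^sup>2 < 1" using assms(6,7) by (simp add: power_less_one_iff)
    hence "0 \<le> CLY / (1 - lam\<^sup>2)" using assms(10) by simp
    thus ?thesis using assms(12) by linarith
  qed
  from uniform_inverse_bound[OF assms(15,14) K] obtain \<epsilon>7 N1 M where \<epsilon>7: "0 < \<epsilon>7" and M: "0 < M"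
    and inv: "\<forall>\<epsilon>. 0 \<le> \<epsilon> \<and> \<epsilon> \<le> \<epsilon>1 \<and> \<epsilon> \<le> \<epsilon>7 \<longrightarrow> (\<forall>N\<ge>N1. \<forall>f\<in>BK K \<inter> F_N N. \<forall>h\<in>V_N N.
     Wnorm 1 h \<le> M * Wnorm 1 (\<lambda>x. h x - disc_deriv N \<epsilon> f h x))"
    by - (elim exE conjE, rule that; assumption)
  obtain c N2 where c: "0 < c" and pos: "\<And>\<epsilon> N hs x. \<epsilon> \<in> {0..\<epsilon>0} \<Longrightarrow> N2 \<le> N \<Longrightarrow> hs \<in> BK (max K 1) \<inter> F_N N \<Longrightarrow> disc_op N \<epsilon> hs = hs \<Longrightarrow> c \<le> hs x"
    using uniform_positivity[of "max K 1"] by auto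
  show ?thesis
  proof (rule exI[of _ \<epsilon>7], intro conjI \<epsilon>7 allI impI)
    fix \<epsilon> assume "0 \<le> \<epsilon> \<and> \<epsilon> < min \<epsilon>2 \<epsilon>7"
    hence e: "0 \<le> \<epsilon>" "\<epsilon> \<le> \<epsilon>1" "\<epsilon> \<le> \<epsilon>7" "\<epsilon> \<in> {0..\<epsilon>0}" using assms(14,17) by auto
    have "\<exists>N3. \<forall>N \<kappa> \<Lambda> \<beta> x y. N3 \<le> N \<longrightarrow> \<epsilon> \<noteq> 0 \<longrightarrow> g x y \<noteq> 0 \<longrightarrow> densities \<inter> F_N N \<subseteq> BK \<kappa> \<longrightarrow> admissible T g \<epsilon> N \<kappa> \<Lambda> \<beta> \<longrightarrow> \<beta> \<le> c"
    proof (cases "\<epsilon> \<noteq> 0 \<and> (\<exists>x y. g x y \<noteq> 0)")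
      case True
      then obtain x y where g: "g x y \<noteq> 0" and "0 < \<epsilon>" using e(1) by auto
      show ?thesis using admissible_radius_small[OF e(4) \<open>0 < \<epsilon>\<close> g c] by metis
    qed blast
    then obtain N3 where radius: "\<And>N \<kappa> \<Lambda> \<beta> x y. N3 \<le> N \<Longrightarrow> \<epsilon> \<noteq> 0 \<Longrightarrow> g x y \<noteq> 0 \<Longrightarrow> densities \<inter> F_N N \<subseteq> BK \<kappa> \<Longrightarrow> admissible T g \<epsilon> N \<kappa> \<Lambda> \<beta> \<Longrightarrow> \<beta> \<le> c"
      by blast
    show "?P \<epsilon>"
    proof (rule exI[of _ "N1 + N2 + N3 + 2"], intro allI impI conjI)
      fix N assume N: "N1 + N2 + N3 + 2 \<le> N"
      hence Ns: "N1 \<le> N" "N2 \<le> N" "N3 \<le> N" "2 \<le> N" by auto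
      interpret discretised T g \<epsilon>0 lam C0 CLY \<epsilon> N by unfold_locales (rule e(4), rule Ns(4))
      have ab: "all_bounded K M" unfolding all_bounded_def bounded_below_def
        by (intro ballI inv[rule_format, OF conjI[OF e(1) conjI[OF e(2,3)]] Ns(1)])
      show "\<exists>\<Lambda> \<beta>. admissible T g \<epsilon> N K \<Lambda> \<beta>" using admissible_exists[OF ab] M by simp
      fix \<Lambda> \<beta> hs assume "admissible T g \<epsilon> N K \<Lambda> \<beta> \<and> hs \<in> BK K \<and> sc_transfer_N T g \<epsilon> N hs = hs"
      hence hB: "hs \<in> BK K" and fp: "\<Phi> hs = hs" by auto
      have hd: "hs \<in> densities" and hW2: "hs \<in> W 2" and hn: "Wnorm 2 hs \<le> K" using hB by (auto simp: BK_def)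
      have hW: "hs \<in> W 1" using hW2 by (auto simp: W_def)
      have "transfer (fold (\<lambda>f S. T_map T g \<epsilon> f \<circ> S) [hs] id) hs \<in> W 1"
        using LY[unfolded lasota_yorke_def, rule_format, of \<epsilon> "[hs]" 1 hs] e(4) hd hW by simp
      hence "transfer (S \<epsilon> hs) hs \<in> L1" by (simp add: W_def)
      hence "Pi_N N (transfer (S \<epsilon> hs) hs) \<in> F_N N" by (intro Pi_N_F_N N0) (simp add: L1_iff)
      hence hF: "hs \<in> F_N N" using fp by (simp add: sc_transfer_N_def sc_transfer_def)
      have Pfix: "disc_op N \<epsilon> hs = hs" using density_facts(3)[OF hd hF] fp by simp
      have K1: "1 \<le> K"
      proof -
        have "1 \<le> Wnorm 2 hs" unfolding Wnorm2_F_N[OF hF]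
          using density_F_N(2)[OF hd hF] cint_nonneg[of "\<lambda>x. \<bar>deriv hs x\<bar>"] cint_nonneg[of "\<lambda>x. \<bar>deriv (deriv hs) x\<bar>"] by simp
        thus ?thesis using hn by linarith
      qed
      hence mK: "max K 1 = K" by simp
      have hsB: "hs \<in> BK K \<inter> F_N N" using hB hF by simp
      show "?Q \<epsilon> N hs"
        using newton_scheme_converges[OF hsB Pfix K1 ab M c pos[OF e(4) Ns(2), unfolded mK, OF hsB Pfix] radius[OF Ns(3)]]
        unfolding newton_succeeds_def .
    qed
  qed
qed

end
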